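(* Let $(X,d,\mu,\mathcal{E},\mathcal{F})$ be an MMD space, let $n\in\mathbb{N}$, and let $\nu$ be a minimal energy-dominant measure for $(X,d,\mu,\mathcal{E},\mathcal{F})$. Let $\phi=(\phi_1,\dots,\phi_n):X\to\mathbb{R}^n$ be such that each $\phi_i\in\mathcal{F}$ is quasicontinuous for $i=1,\dots,n$, and let $\gamma_\nu(\phi)=\big[\frac{d\Gamma(\phi_i,\phi_j)}{d\nu}\big]_{1\le i,j\le n}$ be the carré du champ matrix of $\phi$ with respect to $\nu$. Then $$\phi_*\big(\mathbf{1}_{\{\det(\gamma_\nu(\phi))>0\}}\cdot\nu\big)\ll\mathcal{L}_n,$$ where $\mathcal{L}_n$ is the Lebesgue measure on $\mathbb{R}^n$.
   Context: An MMD space (metric measure Dirichlet space) $(X,d,\mu,\mathcal{E},\mathcal{F})$ consists of a complete, locally compact, separable metric space $(X,d)$, a Radon measure $\mu$ on $X$ with full support, and a strongly local, regular symmetric Dirichlet form $(\mathcal{E},\mathcal{F})$ on $L^2(X,\mu)$. That is: $\mathcal{F}$ is a dense linear subspace of $L^2(X,\mu)$; $\mathcal{E}:\mathcal{F}\times\mathcal{F}\to\mathbb{R}$ is a nonnegative definite symmetric bilinear form; it is closed ($\mathcal{F}$ is a Hilbert space under $\mathcal{E}_1=\mathcal{E}+\langle\cdot,\cdot\rangle_{L^2(\mu)}$) and Markovian ($f^+\wedge 1\in\mathcal{F}$ and $\mathcal{E}(f^+\wedge 1,f^+\wedge1)\le\mathcal{E}(f,f)$ for $f\in\mathcal{F}$).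 Regular: $\mathcal{F}\cap C_c(X)$ is dense in $(\mathcal{F},\mathcal{E}_1)$ and in $(C_c(X),\|\cdot\|_{\sup})$, where $C_c(X)$ is the space of continuous compactly supported real functions. Strongly local: $\mathcal{E}(f,g)=0$ whenever $f,g\in\mathcal{F}$ have compact supports $\mathrm{supp}_\mu[f],\mathrm{supp}_\mu[g]$ and $\mathrm{supp}_\mu[f-a\mathbf{1}_X]\cap\mathrm{supp}_\mu[g]=\emptyset$ for some $a\in\mathbb{R}$, where $\mathrm{supp}_\mu[f]$ is the support of the measure $|f|\,d\mu$. Energy measure: for $f\in\mathcal{F}\cap L^\infty(X,\mu)$, $\Gamma(f,f)$ is the unique Borel measure with $\int_X g\,d\Gamma(f,f)=\mathcal{E}(f,fg)-\frac12\mathcal{E}(f^2,g)$ for all $g\in\mathcal{F}\cap C_c(X)$; for general $f\in\mathcal{F}$, $\Gamma(f,f)(A)=\lim_{k\to\infty}\Gamma((-k)\vee(f\wedge k),(-k)\vee(f\wedge k))(A)$ for Borel $A$; the signed measure $\Gamma(f,g)$, $f,g\in\mathcal{F}$, is defined by polarization. A $\sigma$-finite Borel measure $\nu$ on $X$ is a minimal energy-dominant measure if (i) $\Gamma(f,f)\ll\nu$ for every $f\in\mathcal{F}$, and (ii) any $\sigma$-finite Borel measure $\nu'$ satisfying (i) in place of $\nu$ satisfies $\nu\ll\nu'$. Capacity: $\mathrm{Cap}(A)=\inf\{\|f\|_{L^2}^2+\mathcal{E}(f,f): f\in\mathcal{F},\ f=1\ \mu\text{-a.e. in a neighborhood of }A\}$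 ($\inf\emptyset=\infty$). A pointwise defined function $f:X\to\mathbb{R}$ is quasicontinuous if for every $\epsilon>0$ there is an open $O\subset X$ with $\mathrm{Cap}(O)<\epsilon$ and $f|_{X\setminus O}$ continuous. $\phi_*$ denotes pushforward of measures. *)

theory Defs
  imports "HOL-Analysis.Analysis"
begin

section \<open>Symmetric Dirichlet forms\<close>

text \<open>
  Elements of \<open>L\<^sup>2\<close> are represented by pointwise defined functions. Functions that agree
  almost everywhere are not identified; instead, the domain of a form is required to be closed
  under passing to another version, and the form to be invariant under it.
\<close>

definition L2_fun :: "'a measure \<Rightarrow> ('a \<Rightarrow> real) set" where
  "L2_fun N = {f \<in> borel_measurable N. integrable N (\<lambda>x. (f x)\<^sup>2)}"

definition E1_form ::
  "'a measure \<Rightarrow> (('a \<Rightarrow> real) \<Rightarrow> ('a \<Rightarrow> real) \<Rightarrow> real) \<Rightarrow> ('a \<Rightarrow> real) \<Rightarrow> ('a \<Rightarrow> real) \<Rightarrow> real" where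
  "E1_form N E f g = E f g + (LINT x|N. f x * g x)"

locale symmetric_dirichlet_form =
  fixes N :: "'a measure"
    and F :: "('a \<Rightarrow> real) set"
    and E :: "('a \<Rightarrow> real) \<Rightarrow> ('a \<Rightarrow> real) \<Rightarrow> real"
  assumes dom_L2: "F \<subseteq> L2_fun N"
    and dom_version: "\<And>f g. f \<in> F \<Longrightarrow> g \<in> borel_measurable N \<Longrightarrow> AE x in N. f x = g x \<Longrightarrow> g \<in> F"
    and form_version: "\<And>f f' g. f \<in> F \<Longrightarrow> f' \<in> F \<Longrightarrow> g \<in> F \<Longrightarrow> AE x in N. f x = f' x \<Longrightarrow> E f g = E f' g"
    and dom_zero: "(\<lambda>x. 0) \<in> F"
    and dom_add: "\<And>f g. f \<in> F \<Longrightarrow> g \<in> F \<Longrightarrow> (\<lambda>x. f x + g x) \<in> F"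
    and dom_scale: "\<And>c f. f \<in> F \<Longrightarrow> (\<lambda>x. c * f x) \<in> F"
    and dom_dense: "\<And>f e. f \<in> L2_fun N \<Longrightarrow> 0 < e \<Longrightarrow> \<exists>g\<in>F. (LINT x|N. (f x - g x)\<^sup>2) < e"
    and form_sym: "\<And>f g. f \<in> F \<Longrightarrow> g \<in> F \<Longrightarrow> E f g = E g f"
    and form_add: "\<And>f g h. f \<in> F \<Longrightarrow> g \<in> F \<Longrightarrow> h \<in> F \<Longrightarrow> E (\<lambda>x. f x + g x) h = E f h + E g h"
    and form_scale: "\<And>c f g. f \<in> F \<Longrightarrow> g \<in> F \<Longrightarrow> E (\<lambda>x. c * f x) g = c * E f g"
    and form_nonneg: "\<And>f. f \<in> F \<Longrightarrow> 0 \<le> E f f"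
    and form_closed: "\<And>u :: nat \<Rightarrow> 'a \<Rightarrow> real.
      (\<And>n. u n \<in> F) \<Longrightarrow>
      (\<And>e. 0 < e \<Longrightarrow>
        \<exists>n0. \<forall>m\<ge>n0. \<forall>n\<ge>n0. E1_form N E (\<lambda>x. u m x - u n x) (\<lambda>x. u m x - u n x) < e) \<Longrightarrow>
      \<exists>f\<in>F. (\<lambda>n. E1_form N E (\<lambda>x. u n x - f x) (\<lambda>x. u n x - f x)) \<longlonglongrightarrow> 0"
    and dom_markov: "\<And>f. f \<in> F \<Longrightarrow> (\<lambda>x. min (max (f x) 0) 1) \<in> F"
    and form_markov: "\<And>f. f \<in> F \<Longrightarrow>
      E (\<lambda>x. min (max (f x) 0) 1) (\<lambda>x. min (max (f x) 0) 1) \<le> E f f"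


section \<open>Metric measure Dirichlet spaces\<close>

definition radon_measure :: "'a::topological_space measure \<Rightarrow> bool" where
  "radon_measure M \<longleftrightarrow>
     sets M = sets borel \<and>
     (\<forall>K. compact K \<longrightarrow> emeasure M K < \<infinity>) \<and>
     (\<forall>A\<in>sets borel. emeasure M A = (INF U\<in>{U. open U \<and> A \<subseteq> U}. emeasure M U)) \<and>
     (\<forall>U. open U \<longrightarrow> emeasure M U = (SUP K\<in>{K. compact K \<and> K \<subseteq> U}. emeasure M K))"

definition measure_support :: "'a::topological_space measure \<Rightarrow> 'a set" where
  "measure_support N = {x. \<forall>U. open U \<longrightarrow> x \<in> U \<longrightarrow> 0 < emeasure N U}"

definition fun_support :: "'a::topological_space measure \<Rightarrow> ('a \<Rightarrow> real) \<Rightarrow> 'a set" where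
  "fun_support N f = measure_support (density N (\<lambda>x. ennreal \<bar>f x\<bar>))"

definition C_c :: "('a::topological_space \<Rightarrow> real) set" where
  "C_c = {f. continuous_on UNIV f \<and> compact (closure {x. f x \<noteq> 0})}"

text \<open>
  The reference measure \<open>M\<close> is a Borel measure, but \<open>L\<^sup>2\<close> is formed over its completion. The
  Hilbert space is the same; the point is that the domain then contains all versions of its
  elements, in particular quasicontinuous ones, which need not be Borel measurable.
\<close>

locale mmd_space = symmetric_dirichlet_form "completion M" F E
  for M :: "'a::polish_space measure"
    and F :: "('a \<Rightarrow> real) set"
    and E :: "('a \<Rightarrow> real) \<Rightarrow> ('a \<Rightarrow> real) \<Rightarrow> real" +
  assumes locally_compact: "locally_compact_space (euclidean :: 'a topology)"
    and radon: "radon_measure M"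
    and full_support: "measure_support M = UNIV"
    and regular_dom: "\<And>f e. f \<in> F \<Longrightarrow> 0 < e \<Longrightarrow>
      \<exists>g \<in> F \<inter> C_c. E1_form (completion M) E (\<lambda>x. f x - g x) (\<lambda>x. f x - g x) < e"
    and regular_C_c: "\<And>f e. f \<in> C_c \<Longrightarrow> (0::real) < e \<Longrightarrow>
      \<exists>g \<in> F \<inter> C_c. \<forall>x. \<bar>f x - g x\<bar> < e"
    and strongly_local: "\<And>f g a. f \<in> F \<Longrightarrow> g \<in> F \<Longrightarrow>
      compact (fun_support (completion M) f) \<Longrightarrow> compact (fun_support (completion M) g) \<Longrightarrow>
      fun_support (completion M) (\<lambda>x. f x - a) \<inter> fun_support (completion M) g = {} \<Longrightarrow>
      E f g = 0"


section \<open>Energy measures\<close>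

text \<open>
  Integrability is demanded explicitly because the Bochner integral of a non-integrable function
  is 0 by convention; without it the measure would not be determined by the identity.
\<close>

definition energy_measure_bounded ::
  "('a::topological_space \<Rightarrow> real) set \<Rightarrow> (('a \<Rightarrow> real) \<Rightarrow> ('a \<Rightarrow> real) \<Rightarrow> real) \<Rightarrow>
   ('a \<Rightarrow> real) \<Rightarrow> 'a measure" where
  "energy_measure_bounded F E f =
     (THE G. sets G = sets borel \<and>
        (\<forall>g \<in> F \<inter> C_c. integrable G g \<and>
           (LINT x|G. g x) = E f (\<lambda>x. f x * g x) - 1/2 * E (\<lambda>x. (f x)\<^sup>2) g))"

definition trunc_fun :: "nat \<Rightarrow> ('a \<Rightarrow> real) \<Rightarrow> 'a \<Rightarrow> real" where
  "trunc_fun k f x = max (- real k) (min (f x) (real k))"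

text \<open>
  The measure \<open>\<Gamma>(f,f)\<close>. For essentially bounded \<open>f\<close> the truncations are eventually versions
  of \<open>f\<close> itself, so the limit returns the measure defined above.
\<close>

definition energy_measure ::
  "('a::topological_space \<Rightarrow> real) set \<Rightarrow> (('a \<Rightarrow> real) \<Rightarrow> ('a \<Rightarrow> real) \<Rightarrow> real) \<Rightarrow>
   ('a \<Rightarrow> real) \<Rightarrow> 'a measure" where
  "energy_measure F E f =
     (THE G. sets G = sets borel \<and>
        (\<forall>A \<in> sets borel.
           (\<lambda>k. emeasure (energy_measure_bounded F E (trunc_fun k f)) A) \<longlonglongrightarrow> emeasure G A))"

text \<open>The signed measure \<open>\<Gamma>(f,g)\<close>, as a set function.\<close>

definition mutual_energy_measure ::
  "('a::topological_space \<Rightarrow> real) set \<Rightarrow> (('a \<Rightarrow> real) \<Rightarrow> ('a \<Rightarrow> real) \<Rightarrow> real) \<Rightarrow>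
   ('a \<Rightarrow> real) \<Rightarrow> ('a \<Rightarrow> real) \<Rightarrow> 'a set \<Rightarrow> real" where
  "mutual_energy_measure F E f g A =
     (measure (energy_measure F E (\<lambda>x. f x + g x)) A
      - measure (energy_measure F E (\<lambda>x. f x - g x)) A) / 4"

definition energy_dominant ::
  "('a::topological_space \<Rightarrow> real) set \<Rightarrow> (('a \<Rightarrow> real) \<Rightarrow> ('a \<Rightarrow> real) \<Rightarrow> real) \<Rightarrow>
   'a measure \<Rightarrow> bool" where
  "energy_dominant F E \<nu> \<longleftrightarrow>
     sets \<nu> = sets borel \<and> sigma_finite_measure \<nu> \<and>
     (\<forall>f\<in>F. absolutely_continuous \<nu> (energy_measure F E f))"

definition minimal_energy_dominant ::
  "('a::topological_space \<Rightarrow> real) set \<Rightarrow> (('a \<Rightarrow> real) \<Rightarrow> ('a \<Rightarrow> real) \<Rightarrow> real) \<Rightarrow>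
   'a measure \<Rightarrow> bool" where
  "minimal_energy_dominant F E \<nu> \<longleftrightarrow>
     energy_dominant F E \<nu> \<and>
     (\<forall>\<nu>'. energy_dominant F E \<nu>' \<longrightarrow> absolutely_continuous \<nu>' \<nu>)"

text \<open>
  \<open>\<gamma>\<close> is a version of the carre du champ matrix: its \<open>(i,j)\<close> entry is a Radon-Nikodym
  derivative of the finite signed measure \<open>\<Gamma>(\<phi>\<^sub>i, \<phi>\<^sub>j)\<close> with respect to \<open>\<nu>\<close>.
  Such a version is determined \<open>\<nu>\<close>-almost everywhere.
\<close>

definition carre_du_champ_matrix ::
  "('a::topological_space \<Rightarrow> real) set \<Rightarrow> (('a \<Rightarrow> real) \<Rightarrow> ('a \<Rightarrow> real) \<Rightarrow> real) \<Rightarrow>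
   'a measure \<Rightarrow> ('a \<Rightarrow> real ^ 'n) \<Rightarrow> ('a \<Rightarrow> real ^ 'n ^ 'n) \<Rightarrow> bool" where
  "carre_du_champ_matrix F E \<nu> \<phi> \<gamma> \<longleftrightarrow>
     (\<forall>i j. integrable \<nu> (\<lambda>x. \<gamma> x $ i $ j) \<and>
        (\<forall>A \<in> sets borel.
           mutual_energy_measure F E (\<lambda>x. \<phi> x $ i) (\<lambda>x. \<phi> x $ j) A = (LINT x:A|\<nu>. \<gamma> x $ i $ j)))"


section \<open>Capacity and quasicontinuity\<close>

definition capacity ::
  "'a::topological_space measure \<Rightarrow> ('a \<Rightarrow> real) set \<Rightarrow>
   (('a \<Rightarrow> real) \<Rightarrow> ('a \<Rightarrow> real) \<Rightarrow> real) \<Rightarrow> 'a set \<Rightarrow> ennreal" where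
  "capacity M F E A =
     (INF f \<in> {f \<in> F. \<exists>U. open U \<and> A \<subseteq> U \<and> (AE x in M. x \<in> U \<longrightarrow> f x = 1)}.
        ennreal (E1_form (completion M) E f f))"

definition quasicontinuous ::
  "'a::topological_space measure \<Rightarrow> ('a \<Rightarrow> real) set \<Rightarrow>
   (('a \<Rightarrow> real) \<Rightarrow> ('a \<Rightarrow> real) \<Rightarrow> real) \<Rightarrow> ('a \<Rightarrow> real) \<Rightarrow> bool" where
  "quasicontinuous M F E f \<longleftrightarrow>
     (\<forall>e>0. \<exists>U. open U \<and> capacity M F E U < ennreal e \<and> continuous_on (- U) f)"

text \<open>
  The measure \<open>\<one>\<^bsub>{det \<gamma> > 0}\<^esub> \<sqdot> \<nu>\<close>. It is completed because a quasicontinuous function is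
  only Borel measurable up to a set of zero capacity, which \<open>\<nu>\<close> does not charge.
\<close>

definition nondegenerate_part ::
  "'a measure \<Rightarrow> ('a \<Rightarrow> real ^ 'n ^ 'n) \<Rightarrow> 'a measure" where
  "nondegenerate_part \<nu> \<gamma> = completion (density \<nu> (indicator {x. 0 < det (\<gamma> x)}))"

end

theory Submission
 imports Defs
begin

text \<open>
If the image charged a null set, then near a point the carre du champ matrix is almost a constant
invertible matrix. Testing the form of resolvents of the coordinates against smooth functions of the
map bounds the divergence of a vector field, integrated against the image, by the field and a small
error measure times its derivative. A field made from the kernel \<open>x / |x|^n\<close> and a stopping
time for the error contradicts this.
\<close>

text \<open>The coordinates need not lie in the domain of a generator. Replacing them by resolvents
  turns the form, tested against a function, into an \<open>L2\<close> pairing that sees no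
  derivative of the field. The price is a constant without control, so the field itself must be
  uniformly small; the field of a set of small measure is. The error measure is small in mass but
  otherwise arbitrary, possibly singular, while the derivative of the field is a singular integral
  with no useful bound beyond \<open>L2\<close>. Cubes on which the error has density above a
  threshold \<open>lam\<close> have total volume of order \<open>1 / lam\<close>. A neighbourhood of
  them is added to the set that generates the field: inside the enlarged set the derivative varies
  over each cube by at most a dimensional constant, so the error may be averaged over the cubes to a
  density of order \<open>lam\<close>. Young's inequality against the \<open>L2\<close> bound then
  loses exactly the factor \<open>lam\<close> that the volume gains, and only a dimensional multiple
  of the mass of the error is left.\<close>

notation LIMSEQ (infix "--->" 60)

lemmas integrable_add = Bochner_Integration.integrable_add
 and integrable_bound = Bochner_Integration.integrable_bound
 and integrable_diff = Bochner_Integration.integrable_diff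
 and integrable_sum = Bochner_Integration.integrable_sum
 and integral_add = Bochner_Integration.integral_add
 and integral_cong = Bochner_Integration.integral_cong
 and integral_diff = Bochner_Integration.integral_diff
 and integral_nonneg = Bochner_Integration.integral_nonneg
 and integral_sum = Bochner_Integration.integral_sum

section \<open>Kernels on Euclidean space\<close>

text \<open>Dyadic annuli: a radially decreasing function is dominated by a sum of multiples of indicators of balls.\<close>

lemma nn_integral_le_dyadic:
 fixes f :: "'a::euclidean_space => ennreal"
 assumes c: "!!k. 0 <= c k" and r: "!!k::nat. 0 <= r k"
  and le: "AE z in lborel. f z = 0 \<or> (EX k. norm z < r k & f z <= ennreal (c k))"
  and sum: "summable (%k. c k * r k ^ DIM('a))"
 shows "(\<integral>\<^sup>+z. f z \<partial>lborel) <= ennreal (unit_ball_vol (real DIM('a)) * (\<Sum>k. c k * r k ^ DIM('a)))"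
proof -
 have "(\<integral>\<^sup>+z. f z \<partial>lborel) <= (\<integral>\<^sup>+z. (\<Sum>k. ennreal (c k) * indicator (ball 0 (r k)) z) \<partial>(lborel :: 'a measure))"
 proof (rule nn_integral_mono_AE, use le in eventually_elim)
  case (elim z)
  show ?case
  proof (cases "f z = 0")
   case False
   then obtain k where k: "norm z < r k" "f z <= ennreal (c k)" using elim by blast
   have "f z <= ennreal (c k) * indicator (ball 0 (r k)) z" using k by simp
   also have "... = sum (%j. ennreal (c j) * indicator (ball 0 (r j)) z) {k}" by (subst sum.insert) auto
   also have "... <= (\<Sum>j. ennreal (c j) * indicator (ball 0 (r j)) z)" by (rule sum_le_suminf) auto
   finally show ?thesis .
  qed simp
 qed
 also have "... = (\<Sum>k. \<integral>\<^sup>+z. ennreal (c k) * indicator (ball 0 (r k)) z \<partial>(lborel :: 'a measure))"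
  by (rule nn_integral_suminf) (intro borel_measurable_times_ennreal borel_measurable_const borel_measurable_indicator; simp)
 also have "... = (\<Sum>k. ennreal (unit_ball_vol (real DIM('a)) * (c k * r k ^ DIM('a))))"
 proof (rule suminf_cong)
  fix k
  have "(\<integral>\<^sup>+z. ennreal (c k) * indicator (ball 0 (r k)) z \<partial>(lborel :: 'a measure)) = ennreal (c k) * emeasure lborel (ball (0::'a) (r k))"
   by (rule nn_integral_cmult_indicator) auto
  also have "... = ennreal (c k) * ennreal (unit_ball_vol (real DIM('a)) * r k ^ DIM('a))"
   by (subst emeasure_ball[OF r]) simp
  also have "... = ennreal (unit_ball_vol (real DIM('a)) * (c k * r k ^ DIM('a)))"
   by (subst ennreal_mult[symmetric]) (use c r in "auto simp: mult_ac")
  finally show "(\<integral>\<^sup>+z. ennreal (c k) * indicator (ball 0 (r k)) z \<partial>(lborel :: 'a measure)) = ennreal (unit_ball_vol (real DIM('a)) * (c k * r k ^ DIM('a)))" .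
 qed
 also have "... = ennreal (\<Sum>k. unit_ball_vol (real DIM('a)) * (c k * r k ^ DIM('a)))"
  by (rule suminf_ennreal2) (use c r summable_mult[OF sum] in auto)
 also have "(\<Sum>k. unit_ball_vol (real DIM('a)) * (c k * r k ^ DIM('a))) = unit_ball_vol (real DIM('a)) * (\<Sum>k. c k * r k ^ DIM('a))"
  by (rule suminf_mult[OF sum])
 finally show ?thesis .
qed

text \<open>The exponent exceeds the dimension by one, so on the annuli of radii
  \<open>2 ^ k * s\<close> the bound times the volume decays geometrically; the shift by
  \<open>s\<close> removes the singularity. The factor \<open>1 / s\<close> is forced by
  scaling.\<close>

lemma nn_integral_tail_kernel:
 assumes s: "0 < (s::real)"
 shows "(\<integral>\<^sup>+z. ennreal (1 / (norm (z::'a::euclidean_space) + s) ^ (DIM('a) + 1)) \<partial>lborel)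
   <= ennreal (unit_ball_vol (real DIM('a)) * 2 ^ (DIM('a) + 2) / s)"
proof -
 let ?n = "DIM('a)"
 define r where "r k = 2 ^ k * s" for k :: nat
 define c where "c k = 2 ^ (?n + 1) / (r k) ^ (?n + 1)" for k :: nat
 have r: "0 < r k" for k using s by (simp add: r_def)
 have cr: "c k * r k ^ ?n = (2 ^ (?n + 1) / s) * (1 / 2) ^ k" for k
 proof -
  have "c k * r k ^ ?n = 2 ^ (?n + 1) / r k" using r[of k] by (simp add: c_def)
  thus ?thesis by (simp add: r_def power_divide)
 qed
 have sums: "(%k. c k * r k ^ ?n) sums ((2 ^ (?n + 1) / s) * 2)"
  unfolding cr using geometric_sums[of "1/2 :: real"] by (intro sums_mult) simp
 have "(\<integral>\<^sup>+z. ennreal (1 / (norm (z::'a) + s) ^ (?n + 1)) \<partial>lborel) <= ennreal (unit_ball_vol (real ?n) * (\<Sum>k. c k * r k ^ ?n))"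
 proof (rule nn_integral_le_dyadic)
  show "AE z in lborel. ennreal (1 / (norm (z::'a) + s) ^ (?n + 1)) = 0 \<or> (EX k. norm z < r k & ennreal (1 / (norm (z::'a) + s) ^ (?n + 1)) <= ennreal (c k))"
  proof (intro AE_I2 disjI2)
   fix z :: 'a
   obtain k0 where k0: "norm z / s < 2 ^ k0" using real_arch_pow[of 2 "norm z / s"] by auto
   hence ex: "EX k. norm z < r k" using s by (intro exI[of _ k0]) (simp add: r_def field_simps)
   \<comment> \<open>By minimality \<open>r k / 2\<close> is at most \<open>norm z + s\<close>: for
     \<open>k = 0\<close> because of the summand \<open>s\<close>, otherwise because the preceding
     radius fails.\<close>
   define k where "k = (LEAST k. norm z < r k)"
   have k: "norm z < r k" unfolding k_def by (rule LeastI_ex[OF ex])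
   have "r k / 2 <= norm z + s"
   proof (cases k)
    case 0
    thus ?thesis using s by (simp add: r_def)
   next
    case (Suc j)
    have "\<not> norm z < r j" using not_less_Least[of j "%k. norm z < r k"] Suc unfolding k_def by simp
    thus ?thesis using s Suc by (simp add: r_def)
   qed
   hence "(r k / 2) ^ (?n + 1) <= (norm z + s) ^ (?n + 1)" using r[of k] by (intro power_mono) auto
   hence "1 / (norm z + s) ^ (?n + 1) <= 1 / (r k / 2) ^ (?n + 1)"
    using r[of k] by (intro divide_left_mono mult_pos_pos zero_less_power) (auto intro: add_nonneg_pos s)
   also have "... = c k" by (simp add: c_def power_divide)
   finally show "EX k. norm z < r k & ennreal (1 / (norm z + s) ^ (?n + 1)) <= ennreal (c k)"
    using k by (intro exI[of _ k]) (auto intro: ennreal_leI)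
  qed
 qed (use r sums in "auto simp: c_def sums_iff less_imp_le")
 thus ?thesis using sums by (simp add: sums_iff field_simps)
qed

text \<open>Here the exponent falls short of the dimension by one, and the radii shrink instead of
  growing: the terms decay geometrically towards the origin. The origin lies in no annulus and is
  discarded as a null set.\<close>

lemma nn_integral_singular_kernel:
 assumes s: "0 < (s::real)"
 shows "(\<integral>\<^sup>+z. ennreal (1 / norm (z::'a::euclidean_space) ^ (DIM('a) - 1)) * indicator (ball 0 s) z \<partial>lborel)
   <= ennreal (unit_ball_vol (real DIM('a)) * 2 ^ DIM('a) * s)"
proof -
 let ?n = "DIM('a)"
 have n: "0 < ?n" by simp
 then obtain m where m: "?n = Suc m" using gr0_conv_Suc by blast
 define r where "r k = s / 2 ^ k" for k :: nat
 define c where "c k = 2 ^ m / (r k) ^ m" for k :: nat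
 have r: "0 < r k" for k using s by (simp add: r_def)
 have cr: "c k * r k ^ ?n = (2 ^ m * s) * (1 / 2) ^ k" for k
 proof -
  have "c k * r k ^ ?n = 2 ^ m * r k" using r[of k] by (simp add: c_def m)
  thus ?thesis by (simp add: r_def power_divide)
 qed
 have sums: "(%k. c k * r k ^ ?n) sums ((2 ^ m * s) * 2)"
  unfolding cr using geometric_sums[of "1/2 :: real"] by (intro sums_mult) simp
 have "(\<integral>\<^sup>+z. ennreal (1 / norm (z::'a) ^ (?n - 1)) * indicator (ball 0 s) z \<partial>lborel) <= ennreal (unit_ball_vol (real ?n) * (\<Sum>k. c k * r k ^ ?n))"
 proof (rule nn_integral_le_dyadic)
  have "AE z in lborel. z ~= (0::'a)" by (rule AE_lborel_singleton)
  thus "AE z in lborel. ennreal (1 / norm (z::'a) ^ (?n - 1)) * indicator (ball 0 s) z = 0 \<or>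
    (EX k. norm z < r k & ennreal (1 / norm (z::'a) ^ (?n - 1)) * indicator (ball 0 s) z <= ennreal (c k))"
  proof eventually_elim
   case (elim z)
   show ?case
   proof (cases "norm z < s")
    case False
    thus ?thesis by simp
   next
    case True
    have "EX k. \<not> norm z < r k"
    proof -
     obtain k where "s / norm z < 2 ^ k" using real_arch_pow[of 2 "s / norm z"] by auto
     hence "r k < norm z" using elim by (simp add: r_def field_simps)
     thus ?thesis by (intro exI[of _ k]) simp
    qed
    define k where "k = (LEAST k. \<not> norm z < r k)"
    have k: "\<not> norm z < r k" unfolding k_def by (rule LeastI_ex) fact
    have "k ~= 0"
    proof
     assume "k = 0"
     thus False using k True by (simp add: r_def)
    qed
    then obtain j where j: "k = Suc j" using not0_implies_Suc by blast
    have nj: "norm z < r j" using not_less_Least[of j "%k. \<not> norm z < r k"] j unfolding k_def by simp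
    have "r j / 2 <= norm z" using k j by (simp add: r_def)
    hence "(r j / 2) ^ m <= norm z ^ m" using r[of j] by (intro power_mono) auto
    hence "1 / norm z ^ m <= 1 / (r j / 2) ^ m"
     using r[of j] elim by (intro divide_left_mono mult_pos_pos zero_less_power) auto
    also have "... = c j" by (simp add: c_def power_divide)
    finally show ?thesis using nj True m by (intro disjI2 exI[of _ j]) (auto intro: ennreal_leI)
   qed
  qed
 qed (use r sums in "auto simp: c_def sums_iff less_imp_le")
 thus ?thesis using sums m by (simp add: sums_iff field_simps)
qed

lemma nn_integral_lborel_reflect:
 fixes f :: "'a::euclidean_space => ennreal"
 assumes [measurable]: "f : borel_measurable borel"
 shows "(\<integral>\<^sup>+y. f (x - y) \<partial>lborel) = (\<integral>\<^sup>+z. f z \<partial>lborel)"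
proof -
 have "(lborel :: 'a measure) = density (distr lborel borel (%y. x + (-1) *\<^sub>R y)) (%_. \<bar>-1::real\<bar> ^ DIM('a))"
  by (rule lborel_affine) simp
 hence "(lborel :: 'a measure) = distr lborel borel (%y. x - y)"
  by (simp add: density_1)
 hence "(\<integral>\<^sup>+z. f z \<partial>lborel) = (\<integral>\<^sup>+z. f z \<partial>distr lborel borel (%y. x - y))" by simp
 also have "... = (\<integral>\<^sup>+y. f (x - y) \<partial>lborel)" by (rule nn_integral_distr) auto
 finally show ?thesis by simp
qed

lemma integral_lborel_reflect:
 fixes f :: "'a::euclidean_space => real"
 assumes [measurable]: "f : borel_measurable borel"
 shows "(LINT y|lborel. f (x - y)) = (LINT z|lborel. f z)" "integrable lborel (%y. f (x - y)) = integrable lborel f"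
proof -
 have "(lborel :: 'a measure) = density (distr lborel borel (%y. x + (-1) *\<^sub>R y)) (%_. \<bar>-1::real\<bar> ^ DIM('a))"
  by (rule lborel_affine) simp
 hence eq: "distr lborel borel (%y. x - y) = (lborel :: 'a measure)"
  by (simp add: density_1)
 show "(LINT y|lborel. f (x - y)) = (LINT z|lborel. f z)"
  using integral_distr[of "%y. x - y" lborel borel f] unfolding eq by simp
 show "integrable lborel (%y. f (x - y)) = integrable lborel f"
  using integrable_distr_eq[of "%y. x - y" lborel borel f] unfolding eq by simp
qed

lemma lborel_translate:
 fixes f :: "'a::euclidean_space => real"
 assumes [measurable]: "f : borel_measurable borel"
 shows "(LINT y|lborel. f (x + y)) = (LINT z|lborel. f z)" "integrable lborel (%y. f (x + y)) = integrable lborel f"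
proof -
 have eq: "distr lborel borel (%y. x + y) = (lborel :: 'a measure)" by (rule lborel_distr_plus)
 show "(LINT y|lborel. f (x + y)) = (LINT z|lborel. f z)"
  using integral_distr[of "%y. x + y" lborel borel f] unfolding eq by simp
 show "integrable lborel (%y. f (x + y)) = integrable lborel f"
  using integrable_distr_eq[of "%y. x + y" lborel borel f] unfolding eq by simp
qed

text \<open>Translation invariance of Lebesgue measure annihilates the integral of every difference
  quotient, so no boundary term appears. The mean value theorem turns the quotients into values of
  \<open>g\<close> on a segment in direction \<open>v\<close>, which is why \<open>w\<close> has to
  dominate \<open>g\<close> along a whole segment.\<close>

lemma integral_directional_derivative_zero:
 fixes f g w :: "'a::euclidean_space => real" and v :: 'a
 assumes f: "integrable lborel f" "f : borel_measurable borel" and g: "g : borel_measurable borel"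
  and d: "!!x t. ((%t. f (x + t *\<^sub>R v)) has_real_derivative g (x + t *\<^sub>R v)) (at t)"
  and w: "integrable lborel w" "!!x t. \<bar>t\<bar> <= 1 ==> \<bar>g (x + t *\<^sub>R v)\<bar> <= w x"
 shows "(LINT x|lborel. g x) = 0"
proof -
 define q where "q n x = (f (x + (1 / real (Suc n)) *\<^sub>R v) - f x) * real (Suc n)" for n :: nat and x
 note [measurable] = f(2) g
 have "(%n. LINT x|lborel. q n x) ---> (LINT x|lborel. g x)"
 proof (rule integral_dominated_convergence[where w=w])
  show "AE x in lborel. (%n. q n x) ---> g x"
  proof (rule AE_I2)
   fix x
   have "(%h. (f (x + h *\<^sub>R v) - f x) / h) \<midarrow>0\<rightarrow> g x"
    using d[of x 0] by (simp add: DERIV_def)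
   moreover have "filterlim (%n. 1 / real (Suc n)) (at 0) sequentially"
    using LIMSEQ_Suc[OF lim_1_over_n] by (intro filterlim_atI) auto
   ultimately have "(%n. (f (x + (1 / real (Suc n)) *\<^sub>R v) - f x) / (1 / real (Suc n))) ---> g x"
    by (rule filterlim_compose)
   thus "(%n. q n x) ---> g x" by (simp add: q_def)
  qed
  show "AE x in lborel. norm (q n x) <= w x" for n
  proof (rule AE_I2)
   fix x
   let ?h = "1 / real (Suc n)"
   obtain t where t: "0 < t" "t < ?h" "f (x + ?h *\<^sub>R v) - f (x + 0 *\<^sub>R v) = (?h - 0) * g (x + t *\<^sub>R v)"
    using MVT2[of 0 ?h "%t. f (x + t *\<^sub>R v)" "%t. g (x + t *\<^sub>R v)"] d by auto
   hence "q n x = g (x + t *\<^sub>R v)" by (simp add: q_def)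
   moreover have "?h <= 1" by simp
   hence "\<bar>t\<bar> <= 1" using t by linarith
   ultimately show "norm (q n x) <= w x" using w(2)[of t x] by simp
  qed
 qed (use w in "auto simp: q_def")
 moreover have "(LINT x|lborel. q n x) = 0" for n
 proof -
  have i: "integrable lborel (%x. f (x + (1 / real (Suc n)) *\<^sub>R v))" "(LINT x|lborel. f (x + (1 / real (Suc n)) *\<^sub>R v)) = (LINT x|lborel. f x)"
   using lborel_translate[OF f(2), of "(1 / real (Suc n)) *\<^sub>R v"] f(1) by (auto simp: add.commute)
  show ?thesis unfolding q_def using i f(1) by simp
 qed
 ultimately show ?thesis using LIMSEQ_unique[OF _ tendsto_const] by fastforce
qed

text \<open>The bound \<open>B\<close> on the derivative keeps every remainder quotient below
  \<open>2 * B\<close>, and constants are integrable against a finite measure. The limit is taken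
  along sequences so that dominated convergence applies.\<close>

lemma has_derivative_convolution:
 fixes g :: "'a::euclidean_space => real"
 assumes m: "finite_measure m" "sets m = sets borel"
  and g: "continuous_on UNIV g" "!!z. \<bar>g z\<bar> <= B0"
  and d: "!!z. (g has_derivative g' z) (at z)" and b: "!!z h. \<bar>g' z h\<bar> <= B * norm h"
  and c: "!!h. continuous_on UNIV (%z. g' z h)"
 shows "((%x. LINT y|m. g (x - y)) has_derivative (%h. LINT y|m. g' (x - y) h)) (at x)"
  "integrable m (%y. g (x - y))" "integrable m (%y. g' (x - y) h)"
proof -
 interpret finite_measure m by fact
 have gm: "g : borel_measurable borel" and g'm: "(%z. g' z h) : borel_measurable borel" for h
  using borel_measurable_continuous_onI[OF g(1)] borel_measurable_continuous_onI[OF c] by auto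
 have mg: "(%y. g (x - y)) : borel_measurable m" and mg': "(%y. g' (x - y) h) : borel_measurable m" for x h
  by (subst measurable_cong_sets[OF m(2) refl], use gm g'm in measurable)+
 have i1: "integrable m (%y. g (x - y))" for x
  by (rule integrable_const_bound[OF _ mg, where B=B0]) (use g(2) in auto)
 have i2: "integrable m (%y. g' (x - y) h)" for x h
  by (rule integrable_const_bound[OF _ mg', where B="B * norm h"]) (use b in auto)
 show "integrable m (%y. g (x - y))" "integrable m (%y. g' (x - y) h)" by (rule i1, rule i2)
 have lin: "bounded_linear (g' z)" for z using d has_derivative_bounded_linear by blast
 have B: "0 <= B"
 proof -
  obtain i :: 'a where i: "i : Basis" using nonempty_Basis by blast
  hence "0 <= B * norm i" using b[of 0 i] by (meson abs_ge_zero order_trans)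
  thus ?thesis using i by simp
 qed
 have gB: "\<bar>g (z + h) - g z\<bar> <= B * norm h" for z h
 proof -
  have "norm (g (z + h) - g z) <= B * norm (z + h - z)"
  proof (rule differentiable_bound[where S=UNIV and f'=g'])
   show "onorm (g' z) <= B" for z by (rule onorm_bound) (use B b in "auto simp: mult.commute")
  qed (use d in auto)
  thus ?thesis by simp
 qed
 show "((%x. LINT y|m. g (x - y)) has_derivative (%h. LINT y|m. g' (x - y) h)) (at x)"
  unfolding has_derivative_at_within
 proof (intro conjI)
  show "bounded_linear (%h. LINT y|m. g' (x - y) h)"
  proof (rule bounded_linear_intro[where K="B * measure m (space m)"])
   show "(LINT y|m. g' (x - y) (h + k)) = (LINT y|m. g' (x - y) h) + (LINT y|m. g' (x - y) k)" for h k
    using i2 by (simp add: linear_add[OF bounded_linear.linear[OF lin]])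
   show "(LINT y|m. g' (x - y) (r *\<^sub>R h)) = r *\<^sub>R (LINT y|m. g' (x - y) h)" for r h
    by (simp add: linear_scale[OF bounded_linear.linear[OF lin]])
   show "norm (LINT y|m. g' (x - y) h) <= norm h * (B * measure m (space m))" for h
   proof -
    have "norm (LINT y|m. g' (x - y) h) <= (LINT y|m. norm (g' (x - y) h))" by (rule integral_norm_bound)
    also have "... <= (LINT y|m. B * norm h)" by (rule integral_mono[OF integrable_norm[OF i2]]) (use b in auto)
    finally show ?thesis by (simp add: mult_ac)
   qed
  qed
  have "((%y. (LINT u|m. (g (y - u) - g (x - u) - g' (x - u) (y - x)) / norm (y - x))) \<longlongrightarrow> 0) (at x)"
   unfolding tendsto_at_iff_sequentially comp_def
  proof (intro allI impI)
   fix X :: "nat => 'a"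
   assume X: "ALL i. X i : UNIV - {x}" "X ---> x"
   have "(%n. LINT u|m. (g (X n - u) - g (x - u) - g' (x - u) (X n - x)) / norm (X n - x)) ---> (LINT u|m. 0)"
   proof (rule integral_dominated_convergence[where w="%_. 2 * B"])
    show "AE u in m. (%n. (g (X n - u) - g (x - u) - g' (x - u) (X n - x)) / norm (X n - x)) ---> 0"
    proof (rule AE_I2)
     fix u
     have "((%y. (g y - g (x - u) - g' (x - u) (y - (x - u))) / norm (y - (x - u))) \<longlongrightarrow> 0) (at (x - u))"
      using d[of "x - u"] by (simp add: has_derivative_at_within divide_inverse mult.commute)
     moreover have "filterlim (%n. X n - u) (at (x - u)) sequentially"
      using X by (intro filterlim_atI tendsto_diff tendsto_const) auto
     ultimately have "(%n. (g (X n - u) - g (x - u) - g' (x - u) (X n - u - (x - u))) / norm (X n - u - (x - u))) ---> 0"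
      by (rule filterlim_compose)
     thus "(%n. (g (X n - u) - g (x - u) - g' (x - u) (X n - x)) / norm (X n - x)) ---> 0" by simp
    qed
    show "AE u in m. norm ((g (X n - u) - g (x - u) - g' (x - u) (X n - x)) / norm (X n - x)) <= 2 * B" for n
    proof (rule AE_I2)
     fix u
     have p: "0 < norm (X n - x)" using X by auto
     have "\<bar>g (X n - u) - g (x - u)\<bar> <= B * norm (X n - x)" using gB[of "x - u" "X n - x"] by simp
     moreover have "\<bar>g' (x - u) (X n - x)\<bar> <= B * norm (X n - x)" by (rule b)
     ultimately have "\<bar>g (X n - u) - g (x - u) - g' (x - u) (X n - x)\<bar> <= 2 * B * norm (X n - x)" by linarith
     thus "norm ((g (X n - u) - g (x - u) - g' (x - u) (X n - x)) / norm (X n - x)) <= 2 * B"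
      using p by (simp add: abs_divide pos_divide_le_eq)
    qed
   qed (use mg mg' in "auto intro!: borel_measurable_diff borel_measurable_divide")
   thus "(%n. LINT u|m. (g (X n - u) - g (x - u) - g' (x - u) (X n - x)) / norm (X n - x)) ---> 0" by simp
  qed
  moreover have "(LINT u|m. (g (y - u) - g (x - u) - g' (x - u) (y - x)) / norm (y - x))
    = (1 / norm (y - x)) *\<^sub>R ((LINT u|m. g (y - u)) - (LINT u|m. g (x - u)) - (LINT u|m. g' (x - u) (y - x)))" for y
   using i1 i2 by simp
  ultimately show "((%y. ((LINT y'|m. g (y - y')) - (LINT y|m. g (x - y)) - (LINT y'|m. g' (x - y') (y - x))) /\<^sub>R norm (y - x)) \<longlongrightarrow> 0) (at x)"
  proof -
   assume a: "((%y. (LINT u|m. (g (y - u) - g (x - u) - g' (x - u) (y - x)) / norm (y - x))) \<longlongrightarrow> 0) (at x)"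
    and e: "!!y. (LINT u|m. (g (y - u) - g (x - u) - g' (x - u) (y - x)) / norm (y - x))
     = (1 / norm (y - x)) *\<^sub>R ((LINT u|m. g (y - u)) - (LINT u|m. g (x - u)) - (LINT u|m. g' (x - u) (y - x)))"
   show ?thesis using a unfolding e by (simp only: inverse_eq_divide)
  qed
 qed
qed

section \<open>The regularised kernel and its derivatives\<close>

definition rr :: "real => 'a::euclidean_space => real" where
 "rr e z = 1 / sqrt ((norm z)^2 + e\<^sup>2)"

lemma rr_nonneg [simp]: "0 <= rr e z"
 by (simp add: rr_def)

context
 fixes e :: real
 assumes e: "0 < e"
begin

lemma rr_sq_pos: "0 < (norm (z::'a::euclidean_space))\<^sup>2 + e\<^sup>2"
 using e by (intro add_nonneg_pos) auto

lemma rr_pos: "0 < rr e z"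
 unfolding rr_def by (intro divide_pos_pos real_sqrt_gt_zero rr_sq_pos) simp

lemma rr_sq: "(rr e z)^2 * ((norm z)^2 + e\<^sup>2) = 1"
 using rr_sq_pos[of z] e by (simp add: rr_def power_divide)

lemma rr_le_inverse:
 assumes a: "0 < a" and le: "a\<^sup>2 <= (norm z)\<^sup>2 + e\<^sup>2"
 shows "rr e z <= 1 / a"
proof -
 have "a <= sqrt ((norm z)^2 + e\<^sup>2)" using le a by (intro real_le_rsqrt)
 thus ?thesis unfolding rr_def using a by (intro divide_left_mono mult_pos_pos real_sqrt_gt_zero rr_sq_pos) auto
qed

lemma rr_le_e: "rr e z <= 1 / e"
 by (rule rr_le_inverse) (use e in auto)

lemma rr_le_norm: "z ~= 0 ==> rr e z <= 1 / norm z"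
 by (rule rr_le_inverse) auto

lemma rr_le_sum: "rr e z <= 2 / (norm z + e)"
proof -
 have "rr e z <= 1 / ((norm z + e) / 2)"
 proof (rule rr_le_inverse)
  have "0 <= (norm z - e)\<^sup>2" "0 <= (norm z)\<^sup>2" "0 <= e\<^sup>2" by auto
  thus "((norm z + e) / 2)^2 <= (norm z)\<^sup>2 + e\<^sup>2"
   unfolding power_divide power2_sum power2_diff by (simp add: divide_le_eq, linarith)
 qed (use e in "auto intro: add_nonneg_pos")
 thus ?thesis by simp
qed

lemma rr_norm_le1: "norm z * rr e z <= 1"
proof (cases "z = 0")
 case False
 thus ?thesis using rr_le_norm[OF False] by (simp add: field_simps)
qed simp

lemma rr_e_le1: "e * rr e z <= 1"
 using rr_le_e[of z] e by (simp add: field_simps)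

lemma rr_uminus: "rr e (- z) = rr e z"
 by (simp add: rr_def)

lemma rr_has_derivative: "(rr e has_derivative (%h. - (z \<bullet> h) * rr e z ^ 3)) (at z)"
proof -
 let ?q = "%z::'a. z \<bullet> z + e\<^sup>2"
 have q: "0 < ?q z" using rr_sq_pos[of z] by (simp add: power2_norm_eq_inner)
 have "((%z. inverse (sqrt (?q z))) has_derivative (%h. - (inverse (sqrt (?q z)) * ((2 * (z \<bullet> h)) * (inverse (sqrt (?q z)) / 2)) * inverse (sqrt (?q z))))) (at z)"
  by (rule derivative_eq_intros refl | use q in "simp add: inner_commute field_simps; fail")+
 moreover have "rr e = (%z. inverse (sqrt (?q z)))"
  by (auto simp: rr_def inverse_eq_divide power2_norm_eq_inner)
 ultimately show ?thesis by (simp add: power3_eq_cube mult_ac)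
qed

lemma rr_power_has_derivative:
 "((%z. rr e z ^ k) has_derivative (%h. - (real k * (z \<bullet> h) * rr e z ^ (k + 2)))) (at z)"
proof (induction k)
 case (Suc k)
 have "((%z. rr e z * rr e z ^ k) has_derivative (%h. rr e z * (- (real k * (z \<bullet> h) * rr e z ^ (k + 2))) + (- (z \<bullet> h) * rr e z ^ 3) * rr e z ^ k)) (at z)"
  by (rule has_derivative_mult[OF rr_has_derivative Suc])
 thus ?case by (simp add: algebra_simps power_add power3_eq_cube power2_eq_square)
qed simp

lemma rr_continuous: "continuous_on UNIV (rr e)"
 using rr_has_derivative has_derivative_continuous by (intro continuous_at_imp_continuous_on) blast

end

text \<open>The \<open>i\<close>-th component of \<open>x / |x| ^ n\<close>, with \<open>|x|\<close>
  smoothed at scale \<open>e\<close>. Before smoothing this is, up to a constant factor, the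
  gradient of the fundamental solution of the Laplacian. \<open>G1\<close> and \<open>G2\<close> are
  its first and second derivatives in the directions \<open>h\<close> and \<open>k\<close>.\<close>

definition G0 :: "real => 'n::finite => real ^ 'n => real" where
 "G0 e i z = z $ i * rr e z ^ CARD('n)"

definition G1 :: "real => 'n::finite => real ^ 'n => real ^ 'n => real" where
 "G1 e i z h = h $ i * rr e z ^ CARD('n) - real CARD('n) * z $ i * (z \<bullet> h) * rr e z ^ (CARD('n) + 2)"

definition G2 :: "real => 'n::finite => real ^ 'n => real ^ 'n => real ^ 'n => real" where
 "G2 e i z h k = - real CARD('n) * (h $ i * (z \<bullet> k) + k $ i * (z \<bullet> h) + z $ i * (h \<bullet> k)) * rr e z ^ (CARD('n) + 2)
   + real CARD('n) * real (CARD('n) + 2) * z $ i * (z \<bullet> h) * (z \<bullet> k) * rr e z ^ (CARD('n) + 4)"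

lemma card_pos: "0 < CARD('n::finite)" "1 <= CARD('n::finite)"
 by (simp_all add: Suc_leI)

context
 fixes e :: real
 assumes e: "0 < e"
begin

lemma G0_has_derivative: "(G0 e i has_derivative G1 e i z) (at z)"
proof -
 have "((%z. z $ i * rr e z ^ CARD('a)) has_derivative (%h. z $ i * (- (real CARD('a) * (z \<bullet> h) * rr e z ^ (CARD('a) + 2))) + h $ i * rr e z ^ CARD('a))) (at z)"
  by (rule has_derivative_mult[OF bounded_linear_imp_has_derivative[OF bounded_linear_vec_nth] rr_power_has_derivative[OF e]])
 thus ?thesis unfolding G0_def[abs_def] G1_def[abs_def] by (simp add: algebra_simps)
qed

lemma G1_has_derivative: "((%z. G1 e i z h) has_derivative (%k. G2 e i z h k)) (at z)"
proof -
 let ?n = "CARD('a)"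
 have a: "((%z. h $ i * rr e z ^ ?n) has_derivative (%k. h $ i * (- (real ?n * (z \<bullet> k) * rr e z ^ (?n + 2))))) (at z)"
  by (rule has_derivative_mult_right[OF rr_power_has_derivative[OF e]])
 have b: "((%z. z $ i * (z \<bullet> h)) has_derivative (%k. z $ i * (k \<bullet> h) + k $ i * (z \<bullet> h))) (at z)"
  by (rule has_derivative_mult[OF bounded_linear_imp_has_derivative[OF bounded_linear_vec_nth] bounded_linear_imp_has_derivative[OF bounded_linear_inner_left]])
 have c: "((%z. (z $ i * (z \<bullet> h)) * rr e z ^ (?n + 2)) has_derivative (%k. (z $ i * (z \<bullet> h)) * (- (real (?n + 2) * (z \<bullet> k) * rr e z ^ (?n + 2 + 2))) + (z $ i * (k \<bullet> h) + k $ i * (z \<bullet> h)) * rr e z ^ (?n + 2))) (at z)"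
  by (rule has_derivative_mult[OF b rr_power_has_derivative[OF e]])
 have "((%z. h $ i * rr e z ^ ?n - real ?n * ((z $ i * (z \<bullet> h)) * rr e z ^ (?n + 2))) has_derivative
   (%k. h $ i * (- (real ?n * (z \<bullet> k) * rr e z ^ (?n + 2))) - real ?n * ((z $ i * (z \<bullet> h)) * (- (real (?n + 2) * (z \<bullet> k) * rr e z ^ (?n + 2 + 2))) + (z $ i * (k \<bullet> h) + k $ i * (z \<bullet> h)) * rr e z ^ (?n + 2)))) (at z)"
  by (rule has_derivative_diff[OF a has_derivative_mult_right[OF c]])
 moreover have "(%z. G1 e i z h) = (%z. h $ i * rr e z ^ ?n - real ?n * ((z $ i * (z \<bullet> h)) * rr e z ^ (?n + 2)))"
  by (simp add: G1_def mult.assoc)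
 moreover have "(%k. G2 e i z h k) = (%k. h $ i * (- (real ?n * (z \<bullet> k) * rr e z ^ (?n + 2))) - real ?n * ((z $ i * (z \<bullet> h)) * (- (real (?n + 2) * (z \<bullet> k) * rr e z ^ (?n + 2 + 2))) + (z $ i * (k \<bullet> h) + k $ i * (z \<bullet> h)) * rr e z ^ (?n + 2)))"
 proof
  fix k
  define a where "a = rr e z ^ (?n + 2)"
  define b where "b = rr e z ^ (?n + 4)"
  have p: "rr e z ^ (?n + 2 + 2) = b" by (simp add: b_def numeral_eq_Suc)
  show "G2 e i z h k = h $ i * (- (real ?n * (z \<bullet> k) * rr e z ^ (?n + 2))) - real ?n * ((z $ i * (z \<bullet> h)) * (- (real (?n + 2) * (z \<bullet> k) * rr e z ^ (?n + 2 + 2))) + (z $ i * (k \<bullet> h) + k $ i * (z \<bullet> h)) * rr e z ^ (?n + 2))"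
   unfolding G2_def p a_def[symmetric] b_def[symmetric] inner_commute[of k h] by (simp add: algebra_simps)
 qed
 ultimately show ?thesis by simp
qed

lemma inner_rr_le: "\<bar>z \<bullet> h\<bar> * rr e z <= norm h" "\<bar>(z::real^'n) $ i\<bar> * rr e z <= 1"
proof -
 have r: "0 <= rr e z" using rr_pos[OF e, of z] by simp
 have "\<bar>z \<bullet> h\<bar> * rr e z <= (norm z * norm h) * rr e z" by (intro mult_right_mono Cauchy_Schwarz_ineq2 r)
 also have "... = norm h * (norm z * rr e z)" by simp
 also have "... <= norm h * 1" by (intro mult_left_mono rr_norm_le1[OF e]) auto
 finally show "\<bar>z \<bullet> h\<bar> * rr e z <= norm h" by simp
 have "\<bar>z $ i\<bar> * rr e z <= norm z * rr e z" by (intro mult_right_mono component_le_norm_cart r)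
 thus "\<bar>z $ i\<bar> * rr e z <= 1" using rr_norm_le1[OF e, of z] by linarith
qed

text \<open>The pattern of all three bounds: every factor of \<open>z\<close> is absorbed by one
  factor \<open>rr\<close>, since \<open>norm z * rr e z\<close> is at most 1. What remains is the
  homogeneity, \<open>n - 1\<close> for the kernel and one more for each derivative.\<close>

lemma G0_bound: "\<bar>G0 e i (z::real^'n)\<bar> <= rr e z ^ (CARD('n) - 1)"
proof -
 obtain m where m: "CARD('n) = Suc m" using card_pos(1)[where 'n='n] gr0_conv_Suc by blast
 have "\<bar>G0 e i z\<bar> = (\<bar>z $ i\<bar> * rr e z) * rr e z ^ m"
  using rr_pos[OF e, of z] by (simp add: G0_def m abs_mult)
 also have "... <= 1 * rr e z ^ m" using rr_pos[OF e, of z] by (intro mult_right_mono inner_rr_le) auto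
 finally show ?thesis by (simp add: m)
qed

lemma G1_bound: "\<bar>G1 e i (z::real^'n) h\<bar> <= real (CARD('n) + 1) * rr e z ^ CARD('n) * norm h"
proof -
 let ?n = "CARD('n)" and ?r = "rr e z"
 have r: "0 < ?r" by (rule rr_pos[OF e])
 have a: "\<bar>h $ i * ?r ^ ?n\<bar> <= norm h * ?r ^ ?n"
  using r by (simp add: abs_mult component_le_norm_cart)
 have "\<bar>z $ i * (z \<bullet> h) * ?r ^ (?n + 2)\<bar> = ((\<bar>z $ i\<bar> * ?r) * (\<bar>z \<bullet> h\<bar> * ?r)) * ?r ^ ?n"
  using r by (simp add: abs_mult power_add power2_eq_square)
 also have "... <= (1 * norm h) * ?r ^ ?n" using r by (intro mult_right_mono mult_mono inner_rr_le) auto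
 finally have "real ?n * \<bar>z $ i * (z \<bullet> h) * ?r ^ (?n + 2)\<bar> <= real ?n * (norm h * ?r ^ ?n)"
  by (intro mult_left_mono) auto
 hence "\<bar>real ?n * (z $ i * (z \<bullet> h) * ?r ^ (?n + 2))\<bar> <= real ?n * (norm h * ?r ^ ?n)" by (simp add: abs_mult)
 moreover have "G1 e i z h = h $ i * ?r ^ ?n - real ?n * (z $ i * (z \<bullet> h) * ?r ^ (?n + 2))" by (simp add: G1_def mult.assoc)
 ultimately have "\<bar>G1 e i z h\<bar> <= norm h * ?r ^ ?n + real ?n * (norm h * ?r ^ ?n)" using a by linarith
 thus ?thesis by (simp add: algebra_simps)
qed

lemma G2_bound: "\<bar>G2 e i (z::real^'n) h k\<bar> <= (3 * real CARD('n) + real CARD('n) * real (CARD('n) + 2)) * rr e z ^ (CARD('n) + 1) * (norm h * norm k)"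
proof -
 let ?n = "CARD('n)" and ?r = "rr e z"
 let ?R = "?r ^ (?n + 1) * (norm h * norm k)"
 have r: "0 < ?r" by (rule rr_pos[OF e])
 have 1: "\<bar>h $ i * (z \<bullet> k) * ?r ^ (?n + 2)\<bar> <= ?r ^ (?n + 1) * (norm h * norm k)" for h k
 proof -
  have "\<bar>h $ i * (z \<bullet> k) * ?r ^ (?n + 2)\<bar> = (\<bar>h $ i\<bar> * (\<bar>z \<bullet> k\<bar> * ?r)) * ?r ^ (?n + 1)"
   using r by (simp add: abs_mult power_add power2_eq_square)
  also have "... <= (norm h * norm k) * ?r ^ (?n + 1)" using r by (intro mult_right_mono mult_mono inner_rr_le component_le_norm_cart) auto
  also have "... = ?r ^ (?n + 1) * (norm h * norm k)" by simp
  finally show ?thesis .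
 qed
 have 3: "\<bar>z $ i * (h \<bullet> k) * ?r ^ (?n + 2)\<bar> <= ?R"
 proof -
  have "\<bar>z $ i * (h \<bullet> k) * ?r ^ (?n + 2)\<bar> = ((\<bar>z $ i\<bar> * ?r) * \<bar>h \<bullet> k\<bar>) * ?r ^ (?n + 1)"
   using r by (simp add: abs_mult power_add power2_eq_square)
  also have "... <= (1 * (norm h * norm k)) * ?r ^ (?n + 1)" using r by (intro mult_right_mono mult_mono inner_rr_le Cauchy_Schwarz_ineq2) auto
  also have "... = ?R" by simp
  finally show ?thesis .
 qed
 have 4: "\<bar>z $ i * (z \<bullet> h) * (z \<bullet> k) * ?r ^ (?n + 4)\<bar> <= ?R"
 proof -
  have "?r ^ (?n + 4) = ?r ^ (?n + 1) * (?r * ?r * ?r)" by (simp add: power_add eval_nat_numeral)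
  hence "\<bar>z $ i * (z \<bullet> h) * (z \<bullet> k) * ?r ^ (?n + 4)\<bar> = ((\<bar>z $ i\<bar> * ?r) * ((\<bar>z \<bullet> h\<bar> * ?r) * (\<bar>z \<bullet> k\<bar> * ?r))) * ?r ^ (?n + 1)"
   using r by (simp add: abs_mult)
  also have "... <= (1 * (norm h * norm k)) * ?r ^ (?n + 1)" using r by (intro mult_right_mono mult_mono inner_rr_le) auto
  also have "... = ?R" by simp
  finally show ?thesis .
 qed
 have eq: "G2 e i z h k = - (real ?n * (h $ i * (z \<bullet> k) * ?r ^ (?n + 2))) - real ?n * (k $ i * (z \<bullet> h) * ?r ^ (?n + 2)) - real ?n * (z $ i * (h \<bullet> k) * ?r ^ (?n + 2))
   + real ?n * real (?n + 2) * (z $ i * (z \<bullet> h) * (z \<bullet> k) * ?r ^ (?n + 4))"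
  unfolding G2_def by (simp add: algebra_simps)
 have m: "\<bar>c * t\<bar> <= c * ?R" if "0 <= c" "\<bar>t\<bar> <= ?R" for c t using that by (simp add: abs_mult mult_left_mono)
 have k1: "\<bar>k $ i * (z \<bullet> h) * ?r ^ (?n + 2)\<bar> <= ?R" using 1[of k h] by (simp add: mult.commute[of "norm k"])
 have "\<bar>G2 e i z h k\<bar> <= real ?n * ?R + real ?n * ?R + real ?n * ?R + (real ?n * real (?n + 2)) * ?R"
  unfolding eq using m[OF of_nat_0_le_iff 1[of h k], of ?n] m[OF of_nat_0_le_iff k1, of ?n] m[OF of_nat_0_le_iff 3, of ?n] m[OF mult_nonneg_nonneg[OF of_nat_0_le_iff of_nat_0_le_iff] 4, of ?n "?n + 2"]
  by linarith
 thus ?thesis by (simp add: algebra_simps)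
qed

lemma G_continuous: "continuous_on UNIV (G0 e i)" "continuous_on UNIV (%z. G1 e i z h)" "continuous_on UNIV (%z. G2 e i z h k)"
 unfolding G0_def[abs_def] G1_def G2_def
 by (intro continuous_intros rr_continuous[OF e])+

text \<open>Oddness makes the second derivative integrate to zero over the whole space. An integral
  over a set can then be traded for one over its complement, away from the singularity.\<close>

lemma G2_odd: "G2 e i (- z) h k = - G2 e i z h k"
 by (simp add: G2_def rr_uminus[OF e] algebra_simps)

lemma G2_sym: "G2 e i z h k = G2 e i z k h"
 by (simp add: G2_def inner_commute algebra_simps)

text \<open>The kernel is a gradient field, so its derivative is a symmetric matrix. The
  \<open>L2\<close> identity for the field rests on this.\<close>

lemma G1_sym: "G1 e i z (axis j 1) = G1 e j z (axis i 1)"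
proof -
 have "axis j 1 $ i = (axis i 1 $ j :: real)" by (simp add: axis_def)
 thus ?thesis by (simp add: G1_def inner_axis)
qed

lemma G1_linear: "G1 e i z h = (SUM j:UNIV. h $ j * G1 e i z (axis j 1))"
proof -
 have 1: "(SUM j:UNIV. h $ j * (axis j 1 $ i :: real)) = h $ i"
  by (simp add: axis_def if_distrib cong: if_cong)
 have 2: "(SUM j:UNIV. h $ j * (z \<bullet> axis j 1)) = z \<bullet> h"
  unfolding inner_axis by (simp add: inner_vec_def mult.commute)
 have "(SUM j:UNIV. h $ j * G1 e i z (axis j 1)) = (SUM j:UNIV. h $ j * (axis j 1 $ i)) * rr e z ^ CARD('a)
   - real CARD('a) * z $ i * (SUM j:UNIV. h $ j * (z \<bullet> axis j 1)) * rr e z ^ (CARD('a) + 2)"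
  unfolding G1_def sum_distrib_left sum_distrib_right sum_subtractf[symmetric] by (rule sum.cong) (auto simp: algebra_simps)
 thus ?thesis unfolding 1 2 by (simp add: G1_def)
qed

text \<open>Without smoothing the divergence vanishes off the origin. With it, \<open>rr_sq\<close>
  leaves a positive bump that behaves like a multiple of an approximate identity at scale
  \<open>e\<close>.\<close>

lemma G1_div: "(SUM i:UNIV. G1 e i (z::real^'n) (axis i 1)) = real CARD('n) * e\<^sup>2 * rr e z ^ (CARD('n) + 2)"
proof -
 let ?r = "rr e z"
 have "(SUM i:UNIV. G1 e i z (axis i 1)) = real CARD('n) * ?r ^ CARD('n) - real CARD('n) * (z \<bullet> z) * ?r ^ (CARD('n) + 2)"
  unfolding G1_def inner_axis sum_subtractf by (simp add: inner_vec_def sum_distrib_left sum_distrib_right mult.assoc)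
 also have "?r ^ CARD('n) = ?r ^ CARD('n) * (?r\<^sup>2 * ((norm z)^2 + e\<^sup>2))" using rr_sq[OF e, of z] by simp
 also have "... = ?r ^ (CARD('n) + 2) * ((z \<bullet> z) + e\<^sup>2)" by (simp add: power_add power2_norm_eq_inner[symmetric] power2_eq_square)
 finally show ?thesis by (simp add: algebra_simps)
qed

end

section \<open>The vector field of a set\<close>

definition mA :: "('a::euclidean_space) set => 'a measure" where
 "mA A = density lborel (indicator A)"

text \<open>The field of a uniform mass distribution on \<open>A\<close>, as in Newtonian gravity.
  \<open>D1\<close> and \<open>D2\<close> are its first and second derivatives, taken under the
  integral sign.\<close>

definition TT :: "real => (real^'n::finite) set => 'n => real^'n => real" where
 "TT e A i x = (LINT y|mA A. G0 e i (x - y))"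
definition D1 :: "real => (real^'n::finite) set => 'n => real^'n => real^'n => real" where
 "D1 e A i x h = (LINT y|mA A. G1 e i (x - y) h)"
definition D2 :: "real => (real^'n::finite) set => 'n => real^'n => real^'n => real^'n => real" where
 "D2 e A i x h k = (LINT y|mA A. G2 e i (x - y) h k)"

text \<open>\<open>KT / e\<close> bounds the integral of \<open>rr ^ (n + 1)\<close>: the first two
  factors come from \<open>nn_integral_tail_kernel\<close>, the last from \<open>rr_le_sum\<close>.
  \<open>K1\<close> is the resulting bound for the divergence kernel, and \<open>K2\<close> the one
  for second derivatives, with the coefficient of \<open>G2_bound\<close>. All depend on the
  dimension alone.\<close>

definition KT :: "nat => real" where "KT n = unit_ball_vol (real n) * 2 ^ (n + 2) * 2 ^ (n + 1)"
definition K1 :: "nat => real" where "K1 n = real n * KT n"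
definition K2 :: "nat => real" where "K2 n = (3 * real n + real n * real (n + 2)) * KT n"

lemma KT_pos: "0 < KT n" unfolding KT_def by (simp add: unit_ball_vol_pos)

lemma abs_integral_le:
 assumes "f : borel_measurable M" "(\<integral>\<^sup>+y. ennreal \<bar>f y\<bar> \<partial>M) <= ennreal c" "0 <= c"
 shows "\<bar>integral\<^sup>L M (f :: _ => real)\<bar> <= c"
proof -
 have "ennreal (norm (integral\<^sup>L M f)) <= (\<integral>\<^sup>+y. ennreal (norm (f y)) \<partial>M)"
  by (rule integral_norm_bound_ennreal)
   (use assms le_less_trans[OF assms(2)] in "auto simp: integrable_iff_bounded")
 hence "ennreal \<bar>integral\<^sup>L M f\<bar> <= ennreal c" using assms(2) by (simp add: order_trans)
 thus ?thesis using assms(3) by simp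
qed

context
 fixes e :: real and A :: "(real^'n::finite) set"
 assumes e: "0 < e" and A[measurable]: "A : sets borel" and Afin: "emeasure lborel A < \<infinity>"
begin

lemma sets_mA: "sets (mA A) = sets borel"
 by (simp add: mA_def)

lemma measurable_mA: "f : borel_measurable borel ==> f : borel_measurable (mA A)"
 by (simp add: measurable_cong_sets[OF sets_mA refl])

lemma finite_mA: "finite_measure (mA A)"
 by (rule finite_measureI) (use Afin in "simp add: mA_def emeasure_density")

lemma measure_mA: "measure (mA A) UNIV = measure lborel A"
 by (simp add: mA_def measure_def emeasure_density)

lemma nn_integral_mA_le:
 assumes [measurable]: "f : borel_measurable borel"
 shows "(\<integral>\<^sup>+y. f (x - y) \<partial>mA A) <= (\<integral>\<^sup>+z. f z \<partial>lborel)"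
proof -
 have "(\<integral>\<^sup>+y. f (x - y) \<partial>mA A) = (\<integral>\<^sup>+y. f (x - y) * indicator A y \<partial>lborel)"
  unfolding mA_def by (subst nn_integral_density) (auto simp: mult.commute)
 also have "... <= (\<integral>\<^sup>+y. f (x - y) \<partial>lborel)"
  by (rule nn_integral_mono) (auto simp: indicator_def)
 also have "... = (\<integral>\<^sup>+z. f z \<partial>lborel)" by (rule nn_integral_lborel_reflect) measurable
 finally show ?thesis .
qed

lemma rr_power_le: "rr e (z::real^'n) ^ k <= 1 / e ^ k"
 using power_mono[OF rr_le_e[OF e, of z] less_imp_le[OF rr_pos[OF e]], of k] by (simp add: power_divide)

lemma rr_borel [measurable]: "rr e : borel_measurable (borel :: (real^'n) measure)"
 by (rule borel_measurable_continuous_onI[OF rr_continuous[OF e]])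

lemma nn_integral_rr: "(\<integral>\<^sup>+z. ennreal (rr e (z::real^'n) ^ (CARD('n) + 1)) \<partial>lborel) <= ennreal (KT CARD('n) / e)"
proof -
 have "(\<integral>\<^sup>+z. ennreal (rr e (z::real^'n) ^ (CARD('n) + 1)) \<partial>lborel)
   <= (\<integral>\<^sup>+z. ennreal (2 ^ (CARD('n) + 1)) * ennreal (1 / (norm (z::real^'n) + e) ^ (DIM(real^'n) + 1)) \<partial>lborel)"
 proof (rule nn_integral_mono)
  fix z :: "real^'n"
  have "rr e z ^ (CARD('n) + 1) <= (2 / (norm z + e)) ^ (CARD('n) + 1)"
   using rr_pos[OF e, of z] by (intro power_mono rr_le_sum[OF e]) auto
  also have "... = 2 ^ (CARD('n) + 1) * (1 / (norm z + e) ^ (DIM(real^'n) + 1))" by (simp add: power_divide)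
  finally show "ennreal (rr e z ^ (CARD('n) + 1)) <= ennreal (2 ^ (CARD('n) + 1)) * ennreal (1 / (norm z + e) ^ (DIM(real^'n) + 1))"
   using e by (subst ennreal_mult[symmetric]) (auto intro!: ennreal_leI)
 qed
 also have "... = ennreal (2 ^ (CARD('n) + 1)) * (\<integral>\<^sup>+z. ennreal (1 / (norm (z::real^'n) + e) ^ (DIM(real^'n) + 1)) \<partial>lborel)"
  by (rule nn_integral_cmult) measurable
 also have "... <= ennreal (2 ^ (CARD('n) + 1)) * ennreal (unit_ball_vol (real DIM(real^'n)) * 2 ^ (DIM(real^'n) + 2) / e)"
  by (rule mult_left_mono[OF nn_integral_tail_kernel[OF e]]) simp
 also have "... = ennreal (KT CARD('n) / e)"
  using e by (subst ennreal_mult[symmetric]) (auto simp: KT_def mult_ac)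
 finally show ?thesis .
qed

lemma TT_has_derivative: "(TT e A i has_derivative D1 e A i x) (at x)" "integrable (mA A) (%y. G0 e i (x - y))"
 and G1_integrable: "integrable (mA A) (%y. G1 e i (x - y) h)"
proof -
 have b0: "\<bar>G0 e i z\<bar> <= 1 / e ^ (CARD('n) - 1)" for z
  by (rule order_trans[OF G0_bound[OF e] rr_power_le])
 have b1: "\<bar>G1 e i z h\<bar> <= (real (CARD('n) + 1) * (1 / e ^ CARD('n))) * norm h" for z h
  by (rule order_trans[OF G1_bound[OF e]]) (intro mult_right_mono mult_left_mono rr_power_le; simp)
 note * = has_derivative_convolution[OF finite_mA sets_mA G_continuous(1)[OF e] b0 G0_has_derivative[OF e] b1 G_continuous(2)[OF e]]
 show "(TT e A i has_derivative D1 e A i x) (at x)" "integrable (mA A) (%y. G0 e i (x - y))" "integrable (mA A) (%y. G1 e i (x - y) h)"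
  using * unfolding TT_def[abs_def] D1_def[abs_def] by auto
qed

lemma D1_has_derivative: "((%x. D1 e A i x h) has_derivative (%k. D2 e A i x h k)) (at x)"
 and G2_integrable: "integrable (mA A) (%y. G2 e i (x - y) h k)"
proof -
 have b1: "\<bar>G1 e i z h\<bar> <= real (CARD('n) + 1) * (1 / e ^ CARD('n)) * norm h" for z
  by (rule order_trans[OF G1_bound[OF e]]) (intro mult_right_mono mult_left_mono rr_power_le; simp)
 have b2: "\<bar>G2 e i z h k\<bar> <= ((3 * real CARD('n) + real CARD('n) * real (CARD('n) + 2)) * (1 / e ^ (CARD('n) + 1)) * norm h) * norm k" for z k
 proof -
  have "\<bar>G2 e i z h k\<bar> <= (3 * real CARD('n) + real CARD('n) * real (CARD('n) + 2)) * (1 / e ^ (CARD('n) + 1)) * (norm h * norm k)"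
   by (rule order_trans[OF G2_bound[OF e]]) (intro mult_right_mono mult_left_mono rr_power_le; simp)
  thus ?thesis by (simp only: mult.assoc)
 qed
 note * = has_derivative_convolution[OF finite_mA sets_mA G_continuous(2)[OF e] b1 G1_has_derivative[OF e] b2 G_continuous(3)[OF e]]
 show "((%x. D1 e A i x h) has_derivative (%k. D2 e A i x h k)) (at x)" "integrable (mA A) (%y. G2 e i (x - y) h k)"
  using * unfolding D2_def[abs_def] D1_def[abs_def] by auto
qed

lemma TT_continuous: "continuous_on UNIV (TT e A i)" "continuous_on UNIV (%x. D1 e A i x h)"
 using TT_has_derivative(1) D1_has_derivative has_derivative_continuous
 by (intro continuous_at_imp_continuous_on; blast)+

lemma D1_sym: "D1 e A i x (axis j 1) = D1 e A j x (axis i 1)"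
 unfolding D1_def G1_sym[OF e, of i _ j] ..

lemma D2_sym: "D2 e A i x h k = D2 e A i x k h"
 unfolding D2_def G2_sym[OF e, of i _ h k] ..

lemma D1_linear: "D1 e A i x h = (SUM j:UNIV. h $ j * D1 e A i x (axis j 1))"
 unfolding D1_def by (subst G1_linear[OF e], subst integral_sum) (auto intro!: G1_integrable)

text \<open>The kernel is split at a radius \<open>s\<close> of free choice: the singular part
  integrates to a multiple of \<open>s\<close>, and the rest is at most the measure of
  \<open>A\<close> divided by \<open>s ^ (n - 1)\<close>. The bound does not see \<open>e\<close>,
  and a suitable \<open>s\<close> makes it small when \<open>A\<close> has small measure.\<close>

lemma TT_bound:
 assumes s: "0 < s"
 shows "\<bar>TT e A i x\<bar> <= unit_ball_vol (real CARD('n)) * 2 ^ CARD('n) * s + measure lborel A / s ^ (CARD('n) - 1)"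
 unfolding TT_def
proof (rule abs_integral_le)
 let ?n = "CARD('n)"
 interpret finite_measure "mA A" by (rule finite_mA)
 show "(%y. G0 e i (x - y)) : borel_measurable (mA A)" using TT_has_derivative(2) by auto
 define f where "f z = ennreal (1 / norm (z::real^'n) ^ (DIM(real^'n) - 1)) * indicator (ball 0 s) z" for z
 have [measurable]: "ball (0 :: real^'n) s : sets borel" by simp
 have [measurable]: "f : borel_measurable borel" unfolding f_def[abs_def] by measurable
 have "AE y in lborel. y ~= x" by (rule AE_lborel_singleton)
 hence ae: "AE y in mA A. y ~= x" unfolding mA_def by (subst AE_density) (auto elim: eventually_mono)
 have "(\<integral>\<^sup>+y. ennreal \<bar>G0 e i (x - y)\<bar> \<partial>mA A) <= (\<integral>\<^sup>+y. f (x - y) + ennreal (1 / s ^ (?n - 1)) \<partial>mA A)"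
 proof (rule nn_integral_mono_AE, use ae in eventually_elim)
  case (elim y)
  have z: "x - y ~= 0" using elim by simp
  have "\<bar>G0 e i (x - y)\<bar> <= rr e (x - y) ^ (?n - 1)" by (rule G0_bound[OF e])
  also have "... <= (1 / norm (x - y)) ^ (?n - 1)" using rr_pos[OF e, of "x - y"] by (intro power_mono rr_le_norm[OF e z]) auto
  also have "... = 1 / norm (x - y) ^ (?n - 1)" by (simp add: power_divide)
  finally have 1: "\<bar>G0 e i (x - y)\<bar> <= 1 / norm (x - y) ^ (?n - 1)" .
  show ?case
  proof (cases "norm (x - y) < s")
   case True
   hence "ennreal \<bar>G0 e i (x - y)\<bar> <= f (x - y)" using 1 by (auto simp: f_def intro!: ennreal_leI)
   thus ?thesis by (rule add_increasing2[rotated]) simp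
  next
   case False
   have "1 / norm (x - y) ^ (?n - 1) <= 1 / s ^ (?n - 1)"
    using False s by (intro divide_left_mono power_mono mult_pos_pos zero_less_power) auto
   hence "ennreal \<bar>G0 e i (x - y)\<bar> <= ennreal (1 / s ^ (?n - 1))" using 1 by (intro ennreal_leI) linarith
   thus ?thesis by (rule add_increasing[rotated]) simp
  qed
 qed
 also have "... = (\<integral>\<^sup>+y. f (x - y) \<partial>mA A) + ennreal (1 / s ^ (?n - 1)) * emeasure (mA A) UNIV"
  by (subst nn_integral_add) (auto intro!: measurable_mA simp: mA_def)
 also have "... <= ennreal (unit_ball_vol (real ?n) * 2 ^ ?n * s) + ennreal (measure lborel A / s ^ (?n - 1))"
 proof (rule add_mono)
  have "(\<integral>\<^sup>+y. f (x - y) \<partial>mA A) <= (\<integral>\<^sup>+z. f z \<partial>lborel)" by (rule nn_integral_mA_le) measurable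
  also have "... <= ennreal (unit_ball_vol (real DIM(real^'n)) * 2 ^ DIM(real^'n) * s)"
   unfolding f_def by (rule nn_integral_singular_kernel[OF s])
  finally show "(\<integral>\<^sup>+y. f (x - y) \<partial>mA A) <= ennreal (unit_ball_vol (real ?n) * 2 ^ ?n * s)" by simp
  have "emeasure (mA A) UNIV = ennreal (measure lborel A)" using emeasure_eq_measure measure_mA by simp
  thus "ennreal (1 / s ^ (?n - 1)) * emeasure (mA A) UNIV <= ennreal (measure lborel A / s ^ (?n - 1))"
   using s by (simp add: ennreal_mult[symmetric])
 qed
 also have "... = ennreal (unit_ball_vol (real ?n) * 2 ^ ?n * s + measure lborel A / s ^ (?n - 1))"
  using s by (intro ennreal_plus[symmetric]) (auto simp: unit_ball_vol_nonneg)
 finally show "(\<integral>\<^sup>+y. ennreal \<bar>G0 e i (x - y)\<bar> \<partial>mA A) <= ennreal (unit_ball_vol (real ?n) * 2 ^ ?n * s + measure lborel A / s ^ (?n - 1))" .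
qed (use s in "auto intro!: add_nonneg_nonneg simp: unit_ball_vol_nonneg")

lemma D2_bound: "\<bar>D2 e A i x h k\<bar> <= K2 CARD('n) / e * (norm h * norm k)"
 unfolding D2_def
proof (rule abs_integral_le)
 let ?n = "CARD('n)" and ?C = "3 * real CARD('n) + real CARD('n) * real (CARD('n) + 2)"
 show "(%y. G2 e i (x - y) h k) : borel_measurable (mA A)" using G2_integrable by auto
 have "(\<integral>\<^sup>+y. ennreal \<bar>G2 e i (x - y) h k\<bar> \<partial>mA A) <= (\<integral>\<^sup>+y. ennreal (?C * (norm h * norm k)) * ennreal (rr e (x - y) ^ (?n + 1)) \<partial>mA A)"
 proof (rule nn_integral_mono)
  fix y
  have "\<bar>G2 e i (x - y) h k\<bar> <= ?C * (norm h * norm k) * rr e (x - y) ^ (?n + 1)"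
   using G2_bound[OF e, of i "x - y" h k] by (simp only: mult_ac)
  thus "ennreal \<bar>G2 e i (x - y) h k\<bar> <= ennreal (?C * (norm h * norm k)) * ennreal (rr e (x - y) ^ (?n + 1))"
   using rr_pos[OF e, of "x - y"] by (subst ennreal_mult[symmetric]) (auto intro!: ennreal_leI)
 qed
 also have "... = ennreal (?C * (norm h * norm k)) * (\<integral>\<^sup>+y. ennreal (rr e (x - y) ^ (?n + 1)) \<partial>mA A)"
  by (rule nn_integral_cmult) (intro measurable_mA, measurable)
 also have "... <= ennreal (?C * (norm h * norm k)) * ennreal (KT ?n / e)"
  by (intro mult_left_mono order_trans[OF nn_integral_mA_le[of "%z. ennreal (rr e z ^ (?n + 1))"] nn_integral_rr]) auto
 also have "... = ennreal (K2 ?n / e * (norm h * norm k))"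
  using e KT_pos[of ?n] by (subst ennreal_mult[symmetric]) (auto simp: K2_def mult_ac less_imp_le)
 finally show "(\<integral>\<^sup>+y. ennreal \<bar>G2 e i (x - y) h k\<bar> \<partial>mA A) <= ennreal (K2 ?n / e * (norm h * norm k))" .
qed (use e KT_pos[of "CARD('n)"] in "auto simp: K2_def less_imp_le")

lemma G2_lborel_integrable: "integrable lborel (%z. G2 e i (z::real^'n) h k)"
proof (rule integrable_bound)
 let ?C = "(3 * real CARD('n) + real CARD('n) * real (CARD('n) + 2)) * (norm h * norm k)"
 have "integrable lborel (%z::real^'n. rr e z ^ (CARD('n) + 1))"
  using le_less_trans[OF nn_integral_rr] rr_pos[OF e] by (intro integrableI_nonneg) (auto intro!: AE_I2 simp: less_imp_le)
 thus "integrable lborel (%z::real^'n. ?C * rr e z ^ (CARD('n) + 1))" by simp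
 show "(%z. G2 e i z h k) : borel_measurable lborel"
  using borel_measurable_continuous_onI[OF G_continuous(3)[OF e]] by simp
 show "AE z in lborel. norm (G2 e i z h k) <= norm (?C * rr e z ^ (CARD('n) + 1))"
 proof (rule AE_I2)
  fix z
  have "\<bar>G2 e i z h k\<bar> <= ?C * rr e z ^ (CARD('n) + 1)" using G2_bound[OF e, of i z h k] by (simp only: mult_ac)
  thus "norm (G2 e i z h k) <= norm (?C * rr e z ^ (CARD('n) + 1))" by simp
 qed
qed

text \<open>Inside \<open>A\<close> the second derivative is controlled by the distance to the complement,
 because the odd kernel has total integral zero.\<close>

lemma D2_bound_inside:
 assumes s: "0 < s" and b: "ball x s <= A"
 shows "\<bar>D2 e A i x h k\<bar> <= K2 CARD('n) / s * (norm h * norm k)"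
proof -
 let ?n = "CARD('n)" and ?C = "3 * real CARD('n) + real CARD('n) * real (CARD('n) + 2)"
 let ?g = "%z. G2 e i z h k"
 have gm[measurable]: "?g : borel_measurable borel" by (rule borel_measurable_continuous_onI[OF G_continuous(3)[OF e]])
 have gi: "integrable lborel (%y. ?g (x - y))" using integral_lborel_reflect(2)[OF gm] G2_lborel_integrable by simp
 have "(LINT y|lborel. ?g (0 - y)) = (LINT z|lborel. ?g z)" by (rule integral_lborel_reflect(1)[OF gm])
 hence z0: "(LINT z|lborel. ?g z) = 0" using G2_odd[OF e, of i _ h k] by simp
 have tot: "(LINT y|lborel. ?g (x - y)) = 0" using integral_lborel_reflect(1)[OF gm, of x] z0 by simp
 have D2eq: "D2 e A i x h k = (LINT y|lborel. indicator A y * ?g (x - y))"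
 proof -
  have "mA A = density lborel (%y. ennreal (indicator A y))" by (simp add: mA_def ennreal_indicator)
  thus ?thesis unfolding D2_def by (simp add: integral_density)
 qed
 have iA: "integrable lborel (%y. indicator A y * ?g (x - y))" and iB: "integrable lborel (%y. indicator (- A) y * ?g (x - y))"
  using integrable_mult_indicator[OF _ gi, of A] integrable_mult_indicator[OF _ gi, of "- A"] A by auto
 have "(LINT y|lborel. ?g (x - y)) = (LINT y|lborel. indicator A y * ?g (x - y) + indicator (- A) y * ?g (x - y))"
  by (rule integral_cong) (auto simp: indicator_def)
 also have "... = (LINT y|lborel. indicator A y * ?g (x - y)) + (LINT y|lborel. indicator (- A) y * ?g (x - y))"
  by (rule integral_add[OF iA iB])
 finally have eq: "D2 e A i x h k = - (LINT y|lborel. indicator (- A) y * ?g (x - y))" using tot D2eq by simp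
 define f where "f z = ennreal (1 / (norm (z::real^'n) + s) ^ (DIM(real^'n) + 1))" for z
 have fm[measurable]: "f : borel_measurable borel" unfolding f_def[abs_def] by measurable
 have "\<bar>LINT y|lborel. indicator (- A) y * ?g (x - y)\<bar> <= K2 ?n / s * (norm h * norm k)"
 proof (rule abs_integral_le)
  show "(%y. indicator (- A) y * ?g (x - y)) : borel_measurable lborel" using iB by auto
  have "(\<integral>\<^sup>+y. ennreal \<bar>indicator (- A) y * ?g (x - y)\<bar> \<partial>lborel) <= (\<integral>\<^sup>+y. ennreal (?C * (norm h * norm k) * 2 ^ (?n + 1)) * f (x - y) \<partial>lborel)"
  proof (rule nn_integral_mono)
   fix y
   show "ennreal \<bar>indicator (- A) y * ?g (x - y)\<bar> <= ennreal (?C * (norm h * norm k) * 2 ^ (?n + 1)) * f (x - y)"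
   proof (cases "y : A")
    case False
    hence "y \<notin> ball x s" using b by blast
    hence d: "s <= norm (x - y)" by (simp add: dist_norm)
    hence nz: "x - y ~= 0" using s by auto
    \<comment> \<open>Off \<open>A\<close> the distance is at least \<open>s\<close>, so the tail
      kernel at scale \<open>s\<close> dominates and the regularisation scale \<open>e\<close>
      disappears from the bound.\<close>
    have "rr e (x - y) <= 1 / norm (x - y)" by (rule rr_le_norm[OF e nz])
    also have "... <= 2 / (norm (x - y) + s)"
    proof -
     have "0 < norm (x - y)" using nz by simp
     thus ?thesis using d s by (simp add: divide_le_eq pos_le_divide_eq add_pos_pos field_simps)
    qed
    finally have "rr e (x - y) ^ (?n + 1) <= (2 / (norm (x - y) + s)) ^ (?n + 1)"
     using rr_pos[OF e, of "x - y"] by (intro power_mono) auto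
    also have "... = 2 ^ (?n + 1) * (1 / (norm (x - y) + s) ^ (?n + 1))" by (simp add: power_divide)
    finally have "?C * (norm h * norm k) * rr e (x - y) ^ (?n + 1) <= ?C * (norm h * norm k) * (2 ^ (?n + 1) * (1 / (norm (x - y) + s) ^ (?n + 1)))"
     by (intro mult_left_mono) auto
    moreover have "\<bar>?g (x - y)\<bar> <= ?C * (norm h * norm k) * rr e (x - y) ^ (?n + 1)"
     using G2_bound[OF e, of i "x - y" h k] by (simp only: mult_ac)
    ultimately have "\<bar>?g (x - y)\<bar> <= ?C * (norm h * norm k) * 2 ^ (?n + 1) * (1 / (norm (x - y) + s) ^ (?n + 1))"
     by (simp only: mult.assoc)
    thus ?thesis using False s unfolding f_def
     by (subst ennreal_mult[symmetric]) (auto intro!: ennreal_leI)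
   qed simp
  qed
  also have "... = ennreal (?C * (norm h * norm k) * 2 ^ (?n + 1)) * (\<integral>\<^sup>+y. f (x - y) \<partial>lborel)"
   by (rule nn_integral_cmult) measurable
  also have "(\<integral>\<^sup>+y. f (x - y) \<partial>lborel) = (\<integral>\<^sup>+z. f z \<partial>lborel)" by (rule nn_integral_lborel_reflect[OF fm])
  also have "ennreal (?C * (norm h * norm k) * 2 ^ (?n + 1)) * (\<integral>\<^sup>+z. f z \<partial>lborel)
    <= ennreal (?C * (norm h * norm k) * 2 ^ (?n + 1)) * ennreal (unit_ball_vol (real DIM(real^'n)) * 2 ^ (DIM(real^'n) + 2) / s)"
   unfolding f_def by (rule mult_left_mono[OF nn_integral_tail_kernel[OF s]]) simp
  also have "... = ennreal (K2 ?n / s * (norm h * norm k))"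
   using s by (subst ennreal_mult[symmetric]) (auto simp: K2_def KT_def mult_ac unit_ball_vol_nonneg)
  finally show "(\<integral>\<^sup>+y. ennreal \<bar>indicator (- A) y * ?g (x - y)\<bar> \<partial>lborel) <= ennreal (K2 ?n / s * (norm h * norm k))" .
 qed (use s KT_pos[of "CARD('n)"] in "auto simp: K2_def less_imp_le")
 thus ?thesis unfolding eq by simp
qed

definition dv :: "real^'n => real" where "dv x = (SUM i:UNIV. D1 e A i x (axis i 1))"

lemma dv_eq: "dv x = (LINT y|mA A. real CARD('n) * e\<^sup>2 * rr e (x - y) ^ (CARD('n) + 2))"
 "integrable (mA A) (%y. real CARD('n) * e\<^sup>2 * rr e (x - y) ^ (CARD('n) + 2))"
proof -
 have "integrable (mA A) (%y. SUM i:UNIV. G1 e i (x - y) (axis i 1))" by (intro integrable_sum G1_integrable)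
 thus "integrable (mA A) (%y. real CARD('n) * e\<^sup>2 * rr e (x - y) ^ (CARD('n) + 2))" by (simp only: G1_div[OF e])
 show "dv x = (LINT y|mA A. real CARD('n) * e\<^sup>2 * rr e (x - y) ^ (CARD('n) + 2))"
  unfolding dv_def D1_def by (subst integral_sum[symmetric]) (auto intro!: G1_integrable simp: G1_div[OF e])
qed

lemma dv_nonneg: "0 <= dv x"
 unfolding dv_eq by (rule integral_nonneg) (use rr_pos[OF e] in "auto simp: less_imp_le")

text \<open>One of the two factors \<open>e\<close> is spent on one factor \<open>rr\<close>,
  lowering the exponent to \<open>n + 1\<close>, for which the integral over the space is of order
  \<open>1 / e\<close>. The remaining factor \<open>e\<close> cancels that.\<close>

lemma div_kernel_le: "real CARD('n) * e\<^sup>2 * rr e (z::real^'n) ^ (CARD('n) + 2) <= (real CARD('n) * e) * rr e z ^ (CARD('n) + 1)"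
proof -
 have "real CARD('n) * e\<^sup>2 * rr e z ^ (CARD('n) + 2) = (real CARD('n) * e * rr e z ^ (CARD('n) + 1)) * (e * rr e z)"
  by (simp add: power2_eq_square)
 also have "... <= (real CARD('n) * e * rr e z ^ (CARD('n) + 1)) * 1"
  using e rr_pos[OF e, of z] by (intro mult_left_mono rr_e_le1[OF e]) auto
 finally show ?thesis by simp
qed

lemma nn_integral_div_kernel: "(\<integral>\<^sup>+z. ennreal (real CARD('n) * e\<^sup>2 * rr e (z::real^'n) ^ (CARD('n) + 2)) \<partial>lborel) <= ennreal (K1 CARD('n))"
proof -
 have "(\<integral>\<^sup>+z. ennreal (real CARD('n) * e\<^sup>2 * rr e (z::real^'n) ^ (CARD('n) + 2)) \<partial>lborel)
  <= (\<integral>\<^sup>+z. ennreal (real CARD('n) * e) * ennreal (rr e (z::real^'n) ^ (CARD('n) + 1)) \<partial>lborel)"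
  using div_kernel_le e rr_pos[OF e] by (intro nn_integral_mono, subst ennreal_mult[symmetric]) (auto intro!: ennreal_leI simp: less_imp_le)
 also have "... = ennreal (real CARD('n) * e) * (\<integral>\<^sup>+z. ennreal (rr e (z::real^'n) ^ (CARD('n) + 1)) \<partial>lborel)"
  by (rule nn_integral_cmult) measurable
 also have "... <= ennreal (real CARD('n) * e) * ennreal (KT CARD('n) / e)"
  by (rule mult_left_mono[OF nn_integral_rr]) simp
 also have "... = ennreal (K1 CARD('n))"
  using e KT_pos[of "CARD('n)"] by (subst ennreal_mult[symmetric]) (auto simp: K1_def)
 finally show ?thesis .
qed

lemma dv_nn: "ennreal (dv x) = (\<integral>\<^sup>+y. ennreal (real CARD('n) * e\<^sup>2 * rr e (x - y) ^ (CARD('n) + 2)) \<partial>mA A)"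
 unfolding dv_eq(1) by (rule nn_integral_eq_integral[OF dv_eq(2), symmetric]) (use rr_pos[OF e] in "auto simp: less_imp_le")

lemma dv_le: "dv x <= K1 CARD('n)"
proof -
 have "ennreal (dv x) <= ennreal (K1 CARD('n))" unfolding dv_nn
  by (rule order_trans[OF nn_integral_mA_le[of "%z. ennreal (real CARD('n) * e\<^sup>2 * rr e z ^ (CARD('n) + 2))"] nn_integral_div_kernel]) measurable
 thus ?thesis using KT_pos[of "CARD('n)"] by (simp add: K1_def less_imp_le)
qed

lemma dv_continuous: "continuous_on UNIV dv"
 unfolding dv_def[abs_def] by (intro continuous_intros TT_continuous)

lemma dv_integral: "integrable lborel dv" "(LINT x|lborel. dv x) <= K1 CARD('n) * measure lborel A"
proof -
 note [measurable] = borel_measurable_continuous_onI[OF dv_continuous]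
 interpret fm: finite_measure "mA A" by (rule finite_mA)
 interpret P: pair_sigma_finite lborel "mA A" by (unfold_locales)
 have [measurable_cong]: "sets (mA A) = sets borel" by (rule sets_mA)
 have "(\<integral>\<^sup>+x. ennreal (dv x) \<partial>lborel) = (\<integral>\<^sup>+x. \<integral>\<^sup>+y. ennreal (real CARD('n) * e\<^sup>2 * rr e (x - y) ^ (CARD('n) + 2)) \<partial>mA A \<partial>lborel)"
  unfolding dv_nn ..
 also have "... = (\<integral>\<^sup>+y. \<integral>\<^sup>+x. ennreal (real CARD('n) * e\<^sup>2 * rr e (x - y) ^ (CARD('n) + 2)) \<partial>lborel \<partial>mA A)"
  by (rule P.Fubini'[symmetric]) measurable
 also have "... <= (\<integral>\<^sup>+y. ennreal (K1 CARD('n)) \<partial>mA A)"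
 proof (rule nn_integral_mono)
  fix y :: "real^'n"
  have "(\<integral>\<^sup>+x. ennreal (real CARD('n) * e\<^sup>2 * rr e (x - y) ^ (CARD('n) + 2)) \<partial>lborel) = (\<integral>\<^sup>+x. ennreal (real CARD('n) * e\<^sup>2 * rr e (y - x) ^ (CARD('n) + 2)) \<partial>lborel)"
  proof (rule nn_integral_cong)
   fix x show "ennreal (real CARD('n) * e\<^sup>2 * rr e (x - y) ^ (CARD('n) + 2)) = ennreal (real CARD('n) * e\<^sup>2 * rr e (y - x) ^ (CARD('n) + 2))"
    using rr_uminus[OF e, of "y - x"] by (simp only: minus_diff_eq)
  qed
  also have "... = (\<integral>\<^sup>+z. ennreal (real CARD('n) * e\<^sup>2 * rr e (z::real^'n) ^ (CARD('n) + 2)) \<partial>lborel)"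
  proof -
   define f where "f = (%z::real^'n. ennreal (real CARD('n) * e\<^sup>2 * rr e z ^ (CARD('n) + 2)))"
   have "f : borel_measurable borel" unfolding f_def by measurable
   from nn_integral_lborel_reflect[OF this, of y] show ?thesis unfolding f_def .
  qed
  also have "... <= ennreal (K1 CARD('n))" by (rule nn_integral_div_kernel)
  finally show "(\<integral>\<^sup>+x. ennreal (real CARD('n) * e\<^sup>2 * rr e (x - y) ^ (CARD('n) + 2)) \<partial>lborel) <= ennreal (K1 CARD('n))" .
 qed
 also have "... = ennreal (K1 CARD('n)) * emeasure (mA A) UNIV" by (simp add: mA_def)
 also have "... = ennreal (K1 CARD('n) * measure lborel A)"
  unfolding fm.emeasure_eq_measure measure_mA using KT_pos[of "CARD('n)"] by (subst ennreal_mult) (auto simp: K1_def less_imp_le)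
 finally have le: "(\<integral>\<^sup>+x. ennreal (dv x) \<partial>lborel) <= ennreal (K1 CARD('n) * measure lborel A)" .
 show i: "integrable lborel dv"
  using le_less_trans[OF le] dv_nonneg by (intro integrableI_nonneg) auto
 have "ennreal (LINT x|lborel. dv x) = (\<integral>\<^sup>+x. ennreal (dv x) \<partial>lborel)"
  by (rule nn_integral_eq_integral[OF i, symmetric]) (use dv_nonneg in auto)
 thus "(LINT x|lborel. dv x) <= K1 CARD('n) * measure lborel A"
 proof -
  have "0 <= K1 CARD('n) * measure lborel A" using KT_pos[of "CARD('n)"] by (simp add: K1_def less_imp_le)
  moreover have "ennreal (LINT x|lborel. dv x) <= ennreal (K1 CARD('n) * measure lborel A)"
   using le \<open>ennreal (LINT x|lborel. dv x) = _\<close> by (simp only:)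
  ultimately show ?thesis by (simp only: ennreal_le_iff)
 qed
qed

text \<open>On a ball of radius \<open>e\<close> the divergence kernel is at least a multiple of
  \<open>1 / e ^ n\<close>, which the volume of the ball cancels: the lower bound is independent of
  \<open>e\<close> and of \<open>A\<close>.\<close>

lemma dv_lower:
 assumes b: "ball x e <= A"
 shows "real CARD('n) * unit_ball_vol (real CARD('n)) / 2 ^ (CARD('n) + 2) <= dv x"
proof -
 let ?n = "CARD('n)"
 let ?c = "real ?n * e\<^sup>2 * (1 / (2 * e)) ^ (?n + 2)"
 have c: "0 <= ?c" using e by simp
 have "ennreal (?c * measure lborel (ball x e)) = ennreal ?c * emeasure lborel (ball x e)"
 proof -
  have "emeasure lborel (ball x e) = ennreal (measure lborel (ball x e))"
   using emeasure_lborel_ball_finite[of x e] by (intro emeasure_eq_ennreal_measure) auto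
  thus ?thesis using c by (simp only: ennreal_mult measure_nonneg)
 qed
 also have "... = (\<integral>\<^sup>+y. ennreal ?c * indicator (ball x e) y \<partial>lborel)" by (rule nn_integral_cmult_indicator[symmetric]) auto
 also have "... <= (\<integral>\<^sup>+y. ennreal (real ?n * e\<^sup>2 * rr e (x - y) ^ (?n + 2)) * indicator A y \<partial>lborel)"
 proof (rule nn_integral_mono)
  fix y
  show "ennreal ?c * indicator (ball x e) y <= ennreal (real ?n * e\<^sup>2 * rr e (x - y) ^ (?n + 2)) * indicator A y"
  proof (cases "y : ball x e")
   case True
   hence d: "norm (x - y) < e" by (simp add: dist_norm)
   have "sqrt ((norm (x - y))^2 + e\<^sup>2) <= norm (x - y) + e" using sqrt_sum_squares_le_sum[of "norm (x - y)" e] e by simp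
   hence "sqrt ((norm (x - y))^2 + e\<^sup>2) <= 2 * e" using d by linarith
   hence "1 / (2 * e) <= rr e (x - y)" unfolding rr_def using rr_sq_pos[OF e, of "x - y"] e by (intro divide_left_mono) auto
   hence "(1 / (2 * e)) ^ (?n + 2) <= rr e (x - y) ^ (?n + 2)" using e by (intro power_mono) auto
   hence "?c <= real ?n * e\<^sup>2 * rr e (x - y) ^ (?n + 2)" by (rule mult_left_mono) simp
   moreover have "y : A" using True b by blast
   ultimately show ?thesis using True by (simp only: indicator_simps mult_1_right ennreal_leI)
  qed simp
 qed
 also have "... = ennreal (dv x)" unfolding dv_nn mA_def by (subst nn_integral_density) (auto simp: mult.commute)
 finally have "?c * measure lborel (ball x e) <= dv x" using dv_nonneg by simp
 moreover have "measure lborel (ball x e) = unit_ball_vol (real ?n) * e ^ ?n"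
  using content_ball[of e x] e by simp
 ultimately show ?thesis using e by (simp add: field_simps power_mult_distrib power_add power2_eq_square)
qed

end

subsection \<open>A stopping time for finite measures on \<open>\<real>\<^sup>n\<close>\<close>

text \<open>The possible index differences between the cell of a point and the cells of points
  within two sides of it in every coordinate.\<close>

definition shifts :: "(real ^ 'n::finite) set" where
 "shifts = (%f. \<chi> i. f i) ` (PiE UNIV (%_. {-2, -1, 0, 1, 2}))"

lemma finite_shifts: "finite (shifts :: (real ^ 'n::finite) set)"
 unfolding shifts_def by (intro finite_imageI finite_PiE) auto

lemma shiftsI:
 assumes "!!i. v $ i : {-2, -1, 0, 1, 2}"
 shows "v : shifts"
 unfolding shifts_def using assms by (intro image_eqI[where x="%i. v $ i"]) (auto simp: vec_eq_iff)

text \<open>Half-open cubes of the grid of mesh \<open>h\<close>, encoded as an equivalence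
  relation. The floors are compared as reals so that measurability reduces to an equality of real
  functions.\<close>

definition same_cell :: "real => real ^ 'n::finite => real ^ 'n => bool" where
 "same_cell h x y \<longleftrightarrow> (ALL i. real_of_int \<lfloor>x $ i / h\<rfloor> = real_of_int \<lfloor>y $ i / h\<rfloor>)"

lemma same_cell_sym: "same_cell h x y = same_cell h y x"
 by (auto simp: same_cell_def)

lemma same_cell_refl [simp]: "same_cell h x x"
 by (auto simp: same_cell_def)

lemma same_cell_cong: "same_cell h x y ==> same_cell h x z = same_cell h y z"
 by (auto simp: same_cell_def)

lemma same_cell_double:
 assumes "same_cell h x y"
 shows "same_cell (2 * h) x y"
proof -
 have "\<lfloor>t / (2 * h)\<rfloor> = \<lfloor>t / h\<rfloor> div 2" for t
  using floor_divide_real_eq_div[of 2 "t / h"] by (simp add: mult.commute)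
 thus ?thesis using assms by (simp add: same_cell_def)
qed

lemma same_cell_dist:
 assumes h: "0 < h" and "same_cell h x y"
 shows "\<bar>x $ i - y $ i\<bar> <= h"
proof -
 have "\<lfloor>x $ i / h\<rfloor> = \<lfloor>y $ i / h\<rfloor>" using assms by (simp add: same_cell_def)
 hence "\<bar>x $ i / h - y $ i / h\<bar> <= 1" by linarith
 hence "\<bar>(x $ i - y $ i) / h\<bar> <= 1" by (simp add: diff_divide_distrib)
 thus ?thesis using h by (simp add: abs_divide divide_le_eq)
qed

text \<open>Translation by multiples of the mesh permutes the cells, so it suffices to subtract the
  difference of the cell indices, which lies between -2 and 2.\<close>

lemma same_cell_shift:
 assumes h: "0 < h" and d: "!!i. \<bar>y $ i - x $ i\<bar> <= 2 * h"
 shows "\<exists>v\<in>shifts. same_cell h x (y - h *\<^sub>R v)"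
proof
 let ?v = "\<chi> i. real_of_int (\<lfloor>y $ i / h\<rfloor> - \<lfloor>x $ i / h\<rfloor>)"
 show "?v : shifts"
 proof (rule shiftsI)
  fix i
  have "\<bar>(y $ i - x $ i) / h\<bar> <= 2" using d[of i] h by (simp add: abs_divide divide_le_eq)
  hence "\<bar>y $ i / h - x $ i / h\<bar> <= 2" by (simp add: diff_divide_distrib)
  hence "\<lfloor>y $ i / h\<rfloor> - \<lfloor>x $ i / h\<rfloor> : {-2..2}" by simp linarith
  hence "\<lfloor>y $ i / h\<rfloor> - \<lfloor>x $ i / h\<rfloor> : {-2,-1,0,1,2}" by auto
  hence "real_of_int (\<lfloor>y $ i / h\<rfloor> - \<lfloor>x $ i / h\<rfloor>) : real_of_int ` {-2,-1,0,1,2}" by (rule imageI)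
  thus "?v $ i : {-2,-1,0,1,2}" by simp
 qed
 have "\<lfloor>(y $ i - h * real_of_int k) / h\<rfloor> = \<lfloor>y $ i / h\<rfloor> - k" for i k
  using h by (simp add: diff_divide_distrib)
 thus "same_cell h x (y - h *\<^sub>R ?v)"
  using h by (simp add: same_cell_def del: of_int_diff)
qed

lemma same_cell_measurable [measurable (raw)]:
 fixes f g :: "'a => real ^ 'n::finite"
 assumes f: "f : borel_measurable M" and g: "g : borel_measurable M"
 shows "Measurable.pred M (%x. same_cell h (f x) (g x))"
proof -
 have [measurable]: "(%x. f x $ i) : borel_measurable M" "(%x. g x $ i) : borel_measurable M" for i
  by (rule measurable_compose[OF f] measurable_compose[OF g], intro borel_measurable_continuous_onI continuous_intros)+
 have "Measurable.pred M (%x. \<forall>i\<in>UNIV. real_of_int \<lfloor>f x $ i / h\<rfloor> = real_of_int \<lfloor>g x $ i / h\<rfloor>)"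
 proof (rule pred_intros_finite)
  fix i :: 'n
  define F where "F u = real_of_int \<lfloor>u / h\<rfloor>" for u
  have [measurable]: "F : borel_measurable borel" unfolding F_def[abs_def] by measurable
  have [measurable]: "(%x. F (f x $ i)) : borel_measurable M" "(%x. F (g x $ i)) : borel_measurable M" by measurable
  have "Measurable.pred M (%x. F (f x $ i) = F (g x $ i))"
   unfolding pred_def by (rule borel_measurable_eq) measurable
  thus "Measurable.pred M (%x. real_of_int \<lfloor>f x $ i / h\<rfloor> = real_of_int \<lfloor>g x $ i / h\<rfloor>)" unfolding F_def .
 qed simp
 thus ?thesis by (simp add: same_cell_def)
qed

text \<open>The half-open cell is squeezed between an open and a closed box of equal volume.\<close>

lemma emeasure_cell:
 fixes x :: "real ^ 'n::finite"
 assumes h: "0 < h"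
 shows "emeasure lborel {y. same_cell h x y} = ennreal (h ^ CARD('n))"
proof -
 define a where "a = (\<chi> i. h * real_of_int \<lfloor>x $ i / h\<rfloor>)"
 define b where "b = a + (\<chi> i. h)"
 have D: "!!d. d : Basis ==> (\<chi> i. h) \<bullet> (d :: real^'n) = h" by (auto simp: Basis_vec_def inner_axis)
 have cell: "same_cell h x y \<longleftrightarrow> (ALL i. a $ i <= y $ i & y $ i < a $ i + h)" for y
 proof -
  have "real_of_int \<lfloor>x $ i / h\<rfloor> = real_of_int \<lfloor>y $ i / h\<rfloor> \<longleftrightarrow> a $ i <= y $ i & y $ i < a $ i + h" for i
  proof -
   have "real_of_int \<lfloor>x $ i / h\<rfloor> = real_of_int \<lfloor>y $ i / h\<rfloor> \<longleftrightarrow> \<lfloor>y $ i / h\<rfloor> = \<lfloor>x $ i / h\<rfloor>" by auto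
   also have "... \<longleftrightarrow> real_of_int \<lfloor>x $ i / h\<rfloor> <= y $ i / h & y $ i / h < real_of_int \<lfloor>x $ i / h\<rfloor> + 1"
    by (rule floor_eq_iff)
   also have "... \<longleftrightarrow> a $ i <= y $ i & y $ i < a $ i + h" using h by (simp add: a_def field_simps)
   finally show ?thesis .
  qed
  thus ?thesis by (simp add: same_cell_def)
 qed
 have "box a b <= {y. same_cell h x y}" "{y. same_cell h x y} <= cbox a b"
  by (auto simp: cell mem_box_cart b_def less_imp_le)
 moreover have "emeasure lborel (box a b) = ennreal (h ^ CARD('n))"
  by (subst emeasure_lborel_box) (use h in "auto simp: b_def inner_add_left D algebra_simps")
 moreover have "emeasure lborel (cbox a b) = ennreal (h ^ CARD('n))"
  by (subst emeasure_lborel_cbox) (use h in "auto simp: b_def inner_add_left D algebra_simps")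
 moreover have "{y. same_cell h x y} : sets borel"
  unfolding same_cell_def by measurable
 ultimately show ?thesis
  by (metis antisym emeasure_mono sets_lborel borel_closed closed_cbox)
qed

text \<open>A Calderon-Zygmund stopping time on dyadic cells of side \<open>L / 2 ^ j\<close>:
  \<open>lam\<close> is the critical density and \<open>N\<close> the last generation examined. By
  \<open>big\<close> the largest cells do not exceed the critical density.\<close>

locale stopping =
 fixes e :: "(real ^ 'n::finite) measure" and lam L :: real and N :: nat
 assumes fin: "finite_measure e" and sets_e [measurable_cong, simp]: "sets e = sets borel"
  and lam: "0 < lam" and L: "0 < L" and big: "measure e UNIV <= lam * L ^ CARD('n)"
begin

sublocale finite_measure e by (rule fin)

lemma space_e [simp]: "space e = UNIV"
 using sets_eq_imp_space_eq[OF sets_e] by simp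

definition hh :: "nat => real" where "hh j = L / 2 ^ j"

lemma hh_pos: "0 < hh j" using L by (simp add: hh_def)

lemma hh_Suc: "hh j = 2 * hh (Suc j)" by (simp add: hh_def)

definition mass :: "nat => real ^ 'n => ennreal" where
 "mass j x = (\<integral>\<^sup>+y. (if same_cell (hh j) x y then 1 else 0) \<partial>e)"

definition heavy :: "nat => real ^ 'n => bool" where
 "heavy j x \<longleftrightarrow> ennreal (lam * hh j ^ CARD('n)) < mass j x"

text \<open>The generation at which the search, from large cells to small, comes to an end. The
  alternative \<open>j = N\<close> ends it even if no cell around \<open>x\<close> is heavy.\<close>

definition lev :: "real ^ 'n => nat" where
 "lev x = (LEAST j. j = N \<or> heavy j x)"

text \<open>The kernel that averages over the stopping cell of \<open>x\<close>. At most one term is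
  nonzero, see \<open>kk_eq\<close>; the sum over all generations makes joint measurability
  immediate.\<close>

definition kk :: "real ^ 'n => real ^ 'n => ennreal" where
 "kk x y = (SUM j<=N. if lev x = j & same_cell (hh j) x y then ennreal (1 / hh j ^ CARD('n)) else 0)"

lemma mass_measurable [measurable]: "mass j : borel_measurable borel"
 unfolding mass_def[abs_def] by measurable

lemma heavy_measurable [measurable]: "Measurable.pred borel (heavy j)"
 unfolding heavy_def by measurable

lemma lev_measurable [measurable]: "lev : measurable borel (count_space UNIV)"
 unfolding lev_def by measurable

lemma kk_measurable [measurable]: "(%p. kk (fst p) (snd p)) : borel_measurable (borel \<Otimes>\<^sub>M borel)"
 unfolding kk_def by measurable

lemma kk_measurable2 [measurable]: "kk x : borel_measurable borel"
 unfolding kk_def[abs_def] by measurable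

lemma lev_le: "lev x <= N" unfolding lev_def by (rule Least_le) simp

lemma lev_cases: "lev x = N \<or> heavy (lev x) x"
 unfolding lev_def by (rule LeastI[where k=N]) simp

lemma not_heavy: "j < lev x ==> \<not> heavy j x"
 unfolding lev_def using not_less_Least by blast

lemma cell_mono: "same_cell (hh j) x y ==> i <= j ==> same_cell (hh i) x y"
proof (induction j)
 case (Suc j)
 thus ?case using same_cell_double[OF Suc.prems(1)] hh_Suc[of j] by (cases "i = Suc j") auto
qed simp

lemma heavy_cong: "same_cell (hh j) x y ==> heavy j x = heavy j y"
 by (simp add: heavy_def mass_def same_cell_cong[of _ x y])

text \<open>Whether a cell is heavy does not depend on the point chosen in it, and points of one
  cell share all coarser cells. The stopping cells therefore partition the space, which makes
  \<open>kk\<close> symmetric.\<close>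

lemma lev_cong:
 assumes "same_cell (hh (lev x)) x y"
 shows "lev y = lev x"
 unfolding lev_def[of y]
proof (rule Least_equality)
 show "lev x = N \<or> heavy (lev x) y" using lev_cases[of x] heavy_cong[OF assms] by blast
next
 fix i assume i: "i = N \<or> heavy i y"
 show "lev x <= i"
 proof (rule ccontr)
  assume "\<not> lev x <= i"
  hence l: "i < lev x" by simp
  hence "\<not> heavy i y" using not_heavy[OF l] heavy_cong[OF cell_mono[OF assms]] by simp
  thus False using i l lev_le[of x] by auto
 qed
qed

lemma kk_eq: "kk x y = (if same_cell (hh (lev x)) x y then ennreal (1 / hh (lev x) ^ CARD('n)) else 0)"
proof -
 have "kk x y = (SUM j<=N. if j = lev x then (if same_cell (hh j) x y then ennreal (1 / hh j ^ CARD('n)) else 0) else 0)"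
  unfolding kk_def by (intro sum.cong) auto
 also have "... = (if same_cell (hh (lev x)) x y then ennreal (1 / hh (lev x) ^ CARD('n)) else 0)"
  using lev_le[of x] by (subst sum.delta) auto
 finally show ?thesis .
qed

lemma kk_sym: "kk x y = kk y x"
proof (cases "same_cell (hh (lev x)) x y")
 case True
 thus ?thesis using lev_cong[OF True] by (simp add: kk_eq same_cell_sym)
next
 case False
 hence "\<not> same_cell (hh (lev y)) y x" using lev_cong[of y x] by (auto simp: same_cell_sym)
 thus ?thesis using False by (simp add: kk_eq)
qed

lemma kk_mass_one: "(\<integral>\<^sup>+y. kk x y \<partial>lborel) = 1"
proof -
 have [measurable]: "{y. same_cell (hh (lev x)) x y} : sets borel" unfolding same_cell_def by measurable
 have "(\<integral>\<^sup>+y. kk x y \<partial>lborel) = (\<integral>\<^sup>+y. ennreal (1 / hh (lev x) ^ CARD('n)) * indicator {y. same_cell (hh (lev x)) x y} y \<partial>lborel)"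
  by (intro nn_integral_cong) (simp add: kk_eq)
 also have "... = ennreal (1 / hh (lev x) ^ CARD('n)) * ennreal (hh (lev x) ^ CARD('n))"
  by (subst nn_integral_cmult_indicator) (simp_all add: emeasure_cell[OF hh_pos])
 also have "... = 1" using hh_pos[of "lev x"] by (subst ennreal_mult[symmetric]) auto
 finally show ?thesis .
qed

definition avg :: "real ^ 'n => ennreal" where
 "avg y = (\<integral>\<^sup>+x. kk x y \<partial>e)"

lemma avg_measurable [measurable]: "avg : borel_measurable borel"
proof -
 have "avg = (%y. \<integral>\<^sup>+x. kk y x \<partial>e)" unfolding avg_def[abs_def] by (simp add: kk_sym)
 thus ?thesis by simp
qed

lemma avg_eq: "avg y = ennreal (1 / hh (lev y) ^ CARD('n)) * mass (lev y) y"
proof -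
 have "avg y = (\<integral>\<^sup>+x. ennreal (1 / hh (lev y) ^ CARD('n)) * (if same_cell (hh (lev y)) y x then 1 else 0) \<partial>e)"
  unfolding avg_def by (intro nn_integral_cong) (subst kk_sym, simp add: kk_eq)
 also have "... = ennreal (1 / hh (lev y) ^ CARD('n)) * mass (lev y) y"
  unfolding mass_def by (rule nn_integral_cmult) measurable
 finally show ?thesis .
qed

lemma mass_mono: "mass (Suc j) x <= mass j x"
 unfolding mass_def by (intro nn_integral_mono) (use cell_mono[of "Suc j" x _ j] in auto)

lemma mass_le: "mass j x <= ennreal (measure e UNIV)"
proof -
 have "mass j x <= (\<integral>\<^sup>+y. 1 \<partial>e)" unfolding mass_def by (intro nn_integral_mono) auto
 thus ?thesis by (simp add: emeasure_eq_measure)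
qed

text \<open>The parent of a stopping cell was passed over, so its density is at most
  \<open>lam\<close>, and its volume is \<open>2 ^ n\<close> times larger. The largest cells have no
  parent; there \<open>big\<close> takes its place.\<close>

lemma avg_le: "avg y <= ennreal (2 ^ CARD('n) * lam)"
proof -
 let ?n = "CARD('n)" and ?h = "hh (lev y)"
 have h: "0 < ?h" by (rule hh_pos)
 have "mass (lev y) y <= ennreal (2 ^ ?n * lam * ?h ^ ?n)"
 proof (cases "lev y")
  case 0
  have "lam * L ^ ?n <= 2 ^ ?n * (lam * L ^ ?n)" using lam L by simp
  hence "measure e UNIV <= 2 ^ ?n * lam * ?h ^ ?n" using big 0 by (simp add: hh_def mult.assoc)
  thus ?thesis using order_trans[OF mass_le ennreal_leI] by blast
 next
  case (Suc j)
  have "mass (lev y) y <= mass j y" using mass_mono[of j y] Suc by simp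
  also have "... <= ennreal (lam * hh j ^ ?n)" using not_heavy[of j y] Suc by (simp add: heavy_def not_less)
  also have "lam * hh j ^ ?n = 2 ^ ?n * lam * ?h ^ ?n" using hh_Suc[of j] Suc by (simp add: power_mult_distrib)
  finally show ?thesis .
 qed
 hence "avg y <= ennreal (1 / ?h ^ ?n) * ennreal (2 ^ ?n * lam * ?h ^ ?n)"
  unfolding avg_eq by (intro mult_left_mono) auto
 also have "... = ennreal (2 ^ ?n * lam)" using h lam by (subst ennreal_mult[symmetric]) auto
 finally show ?thesis .
qed

interpretation P: pair_sigma_finite lborel e by unfold_locales

text \<open>By symmetry of \<open>kk\<close>, averaging the function over stopping cells is dual to
  averaging the measure.\<close>

lemma kk_Fubini:
 assumes [measurable]: "g : borel_measurable borel"
 shows "(\<integral>\<^sup>+x. \<integral>\<^sup>+y. kk x y * g y \<partial>lborel \<partial>e) = (\<integral>\<^sup>+y. avg y * g y \<partial>lborel)"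
proof -
 have [measurable]: "(%p. kk (snd p) (fst p)) : borel_measurable (lborel \<Otimes>\<^sub>M e)"
  by (subst kk_sym) measurable
 have "(\<integral>\<^sup>+x. \<integral>\<^sup>+y. kk x y * g y \<partial>lborel \<partial>e) = (\<integral>\<^sup>+y. \<integral>\<^sup>+x. kk x y * g y \<partial>e \<partial>lborel)"
  by (rule P.Fubini') (simp add: split_beta')
 also have "... = (\<integral>\<^sup>+y. avg y * g y \<partial>lborel)"
 proof (rule nn_integral_cong)
  fix y
  have "(%x. kk x y) = (%x. kk y x)" using kk_sym by blast
  hence "(%x. kk x y) : borel_measurable e" by simp
  thus "(\<integral>\<^sup>+x. kk x y * g y \<partial>e) = avg y * g y"
   unfolding avg_def by (rule nn_integral_multc)
 qed
 finally show ?thesis .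
qed

lemma avg_integral: "(\<integral>\<^sup>+y. avg y \<partial>lborel) = ennreal (measure e UNIV)"
 using kk_Fubini[of "%_. 1"] by (simp add: kk_mass_one emeasure_eq_measure)

definition SS :: "(real ^ 'n) set" where "SS = {x. heavy (lev x) x}"

lemma SS_borel [measurable]: "SS : sets borel"
proof -
 have "SS = (\<Union>j\<in>{..N}. {x. lev x = j & heavy j x})" unfolding SS_def using lev_le by auto
 thus ?thesis by simp
qed

text \<open>A weak type estimate: the averaged density is at least \<open>lam\<close> on
  \<open>SS\<close>, and its integral is the mass of \<open>e\<close>.\<close>

lemma SS_measure: "emeasure lborel SS <= ennreal (measure e UNIV / lam)"
proof -
 have "ennreal lam * emeasure lborel SS = (\<integral>\<^sup>+x. ennreal lam * indicator SS x \<partial>lborel)"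
  by (subst nn_integral_cmult_indicator) auto
 also have "... <= (\<integral>\<^sup>+y. avg y \<partial>lborel)"
 proof (intro nn_integral_mono)
  fix x
  show "ennreal lam * indicator SS x <= avg x"
  proof (cases "x : SS")
   case True
   have h: "0 < hh (lev x)" by (rule hh_pos)
   have "ennreal lam = ennreal (1 / hh (lev x) ^ CARD('n)) * ennreal (lam * hh (lev x) ^ CARD('n))"
    using h lam by (subst ennreal_mult[symmetric]) auto
   also have "... <= avg x" unfolding avg_eq using True
    by (intro mult_left_mono) (auto simp: SS_def heavy_def less_imp_le)
   finally show ?thesis using True by simp
  qed simp
 qed
 finally have le: "ennreal lam * emeasure lborel SS <= ennreal (measure e UNIV)" unfolding avg_integral .
 have "emeasure lborel SS = ennreal (1 / lam) * (ennreal lam * emeasure lborel SS)"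
  using lam by (subst mult.assoc[symmetric], subst ennreal_mult[symmetric]) auto
 also have "... <= ennreal (1 / lam) * ennreal (measure e UNIV)" by (rule mult_left_mono[OF le]) simp
 also have "... = ennreal (measure e UNIV / lam)" using lam by (subst ennreal_mult[symmetric]) auto
 finally show ?thesis .
qed

text \<open>A heavy stopping cell carries more mass than \<open>lam * hh N ^ n\<close>, while the
  complement of a large ball carries less. Every such cell therefore meets that ball, and its
  diameter is bounded in terms of \<open>L\<close>.\<close>

lemma SS_bounded: "bounded SS"
proof -
 let ?n = "CARD('n)"
 have "(%m. measure e (- ball 0 (real m))) ---> measure e (\<Inter>m. - ball 0 (real m))"
  by (intro finite_Lim_measure_decseq) (auto simp: decseq_def)
 moreover have "(\<Inter>m. - ball 0 (real m)) = ({} :: (real^'n) set)"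
 proof -
  have "EX m. norm x < real m" for x :: "real^'n" by (rule reals_Archimedean2)
  thus ?thesis by (fastforce simp: not_le[symmetric])
 qed
 ultimately have "(%m. measure e (- ball 0 (real m))) ---> 0" by simp
 moreover have "0 < lam * hh N ^ ?n" using lam hh_pos by simp
 ultimately have "\<forall>\<^sub>F m in sequentially. measure e (- ball 0 (real m)) < lam * hh N ^ ?n" by (rule order_tendstoD)
 then obtain m where m: "measure e (- ball 0 (real m)) < lam * hh N ^ ?n" by (auto simp: eventually_sequentially)
 show ?thesis unfolding bounded_iff
 proof (intro exI ballI)
  fix x assume x: "x : SS"
  let ?h = "hh (lev x)"
  have hN: "hh N <= ?h" unfolding hh_def using L lev_le[of x] by (intro divide_left_mono power_increasing) auto
  have hL: "?h <= L" unfolding hh_def using L by (simp add: divide_le_eq)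
  have "\<exists>y\<in>ball 0 (real m). same_cell ?h x y"
  proof (rule ccontr)
   assume no: "\<not> ?thesis"
   have "mass (lev x) x <= (\<integral>\<^sup>+y. indicator (- ball 0 (real m)) y \<partial>e)"
    unfolding mass_def using no by (intro nn_integral_mono) (auto simp: indicator_def)
   also have "... = ennreal (measure e (- ball 0 (real m)))" by (simp add: emeasure_eq_measure)
   also have "... <= ennreal (lam * ?h ^ ?n)"
   proof (rule ennreal_leI)
    have "hh N ^ ?n <= ?h ^ ?n" using hN hh_pos[of N] by (intro power_mono) auto
    hence "lam * hh N ^ ?n <= lam * ?h ^ ?n" using lam by simp
    thus "measure e (- ball 0 (real m)) <= lam * ?h ^ ?n" using m by simp
   qed
   finally show False using x by (simp add: SS_def heavy_def not_less[symmetric])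
  qed
  then obtain y where y: "norm y < real m" "same_cell ?h x y" by auto
  have "norm (x - y) <= (SUM i:UNIV. \<bar>(x - y) $ i\<bar>)" by (rule norm_le_l1_cart)
  also have "... <= (SUM i:(UNIV::'n set). L)"
  proof (rule sum_mono)
   fix i show "\<bar>(x - y) $ i\<bar> <= L" using same_cell_dist[OF hh_pos y(2), of i] hL by simp
  qed
  also have "... = real ?n * L" by simp
  finally show "norm x <= real m + real ?n * L" using y(1) norm_triangle_sub[of x y] by simp
 qed
qed

text \<open>A neighbourhood of the heavy stopping cells, two sides wide. As a finite union of
  translates of the pieces of \<open>SS\<close> at each generation it needs no covering argument:
  its measure is at most that of \<open>SS\<close> times the number of shifts.\<close>

definition BB :: "(real ^ 'n) set" where
 "BB = (\<Union>j\<in>{..N}. \<Union>v\<in>shifts. (%y. y - hh j *\<^sub>R v) -` {x\<in>SS. lev x = j})"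

lemma BB_borel [measurable]: "BB : sets borel"
proof -
 have "(%y. y - hh j *\<^sub>R v) -` {x\<in>SS. lev x = j} : sets borel" for j v
 proof -
  have "(%y. y - hh j *\<^sub>R v) -` {x\<in>SS. lev x = j} \<inter> space borel : sets borel"
   by (rule measurable_sets[where A=borel]) measurable
  thus ?thesis by simp
 qed
 thus ?thesis unfolding BB_def using finite_shifts by (intro sets.finite_UN) auto
qed

lemma BB_bounded: "bounded BB"
proof -
 have "bounded ((%y. y - w) -` S)" if "bounded S" for w and S :: "(real^'n) set"
 proof -
  have "(%y. y - w) -` S = (+) w ` S" by (force intro: image_eqI[where x="_ - w"])
  thus ?thesis using bounded_translation[OF that] by simp
 qed
 moreover have "bounded {x\<in>SS. lev x = j}" for j by (rule bounded_subset[OF SS_bounded]) auto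
 ultimately show ?thesis unfolding BB_def using finite_shifts by (intro bounded_UN ballI) (simp_all only: finite_atMost)
qed

lemma BB_measure: "emeasure lborel BB <= ennreal (real (card (shifts :: (real^'n) set)) * measure e UNIV / lam)"
proof -
 let ?S = "%j. {x\<in>SS. lev x = j}" and ?V = "shifts :: (real^'n) set"
 have [measurable]: "?S j : sets borel" for j by measurable
 have pre: "(%y. y - w) -` ?S j : sets lborel" "emeasure lborel ((%y. y - w) -` ?S j) = emeasure lborel (?S j)" for w j
 proof -
  have "(%y. y - w) -` ?S j \<inter> space borel : sets borel" by (rule measurable_sets[where A=borel]) measurable
  thus s: "(%y. y - w) -` ?S j : sets lborel" by simp
  have "emeasure lborel (?S j) = emeasure (distr lborel borel ((+) (- w))) (?S j)"
   by (simp add: lborel_distr_plus)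
  also have "... = emeasure lborel ((+) (- w) -` ?S j)" by (subst emeasure_distr) auto
  also have "(+) (- w) -` ?S j = (%y. y - w) -` ?S j" by (auto simp: algebra_simps)
  finally show "emeasure lborel ((%y. y - w) -` ?S j) = emeasure lborel (?S j)" by simp
 qed
 have "emeasure lborel BB <= (SUM j<=N. emeasure lborel (\<Union>v\<in>?V. (%y. y - hh j *\<^sub>R v) -` ?S j))"
  unfolding BB_def using finite_shifts pre(1) by (intro emeasure_subadditive_finite) (auto intro!: sets.finite_UN)
 also have "... <= (SUM j<=N. SUM v:?V. emeasure lborel ((%y. y - hh j *\<^sub>R v) -` ?S j))"
  using finite_shifts pre(1) by (intro sum_mono emeasure_subadditive_finite) auto
 also have "... = of_nat (card ?V) * (SUM j<=N. emeasure lborel (?S j))"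
  unfolding pre(2) by (simp add: sum_distrib_left)
 also have "(SUM j<=N. emeasure lborel (?S j)) = emeasure lborel (\<Union>j\<in>{..N}. ?S j)"
  by (rule sum_emeasure) (auto simp: disjoint_family_on_def)
 also have "... <= emeasure lborel SS" by (intro emeasure_mono) auto
 also have "of_nat (card ?V) * emeasure lborel SS <= ennreal (real (card ?V)) * ennreal (measure e UNIV / lam)"
  using SS_measure by (subst ennreal_of_nat_eq_real_of_nat) (intro mult_left_mono, auto)
 also have "... = ennreal (real (card ?V) * measure e UNIV / lam)"
  using lam by (subst ennreal_mult[symmetric]) auto
 finally show ?thesis by (simp add: mult_left_mono)
qed

lemma BB_contains:
 assumes x: "x : SS" and d: "!!i. \<bar>y $ i - x $ i\<bar> <= 2 * hh (lev x)"
 shows "y : BB"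
proof -
 obtain v where v: "v : shifts" "same_cell (hh (lev x)) x (y - hh (lev x) *\<^sub>R v)"
  using same_cell_shift[OF hh_pos d] by blast
 have l: "lev (y - hh (lev x) *\<^sub>R v) = lev x" by (rule lev_cong[OF v(2)])
 hence "y - hh (lev x) *\<^sub>R v : SS" using x heavy_cong[OF v(2)] by (simp add: SS_def)
 thus ?thesis unfolding BB_def using v(1) l lev_le[of x] by auto
qed

text \<open>Up to its oscillation \<open>c\<close> the function \<open>g\<close> may be replaced by
  its mean over stopping cells, and duality moves the mean onto the measure. \<open>osc1\<close>
  serves the heavy cells, whose surroundings lie in \<open>BB\<close>; \<open>osc2\<close> serves
  the cells of generation \<open>N\<close>.\<close>

lemma stopping_estimate:
 fixes g :: "real ^ 'n => real"
 assumes g [measurable]: "g : borel_measurable borel" and g0: "!!x. 0 <= g x" and c: "0 <= c"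
  and osc1: "!!x z h. 0 < h ==> (!!i. \<bar>x $ i - z $ i\<bar> <= h) ==> (!!y. (!!i. \<bar>y $ i - x $ i\<bar> <= 2 * h) ==> y : BB) ==> g x <= g z + c"
  and osc2: "!!x z. (!!i. \<bar>x $ i - z $ i\<bar> <= hh N) ==> g x <= g z + c"
 shows "(\<integral>\<^sup>+x. ennreal (g x) \<partial>e) <= ennreal (lam / 2) * (\<integral>\<^sup>+x. ennreal ((g x)^2) \<partial>lborel) + ennreal ((2 ^ CARD('n) + c) * measure e UNIV)"
proof -
 let ?n = "CARD('n)"
 have osc: "g x <= g z + c" if "same_cell (hh (lev x)) x z" for x z
 proof -
  have d: "\<bar>x $ i - z $ i\<bar> <= hh (lev x)" for i by (rule same_cell_dist[OF hh_pos that])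
  show ?thesis
  proof (cases "x : SS")
   case True
   show ?thesis by (rule osc1[OF hh_pos d]) (rule BB_contains[OF True])
  next
   case False
   hence "lev x = N" using lev_cases[of x] by (auto simp: SS_def)
   thus ?thesis using d by (intro osc2) simp
  qed
 qed
 have pt: "ennreal (g x) <= (\<integral>\<^sup>+y. kk x y * ennreal (g y) \<partial>lborel) + ennreal c" for x
 proof -
  have [measurable]: "(%y. kk x y) : borel_measurable borel" by measurable
  have "ennreal (g x) = (\<integral>\<^sup>+y. kk x y * ennreal (g x) \<partial>lborel)"
   by (subst nn_integral_multc) (simp_all add: kk_mass_one)
  also have "... <= (\<integral>\<^sup>+y. kk x y * ennreal (g y) + kk x y * ennreal c \<partial>lborel)"
  proof (rule nn_integral_mono)
   fix y
   show "kk x y * ennreal (g x) <= kk x y * ennreal (g y) + kk x y * ennreal c"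
   proof (cases "same_cell (hh (lev x)) x y")
    case True
    have "ennreal (g x) <= ennreal (g y) + ennreal c" using osc[OF True] g0 c by (simp flip: ennreal_plus)
    thus ?thesis by (simp add: mult_left_mono flip: distrib_left)
   qed (simp add: kk_eq)
  qed
  also have "... = (\<integral>\<^sup>+y. kk x y * ennreal (g y) \<partial>lborel) + ennreal c"
   by (subst nn_integral_add) (simp_all add: nn_integral_multc kk_mass_one)
  finally show ?thesis .
 qed
 have "(\<integral>\<^sup>+x. ennreal (g x) \<partial>e) <= (\<integral>\<^sup>+x. (\<integral>\<^sup>+y. kk x y * ennreal (g y) \<partial>lborel) + ennreal c \<partial>e)"
  by (intro nn_integral_mono pt)
 also have "... = (\<integral>\<^sup>+x. \<integral>\<^sup>+y. kk x y * ennreal (g y) \<partial>lborel \<partial>e) + ennreal c * ennreal (measure e UNIV)"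
  by (subst nn_integral_add) (auto simp: emeasure_eq_measure)
 also have "(\<integral>\<^sup>+x. \<integral>\<^sup>+y. kk x y * ennreal (g y) \<partial>lborel \<partial>e) = (\<integral>\<^sup>+y. avg y * ennreal (g y) \<partial>lborel)"
  by (rule kk_Fubini) measurable
 also have "... <= (\<integral>\<^sup>+y. ennreal (lam / 2) * ennreal ((g y)^2) + ennreal (2 ^ ?n) * avg y \<partial>lborel)"
 proof (rule nn_integral_mono)
  fix y
  have "avg y < \<infinity>" using le_less_trans[OF avg_le ennreal_less_top] by simp
  then obtain b where b: "0 <= b" "avg y = ennreal b" by (cases "avg y") auto
  have b2: "b <= 2 ^ ?n * lam" using avg_le[of y] b lam by simp
  \<comment> \<open>Young's inequality; one factor of \<open>b * b\<close> is then bounded by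
    \<open>2 ^ n * lam\<close>, so that the error is linear in the averaged density and integrates
    to the mass of \<open>e\<close>.\<close>
  have "0 <= (lam * g y - b)\<^sup>2" by simp
  hence "2 * lam * (b * g y) <= lam\<^sup>2 * (g y)^2 + b * b" by (simp add: power2_eq_square algebra_simps)
  also have "b * b <= (2 ^ ?n * lam) * b" by (rule mult_right_mono[OF b2 b(1)])
  finally have "lam * (2 * (b * g y)) <= lam * (lam * (g y)^2 + 2 ^ ?n * b)" by (simp add: power2_eq_square algebra_simps)
  hence "2 * (b * g y) <= lam * (g y)^2 + 2 ^ ?n * b" using lam by simp
  moreover have "0 <= 2 ^ ?n * b" using b(1) by simp
  ultimately have "b * g y <= lam / 2 * (g y)^2 + 2 ^ ?n * b" by simp
  hence "ennreal (b * g y) <= ennreal (lam / 2 * (g y)^2 + 2 ^ ?n * b)" by (rule ennreal_leI)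
  moreover have "ennreal (b * g y) = avg y * ennreal (g y)" unfolding b(2) by (rule ennreal_mult[OF b(1) g0])
  moreover have "ennreal (lam / 2 * (g y)^2 + 2 ^ ?n * b) = ennreal (lam / 2 * (g y)^2) + ennreal (2 ^ ?n * b)"
   using lam b(1) by (intro ennreal_plus mult_nonneg_nonneg) auto
  moreover have "ennreal (lam / 2 * (g y)^2) = ennreal (lam / 2) * ennreal ((g y)^2)"
   using lam by (intro ennreal_mult) auto
  moreover have "ennreal (2 ^ ?n * b) = ennreal (2 ^ ?n) * avg y" unfolding b(2) using b(1) by (intro ennreal_mult) auto
  ultimately show "avg y * ennreal (g y) <= ennreal (lam / 2) * ennreal ((g y)^2) + ennreal (2 ^ ?n) * avg y"
   by (simp only:)
 qed
 also have "... = ennreal (lam / 2) * (\<integral>\<^sup>+x. ennreal ((g x)^2) \<partial>lborel) + ennreal (2 ^ ?n) * ennreal (measure e UNIV)"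
  by (subst nn_integral_add) (simp_all add: nn_integral_cmult avg_integral)
 finally have "(\<integral>\<^sup>+x. ennreal (g x) \<partial>e) <= ennreal (lam / 2) * (\<integral>\<^sup>+x. ennreal ((g x)^2) \<partial>lborel) + ennreal (2 ^ ?n) * ennreal (measure e UNIV) + ennreal c * ennreal (measure e UNIV)"
  by (simp add: add_mono)
 also have "... = ennreal (lam / 2) * (\<integral>\<^sup>+x. ennreal ((g x)^2) \<partial>lborel) + ennreal ((2 ^ ?n + c) * measure e UNIV)"
 proof -
  have "ennreal ((2 ^ ?n + c) * measure e UNIV) = ennreal (2 ^ ?n * measure e UNIV) + ennreal (c * measure e UNIV)"
   unfolding distrib_right using c by (intro ennreal_plus mult_nonneg_nonneg) auto
  also have "... = ennreal (2 ^ ?n) * ennreal (measure e UNIV) + ennreal c * ennreal (measure e UNIV)"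
   using c by (intro arg_cong2[where f="(+)"] ennreal_mult) auto
  finally show ?thesis by (simp only: add.assoc)
 qed
 finally show ?thesis .
qed

end

subsection \<open>The \<open>L\<^sup>2\<close> identity for the vector field\<close>

lemma rr_decay:
 assumes e: "0 < e" and y: "norm y <= R" and R: "0 <= R"
 shows "rr e (x - y) <= (2 * (1 + (1 + R) / e)) / (1 + norm x)"
proof -
 let ?d = "norm (x - y)"
 have "norm x <= ?d + norm y" using norm_triangle_sub[of x y] by simp
 hence "1 + norm x <= ?d + (1 + R)" using y by simp
 also have "... <= (?d + (1 + R)) + (e + (1 + R) * ?d / e)" using e R by simp
 also have "... = (1 + (1 + R) / e) * (?d + e)" using e by (simp add: field_simps)
 finally have le: "1 + norm x <= (1 + (1 + R) / e) * (?d + e)" .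
 have p: "0 < ?d + e" "0 < 1 + norm x" using e by (auto intro: add_nonneg_pos add_pos_nonneg)
 obtain q where q: "q = 1 + (1 + R) / e" by blast
 have "1 + norm x <= q * (?d + e)" using le by (simp only: q)
 with p have "2 / (?d + e) <= (2 * q) / (1 + norm x)" by (simp add: field_simps)
 hence "2 / (?d + e) <= (2 * (1 + (1 + R) / e)) / (1 + norm x)" by (simp only: q)
 thus ?thesis using rr_le_sum[OF e, of "x - y"] by simp
qed

lemma mA_integral_bound:
 assumes A[measurable]: "A : sets borel" and fin: "emeasure lborel A < \<infinity>"
  and g[measurable]: "g : borel_measurable borel" and b: "!!y. y : A ==> \<bar>g y\<bar> <= b" and b0: "0 <= b"
 shows "\<bar>LINT y|mA A. g y\<bar> <= b * measure lborel A"
proof (rule abs_integral_le)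
 show "g : borel_measurable (mA A)" by (simp add: mA_def)
 have "(\<integral>\<^sup>+y. ennreal \<bar>g y\<bar> \<partial>mA A) = (\<integral>\<^sup>+y. indicator A y * ennreal \<bar>g y\<bar> \<partial>lborel)"
  unfolding mA_def by (subst nn_integral_density) auto
 also have "... <= (\<integral>\<^sup>+y. ennreal b * indicator A y \<partial>lborel)"
  by (intro nn_integral_mono) (auto simp: indicator_def intro!: ennreal_leI b)
 also have "... = ennreal b * emeasure lborel A" by (rule nn_integral_cmult_indicator) simp
 also have "... = ennreal (b * measure lborel A)"
  using fin b0 by (subst emeasure_eq_ennreal_measure) (auto simp: ennreal_mult)
 finally show "(\<integral>\<^sup>+y. ennreal \<bar>g y\<bar> \<partial>mA A) <= ennreal (b * measure lborel A)" .
qed (use b0 in simp)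

definition uu :: "'a::real_normed_vector => real" where "uu x = 1 / (1 + norm x)"

lemma uu_pos: "0 < uu x" by (simp add: uu_def add_pos_nonneg)
lemma uu_le1: "uu x <= 1" by (simp add: uu_def divide_le_eq_1 add_pos_nonneg)
lemma uu_shift: "norm v <= 1 ==> uu (x + v) <= 2 * uu x"
proof -
 assume v: "norm v <= 1"
 have "norm x <= norm (x + v) + norm v" using norm_triangle_ineq4[of "x + v" v] by simp
 hence "1 + norm x <= 1 + (norm (x + v) + 1)" using v by simp
 also have "... <= 2 * (1 + norm (x + v))" by simp
 finally have "1 + norm x <= 2 * (1 + norm (x + v))" .
 moreover have "0 < 1 + norm x" "0 < 1 + norm (x + v)" by (auto intro: add_pos_nonneg)
 ultimately show ?thesis by (simp add: uu_def field_simps)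
qed

lemma uu_integrable: "integrable lborel (%x::real^'n::finite. uu x ^ (CARD('n) + 1))"
proof (rule integrableI_bounded)
 show "(%x::real^'n. uu x ^ (CARD('n) + 1)) : borel_measurable lborel" unfolding uu_def by measurable
 have "(\<integral>\<^sup>+x. ennreal (norm (uu (x::real^'n) ^ (CARD('n) + 1))) \<partial>lborel) = (\<integral>\<^sup>+x. ennreal (1 / (norm (x::real^'n) + 1) ^ (DIM(real^'n) + 1)) \<partial>lborel)"
  by (intro nn_integral_cong arg_cong[where f=ennreal]) (simp add: uu_def power_one_over add.commute)
 also have "... < \<infinity>" using nn_integral_tail_kernel[of 1, where 'a="real^'n"] by (auto intro: le_less_trans)
 finally show "(\<integral>\<^sup>+x. ennreal (norm (uu (x::real^'n) ^ (CARD('n) + 1))) \<partial>lborel) < \<infinity>" .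
qed

context
 fixes e R :: real and A :: "(real^'n::finite) set"
 assumes e: "0 < e" and A[measurable]: "A : sets borel" and sub: "A <= cball 0 R" and R: "0 <= R"
begin

lemma A_finite: "emeasure lborel A < \<infinity>"
proof -
 have "emeasure lborel A <= emeasure lborel (cball 0 R :: (real^'n) set)" using sub by (intro emeasure_mono) auto
 also have "... < \<infinity>" by (rule emeasure_lborel_cball_finite)
 finally show ?thesis .
qed

text \<open>Qualitative only: \<open>C\<close> depends on \<open>e\<close>, \<open>R\<close> and
  \<open>A\<close>. The decay provides integrable majorants for the integrations by parts and does
  not enter the final bound.\<close>

lemma field_decay:
 obtains C where "0 <= C" "!!x i. \<bar>TT e A i x\<bar> <= C * uu x ^ (CARD('n) - 1)"
  "!!x i j. \<bar>D1 e A i x (axis j 1)\<bar> <= C * uu x ^ CARD('n)"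
  "!!x i j k. \<bar>D2 e A i x (axis j 1) (axis k 1)\<bar> <= C * uu x ^ (CARD('n) + 1)"
proof -
 let ?n = "CARD('n)"
 define q where "q = 2 * (1 + (1 + R) / e)"
 define c where "c = 3 * real ?n + real ?n * real (?n + 2) + real (?n + 1)"
 define C where "C = c * q ^ (?n + 1) * measure lborel A"
 have q1: "1 <= q" using e R by (simp add: q_def)
 have c1: "1 <= c" "real (?n + 1) <= c" "3 * real ?n + real ?n * real (?n + 2) <= c" by (auto simp: c_def)
 have r: "rr e (x - y) ^ k <= q ^ (?n + 1) * uu x ^ k" if "y : A" "k <= ?n + 1" for x y :: "real^'n" and k
 proof -
  have "norm y <= R" using sub that by auto
  hence "rr e (x - y) <= q * uu x" using rr_decay[OF e _ R, of y x] by (simp add: q_def uu_def)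
  hence "rr e (x - y) ^ k <= (q * uu x) ^ k" by (intro power_mono) auto
  also have "... = q ^ k * uu x ^ k" by (rule power_mult_distrib)
  also have "... <= q ^ (?n + 1) * uu x ^ k" using q1 that(2) uu_pos[of x] by (intro mult_right_mono power_increasing) auto
  finally show ?thesis .
 qed
 have gen: "\<bar>LINT y|mA A. g (x - y)\<bar> <= C * uu x ^ k"
  if g: "continuous_on UNIV g" "!!z. \<bar>g z\<bar> <= c' * rr e z ^ k" and c': "0 <= c'" "c' <= c" and k: "k <= ?n + 1"
  for g :: "real^'n => real" and c' k x
 proof -
  have [measurable]: "g : borel_measurable borel" using g(1) by (rule borel_measurable_continuous_onI)
  have "\<bar>LINT y|mA A. g (x - y)\<bar> <= (c * q ^ (?n + 1) * uu x ^ k) * measure lborel A"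
  proof (rule mA_integral_bound[OF A A_finite])
   fix y assume y: "y : A"
   have "\<bar>g (x - y)\<bar> <= c' * rr e (x - y) ^ k" by (rule g(2))
   also have "... <= c * (q ^ (?n + 1) * uu x ^ k)"
    using c' c1 r[OF y k] by (intro mult_mono) auto
   finally show "\<bar>g (x - y)\<bar> <= c * q ^ (?n + 1) * uu x ^ k" by (simp only: mult.assoc)
  qed (use c1 q1 uu_pos[of x] in "auto intro!: mult_nonneg_nonneg")
  thus ?thesis by (simp add: C_def mult_ac)
 qed
 show ?thesis
 proof (rule that)
  show "0 <= C" using c1 q1 by (simp add: C_def)
  show "\<bar>TT e A i x\<bar> <= C * uu x ^ (?n - 1)" for x i
   unfolding TT_def by (rule gen[OF G_continuous(1)[OF e], where c'=1]) (use G0_bound[OF e] c1 in auto)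
  show "\<bar>D1 e A i x (axis j 1)\<bar> <= C * uu x ^ ?n" for x i j
   unfolding D1_def by (rule gen[OF G_continuous(2)[OF e], where c'="real (?n + 1)"])
    (use G1_bound[OF e, where h="axis j 1"] c1 in "auto simp: norm_axis_1")
  show "\<bar>D2 e A i x (axis j 1) (axis k 1)\<bar> <= C * uu x ^ (?n + 1)" for x i j k
   unfolding D2_def by (rule gen[OF G_continuous(3)[OF e], where c'="3 * real ?n + real ?n * real (?n + 2)"])
    (use G2_bound[OF e, where h="axis j 1" and k="axis k 1"] c1 in "auto simp: norm_axis_1")
 qed
qed

lemma directional_chain:
 fixes f :: "'b::real_normed_vector => real"
 assumes "(f has_derivative f') (at (x + t *\<^sub>R v))"
 shows "((%t. f (x + t *\<^sub>R v)) has_real_derivative f' v) (at t)"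
proof -
 have 1: "((%t. x + t *\<^sub>R v) has_derivative (%s. s *\<^sub>R v)) (at t)" by (auto intro!: derivative_eq_intros)
 have "((%t. f (x + t *\<^sub>R v)) has_derivative (%s. f' (s *\<^sub>R v))) (at t)"
  by (rule has_derivative_compose[OF 1 assms])
 moreover have "f' (s *\<^sub>R v) = f' v * s" for s
  using linear_scale[OF has_derivative_linear[OF assms], of s v] by simp
 ultimately show ?thesis by (simp add: has_field_derivative_def)
qed

lemma D2_borel [measurable]: "(%x. D2 e A i x h k) : borel_measurable borel"
proof -
 interpret finite_measure "mA A" by (rule finite_mA[OF e A A_finite])
 have [measurable_cong]: "sets (mA A) = sets borel" by (simp add: mA_def)
 have [measurable]: "(%z. G2 e i z h k) : borel_measurable borel"
  by (rule borel_measurable_continuous_onI[OF G_continuous(3)[OF e]])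
 show ?thesis unfolding D2_def by measurable
qed

text \<open>The derivative matrix is symmetric, so integrating by parts twice turns its squared norm
  into the square of the divergence. The latter is at most \<open>K1\<close> times the divergence
  itself, whose integral is at most \<open>K1\<close> times the measure of \<open>A\<close>. The
  bound is linear in that measure and free of \<open>e\<close>.\<close>

lemma field_L2:
 "(\<integral>\<^sup>+x. ennreal (SUM i:UNIV. SUM j:UNIV. (D1 e A i x (axis j 1))^2) \<partial>lborel) <= ennreal ((K1 CARD('n))^2 * measure lborel A)"
proof -
 let ?n = "CARD('n)"
 define T where "T i x = TT e A i x" for i x
 define S where "S i j x = D1 e A i x (axis j 1)" for i j x
 define H where "H i j k x = D2 e A i x (axis j 1) (axis k 1)" for i j k x
 note ctx = e A A_finite
 have S_sym: "S i j x = S j i x" for i j x unfolding S_def by (rule D1_sym[OF ctx])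
 have H_sym: "H i j k x = H i k j x" for i j k x unfolding H_def by (rule D2_sym[OF ctx])
 have [measurable]: "T i : borel_measurable borel" "S i j : borel_measurable borel" for i j
  unfolding T_def[abs_def] S_def[abs_def] by (rule borel_measurable_continuous_onI TT_continuous[OF ctx])+
 have [measurable]: "H i j k : borel_measurable borel" for i j k unfolding H_def[abs_def] by measurable
 obtain C where C: "0 <= C" "!!x i. \<bar>T i x\<bar> <= C * uu x ^ (?n - 1)" "!!x i j. \<bar>S i j x\<bar> <= C * uu x ^ ?n"
  "!!x i j k. \<bar>H i j k x\<bar> <= C * uu x ^ (?n + 1)"
  using field_decay unfolding T_def S_def H_def by metis
 \<comment> \<open>\<open>g i j\<close> is the derivative in direction \<open>i\<close> of
   \<open>T j * S i j - T i * S j j\<close>. Summed over \<open>i\<close> and \<open>j\<close>, the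
   terms with second derivatives cancel by symmetry (\<open>H0\<close>), and the squared norm minus
   the squared divergence remains.\<close>
 define g where "g i j x = S i j x * S i j x + T j x * H i j i x - (S i i x * S j j x + T i x * H j j i x)" for i j x
 have [measurable]: "g i j : borel_measurable borel" for i j unfolding g_def[abs_def] by measurable
 have pw: "\<bar>a * b\<bar> <= C\<^sup>2 * uu x ^ (?n + 1)" if "\<bar>a\<bar> <= C * uu x ^ k" "\<bar>b\<bar> <= C * uu x ^ l" "?n + 1 <= k + l" for a b and x :: "real^'n" and k l
 proof -
  have u: "0 <= uu x" "uu x <= 1" using uu_pos[of x] uu_le1[of x] by auto
  have "\<bar>a * b\<bar> <= (C * uu x ^ k) * (C * uu x ^ l)" unfolding abs_mult using that C(1) u by (intro mult_mono) auto
  also have "... = C\<^sup>2 * uu x ^ (k + l)" by (simp add: power2_eq_square power_add)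
  also have "... <= C\<^sup>2 * uu x ^ (?n + 1)" using u that(3) by (intro mult_left_mono power_decreasing) auto
  finally show ?thesis .
 qed
 have g0: "integrable lborel (g i j) & (LINT x|lborel. g i j x) = 0" for i j
 proof (cases "i = j")
  case True
  hence "g i j = (%x. 0)" unfolding g_def[abs_def] by simp
  thus ?thesis by simp
 next
  case False
  \<comment> \<open>Distinct indices force dimension at least two, which is what a product such as
    \<open>T j * S i j\<close> needs in order to decay with the integrable exponent
    \<open>n + 1\<close>.\<close>
  have "card {i, j} <= ?n" by (rule card_mono) auto
  hence n2: "2 <= ?n" using False by simp
  define f where "f x = T j x * S i j x - T i x * S j j x" for x
  define w where "w x = 4 * C\<^sup>2 * (2 ^ (?n + 1) * uu x ^ (?n + 1))" for x :: "real^'n"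
  have [measurable]: "f : borel_measurable borel" unfolding f_def[abs_def] by measurable
  have gle: "\<bar>g i j x\<bar> <= 4 * C\<^sup>2 * uu x ^ (?n + 1)" for x
  proof -
   have k: "?n + 1 <= ?n + ?n" "?n + 1 <= (?n - 1) + (?n + 1)" using n2 by auto
   show ?thesis
    using pw[OF C(3)[of i j x] C(3)[of i j x] k(1)] pw[OF C(3)[of i i x] C(3)[of j j x] k(1)]
     pw[OF C(2)[of j x] C(4)[of i j i x] k(2)] pw[OF C(2)[of i x] C(4)[of j j i x] k(2)]
    unfolding g_def by linarith
  qed
  have fle: "\<bar>f x\<bar> <= 2 * C\<^sup>2 * uu x ^ (?n + 1)" for x
  proof -
   have k: "?n + 1 <= (?n - 1) + ?n" using n2 by auto
   show ?thesis
    using pw[OF C(2)[of j x] C(3)[of i j x] k] pw[OF C(2)[of i x] C(3)[of j j x] k]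
    unfolding f_def by linarith
  qed
  have iw: "integrable lborel w" unfolding w_def by (intro integrable_mult_right uu_integrable)
  have wle: "\<bar>g i j (x + t *\<^sub>R axis i 1)\<bar> <= w x" if "\<bar>t\<bar> <= 1" for x t
  proof -
   have "norm (t *\<^sub>R (axis i 1 :: real^'n)) <= 1" using that by (simp add: norm_axis_1)
   hence "uu (x + t *\<^sub>R axis i 1) ^ (?n + 1) <= (2 * uu x) ^ (?n + 1)"
    using uu_pos[of "x + t *\<^sub>R axis i 1"] by (intro power_mono uu_shift) auto
   hence "4 * C\<^sup>2 * uu (x + t *\<^sub>R axis i 1) ^ (?n + 1) <= w x"
    unfolding w_def power_mult_distrib by (intro mult_left_mono) auto
   thus ?thesis using gle[of "x + t *\<^sub>R axis i 1"] by linarith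
  qed
  have "integrable lborel f"
  proof (rule integrable_bound)
   show "integrable lborel (%x::real^'n. 2 * C\<^sup>2 * uu x ^ (?n + 1))" by (intro integrable_mult_right uu_integrable)
   show "AE x in lborel. norm (f x) <= norm (2 * C\<^sup>2 * uu x ^ (?n + 1))"
    using fle by (intro AE_I2) (metis abs_ge_self order_trans real_norm_def)
  qed simp
  moreover have "((%t. f (x + t *\<^sub>R axis i 1)) has_real_derivative g i j (x + t *\<^sub>R axis i 1)) (at t)" for x t
  proof -
   let ?y = "x + t *\<^sub>R axis i 1"
   have dT: "(T l has_derivative D1 e A l ?y) (at ?y)" for l unfolding T_def[abs_def] by (rule TT_has_derivative[OF ctx])
   have dS: "(S l m has_derivative (%k. D2 e A l ?y (axis m 1) k)) (at ?y)" for l m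
    unfolding S_def[abs_def] by (rule D1_has_derivative[OF ctx])
   have "(f has_derivative (%h. (T j ?y * D2 e A i ?y (axis j 1) h + D1 e A j ?y h * S i j ?y) - (T i ?y * D2 e A j ?y (axis j 1) h + D1 e A i ?y h * S j j ?y))) (at ?y)"
    unfolding f_def[abs_def] by (intro has_derivative_diff has_derivative_mult dT dS)
   from directional_chain[OF this]
   show ?thesis using S_sym[of j i ?y] unfolding g_def H_def[symmetric] S_def[symmetric] by (simp add: algebra_simps)
  qed
  moreover have "integrable lborel (g i j)"
  proof (rule integrable_bound[OF iw])
   show "AE x in lborel. norm (g i j x) <= norm (w x)"
    using wle[of 0] by (intro AE_I2) (metis abs_ge_self abs_zero add.right_neutral order_trans real_norm_def scaleR_zero_left zero_le_one)
  qed simp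
  ultimately show ?thesis using integral_directional_derivative_zero[where f=f and g="g i j" and w=w and v="axis i 1"] iw wle by simp
 qed
 have H0: "(SUM i:UNIV. SUM j:UNIV. T i x * H j j i x) = (SUM i:UNIV. SUM j:UNIV. T j x * H i j i x)" for x
  by (subst sum.swap) (simp add: H_sym)
 have eq: "(SUM i:UNIV. SUM j:UNIV. (S i j x)^2) = (SUM i:UNIV. SUM j:UNIV. g i j x) + (dv e A x)^2" for x
 proof -
  have "(dv e A x)^2 = (SUM i:UNIV. SUM j:UNIV. S i i x * S j j x)"
   unfolding dv_def[OF ctx] S_def[symmetric] power2_eq_square by (rule sum_product)
  thus ?thesis unfolding g_def using H0[of x]
   by (simp add: sum.distrib sum_subtractf power2_eq_square)
 qed
 have dv2: "integrable lborel (%x. (dv e A x)^2)" "(LINT x|lborel. (dv e A x)^2) <= (K1 ?n)\<^sup>2 * measure lborel A"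
 proof -
  note [measurable] = borel_measurable_continuous_onI[OF dv_continuous[OF ctx]]
  have le: "(dv e A x)^2 <= K1 ?n * dv e A x" for x
   unfolding power2_eq_square using dv_nonneg[OF ctx] dv_le[OF ctx] by (intro mult_right_mono)
  have i: "integrable lborel (%x. K1 ?n * dv e A x)" by (intro integrable_mult_right dv_integral(1)[OF ctx])
  show i2: "integrable lborel (%x. (dv e A x)^2)"
   by (rule integrable_bound[OF i]) (use order_trans[OF le abs_ge_self] in auto)
  have "(LINT x|lborel. (dv e A x)^2) <= (LINT x|lborel. K1 ?n * dv e A x)" by (intro integral_mono i i2 le)
  also have "... = K1 ?n * (LINT x|lborel. dv e A x)" by simp
  also have "... <= K1 ?n * (K1 ?n * measure lborel A)"
   using KT_pos[of ?n] by (intro mult_left_mono dv_integral(2)[OF ctx]) (simp add: K1_def less_imp_le)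
  finally show "(LINT x|lborel. (dv e A x)^2) <= (K1 ?n)\<^sup>2 * measure lborel A" by (simp add: power2_eq_square mult.assoc)
 qed
 have ig: "integrable lborel (%x. SUM i:UNIV. SUM j:UNIV. g i j x)" using g0 by (intro integrable_sum) auto
 have "(LINT x|lborel. (SUM i:UNIV. SUM j:UNIV. g i j x)) = (SUM i:UNIV. SUM j:UNIV. (LINT x|lborel. g i j x))"
  using g0 by (simp add: integral_sum)
 hence zg: "(LINT x|lborel. (SUM i:UNIV. SUM j:UNIV. g i j x)) = 0" using g0 by simp
 have "(\<integral>\<^sup>+x. ennreal (SUM i:UNIV. SUM j:UNIV. (S i j x)^2) \<partial>lborel) = ennreal (LINT x|lborel. (SUM i:UNIV. SUM j:UNIV. (S i j x)^2))"
 proof (rule nn_integral_eq_integral)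
  show "integrable lborel (%x. SUM i:UNIV. SUM j:UNIV. (S i j x)^2)"
   unfolding eq by (rule integrable_add[OF ig dv2(1)])
 qed (intro AE_I2 sum_nonneg zero_le_power2)
 also have "(LINT x|lborel. (SUM i:UNIV. SUM j:UNIV. (S i j x)^2)) = (LINT x|lborel. (dv e A x)^2)"
  unfolding eq by (subst integral_add[OF ig dv2(1)]) (simp only: zg add_0)
 finally show ?thesis unfolding S_def using dv2(2) by (simp add: ennreal_leI)
qed

end

subsection \<open>Null sets are not charged\<close>

lemma norm_matrix_le: "norm (M :: real^'n::finite^'m::finite) <= (SUM i:UNIV. SUM j:UNIV. \<bar>M $ i $ j\<bar>)"
proof -
 have "norm M <= (SUM i:UNIV. norm (M $ i))" unfolding norm_vec_def[of M] by (rule L2_set_le_sum) simp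
 also have "... <= (SUM i:UNIV. SUM j:UNIV. \<bar>M $ i $ j\<bar>)" by (intro sum_mono norm_le_l1_cart)
 finally show ?thesis .
qed

lemma norm_matrix_sq: "(norm (M :: real^'n::finite^'m::finite))^2 = (SUM i:UNIV. SUM j:UNIV. (M $ i $ j)^2)"
 by (simp add: norm_vec_def L2_set_def sum_nonneg)

definition DT :: "real => (real^'n::finite) set => real^'n => real^'n^'n" where
 "DT e A x = (\<chi> i j. D1 e A i x (axis j 1))"

context
 fixes e :: real and A :: "(real^'n::finite) set"
 assumes e: "0 < e" and A[measurable]: "A : sets borel" and Afin: "emeasure lborel A < \<infinity>"
begin

lemma vector_field_has_derivative: "((%x. \<chi> i. TT e A i x) has_derivative (%h. DT e A x *v h)) (at x)"
proof -
 have "((%x. TT e A i x) has_derivative (%h. SUM j:UNIV. h $ j * D1 e A i x (axis j 1))) (at x)" for i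
  by (rule has_derivative_eq_rhs[OF TT_has_derivative(1)[OF e A Afin]]) (rule ext, rule D1_linear[OF e A Afin])
 thus ?thesis
  by (subst has_derivative_componentwise_within) (auto simp: Basis_vec_def inner_axis matrix_vector_mult_def DT_def mult.commute)
qed

lemma DT_continuous: "continuous_on UNIV (DT e A)"
 unfolding DT_def[abs_def] by (intro continuous_on_vec_lambda TT_continuous[OF e A Afin])

lemma trace_DT: "trace (DT e A x) = dv e A x"
 by (simp add: trace_def DT_def dv_def[OF e A Afin])

lemma DT_bounded: "bounded (range (DT e A))"
 unfolding bounded_iff
proof (intro exI ballI)
 let ?b = "real (CARD('n) + 1) * (1 / e ^ CARD('n)) * measure lborel A"
 fix M assume "M : range (DT e A)"
 then obtain x where x: "M = DT e A x" by blast
 have "\<bar>M $ i $ j\<bar> <= ?b" for i j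
 proof -
  have [measurable]: "(%z. G1 e i z (axis j 1)) : borel_measurable borel"
   by (rule borel_measurable_continuous_onI[OF G_continuous(2)[OF e]])
  have "\<bar>D1 e A i x (axis j 1)\<bar> <= ?b" unfolding D1_def
  proof (rule mA_integral_bound[OF A Afin])
   show "\<bar>G1 e i (x - y) (axis j 1)\<bar> <= real (CARD('n) + 1) * (1 / e ^ CARD('n))" for y
    using order_trans[OF G1_bound[OF e, of i "x - y" "axis j 1"] mult_right_mono[OF mult_left_mono[OF rr_power_le[OF e A Afin]]]]
    by (simp add: norm_axis_1)
  qed (use e in auto)
  thus ?thesis by (simp add: x DT_def)
 qed
 hence "(SUM i:UNIV. SUM j:UNIV. \<bar>M $ i $ j\<bar>) <= (SUM i:(UNIV::'n set). SUM j:(UNIV::'n set). ?b)" by (intro sum_mono)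
 thus "norm M <= (SUM i:(UNIV::'n set). SUM j:(UNIV::'n set). ?b)" using norm_matrix_le[of M] by linarith
qed

lemma DT_osc:
 assumes D2: "!!w i j h. w : closed_segment x z ==> \<bar>D2 e A i w (axis j 1) h\<bar> <= b * norm h"
 shows "norm (DT e A x) <= norm (DT e A z) + real CARD('n) * real CARD('n) * (b * norm (x - z))"
proof -
 have "\<bar>D1 e A i x (axis j 1) - D1 e A i z (axis j 1)\<bar> <= b * norm (x - z)" for i j
 proof -
  have "norm (D1 e A i x (axis j 1) - D1 e A i z (axis j 1)) <= b * norm (x - z)"
  proof (rule differentiable_bound[where S="closed_segment x z" and f'="%w. D2 e A i w (axis j 1)"])
   show "((%x. D1 e A i x (axis j 1)) has_derivative D2 e A i w (axis j 1)) (at w within closed_segment x z)" for w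
    using D1_has_derivative[OF e A Afin, of i "axis j 1" w] by (rule has_derivative_at_withinI)
   show "onorm (D2 e A i w (axis j 1)) <= b" if "w : closed_segment x z" for w
    using D2[OF that] by (intro onorm_le) simp
  qed auto
  thus ?thesis by simp
 qed
 hence "(SUM i:UNIV. SUM j:UNIV. \<bar>(DT e A x - DT e A z) $ i $ j\<bar>) <= (SUM i:(UNIV::'n set). SUM j:(UNIV::'n set). b * norm (x - z))"
  by (intro sum_mono) (simp add: DT_def)
 hence "norm (DT e A x - DT e A z) <= real CARD('n) * real CARD('n) * (b * norm (x - z))"
  using norm_matrix_le[of "DT e A x - DT e A z"] by simp
 thus ?thesis using norm_triangle_sub[of "DT e A x" "DT e A z"] by linarith
qed

end

lemma segment_component:
 fixes x z :: "real^'n::finite"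
 assumes "w : closed_segment x z" "\<bar>x $ i - z $ i\<bar> <= h"
 shows "\<bar>w $ i - x $ i\<bar> <= h"
proof -
 obtain u where u: "0 <= u" "u <= 1" "w = (1 - u) *\<^sub>R x + u *\<^sub>R z" using assms(1) by (auto simp: in_segment)
 have "w $ i - x $ i = u * (z $ i - x $ i)" unfolding u(3) by (simp add: algebra_simps)
 hence "\<bar>w $ i - x $ i\<bar> = u * \<bar>x $ i - z $ i\<bar>" using u(1) by (simp add: abs_mult abs_minus_commute)
 also have "... <= 1 * \<bar>x $ i - z $ i\<bar>" using u by (intro mult_right_mono) auto
 finally show ?thesis using assms(2) by simp
qed

lemma norm_le_cube:
 fixes x z :: "real^'n::finite"
 assumes "!!i. \<bar>x $ i - z $ i\<bar> <= h"
 shows "norm (x - z) <= real CARD('n) * h"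
proof -
 have "norm (x - z) <= (SUM i:UNIV. \<bar>(x - z) $ i\<bar>)" by (rule norm_le_l1_cart)
 also have "... <= (SUM i:(UNIV::'n set). h)" using assms by (intro sum_mono) simp
 finally show ?thesis by simp
qed

text \<open>Formally the dual version of a statement on distributions: the gradient of
  \<open>sig\<close> is the divergence of a matrix measure dominated by \<open>eps\<close>, up to a
  vector measure of mass \<open>C\<close>.\<close>

definition good_estimate :: "(real^'n::finite) measure => (real^'n) measure => real => bool" where
 "good_estimate sig eps C \<longleftrightarrow> (\<forall>T T' tau. (ALL x. (T has_derivative (%h. T' x *v h)) (at x)) --> continuous_on UNIV T' -->
   bounded (range T') --> (ALL x. norm (T x) <= tau) -->
   (LINT x|sig. trace (T' x)) <= (LINT x|eps. norm (T' x)) + C * tau)"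

text \<open>The estimate is tested with the field of \<open>A\<close>, a small neighbourhood of
  \<open>K\<close> joined with the set \<open>BB\<close> of the stopping time for
  \<open>eps\<close>. The divergence is bounded below on \<open>K\<close>. In the stopping estimate
  the \<open>L2\<close> term is of the order of \<open>lam\<close> times the measure of
  \<open>A\<close>; as \<open>lam\<close> grows this stays of the order of the mass of
  \<open>eps\<close>, while the supremum of the field becomes small enough to absorb
  \<open>C\<close>.\<close>

lemma charge_bound:
 fixes sig eps :: "(real^'n::finite) measure"
 assumes sig: "finite_measure sig" "sets sig = sets borel" and eps: "finite_measure eps" "sets eps = sets borel"
  and K: "compact K" "emeasure lborel K = 0" and C: "0 <= C" and H: "good_estimate sig eps C" and eta: "0 < eta"
 shows "real CARD('n) * unit_ball_vol (real CARD('n)) / 2 ^ (CARD('n) + 2) * measure sig K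
  <= ((K1 CARD('n))^2 * real (card (shifts :: (real^'n) set)) + (2 ^ CARD('n) + real CARD('n) ^ 3 * K2 CARD('n))) * measure eps UNIV + eta"
proof -
 let ?n = "CARD('n)"
 define c0 where "c0 = real ?n * unit_ball_vol (real ?n) / 2 ^ (?n + 2)"
 define cv where "cv = real (card (shifts :: (real^'n) set))"
 define a where "a = unit_ball_vol (real ?n) * 2 ^ ?n"
 define m where "m = measure eps UNIV"
 define c where "c = real ?n ^ 3 * K2 ?n"
 have npos: "0 < real ?n" using card_pos(1)[where 'n='n] by simp
 have a: "0 < a" by (simp add: a_def unit_ball_vol_pos)
 have m: "0 <= m" by (simp add: m_def)
 have cv: "0 <= cv" by (simp add: cv_def)
 have k2: "0 <= K2 ?n" using KT_pos[of ?n] by (simp add: K2_def less_imp_le)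
 have c: "0 <= c" using k2 by (simp add: c_def)
 \<comment> \<open>The term \<open>C * tau\<close> of the estimate may cost at most half of
   \<open>eta\<close>.\<close>
 define tau where "tau = eta / (2 * (C + 1))"
 have tau: "0 < tau" "C * tau <= eta / 2" using eta C by (auto simp: tau_def field_simps)
 \<comment> \<open>\<open>s\<close> and \<open>kap\<close> split \<open>tau / n\<close> evenly
   between the two terms of \<open>TT_bound\<close>; \<open>kap\<close> is the measure that
   \<open>A\<close> must not exceed.\<close>
 define s where "s = tau / (2 * real ?n * a)"
 have s: "0 < s" using tau npos a by (simp add: s_def)
 define kap where "kap = tau * s ^ (?n - 1) / (2 * real ?n)"
 have kap: "0 < kap" using tau s npos by (simp add: kap_def)
 \<comment> \<open>The entry with \<open>eta\<close> keeps the contribution of the neighbourhood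
   \<open>U\<close> to the \<open>L2\<close> term below \<open>eta / 2\<close>; the entry with
   \<open>kap\<close> forces the measure of \<open>A\<close> below \<open>kap\<close>.\<close>
 define lam where "lam = max 1 (max ((K1 ?n)^2 / eta) ((cv * m + 1) / kap))"
 have lam: "1 <= lam" "(K1 ?n)^2 <= eta * lam" "cv * m + 1 <= kap * lam"
 proof -
  show "1 <= lam" by (simp add: lam_def)
  have "(K1 ?n)^2 / eta <= lam" "(cv * m + 1) / kap <= lam" by (auto simp: lam_def)
  thus "(K1 ?n)^2 <= eta * lam" "cv * m + 1 <= kap * lam" using eta kap by (auto simp: divide_le_eq mult.commute)
 qed
 define L where "L = max 1 (m / lam)"
 have L: "1 <= L" "m <= lam * L ^ ?n"
 proof -
  show L1: "1 <= L" by (simp add: L_def)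
  have "m / lam <= L" by (simp add: L_def)
  also have "L <= L ^ ?n" using L1 card_pos(1)[where 'n='n] by (intro self_le_power) auto
  finally show "m <= lam * L ^ ?n" using lam(1) by (simp add: divide_le_eq mult.commute)
 qed
 have bK: "bounded K" using K(1) by (rule compact_imp_bounded)
 then obtain R0 where R0: "K <= ball 0 R0" using bounded_subset_ballD by blast
 \<comment> \<open>The square is taken because the measure of \<open>U\<close> must remain small
   after multiplication by \<open>lam\<close>.\<close>
 have "0 < 1 / lam\<^sup>2" using lam(1) by simp
 then obtain U0 where U0: "open U0" "K <= U0" "emeasure lborel (U0 - K) < ennreal (1 / lam\<^sup>2)"
  using outer_regular_lborel[of K "1 / lam\<^sup>2"] borel_compact[OF K(1)] by auto
 define U where "U = U0 \<inter> ball 0 R0"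
 have U: "open U" "K <= U" "bounded U" using U0 R0 by (auto simp: U_def bounded_Int)
 have Um: "emeasure lborel U <= ennreal (1 / lam\<^sup>2)"
 proof -
  have "emeasure lborel U <= emeasure lborel (K \<union> (U0 - K))"
   using borel_compact[OF K(1)] U0(1) by (intro emeasure_mono) (auto simp: U_def)
  also have "... <= emeasure lborel K + emeasure lborel (U0 - K)"
   using borel_compact[OF K(1)] U0(1) by (intro emeasure_subadditive) auto
  finally show ?thesis using K(2) U0(3) by simp
 qed
 obtain e where e: "0 < e" "(\<Union>x\<in>K. ball x e) <= U"
  using compact_subset_open_imp_ball_epsilon_subset[OF K(1) U(1,2)] by blast
 \<comment> \<open>The finest cells get side at most \<open>e\<close>, the scale at which the field
   is already smooth; there the global bound \<open>D2_bound\<close> controls the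
   oscillation.\<close>
 have "EX N. (1 / 2) ^ N < e / L" by (rule real_arch_pow_inv) (use e(1) L(1) in auto)
 then obtain N where N: "(1 / 2) ^ N < e / L" by (elim exE)
 interpret S: stopping eps lam L N
  using eps lam(1) L by (intro stopping.intro) (auto simp: m_def)
 have hN: "S.hh N <= e" using N L(1) by (simp add: S.hh_def power_one_over field_simps)
 define A where "A = S.BB \<union> U"
 have A: "A : sets borel" using U(1) by (simp add: A_def)
 have "bounded A" using S.BB_bounded U(3) by (simp add: A_def)
 then obtain R where R: "0 <= R" "A <= cball 0 R"
  using bounded_subset_ballD[of A 0] by (meson ball_subset_cball less_imp_le order_trans)
 have Afin: "emeasure lborel A < \<infinity>" by (rule A_finite[OF e(1) A R(2,1)])
 note ctx = e(1) A Afin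
 have Am: "measure lborel A <= cv * m / lam + 1 / lam\<^sup>2"
 proof -
  have "emeasure lborel A <= emeasure lborel S.BB + emeasure lborel U"
   unfolding A_def using U(1) by (intro emeasure_subadditive) auto
  also have "... <= ennreal (cv * m / lam) + ennreal (1 / lam\<^sup>2)"
   using S.BB_measure Um by (intro add_mono) (auto simp: cv_def m_def)
  also have "... = ennreal (cv * m / lam + 1 / lam\<^sup>2)" using cv m lam(1) by (intro ennreal_plus[symmetric]) auto
  finally have "ennreal (measure lborel A) <= ennreal (cv * m / lam + 1 / lam\<^sup>2)"
   using Afin by (simp add: emeasure_eq_ennreal_measure)
  thus ?thesis using cv m lam(1) by (subst (asm) ennreal_le_iff) auto
 qed
 have Akap: "measure lborel A <= kap"
 proof -
  have "1 / lam\<^sup>2 <= 1 / lam" using lam(1) by (intro divide_left_mono) (auto simp: power2_eq_square)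
  hence "measure lborel A <= (cv * m + 1) / lam" using Am by (simp add: add_divide_distrib)
  also have "... <= kap" using lam by (simp add: divide_le_eq)
  finally show ?thesis .
 qed
 have Ttau: "norm (\<chi> i. TT e A i x) <= tau" for x
 proof -
  have "norm (\<chi> i. TT e A i x) <= (SUM i:UNIV. \<bar>TT e A i x\<bar>)" using norm_le_l1_cart[of "\<chi> i. TT e A i x"] by simp
  also have "... <= (SUM i:(UNIV::'n set). tau / real ?n)"
  proof (rule sum_mono)
   fix i :: 'n
   have "\<bar>TT e A i x\<bar> <= a * s + measure lborel A / s ^ (?n - 1)" unfolding a_def by (rule TT_bound[OF ctx s])
   also have "... <= a * s + kap / s ^ (?n - 1)" using s by (intro add_left_mono divide_right_mono Akap) auto
   also have "a * s = tau / (2 * real ?n)" using a npos by (simp add: s_def)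
   also have "kap / s ^ (?n - 1) = tau / (2 * real ?n)" using s by (simp add: kap_def)
   also have "tau / (2 * real ?n) + tau / (2 * real ?n) = tau / real ?n" by (simp add: field_simps)
   finally show "\<bar>TT e A i x\<bar> <= tau / real ?n" .
  qed
  also have "... = tau" using npos by simp
  finally show ?thesis .
 qed
 note [measurable] = borel_measurable_continuous_onI[OF DT_continuous[OF ctx]] borel_measurable_continuous_onI[OF dv_continuous[OF ctx]]
 have main: "(LINT x|sig. dv e A x) <= (LINT x|eps. norm (DT e A x)) + C * tau"
  using H[unfolded good_estimate_def, rule_format, OF vector_field_has_derivative[OF ctx] DT_continuous[OF ctx] DT_bounded[OF ctx] Ttau]
  by (simp only: trace_DT[OF ctx])
 have "c0 * measure sig K <= (LINT x|sig. dv e A x)"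
 proof -
  interpret sig: finite_measure sig by (rule sig(1))
  note [measurable_cong] = sig(2)
  have [measurable]: "K : sets borel" by (rule borel_compact[OF K(1)])
  have "c0 * measure sig K = (LINT x|sig. c0 * indicator K x)"
   using sets_eq_imp_space_eq[OF sig(2)] by simp
  also have "... <= (LINT x|sig. dv e A x)"
  proof (rule integral_mono)
   show "integrable sig (%x. c0 * indicator K x)"
    by (rule sig.integrable_const_bound[where B="\<bar>c0\<bar>"]) (auto simp: indicator_def)
   show "integrable sig (dv e A)"
    by (rule sig.integrable_const_bound[where B="K1 ?n"]) (use dv_nonneg[OF ctx] dv_le[OF ctx] in auto)
   show "c0 * indicator K x <= dv e A x" for x
   proof (cases "x : K")
    case True
    hence "ball x e <= A" using e(2) by (auto simp: A_def)
    thus ?thesis using dv_lower[OF ctx] True by (simp add: c0_def)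
   qed (use dv_nonneg[OF ctx] in auto)
  qed
  finally show ?thesis .
 qed
 moreover have "(LINT x|eps. norm (DT e A x)) <= ((K1 ?n)^2 * cv + (2 ^ ?n + c)) * m + eta / 2"
 proof -
  obtain B where B: "!!x. norm (DT e A x) <= B" using DT_bounded[OF ctx] by (auto simp: bounded_iff)
  note [measurable_cong] = eps(2)
  have i: "integrable eps (%x. norm (DT e A x))"
   by (rule S.integrable_const_bound[where B=B]) (use B in auto)
  have "ennreal (LINT x|eps. norm (DT e A x)) = (\<integral>\<^sup>+x. ennreal (norm (DT e A x)) \<partial>eps)"
   by (rule nn_integral_eq_integral[OF i, symmetric]) simp
  also have "... <= ennreal (lam / 2) * (\<integral>\<^sup>+x. ennreal ((norm (DT e A x))^2) \<partial>lborel) + ennreal ((2 ^ ?n + c) * measure eps UNIV)"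
  proof (rule S.stopping_estimate)
   fix x z :: "real^'n" and h :: real
   assume h: "0 < h" and d: "!!i. \<bar>x $ i - z $ i\<bar> <= h" and BB: "!!y. (!!i. \<bar>y $ i - x $ i\<bar> <= 2 * h) ==> y : S.BB"
   have "norm (DT e A x) <= norm (DT e A z) + real ?n * real ?n * (K2 ?n / h * norm (x - z))"
   proof (rule DT_osc[OF ctx])
    fix w i j k assume w: "w : closed_segment x z"
    \<comment> \<open>A point within \<open>h\<close> of the segment is within \<open>2 * h\<close>
      of \<open>x\<close> in every coordinate, hence in \<open>BB\<close>. Along the segment the
      second derivative is therefore of order \<open>1 / h\<close>, and over a distance of order
      \<open>h\<close> the first derivative changes by a constant.\<close>
    have "ball w h <= A"
    proof
     fix y assume "y : ball w h"
     hence "norm (y - w) < h" by (simp add: dist_norm norm_minus_commute)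
     hence "\<bar>y $ i - x $ i\<bar> <= 2 * h" for i
      using segment_component[OF w d, of i] component_le_norm_cart[of "y - w" i] by simp
     thus "y : A" using BB by (simp add: A_def)
    qed
    from D2_bound_inside[OF ctx h this]
    show "\<bar>D2 e A i w (axis j 1) k\<bar> <= K2 ?n / h * norm k" by (metis norm_axis_1 mult_1)
   qed
   also have "... <= norm (DT e A z) + real ?n * real ?n * (K2 ?n / h * (real ?n * h))"
    using k2 h norm_le_cube[OF d] by (intro add_left_mono mult_left_mono) auto
   also have "... = norm (DT e A z) + c" using h by (simp add: c_def power3_eq_cube)
   finally show "norm (DT e A x) <= norm (DT e A z) + c" .
  next
   fix x z :: "real^'n" assume d: "!!i. \<bar>x $ i - z $ i\<bar> <= S.hh N"
   have "norm (DT e A x) <= norm (DT e A z) + real ?n * real ?n * (K2 ?n / e * norm (x - z))"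
   proof (rule DT_osc[OF ctx])
    fix w i j k
    from D2_bound[OF ctx, of i w "axis j 1" k]
    show "\<bar>D2 e A i w (axis j 1) k\<bar> <= K2 ?n / e * norm k" by (simp add: norm_axis_1)
   qed
   also have "... <= norm (DT e A z) + real ?n * real ?n * (K2 ?n / e * (real ?n * e))"
    using k2 e norm_le_cube[of x z e] order_trans[OF d hN] by (intro add_left_mono mult_left_mono) auto
   also have "... = norm (DT e A z) + c" using e by (simp add: c_def power3_eq_cube)
   finally show "norm (DT e A x) <= norm (DT e A z) + c" .
  qed (use c in auto)
  also have "(\<integral>\<^sup>+x. ennreal ((norm (DT e A x))^2) \<partial>lborel) <= ennreal ((K1 ?n)^2 * measure lborel A)"
   using field_L2[OF e(1) A R(2,1)] by (simp add: norm_matrix_sq DT_def)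
  also have "ennreal (lam / 2) * ennreal ((K1 ?n)^2 * measure lborel A) + ennreal ((2 ^ ?n + c) * measure eps UNIV)
   = ennreal (lam / 2 * ((K1 ?n)^2 * measure lborel A) + (2 ^ ?n + c) * m)"
   unfolding m_def[symmetric] using lam(1) c m
   by (subst ennreal_mult[symmetric], simp, simp, subst ennreal_plus[symmetric]) (auto intro!: mult_nonneg_nonneg)
  finally have "ennreal (LINT x|eps. norm (DT e A x)) <= ennreal (lam / 2 * ((K1 ?n)^2 * measure lborel A) + (2 ^ ?n + c) * m)"
   by (simp add: add_mono mult_left_mono)
  moreover have "0 <= lam / 2 * ((K1 ?n)^2 * measure lborel A) + (2 ^ ?n + c) * m"
   using lam(1) c m by (intro add_nonneg_nonneg mult_nonneg_nonneg) auto
  ultimately have "(LINT x|eps. norm (DT e A x)) <= lam / 2 * ((K1 ?n)^2 * measure lborel A) + (2 ^ ?n + c) * m"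
   by (simp only: ennreal_le_iff)
  also have "lam / 2 * ((K1 ?n)^2 * measure lborel A) <= lam / 2 * ((K1 ?n)^2 * (cv * m / lam + 1 / lam\<^sup>2))"
   using lam(1) Am by (intro mult_left_mono) auto
  also have "... = (K1 ?n)^2 * (cv * m) / 2 + (K1 ?n)^2 / lam / 2" using lam(1) by (simp add: field_simps power2_eq_square)
  also have "(K1 ?n)^2 / lam / 2 <= eta / 2" using lam by (simp add: divide_le_eq)
  also have "(K1 ?n)^2 * (cv * m) / 2 <= (K1 ?n)\<^sup>2 * (cv * m)" using cv m by simp
  finally show ?thesis by (simp add: algebra_simps)
 qed
 ultimately have "c0 * measure sig K <= ((K1 ?n)^2 * cv + (2 ^ ?n + c)) * m + eta" using main tau(2) by linarith
 thus ?thesis by (simp only: c0_def cv_def c_def m_def)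
qed

text \<open>Letting \<open>eta\<close> tend to zero in \<open>charge_bound\<close> removes
  everything but the mass of \<open>eps\<close>. The threshold \<open>dlt\<close> depends on the
  dimension alone, and \<open>C\<close> is arbitrary: in the application \<open>C\<close> comes
  without any control, whereas \<open>eps\<close> can be made small.\<close>

lemma null_set_not_charged:
 obtains dlt :: real where "0 < dlt"
  "!!(sig :: (real^'n::finite) measure) eps K C. finite_measure sig ==> sets sig = sets borel ==> finite_measure eps ==> sets eps = sets borel ==>
   compact K ==> emeasure lborel K = 0 ==> 0 <= C ==> good_estimate sig eps C ==> measure eps UNIV <= dlt * measure sig K ==> measure sig K = 0"
proof -
 let ?n = "CARD('n)"
 define c0 where "c0 = real ?n * unit_ball_vol (real ?n) / 2 ^ (?n + 2)"
 define c1 where "c1 = (K1 ?n)^2 * real (card (shifts :: (real^'n) set)) + (2 ^ ?n + real ?n ^ 3 * K2 ?n)"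
 have c0: "0 < c0" using card_pos(1)[where 'n='n] by (simp add: c0_def unit_ball_vol_pos)
 have "0 <= K2 ?n" using KT_pos[of ?n] by (simp add: K2_def less_imp_le)
 hence c1: "0 < c1" unfolding c1_def by (intro add_nonneg_pos add_pos_nonneg) auto
 show thesis
 proof (rule that[of "c0 / (2 * c1)"])
  show "0 < c0 / (2 * c1)" using c0 c1 by simp
  fix sig :: "(real^'n::finite) measure" and eps K C
  assume a: "finite_measure sig" "sets sig = sets borel" "finite_measure eps" "sets eps = sets borel"
   "compact K" "emeasure lborel K = 0" "0 <= C" "good_estimate sig eps C" and small: "measure eps UNIV <= c0 / (2 * c1) * measure sig K"
  have "c0 * measure sig K <= c1 * measure eps UNIV + eta" if "0 < eta" for eta
   using charge_bound[OF a that] by (simp only: c0_def c1_def)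
  hence "c0 * measure sig K <= c1 * measure eps UNIV" by (rule field_le_epsilon)
  also have "... <= c1 * (c0 / (2 * c1) * measure sig K)" using c1 small by (intro mult_left_mono) auto
  also have "... = c0 * measure sig K / 2" using c1 by simp
  finally have "c0 * measure sig K <= 0" by simp
  thus "measure sig K = 0" using c0 measure_nonneg[of sig K] by (simp add: mult_le_0_iff)
 qed
qed

section \<open>Square integrable functions\<close>

definition ip :: "'a measure => ('a => real) => ('a => real) => real" where
 "ip N f g = (LINT x|N. f x * g x)"

lemma L2_funI: "f : borel_measurable N ==> integrable N (%x. (f x)^2) ==> f : L2_fun N"
 by (simp add: L2_fun_def)

lemma L2_meas: "f : L2_fun N ==> f : borel_measurable N"
 by (simp add: L2_fun_def)

lemma L2_sq: "f : L2_fun N ==> integrable N (%x. (f x)^2)"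
 by (simp add: L2_fun_def)

lemma L2_mult_integrable:
 assumes "f : L2_fun N" "g : L2_fun N"
 shows "integrable N (%x. f x * g x)"
proof (rule integrable_bound)
 show "integrable N (%x. (f x)^2 + (g x)^2)"
  using assms by (simp add: L2_fun_def)
 show "(%x. f x * g x) : borel_measurable N"
  using assms[THEN L2_meas] by measurable
 have "\<bar>a * b\<bar> <= a\<^sup>2 + b\<^sup>2" for a b :: real
 proof -
  have "0 <= (\<bar>a\<bar> - \<bar>b\<bar>)\<^sup>2" "0 <= \<bar>a\<bar> * \<bar>b\<bar>" by auto
  thus ?thesis unfolding power2_diff abs_mult power2_abs by linarith
 qed
 thus "AE x in N. norm (f x * g x) <= norm ((f x)^2 + (g x)^2)"
  by (auto intro: AE_I2)
qed

lemma L2_zero: "(%x. 0) : L2_fun N"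
 by (simp add: L2_fun_def)

lemma L2_scale: "f : L2_fun N ==> (%x. c * f x) : L2_fun N"
 by (auto simp: L2_fun_def power_mult_distrib)

lemma L2_add:
 assumes "f : L2_fun N" "g : L2_fun N"
 shows "(%x. f x + g x) : L2_fun N"
 using assms L2_mult_integrable[OF assms]
 by (auto simp: L2_fun_def power2_sum mult.assoc)

lemma L2_diff:
 assumes "f : L2_fun N" "g : L2_fun N"
 shows "(%x. f x - g x) : L2_fun N"
 using assms L2_mult_integrable[OF assms]
 by (auto simp: L2_fun_def power2_diff mult.assoc)

lemma L2_sum: "finite I ==> (!!i. i : I ==> f i : L2_fun N) ==> (%x. SUM i:I. f i x) : L2_fun N"
 by (induction I rule: finite_induct) (auto simp: L2_zero L2_add)

lemma L2_bound:
 assumes "f : L2_fun N" "g : borel_measurable N" "!!x. \<bar>g x\<bar> <= c * \<bar>f x\<bar>"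
 shows "g : L2_fun N"
proof (rule L2_funI[OF assms(2)], rule integrable_bound)
 show "integrable N (%x. (c * f x)^2)"
  using L2_scale[OF assms(1)] by (rule L2_sq)
 have "\<bar>g x\<bar> <= \<bar>c * f x\<bar>" for x
 proof -
  have "c * \<bar>f x\<bar> <= \<bar>c\<bar> * \<bar>f x\<bar>" by (simp add: mult_right_mono)
  thus ?thesis using assms(3)[of x] by (simp add: abs_mult)
 qed
 thus "AE x in N. norm ((g x)^2) <= norm ((c * f x)^2)"
  by (simp add: abs_le_square_iff)
qed (use assms(2) in measurable)

lemma L2_mult_bdd:
 assumes "f : L2_fun N" "g : borel_measurable N" "!!x. \<bar>g x\<bar> <= c"
 shows "(%x. g x * f x) : L2_fun N" "(%x. f x * g x) : L2_fun N"
proof -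
 show "(%x. g x * f x) : L2_fun N"
  by (rule L2_bound[OF assms(1), where c=c])
   (use assms L2_meas[OF assms(1)] in "auto simp: abs_mult mult_right_mono")
 thus "(%x. f x * g x) : L2_fun N" by (simp add: mult.commute)
qed

lemma quadratic_nonneg_discriminant:
 fixes a b c :: real
 assumes "!!t. 0 <= a + 2 * t * b + t\<^sup>2 * c"
 shows "b\<^sup>2 <= a * c"
proof (cases "c = 0")
 case True
 have "b = 0"
 proof (rule ccontr)
  assume "b ~= 0"
  thus False using assms[of "- (a + 1) / (2 * b)"] True by (simp add: field_simps)
 qed
 thus ?thesis using True by simp
next
 case False
 have "c > 0"
 proof (rule ccontr)
  assume "\<not> c > 0"
  hence c: "c < 0" using False by simp
  \<comment> \<open>So large that \<open>t * c\<close> outweighs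
    \<open>\<bar>a\<bar> + 2 * \<bar>b\<bar>\<close>, and at least 1 so that the constant term does
    no harm.\<close>
  define t where "t = (\<bar>a\<bar> + 2 * \<bar>b\<bar> + 1) / (-c) + 1"
  have "(\<bar>a\<bar> + 2 * \<bar>b\<bar> + 1) / (-c) \<ge> 0" using c by (intro divide_nonneg_nonneg) auto
  hence t1: "t \<ge> 1" unfolding t_def using c by (simp add: divide_nonneg_neg divide_nonpos_neg)
  have "t * (-c) = \<bar>a\<bar> + 2 * \<bar>b\<bar> + 1 - c" unfolding t_def using c by (simp add: field_simps)
  hence tc: "t * c <= - (\<bar>a\<bar> + 2 * \<bar>b\<bar> + 1)" using c by linarith
  have "a + 2 * t * b + t\<^sup>2 * c <= t * \<bar>a\<bar> + 2 * t * \<bar>b\<bar> + t * (t * c)"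
  proof -
   have "a <= t * \<bar>a\<bar>" using t1 mult_right_mono[of 1 t "\<bar>a\<bar>"] by simp
   moreover have "t * b <= t * \<bar>b\<bar>" using t1 by (simp add: mult_left_mono)
   ultimately show ?thesis by (simp add: power2_eq_square algebra_simps)
  qed
  also have "... <= t * \<bar>a\<bar> + 2 * t * \<bar>b\<bar> + t * (- (\<bar>a\<bar> + 2 * \<bar>b\<bar> + 1))"
   using tc t1 by (simp add: mult_left_mono)
  also have "... < 0" using t1 by (simp add: algebra_simps)
  finally show False using assms[of t] by simp
 qed
 have "0 <= c * (a + 2 * (-b/c) * b + (-b/c)^2 * c)"
  using assms[of "-b/c"] \<open>c > 0\<close> by simp
 also have "... = a * c - b\<^sup>2" using \<open>c > 0\<close> by (simp add: field_simps power2_eq_square)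
 finally show ?thesis by simp
qed

lemma ip_commute: "ip N f g = ip N g f"
 by (simp add: ip_def mult.commute)

lemma ip_nonneg [simp]: "0 <= ip N f f"
 by (simp add: ip_def)

lemma ip_add: "f : L2_fun N ==> g : L2_fun N ==> h : L2_fun N ==>
  ip N (%x. f x + g x) h = ip N f h + ip N g h"
 by (simp add: ip_def distrib_right L2_mult_integrable)

lemma ip_diff: "f : L2_fun N ==> g : L2_fun N ==> h : L2_fun N ==>
  ip N (%x. f x - g x) h = ip N f h - ip N g h"
 by (simp add: ip_def left_diff_distrib L2_mult_integrable)

lemma ip_scale: "ip N (%x. c * f x) h = c * ip N f h"
 by (simp add: ip_def mult.assoc)

lemma ip_add2: "f : L2_fun N ==> g : L2_fun N ==> h : L2_fun N ==>
  ip N h (%x. f x + g x) = ip N h f + ip N h g"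
 using ip_add[of f N g h] by (simp add: ip_commute)

lemma ip_diff2: "f : L2_fun N ==> g : L2_fun N ==> h : L2_fun N ==>
  ip N h (%x. f x - g x) = ip N h f - ip N h g"
 using ip_diff[of f N g h] by (simp add: ip_commute)

lemma ip_scale2: "ip N h (%x. c * f x) = c * ip N h f"
 using ip_scale[of N c f h] by (simp add: ip_commute)

lemma ip_expand:
 assumes "f : L2_fun N" "g : L2_fun N"
 shows "ip N (%x. f x + t * g x) (%x. f x + t * g x) = ip N f f + 2 * t * ip N f g + t\<^sup>2 * ip N g g"
proof -
 have "ip N (%x. f x + t * g x) (%x. f x + t * g x)
   = ip N f f + t * ip N f g + (t * ip N g f + t * (t * ip N g g))"
  using assms by (simp add: ip_add ip_add2 ip_scale ip_scale2 L2_add L2_scale algebra_simps)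
 thus ?thesis by (simp add: ip_commute[of N g f] power2_eq_square)
qed

lemma ip_Cauchy_Schwarz:
 assumes "f : L2_fun N" "g : L2_fun N"
 shows "(ip N f g)^2 <= ip N f f * ip N g g"
 by (rule quadratic_nonneg_discriminant) (simp flip: ip_expand[OF assms])

lemma ip_Cauchy_Schwarz':
 assumes "f : L2_fun N" "g : L2_fun N"
 shows "\<bar>ip N f g\<bar> <= sqrt (ip N f f) * sqrt (ip N g g)"
 using real_sqrt_le_mono[OF ip_Cauchy_Schwarz[OF assms]] by (simp add: real_sqrt_mult)

lemma ip_AE_cong:
 assumes "f : borel_measurable N" "f' : borel_measurable N" "g : borel_measurable N"
  "AE x in N. f x = f' x"
 shows "ip N f g = ip N f' g"
 unfolding ip_def by (rule integral_cong_AE) (use assms in auto)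

lemma ip_zero_AE:
 assumes "f : L2_fun N" "ip N f f <= 0"
 shows "AE x in N. f x = 0"
proof -
 have "integral\<^sup>L N (%x. (f x)^2) = 0"
  using order_antisym[OF assms(2) ip_nonneg] by (simp add: ip_def power2_eq_square)
 hence "AE x in N. (f x)^2 = 0"
  using integral_nonneg_eq_0_iff_AE[OF L2_sq[OF assms(1)]] by simp
 thus ?thesis by simp
qed

lemma LIMSEQ_null_bound:
 fixes f g :: "nat => real"
 assumes "!!n. \<bar>f n\<bar> <= g n" "g ---> 0"
 shows "f ---> 0"
 by (rule Lim_null_comparison[OF _ assms(2)]) (simp add: assms(1))

definition L2_conv :: "'a measure => (nat => 'a => real) => ('a => real) => bool" where
 "L2_conv N u f \<longleftrightarrow> (%n. ip N (%x. u n x - f x) (%x. u n x - f x)) ---> 0"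

lemma L2_conv_ip1:
 assumes u: "!!n. u n : L2_fun N" and f: "f : L2_fun N" and g: "g : L2_fun N" and c: "L2_conv N u f"
 shows "(%n. ip N (u n) g) ---> ip N f g"
proof -
 have lim: "(%n. sqrt (ip N (%x. u n x - f x) (%x. u n x - f x)) * sqrt (ip N g g)) ---> sqrt 0 * sqrt (ip N g g)"
  using c unfolding L2_conv_def by (intro tendsto_intros)
 have "(%n. ip N (u n) g - ip N f g) ---> 0"
  by (rule LIMSEQ_null_bound[OF _ lim[simplified]])
   (use ip_Cauchy_Schwarz'[OF L2_diff[OF u f] g] u f g in "simp add: ip_diff")
 thus ?thesis by (simp add: LIM_zero_iff)
qed

lemma ip_bound_add:
 assumes "f : L2_fun N" "g : L2_fun N"
 shows "ip N (%x. f x + g x) (%x. f x + g x) <= 2 * ip N f f + 2 * ip N g g"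
 using ip_expand[OF assms, of 1] ip_expand[OF assms, of "-1"]
  ip_nonneg[of N "%x. f x + (- 1) * g x"] by simp

lemma L2_conv_ip:
 assumes u: "!!n. u n : L2_fun N" and f: "f : L2_fun N" and v: "!!n. v n : L2_fun N" and g: "g : L2_fun N"
  and c: "L2_conv N u f" and d: "L2_conv N v g"
 shows "(%n. ip N (u n) (v n)) ---> ip N f g"
proof -
 let ?d = "%n x. u n x - f x" and ?e = "%n x. v n x - g x"
 have eq: "ip N (u n) (v n) = ip N (?d n) (?e n) + ip N (u n) g + ip N f (v n) - ip N f g" for n
  using u f v g by (simp add: ip_diff ip_diff2 L2_diff)
 have lim: "(%n. sqrt (ip N (?d n) (?d n)) * sqrt (ip N (?e n) (?e n))) ---> sqrt 0 * sqrt 0"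
  using c d unfolding L2_conv_def by (intro tendsto_intros)
 have "(%n. ip N (?d n) (?e n)) ---> 0"
  by (rule LIMSEQ_null_bound[OF _ lim[simplified]]) (rule ip_Cauchy_Schwarz'[OF L2_diff[OF u f] L2_diff[OF v g]])
 moreover have "(%n. ip N (u n) g) ---> ip N f g" by (rule L2_conv_ip1[OF u f g c])
 moreover have "(%n. ip N f (v n)) ---> ip N f g"
  using L2_conv_ip1[OF v g f d] by (simp add: ip_commute)
 ultimately have "(%n. ip N (?d n) (?e n) + ip N (u n) g + ip N f (v n) - ip N f g) ---> 0 + ip N f g + ip N f g - ip N f g"
  by (intro tendsto_intros)
 thus ?thesis by (simp add: eq)
qed

lemma L2_conv_dominated:
 assumes u: "!!n. u n : borel_measurable N" and f: "f : borel_measurable N" and g: "g : L2_fun N"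
  and bd: "!!n x. \<bar>u n x\<bar> <= \<bar>g x\<bar>" and lim: "!!x. (%n. u n x) ---> f x"
 shows "L2_conv N u f" "f : L2_fun N" "!!n. u n : L2_fun N"
proof -
 have bf: "\<bar>f x\<bar> <= \<bar>g x\<bar>" for x
  by (rule LIMSEQ_le_const2[OF tendsto_rabs[OF lim[of x]]]) (use bd in auto)
 show "f : L2_fun N" by (rule L2_bound[OF g f, where c=1]) (use bf in auto)
 show "u n : L2_fun N" for n by (rule L2_bound[OF g u, where c=1]) (use bd in auto)
 have "(%n. LINT x|N. (u n x - f x)^2) ---> (LINT x|N. 0)"
 proof (rule integral_dominated_convergence[where w="%x. (2 * g x)^2"])
  show "integrable N (%x. (2 * g x)^2)" using L2_sq[OF L2_scale[OF g]] .
  show "AE x in N. (%n. (u n x - f x)^2) ---> 0"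
  proof (rule AE_I2)
   fix x
   have "(%n. (u n x - f x)^2) ---> (f x - f x)\<^sup>2"
    by (intro tendsto_intros lim)
   thus "(%n. (u n x - f x)^2) ---> 0" by simp
  qed
  show "AE x in N. norm ((u n x - f x)^2) <= (2 * g x)\<^sup>2" for n
  proof (rule AE_I2)
   fix x
   have "\<bar>u n x - f x\<bar> <= \<bar>2 * g x\<bar>" using bd[of n x] bf[of x] by linarith
   thus "norm ((u n x - f x)^2) <= (2 * g x)\<^sup>2" by (simp add: abs_le_square_iff)
  qed
 qed (use u f in measurable)
 thus "L2_conv N u f" by (simp add: L2_conv_def ip_def power2_eq_square)
qed

section \<open>The resolvent of a Dirichlet form\<close>

context symmetric_dirichlet_form
begin

lemma F_L2: "f : F ==> f : L2_fun N"
 using dom_L2 by auto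

lemma F_meas: "f : F ==> f : borel_measurable N"
 using F_L2 L2_meas by auto

lemma dom_diff: "f : F ==> g : F ==> (%x. f x - g x) : F"
 using dom_add[of f "%x. (-1) * g x"] dom_scale[of g "-1"] by simp

lemma dom_sum: "finite I ==> (!!i. i : I ==> f i : F) ==> (%x. SUM i:I. f i x) : F"
 by (induction I rule: finite_induct) (auto simp: dom_zero dom_add)

lemma form_add2: "f : F ==> g : F ==> h : F ==> E h (%x. f x + g x) = E h f + E h g"
 using form_add[of f g h] form_sym[of h "%x. f x + g x"] form_sym[of h f] form_sym[of h g] dom_add[of f g] by simp

lemma form_scale2: "f : F ==> g : F ==> E g (%x. c * f x) = c * E g f"
 using form_scale[of f g c] form_sym[of g "%x. c * f x"] form_sym[of g f] dom_scale[of f c] by simp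

lemma form_diff: "f : F ==> g : F ==> h : F ==> E (%x. f x - g x) h = E f h - E g h"
 using form_add[of f "%x. (-1) * g x" h] form_scale[of g h "-1"] dom_scale[of g "-1"] by simp

lemma form_diff2: "f : F ==> g : F ==> h : F ==> E h (%x. f x - g x) = E h f - E h g"
 using form_add2[of f "%x. (-1) * g x" h] form_scale2[of g h "-1"] dom_scale[of g "-1"] by simp

lemma form_zero: "f : F ==> E (%x. 0) f = 0"
 using form_scale[of f f 0] by simp

lemma form_zero2: "f : F ==> E f (%x. 0) = 0"
 using form_scale2[of f f 0] by simp

lemma form_version2: "f : F ==> f' : F ==> g : F ==> AE x in N. f x = f' x ==> E g f = E g f'"
 using form_version[of f f' g] form_sym[of g f] form_sym[of g f'] by simp

lemma form_expand:
 assumes "f : F" "g : F"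
 shows "E (%x. f x + t * g x) (%x. f x + t * g x) = E f f + 2 * t * E f g + t\<^sup>2 * E g g"
proof -
 have "E (%x. f x + t * g x) (%x. f x + t * g x)
   = E f f + t * E f g + (t * E g f + t * (t * E g g))"
  using assms by (simp add: form_add form_add2 form_scale form_scale2 dom_add dom_scale algebra_simps)
 thus ?thesis using assms by (simp add: form_sym[of g f] power2_eq_square)
qed

lemma form_Cauchy_Schwarz:
 assumes "f : F" "g : F"
 shows "(E f g)^2 <= E f f * E g g"
 by (rule quadratic_nonneg_discriminant)
  (use form_nonneg[OF dom_add[OF assms(1) dom_scale[OF assms(2)]]] in "simp add: form_expand[OF assms]")

lemma form_Cauchy_Schwarz':
 assumes "f : F" "g : F"
 shows "\<bar>E f g\<bar> <= sqrt (E f f) * sqrt (E g g)"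
 using real_sqrt_le_mono[OF form_Cauchy_Schwarz[OF assms]] by (simp add: real_sqrt_mult)

lemma form_bound_add:
 assumes "f : F" "g : F"
 shows "E (%x. f x + g x) (%x. f x + g x) <= 2 * E f f + 2 * E g g"
 using form_expand[OF assms, of 1] form_expand[OF assms, of "-1"]
  form_nonneg[OF dom_add[OF assms(1) dom_scale[OF assms(2), of "-1"]]] by simp

lemma E1_form_eq: "E1_form N E f g = E f g + ip N f g"
 by (simp add: E1_form_def ip_def)

text \<open>The solution minimises \<open>J\<close>, whose derivative at \<open>v\<close> in
  direction \<open>w\<close> is \<open>2 * B v w\<close>. Completeness enters through
  \<open>form_closed\<close>: a minimising sequence is Cauchy in the full norm, and its limit
  satisfies the Euler equation \<open>B g w = 0\<close>.\<close>

lemma resolvent_exists: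
 assumes f: "f : L2_fun N" and l: "l > 0"
 shows "\<exists>v\<in>F. \<forall>w\<in>F. E v w = l * ip N (%x. f x - v x) w"
proof -
 define J where "J v = E v v + l * ip N (%x. v x - f x) (%x. v x - f x)" for v
 define Q where "Q w = E w w + l * ip N w w" for w
 define B where "B v w = E v w + l * ip N (%x. v x - f x) w" for v w
 have exp: "J (%x. v x + t * w x) = J v + 2 * t * B v w + t\<^sup>2 * Q w" if "v : F" "w : F" for v w t
 proof -
  have "ip N (%x. v x + t * w x - f x) (%x. v x + t * w x - f x)
    = ip N (%x. (v x - f x) + t * w x) (%x. (v x - f x) + t * w x)"
   by (simp add: algebra_simps)
  also have "... = ip N (%x. v x - f x) (%x. v x - f x) + 2 * t * ip N (%x. v x - f x) w + t\<^sup>2 * ip N w w"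
   by (rule ip_expand) (use that f F_L2 L2_diff in auto)
  finally show ?thesis using form_expand[OF that, of t] by (simp add: J_def B_def Q_def algebra_simps)
 qed
 have J0: "0 <= J v" if "v : F" for v using form_nonneg[OF that] l by (simp add: J_def)
 define m where "m = Inf (J ` F)"
 have m_le: "m <= J v" if "v : F" for v
  unfolding m_def by (rule cInf_lower) (use that J0 in "auto intro!: bdd_belowI[where m=0]")
 have "\<exists>v\<in>F. J v < m + 1 / real (Suc n)" for n
 proof -
  have "Inf (J ` F) < m + 1 / real (Suc n)" by (simp add: m_def)
  thus ?thesis using cInf_lessD[of "J ` F"] dom_zero by blast
 qed
 then obtain v where v: "!!n. v n : F" "!!n. J (v n) < m + 1 / real (Suc n)" by metis
 \<comment> \<open>The parallelogram argument: at the midpoint of \<open>v i\<close> and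
   \<open>v j\<close> the functional is still at least \<open>m\<close>, which bounds their distance
   by the two defects.\<close>
 have Qbd: "Q (%x. v i x - v j x) <= 2 / real (Suc i) + 2 / real (Suc j)" for i j
 proof -
  let ?w = "%x. v i x - v j x"
  have w: "?w : F" using v dom_diff by blast
  have "J (%x. v j x + 1 * ?w x) = J (v j) + 2 * B (v j) ?w + Q ?w"
   using exp[OF v(1)[of j] w, of 1] by simp
  hence "J (v i) = J (v j) + 2 * B (v j) ?w + Q ?w" by simp
  moreover have "m <= J (v j) + B (v j) ?w + Q ?w / 4"
   using exp[OF v(1)[of j] w, of "1/2"] m_le[OF dom_add[OF v(1)[of j] dom_scale[OF w]], of "1/2"]
   by (simp add: power2_eq_square)
  moreover define a b where "a = 1 / real (Suc i)" and "b = 1 / real (Suc j)"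
  moreover have "2 / real (Suc i) + 2 / real (Suc j) = 2 * a + 2 * b" by (simp add: a_def b_def)
  moreover have "J (v i) < m + a" "J (v j) < m + b" using v(2) by (auto simp: a_def b_def)
  ultimately show ?thesis by linarith
 qed
 define c where "c = 1 + 1 / l"
 have c: "c > 0" using l by (simp add: c_def add_pos_pos)
 have E1Q: "E1_form N E w w <= c * Q w" if "w : F" for w
 proof -
  have "E w w / l \<ge> 0" "l * ip N w w \<ge> 0" using form_nonneg[OF that] ip_nonneg l by auto
  thus ?thesis using l unfolding E1_form_eq Q_def c_def by (simp add: field_simps)
 qed
 have "\<exists>g\<in>F. (%n. E1_form N E (%x. v n x - g x) (%x. v n x - g x)) ---> 0"
 proof (rule form_closed[OF v(1)])
  fix e :: real assume e: "0 < e"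
  obtain n0 where n0: "4 * c / e < real n0" using reals_Archimedean2 by blast
  show "EX n0. \<forall>m\<ge>n0. \<forall>n\<ge>n0. E1_form N E (%x. v m x - v n x) (%x. v m x - v n x) < e"
  proof (intro exI allI impI)
   fix i j assume ij: "n0 <= i" "n0 <= j"
   have n0p: "0 < real n0" using n0 e c by (meson divide_pos_pos less_trans mult_pos_pos zero_less_numeral)
   have "2 / real (Suc i) <= 2 / real n0" "2 / real (Suc j) <= 2 / real n0"
    using ij n0p by (auto intro!: divide_left_mono mult_pos_pos)
   hence "Q (%x. v i x - v j x) <= 4 / real n0" using Qbd[of i j] by linarith
   hence "c * Q (%x. v i x - v j x) <= c * (4 / real n0)" using c by (rule mult_left_mono[OF _ less_imp_le])
   also have "... < e" using n0 n0p e by (simp add: field_simps)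
   finally show "E1_form N E (%x. v i x - v j x) (%x. v i x - v j x) < e"
    using E1Q[OF dom_diff[OF v(1)[of i] v(1)[of j]]] by linarith
  qed
 qed
 then obtain g where g: "g : F" and lim: "(%n. E1_form N E (%x. v n x - g x) (%x. v n x - g x)) ---> 0"
  by blast
 have "E g w = l * ip N (%x. f x - g x) w" if w: "w : F" for w
 proof -
  have 1: "(%n. B (v n) w) ---> 0"
  proof (rule Lim_null_comparison)
   have "(%n. sqrt (1 / real (Suc n) * Q w)) ---> sqrt (0 * Q w)"
    by (intro tendsto_real_sqrt tendsto_mult tendsto_const LIMSEQ_Suc[OF lim_1_over_n])
   thus "(%n. sqrt (1 / real (Suc n) * Q w)) ---> 0" by simp
   \<comment> \<open>Along every line through \<open>v n\<close> the functional can fall by at most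
     the defect \<open>1 / real (Suc n)\<close>; the discriminant of that quadratic gives the
     bound.\<close>
   have "(B (v n) w)^2 <= 1 / real (Suc n) * Q w" for n
   proof (rule quadratic_nonneg_discriminant)
    fix t show "0 <= 1 / real (Suc n) + 2 * t * B (v n) w + t\<^sup>2 * Q w"
     using exp[OF v(1)[of n] w, of t] m_le[OF dom_add[OF v(1)[of n] dom_scale[OF w, of t]]] v(2)[of n]
     by simp
   qed
   thus "\<forall>\<^sub>F n in sequentially. norm (B (v n) w) <= sqrt (1 / real (Suc n) * Q w)"
    by (auto simp: real_sqrt_le_iff simp flip: real_sqrt_abs simp del: real_sqrt_abs)
  qed
  let ?d = "%n x. v n x - g x"
  have d: "?d n : F" for n using v g dom_diff by blast
  have "(%n. B (v n) w - B g w) ---> 0"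
  proof (rule Lim_null_comparison)
   let ?s = "%n. sqrt (E1_form N E (?d n) (?d n))"
   have "(%n. ?s n * sqrt (E w w) + l * (?s n * sqrt (ip N w w))) ---> sqrt 0 * sqrt (E w w) + l * (sqrt 0 * sqrt (ip N w w))"
    by (intro tendsto_intros lim)
   thus "(%n. ?s n * sqrt (E w w) + l * (?s n * sqrt (ip N w w))) ---> 0" by simp
   have "\<bar>B (v n) w - B g w\<bar> <= ?s n * sqrt (E w w) + l * (?s n * sqrt (ip N w w))" for n
   proof -
    have "B (v n) w - B g w = E (?d n) w + l * ip N (?d n) w"
     unfolding B_def using v g w f by (simp add: form_diff ip_diff F_L2 L2_diff algebra_simps)
    moreover have "\<bar>E (?d n) w\<bar> <= ?s n * sqrt (E w w)"
     by (rule order_trans[OF form_Cauchy_Schwarz'[OF d w]])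
      (use ip_nonneg form_nonneg[OF w] in "auto intro!: mult_right_mono simp: E1_form_eq")
    moreover have "\<bar>ip N (?d n) w\<bar> <= ?s n * sqrt (ip N w w)"
     by (rule order_trans[OF ip_Cauchy_Schwarz'[OF F_L2[OF d] F_L2[OF w]]])
      (use ip_nonneg form_nonneg[OF d] in "auto intro!: mult_right_mono simp: E1_form_eq")
    hence "\<bar>l * ip N (?d n) w\<bar> <= l * (?s n * sqrt (ip N w w))" using l by (simp add: abs_mult)
    ultimately show ?thesis by linarith
   qed
   thus "\<forall>\<^sub>F n in sequentially. norm (B (v n) w - B g w) <= ?s n * sqrt (E w w) + l * (?s n * sqrt (ip N w w))"
    by simp
  qed
  hence "(%n. B (v n) w) ---> B g w" by (simp add: LIM_zero_iff)
  hence "B g w = 0" using 1 LIMSEQ_unique by blast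
  thus ?thesis unfolding B_def using g w f by (simp add: ip_diff F_L2 algebra_simps)
 qed
 thus ?thesis using g by blast
qed

text \<open>In the usual notation this is \<open>l\<close> times the resolvent operator at
  \<open>l\<close>, a symmetric sub-Markovian contraction. It is determined only almost everywhere,
  so its algebraic rules are stated almost everywhere.\<close>

definition Res :: "real => ('a => real) => 'a => real" where
 "Res l f = (SOME v. v : F & (\<forall>w\<in>F. E v w = l * ip N (%x. f x - v x) w))"

context
 fixes l :: real
 assumes l: "l > 0"
begin

lemma Res_dom_eq:
 assumes "f : L2_fun N"
 shows Res_dom: "Res l f : F"
  and Res_eq: "w : F ==> E (Res l f) w = l * ip N (%x. f x - Res l f x) w"
proof -
 have "Res l f : F & (\<forall>w\<in>F. E (Res l f) w = l * ip N (%x. f x - Res l f x) w)"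
  unfolding Res_def using resolvent_exists[OF assms l] by (intro someI_ex[where P="%v. v : F & (\<forall>w\<in>F. E v w = l * ip N (%x. f x - v x) w)"]) auto
 thus "Res l f : F" "w : F ==> E (Res l f) w = l * ip N (%x. f x - Res l f x) w" by auto
qed

lemma Res_L2: "f : L2_fun N ==> Res l f : L2_fun N"
 using Res_dom F_L2 by blast

lemma Res_eq': "f : L2_fun N ==> w : F ==> E (Res l f) w = l * (ip N f w - ip N (Res l f) w)"
 by (simp add: Res_eq ip_diff Res_L2 F_L2)

lemma Res_unique:
 assumes f: "f : L2_fun N" and v: "v : F" and eq: "!!w. w : F ==> E v w = l * (ip N f w - ip N v w)"
 shows "AE x in N. v x = Res l f x"
proof -
 let ?d = "%x. v x - Res l f x"
 have d: "?d : F" using dom_diff[OF v Res_dom[OF f]] .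
 have "E ?d ?d = - l * ip N ?d ?d"
  unfolding form_diff[OF v Res_dom[OF f] d] eq[OF d] Res_eq'[OF f d] ip_diff[OF F_L2[OF v] Res_L2[OF f] F_L2[OF d]]
  by (simp add: algebra_simps)
 hence "l * ip N ?d ?d <= 0" using form_nonneg[OF d] by simp
 hence "ip N ?d ?d <= 0" using l by (simp add: mult_le_0_iff)
 hence "AE x in N. ?d x = 0" by (rule ip_zero_AE[OF F_L2[OF d]])
 thus ?thesis by simp
qed

lemma Res_sym:
 assumes "f : L2_fun N" "g : L2_fun N"
 shows "ip N (Res l f) g = ip N f (Res l g)"
proof -
 have "l * (ip N f (Res l g) - ip N (Res l f) (Res l g)) = l * (ip N g (Res l f) - ip N (Res l g) (Res l f))"
  using Res_eq'[OF assms(1) Res_dom[OF assms(2)]] Res_eq'[OF assms(2) Res_dom[OF assms(1)]]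
   form_sym[OF Res_dom[OF assms(1)] Res_dom[OF assms(2)]] by (simp only:)
 hence "ip N f (Res l g) - ip N (Res l f) (Res l g) = ip N g (Res l f) - ip N (Res l g) (Res l f)"
  using l by simp
 thus ?thesis by (simp add: ip_commute)
qed

lemma Res_add:
 assumes f: "f : L2_fun N" and g: "g : L2_fun N"
 shows "AE x in N. Res l (%x. f x + g x) x = Res l f x + Res l g x"
proof -
 have "AE x in N. Res l f x + Res l g x = Res l (%x. f x + g x) x"
  by (rule Res_unique) (use f g in "auto simp: L2_add Res_L2 Res_dom dom_add form_add Res_eq' ip_add F_L2 algebra_simps")
 thus ?thesis by (rule AE_mp) auto
qed

lemma Res_scale:
 assumes f: "f : L2_fun N"
 shows "AE x in N. Res l (%x. c * f x) x = c * Res l f x"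
proof -
 have "AE x in N. c * Res l f x = Res l (%x. c * f x) x"
  by (rule Res_unique) (use f in "auto simp: L2_scale Res_L2 Res_dom dom_scale form_scale Res_eq' ip_scale F_L2 algebra_simps")
 thus ?thesis by (rule AE_mp) auto
qed

lemma Res_zero: "AE x in N. Res l (%x. 0) x = 0"
 using Res_scale[OF L2_zero, of 0] by simp

lemma Res_diff:
 assumes f: "f : L2_fun N" and g: "g : L2_fun N"
 shows "AE x in N. Res l (%x. f x - g x) x = Res l f x - Res l g x"
 using Res_add[OF f L2_scale[OF g, of "-1"]] Res_scale[OF g, of "-1"] by (auto elim: AE_mp)

lemma Res_sum:
 assumes "finite I" "!!i. i : I ==> f i : L2_fun N"
 shows "AE x in N. Res l (%x. SUM i:I. f i x) x = (SUM i:I. Res l (f i) x)"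
 using assms
proof (induction I rule: finite_induct)
 case empty
 thus ?case using Res_zero by simp
next
 case (insert i I)
 have "AE x in N. Res l (%x. f i x + (SUM i:I. f i x)) x = Res l (f i) x + Res l (%x. SUM i:I. f i x) x"
  by (rule Res_add) (use insert in "auto intro: L2_sum")
 moreover have "AE x in N. Res l (%x. SUM i:I. f i x) x = (SUM i:I. Res l (f i) x)"
  using insert by auto
 ultimately show ?case using insert(1,2) by (auto elim: AE_mp)
qed

lemma Res_norm:
 assumes f: "f : L2_fun N"
 shows "ip N (Res l f) (Res l f) <= ip N f f"
proof -
 have "0 <= l * (ip N f (Res l f) - ip N (Res l f) (Res l f))"
  using form_nonneg[OF Res_dom[OF f]] Res_eq'[OF f Res_dom[OF f]] by simp
 hence le: "ip N (Res l f) (Res l f) <= ip N f (Res l f)" using l by (simp add: zero_le_mult_iff)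
 have "0 <= ip N (%x. f x - Res l f x) (%x. f x - Res l f x)" by simp
 also have "... = ip N f f - 2 * ip N f (Res l f) + ip N (Res l f) (Res l f)"
  using ip_expand[OF f Res_L2[OF f], of "-1"] by simp
 finally show ?thesis using le by linarith
qed

lemma Res_conv:
 assumes u: "!!n. u n : L2_fun N" and f: "f : L2_fun N" and c: "L2_conv N u f"
 shows "L2_conv N (%n. Res l (u n)) (Res l f)"
 unfolding L2_conv_def
proof (rule LIMSEQ_null_bound)
 show "(%n. ip N (%x. u n x - f x) (%x. u n x - f x)) ---> 0" using c by (simp add: L2_conv_def)
 fix n
 let ?d = "%x. u n x - f x"
 have d: "?d : L2_fun N" using u f L2_diff by blast
 have "ip N (%x. Res l (u n) x - Res l f x) (%x. Res l (u n) x - Res l f x) = ip N (Res l ?d) (Res l ?d)"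
  unfolding ip_def by (rule integral_cong_AE)
   (use Res_diff[OF u[of n] f] Res_L2[OF u[of n], THEN L2_meas] Res_L2[OF f, THEN L2_meas] Res_L2[OF d, THEN L2_meas] in "auto elim: AE_mp")
 thus "\<bar>ip N (%x. Res l (u n) x - Res l f x) (%x. Res l (u n) x - Res l f x)\<bar> <= ip N ?d ?d"
  using Res_norm[OF d] by simp
qed

text \<open>In the expansion around the resolvent the linear terms cancel by its equation, and the
  excess is \<open>E d d + l * ip N d d\<close> for the difference \<open>d\<close>.\<close>

lemma Res_energy_min:
 assumes f: "f : L2_fun N" and u: "u : F"
  and le: "E u u + l * ip N (%x. u x - f x) (%x. u x - f x)
    <= E (Res l f) (Res l f) + l * ip N (%x. Res l f x - f x) (%x. Res l f x - f x)"
 shows "AE x in N. u x = Res l f x"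
proof -
 let ?v = "Res l f" and ?d = "%x. u x - Res l f x"
 have v: "?v : F" using Res_dom[OF f] .
 have d: "?d : F" using dom_diff[OF u v] .
 have e1: "E u u = E ?v ?v + 2 * E ?v ?d + E ?d ?d" using form_expand[OF v d, of 1] by simp
 have "ip N (%x. u x - f x) (%x. u x - f x) = ip N (%x. (?v x - f x) + 1 * ?d x) (%x. (?v x - f x) + 1 * ?d x)"
  by simp
 also have "... = ip N (%x. ?v x - f x) (%x. ?v x - f x) + 2 * 1 * ip N (%x. ?v x - f x) ?d + 1\<^sup>2 * ip N ?d ?d"
  by (rule ip_expand) (use f v d in "auto simp: L2_diff F_L2")
 finally have e2: "ip N (%x. u x - f x) (%x. u x - f x) = ip N (%x. ?v x - f x) (%x. ?v x - f x) + 2 * ip N (%x. ?v x - f x) ?d + ip N ?d ?d"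
  by simp
 have e3: "E ?v ?d = - l * ip N (%x. ?v x - f x) ?d"
  unfolding Res_eq'[OF f d] ip_diff[OF F_L2[OF v] f F_L2[OF d]] by (simp add: algebra_simps)
 have "E ?d ?d + l * ip N ?d ?d <= 0" using le unfolding e1 e2 e3 by (simp add: algebra_simps)
 hence "l * ip N ?d ?d <= 0" using form_nonneg[OF d] by linarith
 hence "ip N ?d ?d <= 0" using l by (simp add: mult_le_0_iff)
 hence "AE x in N. ?d x = 0" by (rule ip_zero_AE[OF F_L2[OF d]])
 thus ?thesis by simp
qed

text \<open>Truncation to the unit interval raises neither the energy nor the distance to
  \<open>f\<close>, whose values lie there. The truncated resolvent is thus again a minimiser and
  agrees with the resolvent.\<close>

lemma Res_markov:
 assumes f: "f : L2_fun N" and b: "!!x. 0 <= f x" "!!x. f x <= 1"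
 shows "AE x in N. 0 <= Res l f x & Res l f x <= 1"
proof -
 let ?v = "Res l f"
 let ?u = "%x. min (max (?v x) 0) 1"
 have v: "?v : F" using Res_dom[OF f] .
 have u: "?u : F" using dom_markov[OF v] .
 have "ip N (%x. ?u x - f x) (%x. ?u x - f x) <= ip N (%x. ?v x - f x) (%x. ?v x - f x)"
  unfolding ip_def
 proof (rule integral_mono)
  show "integrable N (%x. (?u x - f x) * (?u x - f x))"
   using f F_L2[OF u] by (intro L2_mult_integrable L2_diff)
  show "integrable N (%x. (?v x - f x) * (?v x - f x))"
   using f F_L2[OF v] by (intro L2_mult_integrable L2_diff)
  fix x
  have "\<bar>?u x - f x\<bar> <= \<bar>?v x - f x\<bar>" using b[of x] by (auto simp: min_def max_def)
  thus "(?u x - f x) * (?u x - f x) <= (?v x - f x) * (?v x - f x)"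
   by (metis abs_le_square_iff power2_eq_square)
 qed
 hence "AE x in N. ?u x = ?v x"
  using form_markov[OF v] l by (intro Res_energy_min[OF f u] add_mono mult_left_mono) auto
 thus ?thesis by (rule AE_mp) (auto simp: min_def max_def split: if_splits)
qed

lemma Res_nonneg:
 assumes f: "f : L2_fun N" and b: "!!x. 0 <= f x" "!!x. f x <= c"
 shows "AE x in N. 0 <= Res l f x"
proof -
 define d where "d = max c 1"
 have d: "d > 0" by (simp add: d_def)
 have "AE x in N. 0 <= Res l (%x. (1/d) * f x) x & Res l (%x. (1/d) * f x) x <= 1"
 proof (rule Res_markov)
  fix x have "f x <= d" using b(2)[of x] by (simp add: d_def)
  thus "0 <= (1/d) * f x" "(1/d) * f x <= 1" using b(1)[of x] d by (auto simp: field_simps)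
 qed (use L2_scale[OF f] in blast)
 thus ?thesis using Res_scale[OF f, of "1/d"]
  by eventually_elim (use d in "auto simp: zero_le_divide_iff")
qed

lemma Res_bdd:
 assumes f: "f : L2_fun N" and b: "!!x. 0 <= f x" "!!x. f x <= c"
 shows "AE x in N. \<bar>Res l f x\<bar> <= max c 1"
proof -
 define d where "d = max c 1"
 have d: "d > 0" by (simp add: d_def)
 have "AE x in N. 0 <= Res l (%x. (1/d) * f x) x & Res l (%x. (1/d) * f x) x <= 1"
 proof (rule Res_markov)
  fix x have "f x <= d" using b(2)[of x] by (simp add: d_def)
  thus "0 <= (1/d) * f x" "(1/d) * f x <= 1" using b(1)[of x] d by (auto simp: field_simps)
 qed (use L2_scale[OF f] in blast)
 thus ?thesis unfolding d_def[symmetric] using Res_scale[OF f, of "1/d"]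
  by eventually_elim (use d in "auto simp: zero_le_divide_iff pos_divide_le_eq")
qed

end
end

section \<open>Approximating forms of the resolvent and normal contractions\<close>

lemma norm_sq_Basis: "(norm (z :: 'b::euclidean_space))^2 = (SUM i:Basis. (z \<bullet> i)^2)"
 unfolding power2_norm_eq_inner by (subst euclidean_inner) (simp add: power2_eq_square)

lemma L2_norm_Basis:
 fixes z :: "'a => 'b::euclidean_space"
 assumes "!!i. i : Basis ==> (%x. z x \<bullet> i) : L2_fun N"
 shows "z : borel_measurable N" "(%x. norm (z x)) : L2_fun N"
proof -
 show z: "z : borel_measurable N"
  using assms L2_meas by (subst borel_measurable_euclidean_space) auto
 show "(%x. norm (z x)) : L2_fun N"
  by (rule L2_funI) (use z L2_sq[OF assms] in "auto simp: norm_sq_Basis")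
qed

lemma sum_Basis_prod:
 "(SUM i:(Basis :: ('b::euclidean_space \<times> real) set). f i) = (SUM i:Basis. f (i, 0)) + f (0, 1)"
proof -
 have "(SUM i:(Basis :: ('b \<times> real) set). f i) = (SUM i:(%u. (u, 0)) ` Basis. f i) + (SUM i:(%v. (0, v)) ` (Basis :: real set). f i)"
  unfolding Basis_prod_def by (rule sum.union_disjoint) auto
 also have "... = (SUM i:Basis. f (i, 0)) + f (0, 1)"
  by (simp add: sum.reindex inj_on_def)
 finally show ?thesis .
qed

context symmetric_dirichlet_form
begin

text \<open>The approximating form with a weight. For bounded \<open>k\<close> and \<open>u\<close>
  in the domain, \<open>l / 2 * Lam l k u\<close> tends to the energy functional with weight
  \<open>k\<close> (\<open>Eb_lim\<close>), while \<open>l * Den l u\<close> below is the usual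
  approximation of \<open>E u u\<close> from below (\<open>Den_le_form\<close>).\<close>

definition Lam :: "real => ('a => real) => ('a => real) => real" where
 "Lam l k u = ip N (%x. k x * u x) u - 2 * ip N (%x. k x * u x) (Res l u) + (LINT x|N. (u x)^2 * Res l k x)"

definition Den :: "real => ('a => real) => real" where
 "Den l u = ip N u u - ip N (Res l u) u"

context
 fixes l :: real
 assumes l: "l > 0"
begin

lemma Res_lin3:
 assumes "f : L2_fun N" "g : L2_fun N" "h : L2_fun N"
 shows "AE x in N. Res l (%x. a * f x + (b * g x + c * h x)) x = a * Res l f x + (b * Res l g x + c * Res l h x)"
 using Res_add[OF l L2_scale[OF assms(1)] L2_add[OF L2_scale[OF assms(2)] L2_scale[OF assms(3)]], of a b c]
  Res_add[OF l L2_scale[OF assms(2)] L2_scale[OF assms(3)], of b c]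
  Res_scale[OF l assms(1), of a] Res_scale[OF l assms(2), of b] Res_scale[OF l assms(3), of c]
 by eventually_elim simp

text \<open>
 For a kernel \<open>p\<close> representing the resolvent, the expression below is at least
 \<open>\<integral> k(x) (\<Sum>\<^sub>i c\<^sub>i (z\<^sub>i(x) - z\<^sub>i(y))\<^sup>2) p(dx,dy)\<close>. No kernel is available, so the integrand is
 tested against a countable dense set of values of \<open>z\<close> and extended by continuity.
\<close>

lemma Lam_quadratic_nonneg:
 fixes z :: "'a => 'b::euclidean_space" and c :: "'b => real"
 assumes k: "k : L2_fun N" "!!x. 0 <= k x" "!!x. k x <= K"
  and z: "!!i. i : Basis ==> (%x. z x \<bullet> i) : L2_fun N" and Z: "!!x. norm (z x) <= Z"
  and pos: "!!x y. 0 <= (SUM i:Basis. c i * ((z x - z y) \<bullet> i)^2)"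
  and pos0: "!!x. 0 <= (SUM i:Basis. c i * (z x \<bullet> i)^2)"
 shows "0 <= (SUM i:Basis. c i * Lam l k (%x. z x \<bullet> i))"
proof -
 note [measurable] = L2_meas[OF k(1)] L2_norm_Basis(1)[OF z]
 have kabs: "\<bar>k x\<bar> <= K" for x using k(2,3)[of x] by simp
 have Z0: "0 <= Z" using Z order_trans[OF norm_ge_zero] by blast
 have zb: "\<bar>z x \<bullet> i\<bar> <= Z" if "i : Basis" for x i
  using Basis_le_norm[OF that, of "z x"] Z[of x] by linarith
 have kz: "(%x. k x * (z x \<bullet> i)) : L2_fun N" if "i : Basis" for i
  by (rule L2_mult_bdd(1)[OF z[OF that] _ kabs]) measurable
 have kzz: "(%x. k x * (z x \<bullet> i)^2) : L2_fun N" if "i : Basis" for i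
  using L2_mult_bdd(2)[OF kz[OF that] _ zb[OF that]] by (simp add: power2_eq_square mult.assoc)
 define A where "A i = Res l (%x. k x * (z x \<bullet> i)^2)" for i
 define B where "B i = Res l (%x. k x * (z x \<bullet> i))" for i
 define kap where "kap = Res l k"
 have A: "A i : L2_fun N" if "i : Basis" for i unfolding A_def by (rule Res_L2[OF l kzz[OF that]])
 have B: "B i : L2_fun N" if "i : Basis" for i unfolding B_def by (rule Res_L2[OF l kz[OF that]])
 have kap: "kap : L2_fun N" unfolding kap_def by (rule Res_L2[OF l k(1)])
 note [measurable] = L2_meas[OF A] L2_meas[OF B] L2_meas[OF kap]
 have kapb: "AE x in N. \<bar>kap x\<bar> <= max K 1" unfolding kap_def by (rule Res_bdd[OF l k])
 \<comment> \<open>\<open>q p\<close> is a version of the resolvent of \<open>k\<close> times the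
   quadratic form at \<open>z - p\<close>. Expanded by linearity it is defined for all
   \<open>p\<close> at once and is continuous in \<open>p\<close>.\<close>
 define q where "q p x = (SUM i:Basis. c i * A i x + ((- 2 * c i * (p \<bullet> i)) * B i x + (c i * (p \<bullet> i)^2) * kap x))" for p x
 have qpos: "AE x in N. 0 <= q p x" if p: "p : range z" for p
 proof -
  let ?t = "%i x. c i * (k x * (z x \<bullet> i)^2) + ((- 2 * c i * (p \<bullet> i)) * (k x * (z x \<bullet> i)) + (c i * (p \<bullet> i)^2) * k x)"
  have tL: "?t i : L2_fun N" if "i : Basis" for i
   by (intro L2_add L2_scale kzz kz k that)
  have "AE x in N. Res l (%x. SUM i:Basis. ?t i x) x = (SUM i:Basis. Res l (?t i) x)"
   by (rule Res_sum[OF l]) (use tL in auto)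
  moreover have "AE x in N. \<forall>i\<in>Basis. Res l (?t i) x = c i * A i x + ((- 2 * c i * (p \<bullet> i)) * B i x + (c i * (p \<bullet> i)^2) * kap x)"
   unfolding A_def B_def kap_def
   by (rule AE_finite_allI[OF finite_Basis], rule Res_lin3[OF kzz kz k(1)])
  moreover have "AE x in N. 0 <= Res l (%x. SUM i:Basis. ?t i x) x"
  proof -
   have eq: "(SUM i:Basis. ?t i x) = k x * (SUM i:Basis. c i * ((z x - p) \<bullet> i)^2)" for x
    unfolding sum_distrib_left by (rule sum.cong) (auto simp: inner_diff_left power2_eq_square algebra_simps)
   obtain y where y: "p = z y" using p by auto
   show ?thesis
   proof (rule Res_nonneg[OF l])
    show "(%x. SUM i:Basis. ?t i x) : L2_fun N" by (rule L2_sum) (use tL in auto)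
    fix x
    show "0 <= (SUM i:Basis. ?t i x)" unfolding eq unfolding y by (rule mult_nonneg_nonneg[OF k(2) pos])
    have "(SUM i:Basis. c i * ((z x - p) \<bullet> i)^2) <= (SUM i:Basis. \<bar>c i\<bar> * (2 * Z)^2)"
    proof (rule sum_mono)
     fix i :: 'b assume i: "i : Basis"
     have "\<bar>(z x - p) \<bullet> i\<bar> <= \<bar>2 * Z\<bar>" using zb[OF i, of x] zb[OF i, of y] Z0 by (simp add: inner_diff_left y)
     hence "((z x - p) \<bullet> i)^2 <= (2 * Z)\<^sup>2" by (simp add: abs_le_square_iff)
     thus "c i * ((z x - p) \<bullet> i)^2 <= \<bar>c i\<bar> * (2 * Z)^2" by (intro mult_mono) auto
    qed
    thus "(SUM i:Basis. ?t i x) <= K * (SUM i:Basis. \<bar>c i\<bar> * (2 * Z)^2)"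
     unfolding eq using k(2,3)[of x] pos[of x y] by (intro mult_mono) (auto simp: y)
   qed
  qed
  ultimately show ?thesis unfolding q_def by eventually_elim simp
 qed
 obtain D where D: "countable D" "D <= range z" "range z <= closure D"
  using separable[of "range z"] by metis
 have "AE x in N. \<forall>p\<in>D. 0 <= q p x"
  by (subst AE_ball_countable[OF D(1)]) (use D(2) qpos in auto)
 hence qz: "AE x in N. 0 <= q (z x) x"
 proof eventually_elim
  case (elim x)
  have "continuous_on UNIV (%p. q p x)" unfolding q_def by (intro continuous_intros)
  hence "closed {p. 0 <= q p x}" by (intro closed_Collect_le continuous_on_const)
  hence "closure D <= {p. 0 <= q p x}" using elim by (intro closure_minimal) auto
  thus ?case using D(3) by auto
 qed
 define W where "W x = k x * (SUM i:Basis. c i * (z x \<bullet> i)^2)" for x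
 define R where "R x = (SUM i:Basis. c i * (- 2 * (B i x * (z x \<bullet> i)) + (z x \<bullet> i)^2 * kap x))" for x
 have PWR: "AE x in N. 0 <= (SUM i:Basis. c i * A i x) + R x"
 proof -
  have "(SUM i:Basis. c i * A i x) + R x = q (z x) x" for x
   unfolding R_def q_def sum.distrib[symmetric] by (rule sum.cong) (auto simp: algebra_simps)
  thus ?thesis using qz by simp
 qed
 have zk: "integrable N (%x. (z x \<bullet> i)^2 * kap x)" if i: "i : Basis" for i
 proof (rule integrable_bound)
  show "integrable N (%x. max K 1 * (z x \<bullet> i)^2)" using L2_sq[OF z[OF i]] by simp
  show "AE x in N. norm ((z x \<bullet> i)^2 * kap x) <= norm (max K 1 * (z x \<bullet> i)^2)"
   using kapb by eventually_elim (simp add: abs_mult, subst mult.commute, rule mult_right_mono, auto)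
 qed measurable
 have Rint: "integrable N R" unfolding R_def
  by (intro integrable_sum integrable_mult_right integrable_add zk L2_mult_integrable B z)
 have Wint: "integrable N W" unfolding W_def sum_distrib_left
  by (rule integrable_sum) (use L2_mult_integrable[OF kz z] in \<open>simp add: power2_eq_square mult.assoc mult.left_commute[of "k _"]\<close>)
 have sumeq: "(SUM i:Basis. c i * Lam l k (%x. z x \<bullet> i)) = integral\<^sup>L N W + integral\<^sup>L N R"
 proof -
  have "integral\<^sup>L N W = (SUM i:Basis. c i * ip N (%x. k x * (z x \<bullet> i)) (%x. z x \<bullet> i))"
   unfolding W_def sum_distrib_left ip_def
   by (subst integral_sum)
    (use L2_mult_integrable[OF kz z] in \<open>auto simp add: power2_eq_square mult.assoc mult.left_commute[of "k _"]\<close>)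
  moreover have "integral\<^sup>L N R = (SUM i:Basis. c i * (- 2 * ip N (B i) (%x. z x \<bullet> i) + (LINT x|N. (z x \<bullet> i)^2 * kap x)))"
   unfolding R_def ip_def
   by (subst integral_sum) (use zk L2_mult_integrable[OF B z] in auto)
  moreover have "ip N (B i) (%x. z x \<bullet> i) = ip N (%x. k x * (z x \<bullet> i)) (Res l (%x. z x \<bullet> i))" if "i : Basis" for i
   unfolding B_def by (rule Res_sym[OF l kz[OF that] z[OF that]])
  ultimately show ?thesis
   unfolding Lam_def kap_def[symmetric] by (simp add: sum.distrib[symmetric] algebra_simps)
 qed
 \<comment> \<open>The constant 1 need not be square integrable, so the symmetry of the resolvent is
   used with indicators of sets of finite measure that exhaust the set where \<open>z\<close> does
   not vanish; \<open>R\<close> vanishes elsewhere.\<close>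
 define Y where "Y j = {x : space N. 1 / real (Suc j) <= norm (z x)}" for j
 have Ym[measurable]: "Y j : sets N" for j unfolding Y_def by measurable
 have YL: "(indicator (Y j) :: 'a => real) : L2_fun N" for j
 proof (rule L2_bound[OF L2_norm_Basis(2)[OF z], where c="real (Suc j)"])
  fix x
  show "\<bar>indicator (Y j) x\<bar> <= real (Suc j) * \<bar>norm (z x)\<bar>"
   by (auto simp: indicator_def Y_def field_simps)
 qed auto
 have low: "- integral\<^sup>L N W <= (LINT x|N. indicator (Y j) x * R x)" for j
 proof -
  have int1: "integrable N (%x. indicator (Y j) x * (SUM i:Basis. c i * A i x))"
   by (rule L2_mult_integrable[OF YL]) (intro L2_sum L2_scale A finite_Basis)
  have int2: "integrable N (%x. indicator (Y j) x * R x)"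
   using integrable_mult_indicator[OF Ym Rint] by simp
  have "0 <= (LINT x|N. indicator (Y j) x * ((SUM i:Basis. c i * A i x) + R x))"
   by (rule integral_nonneg_AE) (use PWR in "eventually_elim, auto simp: indicator_def")
  also have "... = (LINT x|N. indicator (Y j) x * (SUM i:Basis. c i * A i x)) + (LINT x|N. indicator (Y j) x * R x)"
   using int1 int2 by (simp add: distrib_left)
  also have "(LINT x|N. indicator (Y j) x * (SUM i:Basis. c i * A i x)) = (SUM i:Basis. c i * ip N (indicator (Y j)) (A i))"
   unfolding sum_distrib_left ip_def
   by (subst integral_sum)
    (use L2_mult_integrable[OF YL A] in \<open>auto simp: mult.left_commute[of _ "c _"]\<close>)
  also have "... = (SUM i:Basis. c i * ip N (Res l (indicator (Y j))) (%x. k x * (z x \<bullet> i)^2))"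
   unfolding A_def by (rule sum.cong) (use Res_sym[OF l YL kzz] in auto)
  also have "... = (LINT x|N. Res l (indicator (Y j)) x * W x)"
   unfolding W_def sum_distrib_left ip_def
   by (subst integral_sum)
    (use L2_mult_integrable[OF Res_L2[OF l YL] kzz] in \<open>auto simp: mult.left_commute[of _ "c _"]\<close>)
  \<comment> \<open>The resolvent of an indicator is at most 1, and \<open>W\<close> is nonnegative
    by \<open>pos0\<close>. A possible loss of mass of the resolvent is absorbed here.\<close>
  also have "... <= integral\<^sup>L N W"
  proof (rule integral_mono_AE[OF _ Wint])
   have W0: "0 <= W x" for x unfolding W_def using k(2)[of x] pos0[of x] by simp
   have "AE x in N. 0 <= Res l (indicator (Y j)) x & Res l (indicator (Y j)) x <= 1"
    by (rule Res_markov[OF l YL]) (auto simp: indicator_def)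
   thus "AE x in N. Res l (indicator (Y j)) x * W x <= W x"
    by eventually_elim (use W0 mult_right_mono in fastforce)
   show "integrable N (%x. Res l (indicator (Y j)) x * W x)"
    unfolding W_def by (subst sum_distrib_left, rule L2_mult_integrable[OF Res_L2[OF l YL]])
     (rule L2_sum, use L2_scale[OF kzz] in \<open>auto simp: mult.left_commute[of "k _"]\<close>)
  qed
  finally show ?thesis by simp
 qed
 have "(%j. LINT x|N. indicator (Y j) x * R x) ---> integral\<^sup>L N R"
 proof (rule integral_dominated_convergence[where w="%x. \<bar>R x\<bar>"])
  show "AE x in N. (%j. indicator (Y j) x * R x) ---> R x"
  proof (rule AE_I2)
   fix x assume x: "x : space N"
   show "(%j. indicator (Y j) x * R x) ---> R x"
   proof (cases "z x = 0")
    case True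
    hence "R x = 0" by (simp add: R_def)
    thus ?thesis by simp
   next
    case False
    then obtain j0 where j0: "1 / real (Suc j0) < norm (z x)"
     using reals_Archimedean[of "norm (z x)"] by (auto simp: inverse_eq_divide)
    have "\<forall>\<^sub>F j in sequentially. indicator (Y j) x * R x = R x"
     using eventually_ge_at_top[of j0]
    proof eventually_elim
     case (elim j)
     have "1 / real (Suc j) <= 1 / real (Suc j0)" using elim by (simp add: frac_le)
     thus ?case using j0 x by (simp add: Y_def)
    qed
    thus ?thesis by (rule tendsto_eventually)
   qed
  qed
  show "AE x in N. norm (indicator (Y j) x * R x) <= \<bar>R x\<bar>" for j
   by (auto simp: indicator_def)
 qed (use Rint in auto)
 hence "- integral\<^sup>L N W <= integral\<^sup>L N R"
  by (rule LIMSEQ_le_const) (use low in auto)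
 thus ?thesis unfolding sumeq by simp
qed

text \<open>The quadratic inequality is applied to the pair \<open>(Phi, w)\<close> with
  coefficients \<open>L\<^sup>2\<close> on \<open>Phi\<close> and \<open>-1\<close> on
  \<open>w\<close>: the Lipschitz condition is exactly its nonnegativity on differences, and
  \<open>lip0\<close> its nonnegativity on single values.\<close>

lemma Lam_normal_contraction:
 fixes Phi :: "'a => 'b::euclidean_space"
 assumes k: "k : L2_fun N" "!!x. 0 <= k x" "!!x. k x <= K"
  and Phi: "!!i. i : Basis ==> (%x. Phi x \<bullet> i) : L2_fun N" "!!x. norm (Phi x) <= Z"
  and w: "w : borel_measurable N" and L: "0 <= L"
  and lip: "!!x y. \<bar>w x - w y\<bar> <= L * norm (Phi x - Phi y)" and lip0: "!!x. \<bar>w x\<bar> <= L * norm (Phi x)"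
 shows "Lam l k w <= L\<^sup>2 * (SUM i:Basis. Lam l k (%x. Phi x \<bullet> i))"
proof -
 define c :: "'b \<times> real => real" where "c i = (if snd i = 0 then L\<^sup>2 else -1)" for i
 have c: "(SUM i:Basis. c (i, 0) * g i) + c (0, 1) * h = L\<^sup>2 * (SUM i:Basis. g i) - h" for g h
  by (simp add: c_def sum_distrib_left)
 have sq: "0 <= L\<^sup>2 * (norm v)^2 - r\<^sup>2" if "\<bar>r\<bar> <= L * norm v" for r and v :: 'b
  using that L by (simp flip: power_mult_distrib add: abs_le_square_iff[symmetric])
 have wL: "w : L2_fun N"
  by (rule L2_bound[OF L2_norm_Basis(2)[OF Phi(1)] w, where c=L]) (use lip0 in auto)
 have "0 <= (SUM i:Basis. c i * Lam l k (%x. (Phi x, w x) \<bullet> i))"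
 proof (rule Lam_quadratic_nonneg[OF k])
  fix i :: "'b \<times> real" assume "i : Basis"
  thus "(%x. (Phi x, w x) \<bullet> i) : L2_fun N"
   using Phi(1) wL by (auto simp: Basis_prod_def)
 next
  fix x
  have "norm (Phi x, w x) <= norm (Phi x) + \<bar>w x\<bar>" using norm_Pair_le[of "Phi x" "w x"] by simp
  also have "... <= Z + L * Z"
   by (intro add_mono Phi(2) order_trans[OF lip0] mult_left_mono L)
  finally show "norm (Phi x, w x) <= Z + L * Z" .
  show "0 <= (SUM i:Basis. c i * ((Phi x, w x) \<bullet> i)^2)"
   unfolding sum_Basis_prod using c[of "%i. (Phi x \<bullet> i)^2"] sq[OF lip0] by (simp add: norm_sq_Basis)
  fix y
  show "0 <= (SUM i:Basis. c i * (((Phi x, w x) - (Phi y, w y)) \<bullet> i)^2)"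
   unfolding sum_Basis_prod using c[of "%i. ((Phi x - Phi y) \<bullet> i)^2"] sq[OF lip] by (simp add: norm_sq_Basis)
 qed
 thus ?thesis
  unfolding sum_Basis_prod using c[of "%i. Lam l k (%x. Phi x \<bullet> i)"] by simp
qed

lemma Lam_nonneg:
 assumes k: "k : L2_fun N" "!!x. 0 <= k x" "!!x. k x <= K"
  and u: "u : L2_fun N" "!!x. \<bar>u x\<bar> <= Z"
 shows "0 <= Lam l k u"
 using Lam_quadratic_nonneg[OF k, of u Z "%_. 1"] u by (simp add: sum_nonneg)

text \<open>Formally \<open>2 * Den\<close> is \<open>Lam\<close> with weight 1 plus the mass lost
  by the resolvent. With the weight cut to \<open>Y\<close>, the last bracket collects the part of
  \<open>u\<close> outside \<open>Y\<close>, which disappears as \<open>Y\<close> exhausts the set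
  where \<open>u\<close> lives.\<close>

lemma Den_via_Lam:
 assumes u: "u : L2_fun N" and Y: "Y : sets N" "(indicator Y :: 'a => real) : L2_fun N"
 shows "2 * Den l u = Lam l (indicator Y) u + (LINT x|N. (u x)^2 * (1 - Res l (indicator Y) x))
   + (ip N (%x. indicator (space N - Y) x * u x) u - 2 * ip N (%x. indicator (space N - Y) x * u x) (Res l u))"
  "integrable N (%x. (u x)^2 * Res l (indicator Y) x)"
  "(%x. indicator (space N - Y) x * u x) : L2_fun N"
proof -
 note [measurable] = L2_meas[OF u] Y(1) L2_meas[OF Res_L2[OF l Y(2)]]
 have 1: "(%x. indicator Y x * u x) : L2_fun N"
  by (rule L2_bound[OF u, where c=1]) (auto simp: indicator_def)
 have 2: "(%x. indicator (space N - Y) x * u x) : L2_fun N"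
  by (rule L2_bound[OF u, where c=1]) (auto simp: indicator_def)
 have split: "ip N u h = ip N (%x. indicator Y x * u x) h + ip N (%x. indicator (space N - Y) x * u x) h" if "h : L2_fun N" for h
  unfolding ip_add[OF 1 2 that, symmetric] unfolding ip_def by (rule integral_cong) (auto simp: indicator_def)
 show 3: "integrable N (%x. (u x)^2 * Res l (indicator Y) x)"
 proof (rule integrable_bound[OF L2_sq[OF u]])
  have "AE x in N. 0 <= Res l (indicator Y) x & Res l (indicator Y) x <= 1"
   by (rule Res_markov[OF l Y(2)]) (auto simp: indicator_def)
  thus "AE x in N. norm ((u x)^2 * Res l (indicator Y) x) <= norm ((u x)^2)"
   by eventually_elim (auto simp: abs_mult mult_left_le)
 qed measurable
 show "(%x. indicator (space N - Y) x * u x) : L2_fun N" by fact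
 have "(LINT x|N. (u x)^2 * (1 - Res l (indicator Y) x)) = ip N u u - (LINT x|N. (u x)^2 * Res l (indicator Y) x)"
  using 3 L2_sq[OF u] by (simp add: right_diff_distrib ip_def power2_eq_square)
 thus "2 * Den l u = Lam l (indicator Y) u + (LINT x|N. (u x)^2 * (1 - Res l (indicator Y) x))
   + (ip N (%x. indicator (space N - Y) x * u x) u - 2 * ip N (%x. indicator (space N - Y) x * u x) (Res l u))"
  unfolding Lam_def Den_def using split[OF u] split[OF Res_L2[OF l u]] ip_commute[of N "Res l u" u] by simp
qed

lemma Den_conv:
 assumes u: "!!n. u n : L2_fun N" and f: "f : L2_fun N" and c: "L2_conv N u f"
 shows "(%n. Den l (u n)) ---> Den l f"
 unfolding Den_def
 by (intro tendsto_diff L2_conv_ip u f c Res_L2[OF l] Res_conv[OF l])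

text \<open>Of the three parts of \<open>Den_via_Lam\<close> the first is nonnegative by the
  inequality for \<open>Lam\<close>, the second by \<open>pos0\<close> and the Markov property, and
  the remainder tends to zero in \<open>L2\<close>.\<close>

lemma Den_quadratic_nonneg_bdd:
 fixes z :: "'a => 'b::euclidean_space" and c :: "'b => real"
 assumes z: "!!i. i : Basis ==> (%x. z x \<bullet> i) : L2_fun N" and Z: "!!x. norm (z x) <= Z"
  and pos: "!!x y. 0 <= (SUM i:Basis. c i * ((z x - z y) \<bullet> i)^2)"
  and pos0: "!!x. 0 <= (SUM i:Basis. c i * (z x \<bullet> i)^2)"
 shows "0 <= (SUM i:Basis. c i * Den l (%x. z x \<bullet> i))"
proof -
 note [measurable] = L2_norm_Basis(1)[OF z]
 define Y where "Y j = {x : space N. 1 / real (Suc j) <= norm (z x)}" for j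
 have Ym[measurable]: "Y j : sets N" for j unfolding Y_def by measurable
 have YL: "(indicator (Y j) :: 'a => real) : L2_fun N" for j
 proof (rule L2_bound[OF L2_norm_Basis(2)[OF z], where c="real (Suc j)"])
  fix x
  show "\<bar>indicator (Y j) x\<bar> <= real (Suc j) * \<bar>norm (z x)\<bar>"
   by (auto simp: indicator_def Y_def field_simps)
 qed auto
 define v where "v j i x = indicator (space N - Y j) x * (z x \<bullet> i)" for j i x
 define T where "T j = (SUM i:Basis. c i * (ip N (v j i) (%x. z x \<bullet> i) - 2 * ip N (v j i) (Res l (%x. z x \<bullet> i))))" for j
 have vL: "v j i : L2_fun N" if "i : Basis" for i j
  unfolding v_def by (rule Den_via_Lam(3)[OF z[OF that] Ym YL])
 have "L2_conv N (%j. v j i) (%x. 0)" if i: "i : Basis" for i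
 proof (rule L2_conv_dominated(1)[OF L2_meas[OF vL[OF i]] _ z[OF i]])
  show "\<bar>v j i x\<bar> <= \<bar>z x \<bullet> i\<bar>" for j x by (auto simp: v_def indicator_def)
  fix x
  show "(%j. v j i x) ---> 0"
  proof (cases "z x = 0 \<or> x \<notin> space N")
   case True
   hence "v j i x = 0" for j by (auto simp: v_def)
   thus ?thesis by simp
  next
   case False
   then obtain j0 where j0: "1 / real (Suc j0) < norm (z x)"
    using reals_Archimedean[of "norm (z x)"] by (auto simp: inverse_eq_divide)
   have "\<forall>\<^sub>F j in sequentially. v j i x = 0"
    using eventually_ge_at_top[of j0]
   proof eventually_elim
    case (elim j)
    have "1 / real (Suc j) <= 1 / real (Suc j0)" using elim by (simp add: frac_le)
    thus ?case using j0 False by (simp add: Y_def v_def)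
   qed
   thus ?thesis by (rule tendsto_eventually)
  qed
 qed auto
 hence "T ---> (SUM i:Basis. c i * (ip N (%x. 0) (%x. z x \<bullet> i) - 2 * ip N (%x. 0) (Res l (%x. z x \<bullet> i))))"
  unfolding T_def by (intro tendsto_sum tendsto_mult tendsto_diff tendsto_const L2_conv_ip1 vL z Res_L2[OF l] L2_zero)
 hence T0: "T ---> 0" by (simp add: ip_def)
 have "T j <= 2 * (SUM i:Basis. c i * Den l (%x. z x \<bullet> i))" for j
 proof -
  have "2 * (SUM i:Basis. c i * Den l (%x. z x \<bullet> i)) = (SUM i:Basis. c i * (2 * Den l (%x. z x \<bullet> i)))"
   by (simp add: sum_distrib_left algebra_simps)
  also have "... = (SUM i:Basis. c i * Lam l (indicator (Y j)) (%x. z x \<bullet> i))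
    + (SUM i:Basis. c i * (LINT x|N. (z x \<bullet> i)^2 * (1 - Res l (indicator (Y j)) x))) + T j"
   unfolding T_def v_def sum.distrib[symmetric]
   by (rule sum.cong[OF refl], subst Den_via_Lam(1)[OF z Ym[of j] YL[of j]]) (auto simp: distrib_left)
  finally have eq: "2 * (SUM i:Basis. c i * Den l (%x. z x \<bullet> i)) = ..." .
  have "0 <= (SUM i:Basis. c i * Lam l (indicator (Y j)) (%x. z x \<bullet> i))"
   by (rule Lam_quadratic_nonneg[OF YL _ _ z Z pos pos0]) (auto simp: indicator_def)
  moreover have "0 <= (SUM i:Basis. c i * (LINT x|N. (z x \<bullet> i)^2 * (1 - Res l (indicator (Y j)) x)))"
  proof -
   have i3: "integrable N (%x. (z x \<bullet> i)^2 * (1 - Res l (indicator (Y j)) x))" if "i : Basis" for i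
    using Den_via_Lam(2)[OF z[OF that] Ym YL] L2_sq[OF z[OF that]] by (simp add: right_diff_distrib)
   have "AE x in N. 0 <= Res l (indicator (Y j)) x & Res l (indicator (Y j)) x <= 1"
    by (rule Res_markov[OF l YL]) (auto simp: indicator_def)
   hence "AE x in N. 0 <= (SUM i:Basis. c i * (z x \<bullet> i)^2) * (1 - Res l (indicator (Y j)) x)"
    by eventually_elim (use pos0 in auto)
   hence "0 <= (LINT x|N. (SUM i:Basis. c i * (z x \<bullet> i)^2) * (1 - Res l (indicator (Y j)) x))"
    by (rule integral_nonneg_AE)
   also have "... = (SUM i:Basis. c i * (LINT x|N. (z x \<bullet> i)^2 * (1 - Res l (indicator (Y j)) x)))"
    unfolding sum_distrib_right mult.assoc
    by (subst integral_sum) (use i3 in auto)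
   finally show ?thesis .
  qed
  ultimately show ?thesis using eq by simp
 qed
 hence "0 <= 2 * (SUM i:Basis. c i * Den l (%x. z x \<bullet> i))"
  using LIMSEQ_le_const2[OF T0] by blast
 thus ?thesis by simp
qed

lemma Den_quadratic_nonneg:
 fixes z :: "'a => 'b::euclidean_space" and c :: "'b => real"
 assumes z: "!!i. i : Basis ==> (%x. z x \<bullet> i) : L2_fun N"
  and pos: "!!x y. 0 <= (SUM i:Basis. c i * ((z x - z y) \<bullet> i)^2)"
  and pos0: "!!x. 0 <= (SUM i:Basis. c i * (z x \<bullet> i)^2)"
 shows "0 <= (SUM i:Basis. c i * Den l (%x. z x \<bullet> i))"
proof -
 note [measurable] = L2_norm_Basis(1)[OF z]
 \<comment> \<open>Large values are replaced by zero rather than projected to a ball: every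
   difference is then a difference of values of \<open>z\<close>, or one value up to sign, or zero,
   and \<open>pos\<close> and \<open>pos0\<close> suffice.\<close>
 define y where "y n x = (if norm (z x) <= real n then z x else 0)" for n x
 have ym: "(%x. y n x \<bullet> i) : borel_measurable N" for n i unfolding y_def by measurable
 have bd: "\<bar>y n x \<bullet> i\<bar> <= \<bar>z x \<bullet> i\<bar>" for n x i by (simp add: y_def)
 have lim: "(%n. y n x \<bullet> i) ---> z x \<bullet> i" for x i
 proof (rule tendsto_eventually)
  obtain n0 where "norm (z x) <= real n0" using real_arch_simple by blast
  thus "\<forall>\<^sub>F n in sequentially. y n x \<bullet> i = z x \<bullet> i"
   unfolding eventually_sequentially y_def by (intro exI[of _ n0]) auto
 qed
 note dom = L2_conv_dominated[of "%n x. y n x \<bullet> i" N "%x. z x \<bullet> i" "%x. z x \<bullet> i" for i, OF ym L2_meas[OF z] z bd lim]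
 have nn: "0 <= (SUM i:Basis. c i * Den l (%x. y n x \<bullet> i))" for n
 proof (rule Den_quadratic_nonneg_bdd)
  show "(%x. y n x \<bullet> i) : L2_fun N" if "i : Basis" for i by (rule dom(3)[OF that that])
  show "norm (y n x) <= real n" for x by (simp add: y_def)
  show "0 <= (SUM i:Basis. c i * (y n x \<bullet> i)^2)" for x using pos0 by (simp add: y_def)
  show "0 <= (SUM i:Basis. c i * ((y n x - y n x') \<bullet> i)^2)" for x x'
   using pos[of x x'] pos0[of x] pos0[of x'] by (auto simp: y_def)
 qed
 have "(%n. SUM i:Basis. c i * Den l (%x. y n x \<bullet> i)) ---> (SUM i:Basis. c i * Den l (%x. z x \<bullet> i))"
  by (intro tendsto_sum tendsto_mult tendsto_const Den_conv dom z)
 thus ?thesis by (rule LIMSEQ_le_const) (use nn in auto)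
qed

lemma Den_normal_contraction:
 fixes Phi :: "'a => 'b::euclidean_space"
 assumes Phi: "!!i. i : Basis ==> (%x. Phi x \<bullet> i) : L2_fun N"
  and w: "w : borel_measurable N" and L: "0 <= L"
  and lip: "!!x y. \<bar>w x - w y\<bar> <= L * norm (Phi x - Phi y)" and lip0: "!!x. \<bar>w x\<bar> <= L * norm (Phi x)"
 shows "w : L2_fun N" "Den l w <= L\<^sup>2 * (SUM i:Basis. Den l (%x. Phi x \<bullet> i))"
proof -
 define c :: "'b \<times> real => real" where "c i = (if snd i = 0 then L\<^sup>2 else -1)" for i
 have c: "(SUM i:Basis. c (i, 0) * g i) + c (0, 1) * h = L\<^sup>2 * (SUM i:Basis. g i) - h" for g h
  by (simp add: c_def sum_distrib_left)
 have sq: "0 <= L\<^sup>2 * (norm v)^2 - r\<^sup>2" if "\<bar>r\<bar> <= L * norm v" for r and v :: 'b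
  using that L by (simp flip: power_mult_distrib add: abs_le_square_iff[symmetric])
 show wL: "w : L2_fun N"
  by (rule L2_bound[OF L2_norm_Basis(2)[OF Phi(1)] w, where c=L]) (use lip0 in auto)
 have "0 <= (SUM i:Basis. c i * Den l (%x. (Phi x, w x) \<bullet> i))"
 proof (rule Den_quadratic_nonneg)
  fix i :: "'b \<times> real" assume "i : Basis"
  thus "(%x. (Phi x, w x) \<bullet> i) : L2_fun N"
   using Phi(1) wL by (auto simp: Basis_prod_def)
 next
  fix x
  show "0 <= (SUM i:Basis. c i * ((Phi x, w x) \<bullet> i)^2)"
   unfolding sum_Basis_prod using c[of "%i. (Phi x \<bullet> i)^2"] sq[OF lip0] by (simp add: norm_sq_Basis)
  fix y
  show "0 <= (SUM i:Basis. c i * (((Phi x, w x) - (Phi y, w y)) \<bullet> i)^2)"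
   unfolding sum_Basis_prod using c[of "%i. ((Phi x - Phi y) \<bullet> i)^2"] sq[OF lip] by (simp add: norm_sq_Basis)
 qed
 thus "Den l w <= L\<^sup>2 * (SUM i:Basis. Den l (%x. Phi x \<bullet> i))"
  unfolding sum_Basis_prod using c[of "%i. Den l (%x. Phi x \<bullet> i)"] by simp
qed

end

subsection \<open>Characterisation of the domain\<close>

definition E_conv :: "(nat => 'a => real) => ('a => real) => bool" where
 "E_conv u f \<longleftrightarrow> (%n. E (%x. u n x - f x) (%x. u n x - f x)) ---> 0"

lemma E_conv_form1:
 assumes u: "!!n. u n : F" and f: "f : F" and g: "g : F" and c: "E_conv u f"
 shows "(%n. E (u n) g) ---> E f g"
proof -
 have lim: "(%n. sqrt (E (%x. u n x - f x) (%x. u n x - f x)) * sqrt (E g g)) ---> sqrt 0 * sqrt (E g g)"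
  using c unfolding E_conv_def by (intro tendsto_intros)
 have "(%n. E (u n) g - E f g) ---> 0"
  by (rule LIMSEQ_null_bound[OF _ lim[simplified]])
   (use form_Cauchy_Schwarz'[OF dom_diff[OF u f] g] u f g in "simp add: form_diff")
 thus ?thesis by (simp add: LIM_zero_iff)
qed

lemma E_conv_form:
 assumes u: "!!n. u n : F" and f: "f : F" and v: "!!n. v n : F" and g: "g : F"
  and c: "E_conv u f" and d: "E_conv v g"
 shows "(%n. E (u n) (v n)) ---> E f g"
proof -
 let ?d = "%n x. u n x - f x" and ?e = "%n x. v n x - g x"
 have eq: "E (u n) (v n) = E (?d n) (?e n) + E (u n) g + E f (v n) - E f g" for n
  using u f v g by (simp add: form_diff form_diff2 dom_diff)
 have lim: "(%n. sqrt (E (?d n) (?d n)) * sqrt (E (?e n) (?e n))) ---> sqrt 0 * sqrt 0"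
  using c d unfolding E_conv_def by (intro tendsto_intros)
 have "(%n. E (?d n) (?e n)) ---> 0"
  by (rule LIMSEQ_null_bound[OF _ lim[simplified]]) (rule form_Cauchy_Schwarz'[OF dom_diff[OF u f] dom_diff[OF v g]])
 moreover have "(%n. E (u n) g) ---> E f g" by (rule E_conv_form1[OF u f g c])
 moreover have "(%n. E f (v n)) ---> E f g"
  using E_conv_form1[OF v g f d] form_sym[OF f v] form_sym[OF f g] by simp
 ultimately have "(%n. E (?d n) (?e n) + E (u n) g + E f (v n) - E f g) ---> 0 + E f g + E f g - E f g"
  by (intro tendsto_intros)
 thus ?thesis by (simp add: eq)
qed

text \<open>Stronger than monotonicity of the energies: if these stay bounded, the resolvents are
  Cauchy in energy. The two resolvent equations together show that \<open>E (Res l u) d\<close> is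
  nonnegative for the difference \<open>d\<close>.\<close>

lemma Res_energy_mono:
 assumes l: "0 < l" "l < m" and u: "u : L2_fun N"
 shows "E (%x. Res m u x - Res l u x) (%x. Res m u x - Res l u x) <= E (Res m u) (Res m u) - E (Res l u) (Res l u)"
proof -
 have m: "0 < m" using l by simp
 let ?v = "Res l u" and ?w = "Res m u" and ?d = "%x. Res m u x - Res l u x"
 have v: "?v : F" and w: "?w : F" using Res_dom[OF l(1) u] Res_dom[OF m u] by auto
 have d: "?d : F" using dom_diff[OF w v] .
 have ipd: "ip N ?d ?d = ip N ?w ?d - ip N ?v ?d" by (rule ip_diff[OF F_L2[OF w] F_L2[OF v] F_L2[OF d]])
 have Ed: "E ?d ?d = E ?w ?d - E ?v ?d" by (rule form_diff[OF w v d])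
 have Ev: "E ?v ?d = l * (ip N u ?d - ip N ?v ?d)" by (rule Res_eq'[OF l(1) u d])
 have Ew: "E ?w ?d = m * (ip N u ?d - ip N ?w ?d)" by (rule Res_eq'[OF m u d])
 have "E ?d ?d = (m - l) * (ip N u ?d - ip N ?w ?d) - l * ip N ?d ?d"
  unfolding Ed Ev Ew ipd by (simp add: algebra_simps)
 moreover have "0 <= E ?d ?d" "0 <= l * ip N ?d ?d" using form_nonneg[OF d] l by auto
 ultimately have "0 <= (m - l) * (ip N u ?d - ip N ?w ?d)" by linarith
 hence "0 <= ip N u ?d - ip N ?w ?d" using l by (simp add: zero_le_mult_iff)
 hence "0 <= ip N u ?d - ip N ?v ?d" using ipd ip_nonneg[of N ?d] by linarith
 hence "0 <= E ?v ?d" unfolding Ev using l by simp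
 moreover have "E ?w ?w = E ?v ?v + 2 * E ?v ?d + E ?d ?d" using form_expand[OF v d, of 1] by simp
 ultimately show ?thesis by linarith
qed

lemma Res_energy_split:
 assumes l: "0 < l" and u: "u : L2_fun N"
 shows "l * Den l u = E (Res l u) (Res l u) + l * ip N (%x. Res l u x - u x) (%x. Res l u x - u x)"
proof -
 have eq: "ip N (%x. Res l u x - u x) (%x. Res l u x - u x) = ip N (Res l u) (Res l u) + 2 * (-1) * ip N (Res l u) u + (-1)^2 * ip N u u"
  using ip_expand[OF Res_L2[OF l u] u, of "-1"] by simp
 show ?thesis
  unfolding eq Den_def Res_eq'[OF l u Res_dom[OF l u]] ip_commute[of N u "Res l u"] by (simp add: algebra_simps)
qed

lemma Den_le_form:
 assumes l: "0 < l" and u: "u : F"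
 shows "l * Den l u <= E u u"
proof -
 let ?v = "Res l u"
 have v: "?v : F" by (rule Res_dom[OF l F_L2[OF u]])
 have eq: "E ?v u = l * Den l u" unfolding Den_def by (rule Res_eq'[OF l F_L2[OF u] u])
 have le: "E ?v ?v <= E ?v u" unfolding eq Res_energy_split[OF l F_L2[OF u]] using l by simp
 have "0 <= E (%x. u x + (-1) * ?v x) (%x. u x + (-1) * ?v x)"
  by (rule form_nonneg[OF dom_add[OF u dom_scale[OF v]]])
 also have "... = E u u + 2 * (-1) * E u ?v + (-1)^2 * E ?v ?v" by (rule form_expand[OF u v])
 finally show ?thesis using le form_sym[OF u v] eq by simp
qed

definition Rs :: "nat => ('a => real) => 'a => real" where
 "Rs n = Res (real (Suc n))"

text \<open>Bounded approximating forms characterise the domain. The energies of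
  \<open>Rs n u\<close> increase and are bounded, so the sequence is Cauchy in energy, and by
  \<open>split\<close> it tends to \<open>u\<close> in \<open>L2\<close>. The limit supplied by
  \<open>form_closed\<close> is a version of \<open>u\<close>, which \<open>dom_version\<close>
  admits.\<close>

lemma form_approx:
 assumes u: "u : L2_fun N" and C: "!!n. real (Suc n) * Den (real (Suc n)) u <= C"
 shows "u : F" "E u u <= C" "E_conv (%n. Rs n u) u" "L2_conv N (%n. Rs n u) u"
proof -
 have pos: "0 < real (Suc n)" for n by simp
 define v where "v n = Rs n u" for n
 have v: "v n : F" for n unfolding v_def Rs_def by (rule Res_dom[OF pos u])
 have vL: "v n : L2_fun N" for n using F_L2[OF v] .
 define e where "e n = ip N (%x. v n x - u x) (%x. v n x - u x)" for n
 have split: "E (v n) (v n) + real (Suc n) * e n <= C" for n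
  using C[of n] Res_energy_split[OF pos u, of n] by (simp add: v_def Rs_def e_def)
 have e0: "0 <= e n" for n by (simp add: e_def)
 have Ev: "E (v n) (v n) <= C" for n
  using split[of n] mult_nonneg_nonneg[OF less_imp_le[OF pos[of n]] e0[of n]] by linarith
 have e1: "e n <= C / real (Suc n)" for n
  using split[of n] form_nonneg[OF v[of n]] by (simp add: field_simps)
 have Clim: "(%n. C / real (Suc n)) ---> 0"
  using LIMSEQ_Suc[OF lim_const_over_n[of C]] by simp
 have elim: "e ---> 0"
  by (rule LIMSEQ_null_bound[OF _ Clim]) (use e0 e1 in auto)
 show conv: "L2_conv N (%n. Rs n u) u" using elim unfolding L2_conv_def e_def v_def .
 have mono: "E (%x. v i x - v j x) (%x. v i x - v j x) <= E (v i) (v i) - E (v j) (v j)" if "j <= i" for i j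
 proof (cases "j = i")
  case True
  thus ?thesis using form_zero[OF dom_zero] by simp
 next
  case False
  thus ?thesis unfolding v_def Rs_def using Res_energy_mono[OF pos _ u, of j "real (Suc i)"] that by simp
 qed
 have inc: "incseq (%n. E (v n) (v n))"
 proof (rule incseq_SucI)
  fix n
  show "E (v n) (v n) <= E (v (Suc n)) (v (Suc n))"
   using mono[of n "Suc n"] form_nonneg[OF dom_diff[OF v v], of "Suc n" n] by simp
 qed
 have "convergent (%n. E (v n) (v n))"
  using incseq_convergent[OF inc, of C] Ev by (blast intro: convergentI)
 hence cau: "Cauchy (%n. E (v n) (v n))" by (rule convergent_Cauchy)
 have "\<exists>f\<in>F. (%n. E1_form N E (%x. v n x - f x) (%x. v n x - f x)) ---> 0"
 proof (rule form_closed[OF v])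
  fix d :: real assume d: "0 < d"
  obtain n1 where n1: "!!m n. n1 <= m ==> n1 <= n ==> dist (E (v m) (v m)) (E (v n) (v n)) < d / 2"
   using cau d unfolding Cauchy_def by (meson half_gt_zero)
  obtain n2 where n2: "!!n. n2 <= n ==> e n < d / 8"
   using order_tendstoD(2)[OF elim, of "d / 8"] d unfolding eventually_sequentially by auto
  have le: "E1_form N E (%x. v i x - v j x) (%x. v i x - v j x) < d" if ij: "max n1 n2 <= i" "max n1 n2 <= j" for i j
  proof -
   have E2: "E (%x. v i x - v j x) (%x. v i x - v j x) = E (%x. v j x - v i x) (%x. v j x - v i x)"
    using v form_sym[OF v v, of i j] by (simp add: form_diff form_diff2 dom_diff)
   have "E (%x. v i x - v j x) (%x. v i x - v j x) <= \<bar>E (v i) (v i) - E (v j) (v j)\<bar>"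
    using mono[of i j] mono[of j i] E2 by (cases "j <= i") auto
   hence a: "E (%x. v i x - v j x) (%x. v i x - v j x) < d / 2"
    using n1[of i j] ij by (simp add: dist_real_def)
   have "ip N (%x. v i x - v j x) (%x. v i x - v j x) = ip N (%x. (v i x - u x) + (-1) * (v j x - u x)) (%x. (v i x - u x) + (-1) * (v j x - u x))"
    by simp
   also have "... <= 2 * e i + 2 * ip N (%x. (-1) * (v j x - u x)) (%x. (-1) * (v j x - u x))"
    unfolding e_def by (rule ip_bound_add) (intro L2_diff L2_scale vL u)+
   also have "... = 2 * e i + 2 * e j" unfolding ip_scale ip_scale2 by (simp add: e_def)
   also have "... < d / 2" using n2[of i] n2[of j] ij by auto
   finally show ?thesis using a by (simp add: E1_form_eq)
  qed
  show "EX n0. \<forall>m\<ge>n0. \<forall>n\<ge>n0. E1_form N E (%x. v m x - v n x) (%x. v m x - v n x) < d"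
   by (rule exI[of _ "max n1 n2"]) (use le in blast)
 qed
 then obtain f where f: "f : F" and lim: "(%n. E1_form N E (%x. v n x - f x) (%x. v n x - f x)) ---> 0"
  by blast
 have fL: "f : L2_fun N" by (rule F_L2[OF f])
 have E1a: "\<bar>E (%x. v n x - f x) (%x. v n x - f x)\<bar> <= E1_form N E (%x. v n x - f x) (%x. v n x - f x)" for n
  using form_nonneg[OF dom_diff[OF v f], of n] by (simp add: E1_form_eq)
 have E1b: "\<bar>ip N (%x. v n x - f x) (%x. v n x - f x)\<bar> <= E1_form N E (%x. v n x - f x) (%x. v n x - f x)" for n
  using form_nonneg[OF dom_diff[OF v f], of n] by (simp add: E1_form_eq)
 have Ec: "E_conv v f" unfolding E_conv_def by (rule LIMSEQ_null_bound[OF E1a lim])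
 have Lc: "L2_conv N v f" unfolding L2_conv_def by (rule LIMSEQ_null_bound[OF E1b lim])
 have "v = (%n. Rs n u)" by (simp add: v_def fun_eq_iff)
 note veq = this
 have Lu: "L2_conv N v u" using conv by (simp add: veq)
 have "AE x in N. f x = u x"
 proof -
  let ?d = "%x. f x - u x"
  have d: "?d : L2_fun N" using L2_diff[OF fL u] .
  have "(%n. ip N (v n) ?d) ---> ip N f ?d" "(%n. ip N (v n) ?d) ---> ip N u ?d"
   using L2_conv_ip1[OF vL fL d Lc] L2_conv_ip1[OF vL u d Lu] by auto
  hence "ip N f ?d = ip N u ?d" using LIMSEQ_unique by blast
  hence "ip N ?d ?d <= 0" unfolding ip_diff[OF fL u d] by simp
  from ip_zero_AE[OF d this] show ?thesis by simp
 qed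
 thus uF: "u : F" using dom_version[OF f L2_meas[OF u]] by blast
 have "E (%x. v n x - u x) (%x. v n x - u x) = E (%x. v n x - f x) (%x. v n x - f x)" for n
 proof -
  have ae: "AE x in N. v n x - u x = v n x - f x" using \<open>AE x in N. f x = u x\<close> by eventually_elim simp
  show ?thesis
   using form_version[OF dom_diff[OF v uF] dom_diff[OF v f] dom_diff[OF v uF] ae]
    form_version2[OF dom_diff[OF v uF] dom_diff[OF v f] dom_diff[OF v f] ae] by simp
 qed
 hence Ecu: "E_conv v u" using Ec by (simp add: E_conv_def)
 thus "E_conv (%n. Rs n u) u" unfolding veq .
 have "(%n. E (v n) (v n)) ---> E u u" by (rule E_conv_form[OF v uF v uF Ecu Ecu])
 thus "E u u <= C" by (rule LIMSEQ_le_const2) (use Ev in auto)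
qed

lemma Rs_conv:
 assumes "u : F"
 shows "E_conv (%n. Rs n u) u" "L2_conv N (%n. Rs n u) u" "Rs n u : F"
 using form_approx[OF F_L2[OF assms], of "E u u"] Den_le_form[OF _ assms] Res_dom[OF _ F_L2[OF assms]]
 by (auto simp: Rs_def)

lemma Rs_eq:
 assumes "u : L2_fun N" "v : F"
 shows "E (Rs n u) v = real (Suc n) * (ip N u v - ip N (Rs n u) v)"
 unfolding Rs_def by (rule Res_eq'[OF _ assms]) simp

text \<open>Membership is part of the conclusion. The contraction holds for \<open>Den\<close>,
  which is meaningful on all of \<open>L2\<close>, and \<open>form_approx\<close> carries it to
  \<open>E\<close>.\<close>

lemma normal_contraction:
 fixes Phi :: "'a => 'b::euclidean_space"
 assumes Phi: "!!i. i : Basis ==> (%x. Phi x \<bullet> i) : F"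
  and w: "w : borel_measurable N" and L: "0 <= L"
  and lip: "!!x y. \<bar>w x - w y\<bar> <= L * norm (Phi x - Phi y)" and lip0: "!!x. \<bar>w x\<bar> <= L * norm (Phi x)"
 shows "w : F" "E w w <= L\<^sup>2 * (SUM i:Basis. E (%x. Phi x \<bullet> i) (%x. Phi x \<bullet> i))"
proof -
 have pos: "0 < real (Suc n)" for n by simp
 note D = Den_normal_contraction[where Phi=Phi, OF pos F_L2[OF Phi] w L lip lip0]
 have "real (Suc n) * Den (real (Suc n)) w <= L\<^sup>2 * (SUM i:Basis. E (%x. Phi x \<bullet> i) (%x. Phi x \<bullet> i))" for n
 proof -
  have "real (Suc n) * Den (real (Suc n)) w <= real (Suc n) * (L\<^sup>2 * (SUM i:Basis. Den (real (Suc n)) (%x. Phi x \<bullet> i)))"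
   by (rule mult_left_mono[OF D(2)]) auto
  also have "... = L\<^sup>2 * (SUM i:Basis. real (Suc n) * Den (real (Suc n)) (%x. Phi x \<bullet> i))"
   by (simp add: sum_distrib_left mult.left_commute)
  also have "... <= L\<^sup>2 * (SUM i:Basis. E (%x. Phi x \<bullet> i) (%x. Phi x \<bullet> i))"
   by (intro mult_left_mono sum_mono Den_le_form Phi pos) auto
  finally show ?thesis .
 qed
 from form_approx[OF D(1) this]
 show "w : F" "E w w <= L\<^sup>2 * (SUM i:Basis. E (%x. Phi x \<bullet> i) (%x. Phi x \<bullet> i))" by auto
qed

text \<open>Lower semicontinuity comes from \<open>Den\<close>, which is continuous in
  \<open>L2\<close>. For the pairing, \<open>w\<close> is replaced by \<open>Rs m w\<close>, against
  which the form is a continuous functional on \<open>L2\<close>; the bound \<open>C\<close> makes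
  the replacement uniform in \<open>n\<close>. No subsequence is extracted.\<close>

lemma weak_conv:
 assumes u: "!!n. u n : F" and C: "!!n. E (u n) (u n) <= C" and f: "f : L2_fun N" and c: "L2_conv N u f"
 shows "f : F" "E f f <= C" "w : F ==> (%n. E w (u n)) ---> E w f"
proof -
 have pos: "0 < real (Suc n)" for n by simp
 have "real (Suc m) * Den (real (Suc m)) f <= C" for m
 proof (rule LIMSEQ_le_const2)
  show "(%n. real (Suc m) * Den (real (Suc m)) (u n)) ---> real (Suc m) * Den (real (Suc m)) f"
   by (intro tendsto_mult tendsto_const Den_conv pos F_L2 u f c)
  show "EX N. \<forall>n\<ge>N. real (Suc m) * Den (real (Suc m)) (u n) <= C"
   using Den_le_form[OF pos u] C order_trans by blast
 qed
 note A = form_approx[OF f this]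
 show f': "f : F" and Ef: "E f f <= C" using A by auto
 assume w: "w : F"
 have C0: "0 <= C" using C[of 0] form_nonneg[OF u[of 0]] by linarith
 show "(%n. E w (u n)) ---> E w f"
 proof (rule LIMSEQ_I)
  fix r :: real assume r: "0 < r"
  let ?d = "%m x. Rs m w x - w x"
  have d: "?d m : F" for m using dom_diff[OF Rs_conv(3)[OF w] w] .
  have "(%m. sqrt (E (?d m) (?d m)) * sqrt C) ---> sqrt 0 * sqrt C"
   using Rs_conv(1)[OF w] unfolding E_conv_def by (intro tendsto_intros)
  hence "\<forall>\<^sub>F m in sequentially. sqrt (E (?d m) (?d m)) * sqrt C < r / 3"
   using r by (intro order_tendstoD(2)) auto
  then obtain m where m: "sqrt (E (?d m) (?d m)) * sqrt C < r / 3"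
   using eventually_happens'[OF sequentially_bot] by blast
  have bd: "\<bar>E (?d m) g\<bar> < r / 3" if "g : F" "E g g <= C" for g
  proof -
   have "\<bar>E (?d m) g\<bar> <= sqrt (E (?d m) (?d m)) * sqrt (E g g)" by (rule form_Cauchy_Schwarz'[OF d that(1)])
   also have "... <= sqrt (E (?d m) (?d m)) * sqrt C" using that form_nonneg[OF d] by (intro mult_left_mono) auto
   finally show ?thesis using m by simp
  qed
  have "(%n. E (Rs m w) (u n)) ---> E (Rs m w) f"
  proof -
   have 1: "Rs m w : L2_fun N" by (rule F_L2[OF Rs_conv(3)[OF w]])
   have "(%n. real (Suc m) * (ip N w (u n) - ip N (Rs m w) (u n))) ---> real (Suc m) * (ip N w f - ip N (Rs m w) f)"
    using L2_conv_ip1[OF F_L2[OF u] f F_L2[OF w] c] L2_conv_ip1[OF F_L2[OF u] f 1 c]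
    by (intro tendsto_intros) (simp_all add: ip_commute)
   thus ?thesis using Rs_eq[OF F_L2[OF w]] u f' by simp
  qed
  then obtain n0 where n0: "!!n. n \<ge> n0 ==> \<bar>E (Rs m w) (u n) - E (Rs m w) f\<bar> < r / 3"
   using LIMSEQ_D[of _ _ "r/3"] r by (metis divide_pos_pos real_norm_def zero_less_numeral)
  show "EX no. \<forall>n\<ge>no. norm (E w (u n) - E w f) < r"
  proof (intro exI allI impI)
   fix n assume n: "n0 <= n"
   have "E w (u n) - E w f = E (Rs m w) (u n) - E (Rs m w) f - E (?d m) (u n) + E (?d m) f"
    using form_diff[OF Rs_conv(3)[OF w] w u] form_diff[OF Rs_conv(3)[OF w] w f'] by simp
   thus "norm (E w (u n) - E w f) < r"
    using n0[OF n] bd[OF u C, of n] bd[OF f' Ef] unfolding real_norm_def by linarith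
  qed
 qed
qed

end

section \<open>Energy functionals\<close>

context symmetric_dirichlet_form
begin

lemma lipschitz_real_compose:
 fixes psi :: "real => real"
 assumes f: "f : F" and lip: "!!s t. \<bar>psi s - psi t\<bar> <= L * \<bar>s - t\<bar>" and 0: "psi 0 = 0" and L: "0 <= L"
 shows "(%x. psi (f x)) : F" "E (%x. psi (f x)) (%x. psi (f x)) <= L\<^sup>2 * E f f"
proof -
 have "L-lipschitz_on UNIV psi" using lip L by (intro lipschitz_onI) (auto simp: dist_real_def)
 hence [measurable]: "psi : borel_measurable borel"
  by (intro borel_measurable_continuous_onI lipschitz_on_continuous_on)
 note [measurable] = F_meas[OF f]
 have w: "(%x. psi (f x)) : borel_measurable N" by measurable
 have F: "(%x. f x \<bullet> i) : F" if "i : Basis" for i :: real using that f by simp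
 have l0: "\<bar>psi (f x)\<bar> <= L * norm (f x)" for x using lip[of "f x" 0] 0 by simp
 show "(%x. psi (f x)) : F" "E (%x. psi (f x)) (%x. psi (f x)) <= L\<^sup>2 * E f f"
  using normal_contraction[where Phi=f, OF F w L _ l0] lip by auto
qed

lemma trunc_fun_bound: "\<bar>trunc_fun n f x\<bar> <= real n" "\<bar>trunc_fun n f x\<bar> <= \<bar>f x\<bar>"
 by (auto simp: trunc_fun_def min_def max_def)

lemma trunc_fun_id: "\<bar>f x\<bar> <= real n ==> trunc_fun n f x = f x"
 by (auto simp: trunc_fun_def)

lemma trunc_dom:
 assumes "f : F"
 shows "trunc_fun n f : F" "E (trunc_fun n f) (trunc_fun n f) <= E f f"
proof -
 have "\<bar>max (- real n) (min s (real n)) - max (- real n) (min t (real n))\<bar> <= 1 * \<bar>s - t\<bar>" for s t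
  by (auto simp: min_def max_def)
 from lipschitz_real_compose[OF assms this]
 show "trunc_fun n f : F" "E (trunc_fun n f) (trunc_fun n f) <= E f f"
  by (auto simp: trunc_fun_def[abs_def])
qed

text \<open>Weak convergence without excess of energy is strong: expand the energy of the
  difference.\<close>

lemma E_conv_if_norm:
 assumes u: "!!n. u n : F" and f: "f : F" and w: "(%n. E f (u n)) ---> E f f" and le: "!!n. E (u n) (u n) <= E f f"
 shows "E_conv u f"
 unfolding E_conv_def
proof (rule LIMSEQ_null_bound)
 have "(%n. 2 * (E f f - E f (u n))) ---> 2 * (E f f - E f f)" by (intro tendsto_intros w)
 thus "(%n. 2 * (E f f - E f (u n))) ---> 0" by simp
 fix n
 have "E (%x. u n x - f x) (%x. u n x - f x) = E (u n) (u n) - 2 * E f (u n) + E f f"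
  using u f form_sym[OF u f, of n] by (simp add: form_diff form_diff2 dom_diff)
 thus "\<bar>E (%x. u n x - f x) (%x. u n x - f x)\<bar> <= 2 * (E f f - E f (u n))"
  using le[of n] form_nonneg[OF dom_diff[OF u f], of n] by simp
qed

lemma trunc_conv:
 assumes f: "f : F"
 shows "L2_conv N (%n. trunc_fun n f) f" "E_conv (%n. trunc_fun n f) f"
proof -
 show L: "L2_conv N (%n. trunc_fun n f) f"
 proof (rule L2_conv_dominated(1)[OF F_meas[OF trunc_dom(1)[OF f]] F_meas[OF f] F_L2[OF f]])
  show "\<bar>trunc_fun n f x\<bar> <= \<bar>f x\<bar>" for n x by (rule trunc_fun_bound)
  fix x
  obtain n0 where "\<bar>f x\<bar> <= real n0" using real_arch_simple by blast
  hence "\<forall>\<^sub>F n in sequentially. trunc_fun n f x = f x"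
   unfolding eventually_sequentially by (intro exI[of _ n0] allI impI trunc_fun_id) auto
  thus "(%n. trunc_fun n f x) ---> f x" by (rule tendsto_eventually)
 qed
 show "E_conv (%n. trunc_fun n f) f"
  by (intro E_conv_if_norm trunc_dom f weak_conv(3)[OF trunc_dom(1)[OF f] trunc_dom(2)[OF f] F_L2[OF f] L f])
qed

definition bF :: "('a => real) set" where
 "bF = {f : F. EX c. ALL x. \<bar>f x\<bar> <= c}"

lemma bF_F: "f : bF ==> f : F"
 by (simp add: bF_def)

lemma bF_bound:
 assumes "f : bF" obtains c where "0 <= c" "!!x. \<bar>f x\<bar> <= c"
proof -
 obtain c where "!!x. \<bar>f x\<bar> <= c" using assms unfolding bF_def by blast
 thus ?thesis using that[of "max c 0"] by (meson max.cobounded1 max.cobounded2 order_trans)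
qed

lemma bFI: "f : F ==> (!!x. \<bar>f x\<bar> <= c) ==> f : bF"
 unfolding bF_def by blast

lemma trunc_bF: "f : F ==> trunc_fun n f : bF"
 by (rule bFI[OF trunc_dom(1) trunc_fun_bound(1)])

text \<open>Multiplication is Lipschitz on a bounded square of the plane and vanishes at the origin,
  so the normal contraction applies to the pair \<open>(f, g)\<close>.\<close>

lemma form_mult_bound:
 assumes f: "f : F" and g: "g : F" and M: "0 <= M" "!!x. \<bar>f x\<bar> <= M" "!!x. \<bar>g x\<bar> <= M"
 shows "(%x. f x * g x) : F" "E (%x. f x * g x) (%x. f x * g x) <= (2 * M)\<^sup>2 * (E f f + E g g)"
proof -
 note [measurable] = F_meas[OF f] F_meas[OF g]
 let ?Phi = "%x. (f x, g x)"
 have F: "(%x. ?Phi x \<bullet> i) : F" if "i : Basis" for i :: "real \<times> real"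
  using that f g by (auto simp: Basis_prod_def)
 have lip: "\<bar>f x * g x - f y * g y\<bar> <= 2 * M * norm (?Phi x - ?Phi y)" for x y
 proof -
  have n: "\<bar>f x - f y\<bar> <= norm (?Phi x - ?Phi y)" "\<bar>g x - g y\<bar> <= norm (?Phi x - ?Phi y)"
   using norm_fst_le[of "f x - f y" "g x - g y"] norm_snd_le[of "g x - g y" "f x - f y"] by auto
  have "f x * g x - f y * g y = f x * (g x - g y) + g y * (f x - f y)" by (simp add: algebra_simps)
  hence "\<bar>f x * g x - f y * g y\<bar> <= \<bar>f x\<bar> * \<bar>g x - g y\<bar> + \<bar>g y\<bar> * \<bar>f x - f y\<bar>"
   by (metis abs_mult abs_triangle_ineq)
  also have "... <= M * norm (?Phi x - ?Phi y) + M * norm (?Phi x - ?Phi y)"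
   by (intro add_mono mult_mono M n) auto
  finally show ?thesis by simp
 qed
 have lip0: "\<bar>f x * g x\<bar> <= 2 * M * norm (?Phi x)" for x
 proof -
  have n: "\<bar>g x\<bar> <= norm (?Phi x)" using norm_snd_le[of "g x" "f x"] by auto
  have "\<bar>f x\<bar> * \<bar>g x\<bar> <= M * norm (?Phi x)" by (intro mult_mono M n) auto
  also have "... <= 2 * M * norm (?Phi x)" using M(1) by (simp add: mult_right_mono)
  finally show ?thesis by (simp add: abs_mult)
 qed
 have s: "(SUM i:Basis. E (%x. ?Phi x \<bullet> i) (%x. ?Phi x \<bullet> i)) = E f f + E g g"
  by (subst sum_Basis_prod) simp
 have m: "(%x. f x * g x) : borel_measurable N" by measurable
 show "(%x. f x * g x) : F" "E (%x. f x * g x) (%x. f x * g x) <= (2 * M)\<^sup>2 * (E f f + E g g)"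
  using normal_contraction[where Phi="?Phi", OF F m _ lip lip0] M(1) unfolding s by auto
qed

lemma bF_mult:
 assumes "f : bF" "g : bF" shows "(%x. f x * g x) : bF"
proof -
 obtain a where a: "0 <= a" "!!x. \<bar>f x\<bar> <= a" using bF_bound[OF assms(1)] by blast
 obtain b where b: "0 <= b" "!!x. \<bar>g x\<bar> <= b" using bF_bound[OF assms(2)] by blast
 show ?thesis
 proof (rule bFI)
  show "(%x. f x * g x) : F"
   by (rule form_mult_bound[OF bF_F[OF assms(1)] bF_F[OF assms(2)], where M="max a b"])
    (use a b in "auto intro: order_trans simp: le_max_iff_disj")
  show "\<bar>f x * g x\<bar> <= a * b" for x using a b by (auto simp: abs_mult intro: mult_mono)
 qed
qed

lemma bF_add:
 assumes "f : bF" "g : bF" shows "(%x. f x + g x) : bF"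
proof -
 obtain a where a: "!!x. \<bar>f x\<bar> <= a" using bF_bound[OF assms(1)] by blast
 obtain b where b: "!!x. \<bar>g x\<bar> <= b" using bF_bound[OF assms(2)] by blast
 show ?thesis by (rule bFI[OF dom_add[OF bF_F[OF assms(1)] bF_F[OF assms(2)]], where c="a + b"])
  (use abs_triangle_ineq add_mono[OF a b] order_trans in blast)
qed

lemma bF_scale:
 assumes "f : bF" shows "(%x. c * f x) : bF"
proof -
 obtain a where a: "!!x. \<bar>f x\<bar> <= a" using bF_bound[OF assms(1)] by blast
 show ?thesis by (rule bFI[OF dom_scale[OF bF_F[OF assms(1)]], where c="\<bar>c\<bar> * a"])
  (use a in "auto simp: abs_mult mult_left_mono")
qed

lemma bF_diff: "f : bF ==> g : bF ==> (%x. f x - g x) : bF"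
 using bF_add[of f "%x. (-1) * g x"] bF_scale[of g "-1"] by simp

lemma bF_lipschitz_real:
 fixes psi :: "real => real"
 assumes f: "f : bF" and lip: "!!s t. \<bar>psi s - psi t\<bar> <= L * \<bar>s - t\<bar>" and 0: "psi 0 = 0" and L: "0 <= L"
 shows "(%x. psi (f x)) : bF"
proof -
 obtain a where a: "!!x. \<bar>f x\<bar> <= a" using bF_bound[OF f] by blast
 have "\<bar>psi (f x)\<bar> <= L * a" for x
  using lip[of "f x" 0] 0 mult_left_mono[OF a L, of x] by simp
 thus ?thesis using lipschitz_real_compose(1)[OF bF_F[OF f] lip 0 L] by (rule bFI[rotated])
qed

lemma bF_pos: "f : bF ==> (%x. max (f x) 0) : bF" "f : bF ==> (%x. max (- f x) 0) : bF"
 by (rule bF_lipschitz_real[of f "%s. max s 0" 1]; auto simp: max_def)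
  (rule bF_lipschitz_real[of f "%s. max (- s) 0" 1]; auto simp: max_def)

text \<open>The polarised right-hand side of the identity that defines the energy measure:
  \<open>Eb f g k\<close> is to become the integral of \<open>k\<close> against
  \<Gamma>(f,g).\<close>

definition Eb :: "('a => real) => ('a => real) => ('a => real) => real" where
 "Eb f g k = 1/2 * (E f (%x. g x * k x) + E g (%x. f x * k x) - E (%x. f x * g x) k)"

lemma Eb_self: "Eb f f k = E f (%x. f x * k x) - 1/2 * E (%x. (f x)^2) k"
 by (simp add: Eb_def power2_eq_square)

lemma Eb_sym: "Eb f g k = Eb g f k"
 by (simp add: Eb_def mult.commute)

lemma Eb_add:
 assumes "f : bF" "g : bF" "h : bF" "k : bF"
 shows "Eb (%x. f x + g x) h k = Eb f h k + Eb g h k"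
proof -
 have [simp]: "f : F" "g : F" "h : F" "k : F" "(%x. f x * k x) : F" "(%x. g x * k x) : F" "(%x. h x * k x) : F"
   "(%x. f x * h x) : F" "(%x. g x * h x) : F"
  using assms bF_mult bF_F by auto
 show ?thesis unfolding Eb_def distrib_right by (simp add: form_add form_add2 algebra_simps)
qed

lemma Eb_scale:
 assumes "f : bF" "h : bF" "k : bF"
 shows "Eb (%x. c * f x) h k = c * Eb f h k"
proof -
 have [simp]: "f : F" "h : F" "k : F" "(%x. f x * k x) : F" "(%x. h x * k x) : F"
   "(%x. f x * h x) : F"
  using assms bF_mult bF_F by auto
 show ?thesis unfolding Eb_def mult.assoc by (simp add: form_scale form_scale2 algebra_simps)
qed

lemma Eb_add3:
 assumes "f : bF" "g : bF" "h : bF" "k : bF"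
 shows "Eb f g (%x. h x + k x) = Eb f g h + Eb f g k"
proof -
 have [simp]: "f : F" "g : F" "h : F" "k : F" "(%x. f x * k x) : F" "(%x. g x * k x) : F"
   "(%x. f x * h x) : F" "(%x. g x * h x) : F" "(%x. f x * g x) : F"
  using assms bF_mult bF_F by auto
 show ?thesis unfolding Eb_def distrib_left by (simp add: form_add form_add2 algebra_simps)
qed

lemma Eb_scale3:
 assumes "f : bF" "g : bF" "k : bF"
 shows "Eb f g (%x. c * k x) = c * Eb f g k"
proof -
 have [simp]: "f : F" "g : F" "k : F" "(%x. f x * k x) : F" "(%x. g x * k x) : F" "(%x. f x * g x) : F"
  using assms bF_mult bF_F by auto
 show ?thesis unfolding Eb_def mult.left_commute[of _ c] by (simp add: form_scale form_scale2 algebra_simps)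
qed

lemma Eb_diff:
 assumes "f : bF" "g : bF" "h : bF" "k : bF"
 shows "Eb (%x. f x - g x) h k = Eb f h k - Eb g h k"
 using Eb_add[OF assms(1) bF_scale[OF assms(2), of "-1"] assms(3,4)] Eb_scale[OF assms(2-4), of "-1"] by simp

lemma Eb_diff3:
 assumes "f : bF" "g : bF" "h : bF" "k : bF"
 shows "Eb f g (%x. h x - k x) = Eb f g h - Eb f g k"
 using Eb_add3[OF assms(1-3) bF_scale[OF assms(4), of "-1"]] Eb_scale3[OF assms(1,2,4), of "-1"] by simp

text \<open>With \<open>f\<close> and \<open>k\<close> replaced by their resolvents in the first
  arguments of \<open>Eb_self\<close>, the resolvent equation produces \<open>Lam\<close> exactly.
  Inequalities for \<open>Lam\<close> thereby pass to \<open>Eb\<close>.\<close>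

lemma Eb_lim:
 assumes "f : bF" "k : bF"
 shows "(%n. real (Suc n) / 2 * Lam (real (Suc n)) k f) ---> Eb f f k"
proof -
 have f: "f : F" and k: "k : F" and fk: "(%x. f x * k x) : F" and ff: "(%x. f x * f x) : F"
  using assms bF_mult bF_F by auto
 have "(%n. E (Rs n f) (%x. f x * k x) - 1/2 * E (Rs n k) (%x. f x * f x)) ---> E f (%x. f x * k x) - 1/2 * E k (%x. f x * f x)"
  by (intro tendsto_intros E_conv_form1 Rs_conv f k fk ff)
 moreover have "E (Rs n f) (%x. f x * k x) - 1/2 * E (Rs n k) (%x. f x * f x) = real (Suc n) / 2 * Lam (real (Suc n)) k f" for n
 proof -
  have e: "ip N (%x. k x * f x) f = ip N f (%x. f x * k x)" "ip N k (%x. f x * f x) = ip N f (%x. f x * k x)"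
   "ip N (%x. k x * f x) (Rs n f) = ip N (Rs n f) (%x. f x * k x)"
   "(LINT x|N. (f x)^2 * Rs n k x) = ip N (Rs n k) (%x. f x * f x)"
   by (simp_all add: ip_def power2_eq_square mult_ac)
  show ?thesis
   unfolding Rs_eq[OF F_L2[OF f] fk] Rs_eq[OF F_L2[OF k] ff] Lam_def
   unfolding Rs_def[symmetric] e by (simp add: field_simps)
 qed
 moreover have "E k (%x. f x * f x) = E (%x. (f x)^2) k"
  using form_sym[OF k ff] by (simp add: power2_eq_square)
 ultimately show ?thesis by (simp only: Eb_self)
qed

lemma Eb_nonneg:
 assumes f: "f : bF" and k: "k : bF" "!!x. 0 <= k x"
 shows "0 <= Eb f f k"
proof -
 obtain a where a: "!!x. \<bar>f x\<bar> <= a" using bF_bound[OF f] by blast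
 obtain b where b: "!!x. \<bar>k x\<bar> <= b" using bF_bound[OF k(1)] by blast
 have "0 <= real (Suc n) / 2 * Lam (real (Suc n)) k f" for n
  by (intro mult_nonneg_nonneg Lam_nonneg[OF _ F_L2[OF bF_F[OF k(1)]] k(2) abs_le_D1[OF b] F_L2[OF bF_F[OF f]] a]) auto
 thus ?thesis using LIMSEQ_le_const[OF Eb_lim[OF f k(1)]] by blast
qed

lemma Eb_normal_contraction:
 fixes Phi :: "'a => 'b::euclidean_space"
 assumes k: "k : bF" "!!x. 0 <= k x"
  and Phi: "!!i. i : Basis ==> (%x. Phi x \<bullet> i) : bF"
  and w: "w : bF" and L: "0 <= L"
  and lip: "!!x y. \<bar>w x - w y\<bar> <= L * norm (Phi x - Phi y)" and lip0: "!!x. \<bar>w x\<bar> <= L * norm (Phi x)"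
 shows "Eb w w k <= L\<^sup>2 * (SUM i:Basis. Eb (%x. Phi x \<bullet> i) (%x. Phi x \<bullet> i) k)"
proof (rule LIMSEQ_le[OF Eb_lim[OF w k(1)]])
 obtain b where b: "!!x. \<bar>k x\<bar> <= b" using bF_bound[OF k(1)] by blast
 have "\<forall>i\<in>Basis. EX a. ALL x. \<bar>Phi x \<bullet> i\<bar> <= a" using Phi unfolding bF_def by blast
 then obtain a where a: "!!i x. i : Basis ==> \<bar>Phi x \<bullet> i\<bar> <= a i" by metis
 have Z: "norm (Phi x) <= (SUM i:Basis. a i)" for x
  by (rule order_trans[OF norm_le_l1 sum_mono[OF a]])
 show "(%n. L\<^sup>2 * (SUM i:Basis. real (Suc n) / 2 * Lam (real (Suc n)) k (%x. Phi x \<bullet> i))) ---> L\<^sup>2 * (SUM i:Basis. Eb (%x. Phi x \<bullet> i) (%x. Phi x \<bullet> i) k)"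
  by (intro tendsto_mult tendsto_const tendsto_sum Eb_lim Phi k)
 have "real (Suc n) / 2 * Lam (real (Suc n)) k w <= L\<^sup>2 * (SUM i:Basis. real (Suc n) / 2 * Lam (real (Suc n)) k (%x. Phi x \<bullet> i))" for n
 proof -
  have "Lam (real (Suc n)) k w <= L\<^sup>2 * (SUM i:Basis. Lam (real (Suc n)) k (%x. Phi x \<bullet> i))"
   by (rule Lam_normal_contraction[OF _ F_L2[OF bF_F[OF k(1)]] k(2) abs_le_D1[OF b] F_L2[OF bF_F[OF Phi]] Z F_meas[OF bF_F[OF w]] L lip lip0])
    auto
  hence "real (Suc n) / 2 * Lam (real (Suc n)) k w <= real (Suc n) / 2 * (L\<^sup>2 * (SUM i:Basis. Lam (real (Suc n)) k (%x. Phi x \<bullet> i)))"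
   by (rule mult_left_mono) auto
  thus ?thesis by (simp only: sum_distrib_left mult.left_commute[of "L\<^sup>2"])
 qed
 thus "EX N. \<forall>n\<ge>N. real (Suc n) / 2 * Lam (real (Suc n)) k w <= L\<^sup>2 * (SUM i:Basis. real (Suc n) / 2 * Lam (real (Suc n)) k (%x. Phi x \<bullet> i))"
  by blast
qed

text \<open>Test functions carried by a set of finite measure; the latter keeps indicators in \<open>L\<^sup>2\<close>.\<close>

definition TF :: "('a => real) set" where
 "TF = {k : bF. \<exists>C\<in>sets N. emeasure N C < \<infinity> & (ALL x. x \<notin> C --> k x = 0)}"

lemma TF_bF: "k : TF ==> k : bF" by (simp add: TF_def)

lemma TF_comp:
 assumes "k : TF" "(%x. psi (k x)) : bF" "psi 0 = 0"
 shows "(%x. psi (k x)) : TF"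
proof -
 obtain C where "C : sets N" "emeasure N C < \<infinity>" "!!x. x \<notin> C ==> k x = 0"
  using assms(1) unfolding TF_def by blast
 thus ?thesis unfolding TF_def using assms(2,3) by auto
qed

lemma Lam_add_k:
 assumes l: "0 < l" and h: "h : L2_fun N" and k: "k : L2_fun N" and u: "u : L2_fun N" "!!x. \<bar>u x\<bar> <= c"
 shows "Lam l (%x. h x + k x) u = Lam l h u + Lam l k u"
proof -
 note [measurable] = L2_meas[OF h] L2_meas[OF k] L2_meas[OF u(1)]
 have hu: "(%x. h x * u x) : L2_fun N" and ku: "(%x. k x * u x) : L2_fun N"
  by (rule L2_mult_bdd(2)[OF h _ u(2)], measurable, rule L2_mult_bdd(2)[OF k _ u(2)], measurable)
 have uu: "(%x. (u x)^2) : L2_fun N"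
  using L2_mult_bdd(2)[OF u(1) _ u(2)] by (simp add: power2_eq_square)
 have e: "(LINT x|N. (u x)^2 * Res l k x) = ip N (Res l k) (%x. (u x)^2)" for k
  by (simp add: ip_def mult.commute)
 have "ip N (Res l (%x. h x + k x)) (%x. (u x)^2) = ip N (%x. Res l h x + Res l k x) (%x. (u x)^2)"
  by (rule ip_AE_cong[OF L2_meas[OF Res_L2[OF l L2_add[OF h k]]] L2_meas[OF L2_add[OF Res_L2[OF l h] Res_L2[OF l k]]] L2_meas[OF uu] Res_add[OF l h k]])
 thus ?thesis
  unfolding Lam_def e using ip_add[OF hu ku u(1)] ip_add[OF hu ku Res_L2[OF l u(1)]] ip_add[OF Res_L2[OF l h] Res_L2[OF l k] uu]
  by (simp add: distrib_right)
qed

text \<open>The weight is completed to the indicator of \<open>Y j\<close>, a set of finite measure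
  that contains \<open>C\<close> and the points where \<open>u\<close> is not small. The difference
  of the weights is nonnegative and only adds to \<open>Lam\<close>; \<open>Den_via_Lam\<close>
  bounds the sum in the limit.\<close>

lemma Lam_le_Den:
 assumes l: "0 < l" and u: "u : L2_fun N" "!!x. \<bar>u x\<bar> <= c"
  and k: "k : L2_fun N" "!!x. 0 <= k x" "!!x. k x <= 1"
  and C: "C : sets N" "emeasure N C < \<infinity>" "!!x. x \<notin> C ==> k x = 0"
 shows "Lam l k u <= 2 * Den l u"
proof -
 note [measurable] = L2_meas[OF u(1)] C(1)
 define Y where "Y j = C \<union> {x : space N. 1 / real (Suc j) <= \<bar>u x\<bar>}" for j
 have Ym[measurable]: "Y j : sets N" for j unfolding Y_def by measurable
 have CL: "(indicator C :: 'a => real) : L2_fun N"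
 proof (rule L2_funI)
  have "(%x. (indicator C x :: real)^2) = indicator C" by (auto simp: indicator_def)
  thus "integrable N (%x. (indicator C x :: real)^2)" using integrable_real_indicator[OF C(1,2)] by simp
 qed measurable
 have YL: "(indicator (Y j) :: 'a => real) : L2_fun N" for j
 proof (rule L2_bound[OF L2_add[OF CL L2_scale[of "%x. \<bar>u x\<bar>" N "real (Suc j)"]], where c=1])
  show "(%x. \<bar>u x\<bar>) : L2_fun N" by (rule L2_bound[OF u(1), where c=1]) auto
  fix x
  have "1 <= real (Suc j) * \<bar>u x\<bar>" if "1 / real (Suc j) <= \<bar>u x\<bar>" using that by (simp add: field_simps)
  thus "\<bar>indicator (Y j) x\<bar> <= 1 * \<bar>indicator C x + real (Suc j) * \<bar>u x\<bar>\<bar>"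
   by (auto simp: indicator_def Y_def)
 qed auto
 define v where "v j x = indicator (space N - Y j) x * u x" for j x
 have vL: "v j : L2_fun N" for j
  unfolding v_def by (rule Den_via_Lam(3)[OF l u(1) Ym YL])
 have cv: "L2_conv N v (%x. 0)"
 proof (rule L2_conv_dominated(1)[OF L2_meas[OF vL] _ u(1)])
  show "\<bar>v j x\<bar> <= \<bar>u x\<bar>" for j x by (auto simp: v_def indicator_def)
  fix x
  show "(%j. v j x) ---> 0"
  proof (cases "u x = 0 \<or> x \<notin> space N")
   case True
   hence "v j x = 0" for j by (auto simp: v_def)
   thus ?thesis by simp
  next
   case False
   then obtain j0 where j0: "1 / real (Suc j0) < \<bar>u x\<bar>"
    using reals_Archimedean[of "\<bar>u x\<bar>"] by (auto simp: inverse_eq_divide)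
   have "\<forall>\<^sub>F j in sequentially. v j x = 0"
    using eventually_ge_at_top[of j0]
   proof eventually_elim
    case (elim j)
    have "1 / real (Suc j) <= 1 / real (Suc j0)" using elim by (simp add: frac_le)
    thus ?case using j0 False by (simp add: Y_def v_def)
   qed
   thus ?thesis by (rule tendsto_eventually)
  qed
 qed auto
 have lim: "(%j. ip N (v j) u - 2 * ip N (v j) (Res l u)) ---> ip N (%x. 0) u - 2 * ip N (%x. 0) (Res l u)"
  by (intro tendsto_intros L2_conv_ip1 vL u cv L2_zero Res_L2[OF l])
 have "ip N (v j) u - 2 * ip N (v j) (Res l u) <= 2 * Den l u - Lam l k u" for j
 proof -
  have "0 <= Lam l (%x. indicator (Y j) x - k x) u"
   by (rule Lam_nonneg[OF l L2_diff[OF YL k(1)] _ _ u, where K=1]) (use k C(3) in "auto simp: indicator_def Y_def")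
  moreover have "Lam l (indicator (Y j)) u = Lam l (%x. indicator (Y j) x - k x) u + Lam l k u"
   using Lam_add_k[OF l L2_diff[OF YL k(1)] k(1) u, of j] by simp
  moreover have "0 <= (LINT x|N. (u x)^2 * (1 - Res l (indicator (Y j)) x))"
  proof (rule integral_nonneg_AE)
   have "AE x in N. 0 <= Res l (indicator (Y j)) x & Res l (indicator (Y j)) x <= 1"
    by (rule Res_markov[OF l YL]) (auto simp: indicator_def)
   thus "AE x in N. 0 <= (u x)\<^sup>2 * (1 - Res l (indicator (Y j)) x)" by eventually_elim auto
  qed
  ultimately show ?thesis using Den_via_Lam(1)[OF l u(1) Ym YL, of j] unfolding v_def by linarith
 qed
 hence "ip N (%x. 0) u - 2 * ip N (%x. 0) (Res l u) <= 2 * Den l u - Lam l k u"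
  using LIMSEQ_le_const2[OF lim] by blast
 thus ?thesis by (simp add: ip_def)
qed

lemma Eb_le_form1:
 assumes f: "f : bF" and k: "k : TF" "!!x. 0 <= k x" "!!x. k x <= 1"
 shows "Eb f f k <= E f f"
proof (rule LIMSEQ_le_const2[OF Eb_lim[OF f TF_bF[OF k(1)]]])
 obtain a where a: "!!x. \<bar>f x\<bar> <= a" using bF_bound[OF f] by blast
 obtain C where C: "C : sets N" "emeasure N C < \<infinity>" "!!x. x \<notin> C ==> k x = 0"
  using k(1) unfolding TF_def by blast
 have "real (Suc n) / 2 * Lam (real (Suc n)) k f <= E f f" for n
 proof -
  have "Lam (real (Suc n)) k f <= 2 * Den (real (Suc n)) f"
   by (rule Lam_le_Den[OF _ F_L2[OF bF_F[OF f]] a F_L2[OF bF_F[OF TF_bF[OF k(1)]]] k(2,3) C]) simp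
  hence "real (Suc n) / 2 * Lam (real (Suc n)) k f <= real (Suc n) / 2 * (2 * Den (real (Suc n)) f)"
   by (rule mult_left_mono) simp
  also have "... = real (Suc n) * Den (real (Suc n)) f" by simp
  also have "... <= E f f" by (rule Den_le_form[OF _ bF_F[OF f]]) simp
  finally show ?thesis .
 qed
 thus "EX N. \<forall>n\<ge>N. real (Suc n) / 2 * Lam (real (Suc n)) k f <= E f f" by blast
qed

lemma Eb_le_form:
 assumes f: "f : bF" and k: "k : TF" "!!x. 0 <= k x" "!!x. k x <= c" and c: "0 < c"
 shows "Eb f f k <= c * E f f"
proof -
 have "Eb f f (%x. (1 / c) * k x) <= E f f"
 proof (rule Eb_le_form1[OF f])
  show "(%x. (1 / c) * k x) : TF"
   by (rule TF_comp[OF k(1) bF_scale[OF TF_bF[OF k(1)]]]) simp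
 qed (use k c in auto)
 thus ?thesis using c unfolding Eb_scale3[OF f f TF_bF[OF k(1)]] by (simp add: field_simps)
qed

lemma Eb_Cauchy_Schwarz:
 assumes f: "f : bF" and g: "g : bF" and k: "k : bF" "!!x. 0 <= k x"
 shows "\<bar>Eb f g k\<bar> <= sqrt (Eb f f k) * sqrt (Eb g g k)"
proof -
 have "(Eb f g k)^2 <= Eb f f k * Eb g g k"
 proof (rule quadratic_nonneg_discriminant)
  fix t
  have "0 <= Eb (%x. f x + t * g x) (%x. f x + t * g x) k"
   by (rule Eb_nonneg[OF bF_add[OF f bF_scale[OF g]] k])
  also have "... = Eb f f k + 2 * t * Eb f g k + t\<^sup>2 * Eb g g k"
   using Eb_add[OF f bF_scale[OF g] bF_add[OF f bF_scale[OF g]] k(1), of t t] Eb_scale[OF g bF_add[OF f bF_scale[OF g]] k(1), of t t]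
    Eb_add[OF f bF_scale[OF g] f k(1), of t] Eb_scale[OF g f k(1), of t]
    Eb_add[OF f bF_scale[OF g] g k(1), of t] Eb_scale[OF g g k(1), of t]
    Eb_sym[of "%x. f x + t * g x" f k] Eb_sym[of "%x. f x + t * g x" g k] Eb_sym[of g f k]
   by (simp add: power2_eq_square algebra_simps)
  finally show "0 <= Eb f f k + 2 * t * Eb f g k + t\<^sup>2 * Eb g g k" .
 qed
 from real_sqrt_le_mono[OF this] show ?thesis by (simp add: real_sqrt_mult)
qed

lemma Eb_bound:
 assumes f: "f : bF" and g: "g : bF" and k: "k : TF" "!!x. \<bar>k x\<bar> <= c" and c: "0 < c"
 shows "\<bar>Eb f g k\<bar> <= 2 * c * (sqrt (E f f) * sqrt (E g g))"
proof -
 let ?p = "%x. max (k x) 0" and ?n = "%x. max (- k x) 0"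
 have kb: "k : bF" by (rule TF_bF[OF k(1)])
 have p: "?p : TF" and n: "?n : TF"
  by (rule TF_comp[OF k(1) bF_pos(1)[OF kb]], simp, rule TF_comp[OF k(1) bF_pos(2)[OF kb]], simp)
 have bd: "\<bar>Eb f g h\<bar> <= c * (sqrt (E f f) * sqrt (E g g))" if h: "h : TF" "!!x. 0 <= h x" "!!x. h x <= c" for h
 proof -
  have "\<bar>Eb f g h\<bar> <= sqrt (Eb f f h) * sqrt (Eb g g h)"
   by (rule Eb_Cauchy_Schwarz[OF f g TF_bF[OF h(1)] h(2)])
  also have "... <= sqrt (c * E f f) * sqrt (c * E g g)"
   using Eb_nonneg[OF f TF_bF[OF h(1)] h(2)] Eb_nonneg[OF g TF_bF[OF h(1)] h(2)] form_nonneg[OF bF_F[OF f]] form_nonneg[OF bF_F[OF g]] c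
   by (intro mult_mono real_sqrt_le_mono Eb_le_form f g h c) auto
  also have "... = c * (sqrt (E f f) * sqrt (E g g))" using c by (simp add: real_sqrt_mult)
  finally show ?thesis .
 qed
 have "Eb f g k = Eb f g (%x. ?p x - ?n x)" by (rule arg_cong[where f="Eb f g"]) (auto simp: max_def)
 also have "... = Eb f g ?p - Eb f g ?n" by (rule Eb_diff3[OF f g TF_bF[OF p] TF_bF[OF n]])
 finally have "\<bar>Eb f g k\<bar> <= \<bar>Eb f g ?p\<bar> + \<bar>Eb f g ?n\<bar>" by simp
 also have "... <= c * (sqrt (E f f) * sqrt (E g g)) + c * (sqrt (E f f) * sqrt (E g g))"
  using k(2) c by (intro add_mono bd p n) (auto simp: abs_le_iff)
 finally show ?thesis by simp
qed

text \<open>The extension of \<open>Eb\<close> to unbounded arguments. By \<open>Lb_lim\<close> the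
  limit exists and every bounded approximation in energy gives the same value.\<close>

definition Lb :: "('a => real) => ('a => real) => ('a => real) => real" where
 "Lb f g k = lim (%n. Eb (trunc_fun n f) (trunc_fun n g) k)"

lemma E_conv_diff_bound:
 assumes u: "u : F" and v: "v : F" and f: "f : F"
 shows "E (%x. u x - v x) (%x. u x - v x) <= 2 * E (%x. u x - f x) (%x. u x - f x) + 2 * E (%x. v x - f x) (%x. v x - f x)"
proof -
 have "E (%x. (u x - f x) + (f x - v x)) (%x. (u x - f x) + (f x - v x)) <= 2 * E (%x. u x - f x) (%x. u x - f x) + 2 * E (%x. f x - v x) (%x. f x - v x)"
  by (rule form_bound_add[OF dom_diff[OF u f] dom_diff[OF f v]])
 moreover have "E (%x. f x - v x) (%x. f x - v x) = E (%x. v x - f x) (%x. v x - f x)"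
  using f v form_sym[OF f v] by (simp add: form_diff form_diff2 dom_diff)
 ultimately show ?thesis by simp
qed

text \<open>Two approximations are compared at independent indices: for equal sequences this is the
  Cauchy property, for different ones the independence of the choice.\<close>

lemma Eb_seq_diff:
 assumes u: "!!n. u n : bF" and v: "!!n. v n : bF" and u': "!!n. u' n : bF" and v': "!!n. v' n : bF"
  and f: "f : F" and g: "g : F" and k: "k : TF"
  and c: "E_conv u f" "E_conv u' f" "E_conv v g" "E_conv v' g" and e: "0 < e"
 shows "EX n0. \<forall>i\<ge>n0. \<forall>j\<ge>n0. \<bar>Eb (u i) (v i) k - Eb (u' j) (v' j) k\<bar> < e"
proof -
 obtain b0 where "!!x. \<bar>k x\<bar> <= b0" using bF_bound[OF TF_bF[OF k]] by blast
 hence "0 < max b0 1" "!!x. \<bar>k x\<bar> <= max b0 1" by (auto simp: le_max_iff_disj)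
 then obtain b where b: "0 < b" "!!x. \<bar>k x\<bar> <= b" by blast
 define M where "M = sqrt (E f f) + sqrt (E g g) + 1"
 have M: "0 < M" unfolding M_def using form_nonneg[OF f] form_nonneg[OF g] by (simp add: add_nonneg_pos)
 \<comment> \<open>Two terms of size \<open>2 * b * M * r\<close> amount to
   \<open>e / 2\<close>.\<close>
 define r where "r = e / (8 * b * M)"
 have r: "0 < r" unfolding r_def using e b M by simp
 have ev1: "\<forall>\<^sub>F n in sequentially. E (%x. w n x - h x) (%x. w n x - h x) < r\<^sup>2 / 4" if "E_conv w h" for w h
  using that r unfolding E_conv_def by (intro order_tendstoD(2)) auto
 have ev2: "\<forall>\<^sub>F n in sequentially. sqrt (E (w n) (w n)) <= M" if w: "!!n. w n : bF" and "E_conv w h" "h : F" "sqrt (E h h) + 1 <= M" for w h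
 proof -
  have "(%n. sqrt (E (w n) (w n))) ---> sqrt (E h h)"
   by (intro tendsto_real_sqrt E_conv_form bF_F that)
  hence "\<forall>\<^sub>F n in sequentially. sqrt (E (w n) (w n)) < M" using that by (intro order_tendstoD(2)) auto
  thus ?thesis by eventually_elim simp
 qed
 have Mf: "sqrt (E f f) + 1 <= M" "sqrt (E g g) + 1 <= M"
  unfolding M_def using form_nonneg[OF f] form_nonneg[OF g] by auto
 have "\<forall>\<^sub>F n in sequentially. E (%x. u n x - f x) (%x. u n x - f x) < r\<^sup>2 / 4 & E (%x. u' n x - f x) (%x. u' n x - f x) < r\<^sup>2 / 4
   & E (%x. v n x - g x) (%x. v n x - g x) < r\<^sup>2 / 4 & E (%x. v' n x - g x) (%x. v' n x - g x) < r\<^sup>2 / 4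
   & sqrt (E (v n) (v n)) <= M & sqrt (E (u' n) (u' n)) <= M"
  by (intro eventually_conj ev1 c ev2[OF v c(3) g Mf(2)] ev2[OF u' c(2) f Mf(1)])
 then obtain n0 where n0: "!!n. n0 <= n ==> E (%x. u n x - f x) (%x. u n x - f x) < r\<^sup>2 / 4 & E (%x. u' n x - f x) (%x. u' n x - f x) < r\<^sup>2 / 4
   & E (%x. v n x - g x) (%x. v n x - g x) < r\<^sup>2 / 4 & E (%x. v' n x - g x) (%x. v' n x - g x) < r\<^sup>2 / 4
   & sqrt (E (v n) (v n)) <= M & sqrt (E (u' n) (u' n)) <= M"
  unfolding eventually_sequentially by blast
 have "\<bar>Eb (u i) (v i) k - Eb (u' j) (v' j) k\<bar> < e" if ij: "n0 <= i" "n0 <= j" for i j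
 proof -
  let ?d = "%x. u i x - u' j x" and ?e = "%x. v i x - v' j x"
  have kb: "k : bF" by (rule TF_bF[OF k])
  have d: "?d : bF" and e': "?e : bF" using u u' v v' bF_diff by auto
  have "E ?d ?d < r\<^sup>2" using E_conv_diff_bound[OF bF_F[OF u] bF_F[OF u'] f, of i j] n0[OF ij(1)] n0[OF ij(2)] by linarith
  hence "sqrt (E ?d ?d) < sqrt (r\<^sup>2)" by (rule real_sqrt_less_mono)
  hence d2: "sqrt (E ?d ?d) < r" using r by simp
  have "E ?e ?e < r\<^sup>2" using E_conv_diff_bound[OF bF_F[OF v] bF_F[OF v'] g, of i j] n0[OF ij(1)] n0[OF ij(2)] by linarith
  hence "sqrt (E ?e ?e) < sqrt (r\<^sup>2)" by (rule real_sqrt_less_mono)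
  hence e2: "sqrt (E ?e ?e) < r" using r by simp
  have eq: "Eb (u i) (v i) k - Eb (u' j) (v' j) k = Eb ?d (v i) k + Eb (u' j) ?e k"
   using Eb_diff[OF u u' v kb, of i j i] Eb_diff[OF v v' u' kb, of i j j] by (simp add: Eb_sym[of "u' j"])
  have "\<bar>Eb (u i) (v i) k - Eb (u' j) (v' j) k\<bar> <= 2 * b * (sqrt (E ?d ?d) * sqrt (E (v i) (v i))) + 2 * b * (sqrt (E (u' j) (u' j)) * sqrt (E ?e ?e))"
   unfolding eq using abs_triangle_ineq[of "Eb ?d (v i) k" "Eb (u' j) ?e k"] Eb_bound[OF d v k b(2,1), of i] Eb_bound[OF u' e' k b(2,1), of j] by linarith
  also have "... <= 2 * b * (r * M) + 2 * b * (M * r)"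
  proof -
   have "sqrt (E ?d ?d) * sqrt (E (v i) (v i)) <= r * M"
    by (rule mult_mono) (use d2 n0[OF ij(1)] r form_nonneg[OF bF_F[OF v]] in auto)
   moreover have "sqrt (E (u' j) (u' j)) * sqrt (E ?e ?e) <= M * r"
    by (rule mult_mono) (use e2 n0[OF ij(2)] M form_nonneg[OF bF_F[OF e']] in auto)
   ultimately show ?thesis using b by (intro add_mono mult_left_mono) auto
  qed
  also have "... = e / 2" unfolding r_def using b M by (simp add: field_simps)
  finally show ?thesis using e by simp
 qed
 thus ?thesis by blast
qed

lemma Lb_lim:
 assumes u: "!!n. u n : bF" and v: "!!n. v n : bF"
  and f: "f : F" and g: "g : F" and k: "k : TF"
  and c: "E_conv u f" "E_conv v g"
 shows "(%n. Eb (u n) (v n) k) ---> Lb f g k"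
proof -
 let ?t = "%n. Eb (trunc_fun n f) (trunc_fun n g) k"
 note T = trunc_bF[OF f] trunc_bF[OF g]
 note Tc = trunc_conv(2)[OF f] trunc_conv(2)[OF g]
 have "Cauchy ?t"
  unfolding Cauchy_def dist_real_def
  using Eb_seq_diff[OF T(1) T(2) T(1) T(2) f g k Tc(1) Tc(1) Tc(2) Tc(2)] by blast
 hence "convergent ?t" by (simp add: Cauchy_convergent)
 hence t: "?t ---> Lb f g k" unfolding Lb_def by (rule convergent_LIMSEQ_iff[THEN iffD1])
 have "(%n. Eb (u n) (v n) k - ?t n) ---> 0"
 proof (rule LIMSEQ_I)
  fix r :: real assume "0 < r"
  from Eb_seq_diff[OF u v T(1) T(2) f g k c(1) Tc(1) c(2) Tc(2) this]
  show "EX no. \<forall>n\<ge>no. norm (Eb (u n) (v n) k - ?t n - 0) < r" by auto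
 qed
 from tendsto_add[OF this t] show ?thesis by simp
qed

lemma E_conv_const: "f : F ==> E_conv (%n. f) f"
 by (simp add: E_conv_def form_zero[OF dom_zero])

lemma E_conv_add:
 assumes "!!n. u n : F" "!!n. v n : F" "f : F" "g : F" "E_conv u f" "E_conv v g"
 shows "E_conv (%n x. u n x + v n x) (%x. f x + g x)"
 unfolding E_conv_def
proof (rule LIMSEQ_null_bound)
 have "(%n. 2 * E (%x. u n x - f x) (%x. u n x - f x) + 2 * E (%x. v n x - g x) (%x. v n x - g x)) ---> 2 * 0 + 2 * 0"
  using assms(5,6) unfolding E_conv_def by (intro tendsto_intros)
 thus "(%n. 2 * E (%x. u n x - f x) (%x. u n x - f x) + 2 * E (%x. v n x - g x) (%x. v n x - g x)) ---> 0" by simp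
 fix n
 have eq: "(%x. u n x + v n x - (f x + g x)) = (%x. (u n x - f x) + (v n x - g x))" by auto
 show "\<bar>E (%x. u n x + v n x - (f x + g x)) (%x. u n x + v n x - (f x + g x))\<bar> <= 2 * E (%x. u n x - f x) (%x. u n x - f x) + 2 * E (%x. v n x - g x) (%x. v n x - g x)"
  unfolding eq using form_bound_add[OF dom_diff[OF assms(1,3)] dom_diff[OF assms(2,4)]]
   form_nonneg[OF dom_add[OF dom_diff[OF assms(1,3)] dom_diff[OF assms(2,4)]]] by simp
qed

lemma E_conv_scale:
 assumes "!!n. u n : F" "f : F" "E_conv u f"
 shows "E_conv (%n x. c * u n x) (%x. c * f x)"
proof -
 have eq: "(%x. c * u n x - c * f x) = (%x. c * (u n x - f x))" for n by (auto simp: algebra_simps)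
 have "E (%x. c * u n x - c * f x) (%x. c * u n x - c * f x) = c * (c * E (%x. u n x - f x) (%x. u n x - f x))" for n
  unfolding eq using form_scale[OF dom_diff[OF assms(1,2)] dom_scale[OF dom_diff[OF assms(1,2)]]]
   form_scale2[OF dom_diff[OF assms(1,2)] dom_diff[OF assms(1,2)]] by simp
 moreover have "(%n. c * (c * E (%x. u n x - f x) (%x. u n x - f x))) ---> c * (c * 0)"
  using assms(3) unfolding E_conv_def by (intro tendsto_intros)
 ultimately show ?thesis by (simp add: E_conv_def)
qed

lemma Lb_trunc: "f : F ==> g : F ==> k : TF ==> (%n. Eb (trunc_fun n f) (trunc_fun n g) k) ---> Lb f g k"
 by (intro Lb_lim trunc_bF trunc_conv)

lemma Lb_eq_Eb: "f : bF ==> g : bF ==> k : TF ==> Lb f g k = Eb f g k"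
 using Lb_lim[of "%_. f" "%_. g" f g k] E_conv_const bF_F by (metis LIMSEQ_unique tendsto_const)

lemma Lb_sym: "Lb f g k = Lb g f k"
 unfolding Lb_def by (simp add: Eb_sym)

lemma Lb_add:
 assumes "f : F" "g : F" "h : F" "k : TF"
 shows "Lb (%x. f x + g x) h k = Lb f h k + Lb g h k"
proof (rule LIMSEQ_unique)
 let ?f = "%n. trunc_fun n f" and ?g = "%n. trunc_fun n g" and ?h = "%n. trunc_fun n h"
 show "(%n. Eb (%x. ?f n x + ?g n x) (?h n) k) ---> Lb (%x. f x + g x) h k"
  by (intro Lb_lim bF_add trunc_bF dom_add E_conv_add trunc_conv trunc_dom assms)
 show "(%n. Eb (%x. ?f n x + ?g n x) (?h n) k) ---> Lb f h k + Lb g h k"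
  using tendsto_add[OF Lb_trunc[OF assms(1,3,4)] Lb_trunc[OF assms(2,3,4)]]
  by (simp add: Eb_add[OF trunc_bF[OF assms(1)] trunc_bF[OF assms(2)] trunc_bF[OF assms(3)] TF_bF[OF assms(4)]])
qed

lemma Lb_scale:
 assumes "f : F" "h : F" "k : TF"
 shows "Lb (%x. c * f x) h k = c * Lb f h k"
proof (rule LIMSEQ_unique)
 let ?f = "%n. trunc_fun n f" and ?h = "%n. trunc_fun n h"
 show "(%n. Eb (%x. c * ?f n x) (?h n) k) ---> Lb (%x. c * f x) h k"
  by (intro Lb_lim bF_scale trunc_bF dom_scale E_conv_scale trunc_conv trunc_dom assms)
 show "(%n. Eb (%x. c * ?f n x) (?h n) k) ---> c * Lb f h k"
  using tendsto_mult_left[OF Lb_trunc[OF assms]]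
  by (simp add: Eb_scale[OF trunc_bF[OF assms(1)] trunc_bF[OF assms(2)] TF_bF[OF assms(3)]])
qed

lemma Lb_diff:
 assumes "f : F" "g : F" "h : F" "k : TF"
 shows "Lb (%x. f x - g x) h k = Lb f h k - Lb g h k"
 using Lb_add[OF assms(1) dom_scale[OF assms(2), of "-1"] assms(3,4)] Lb_scale[OF assms(2-4), of "-1"] by simp

lemma Lb_lin3:
 assumes "f : F" "g : F" "h : TF" "k : TF" "(%x. a * h x + b * k x) : TF"
 shows "Lb f g (%x. a * h x + b * k x) = a * Lb f g h + b * Lb f g k"
proof (rule LIMSEQ_unique[OF Lb_trunc[OF assms(1,2,5)]])
 show "(%n. Eb (trunc_fun n f) (trunc_fun n g) (%x. a * h x + b * k x)) ---> a * Lb f g h + b * Lb f g k"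
  using tendsto_add[OF tendsto_mult_left[OF Lb_trunc[OF assms(1,2,3)], of a] tendsto_mult_left[OF Lb_trunc[OF assms(1,2,4)], of b]]
   trunc_bF[OF assms(1)] trunc_bF[OF assms(2)] TF_bF[OF assms(3)] TF_bF[OF assms(4)]
  by (simp add: Eb_add3 Eb_scale3 bF_scale)
qed

lemma Lb_nonneg:
 assumes "f : F" "k : TF" "!!x. 0 <= k x"
 shows "0 <= Lb f f k"
 by (rule LIMSEQ_le_const[OF Lb_trunc[OF assms(1,1,2)]])
  (use Eb_nonneg[OF trunc_bF[OF assms(1)] TF_bF[OF assms(2)] assms(3)] in blast)

lemma Lb_le_form:
 assumes "f : F" "k : TF" "!!x. 0 <= k x" "!!x. k x <= c" "0 < c"
 shows "Lb f f k <= c * E f f"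
proof (rule LIMSEQ_le_const2[OF Lb_trunc[OF assms(1,1,2)]])
 have "Eb (trunc_fun n f) (trunc_fun n f) k <= c * E f f" for n
  by (rule order_trans[OF Eb_le_form[OF trunc_bF[OF assms(1)] assms(2-5)]])
   (use trunc_dom(2)[OF assms(1)] assms(5) in auto)
 thus "EX N. \<forall>n\<ge>N. Eb (trunc_fun n f) (trunc_fun n f) k <= c * E f f" by blast
qed

end

lemma compact_open_separated:
 fixes K :: "'x::metric_space set"
 assumes K: "compact K" "K ~= {}" and O: "open O'" "K <= O'"
 shows "\<exists>e>0. {x. infdist x K <= e} <= O'"
proof (cases "- O' = {}")
 \<comment> \<open>\<open>infdist\<close> to the empty set is 0 by convention, so this case is kept
   apart.\<close>
 case True
 thus ?thesis by (intro exI[of _ 1]) auto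
next
 case False
 have "continuous_on K (%x. infdist x (- O'))" by (intro continuous_intros)
 then obtain x0 where x0: "x0 : K" "!!x. x : K ==> infdist x0 (- O') <= infdist x (- O')"
  using continuous_attains_inf[OF K] by blast
 define m where "m = infdist x0 (- O')"
 have "closed (- O')" using O(1) by (simp add: closed_Compl)
 hence "m ~= 0" using in_closed_iff_infdist_zero[of "- O'" x0] False x0(1) O(2) by (auto simp: m_def)
 hence m: "0 < m" using infdist_nonneg[of x0 "- O'"] by (simp add: m_def)
 have "y : O'" if y: "infdist y K <= m / 2" for y
 proof (rule ccontr)
  assume "y \<notin> O'"
  have "(INF a\<in>K. dist y a) < m" using y m K(2) by (simp add: infdist_def)
  then obtain a where a: "a : K" "dist y a < m" using cInf_lessD[of "dist y ` K" m] K(2) by auto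
  have "infdist a (- O') <= dist a y" using \<open>y \<notin> O'\<close> by (intro infdist_le) simp
  thus False using x0(2)[OF a(1)] a(2) by (simp add: m_def dist_commute)
 qed
 thus ?thesis using m by (intro exI[of _ "m / 2"]) auto
qed

lemma compact_closed_subset: "compact S ==> closed T ==> T <= S ==> compact T"
 using compact_Int_closed[of S T] by (simp add: inf_absorb2)

section \<open>Regular forms: test functions and the Riesz representation\<close>

context mmd_space
begin

lemma sets_M: "sets M = sets borel"
 using radon by (simp add: radon_measure_def)

lemma space_M: "space M = UNIV"
 using sets_eq_imp_space_eq[OF sets_M] by simp

lemma borel_sets_completion: "A : sets borel ==> A : sets (completion M)"
 using sets_M by (auto intro: sets_completionI_sets)

lemma borel_fun_completion: "f : borel_measurable borel ==> f : borel_measurable (completion M)"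
 by (rule measurable_completion, subst measurable_cong_sets[OF sets_M refl])

lemma compact_finite_measure: "compact K ==> emeasure (completion M) K < \<infinity>"
proof -
 assume K: "compact K"
 have "emeasure M K < \<infinity>" using radon K unfolding radon_measure_def by blast
 moreover have "K : sets M" using borel_closed[OF compact_imp_closed[OF K]] sets_M by simp
 ultimately show ?thesis by simp
qed

text \<open>Closed balls need not be compact. A finite cover of \<open>K\<close> by open sets inside
  compact ones bounds how far the neighbourhood may extend.\<close>

lemma compact_nbhd:
 fixes K :: "'a set"
 assumes K: "compact K" "K ~= {}" and O: "open O'" "K <= O'"
 shows "\<exists>e>0. compact {x. infdist x K <= e} & {x. infdist x K <= e} <= O'"
proof -
 have "\<forall>x::'a. EX U C. open U & compact C & x : U & U <= C"
  using locally_compact by (auto simp: locally_compact_space_def)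
 then obtain U C where UC: "!!x. open (U x)" "!!x. compact (C x)" "!!x::'a. x : U x" "!!x. U x <= C x"
  by metis
 obtain T where T: "T <= K" "finite T" "K <= (\<Union>x\<in>T. U x)"
  using compactE_image[OF K(1), of K U] UC(1,3) by blast
 have "open (O' \<inter> (\<Union>x\<in>T. U x))" using O UC by auto
 then obtain e where e: "0 < e" "{x. infdist x K <= e} <= O' \<inter> (\<Union>x\<in>T. U x)"
  using compact_open_separated[OF K, of "O' \<inter> (\<Union>x\<in>T. U x)"] O(2) T(3) by blast
 have "compact (\<Union>x\<in>T. C x)" using T(2) UC(2) by blast
 moreover have "closed {x. infdist x K <= e}"
  by (intro closed_Collect_le continuous_intros)
 moreover have "{x. infdist x K <= e} <= (\<Union>x\<in>T. C x)"
  using e(2) UC(4) by blast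
 ultimately have "compact {x. infdist x K <= e}" by (rule compact_closed_subset)
 thus ?thesis using e by blast
qed

definition CC :: "('a => real) set" where "CC = F \<inter> C_c"

lemma CC_F: "k : CC ==> k : F" by (simp add: CC_def)

lemma CC_cont: "k : CC ==> continuous_on UNIV k" by (simp add: CC_def C_c_def)

lemma CC_supp: "k : CC ==> compact (closure {x. k x ~= 0})" by (simp add: CC_def C_c_def)

lemma C_c_bounded:
 assumes "k : C_c" shows "EX c. ALL x. \<bar>k x\<bar> <= c"
proof -
 have "compact (k ` closure {x. k x ~= 0})"
  using assms by (intro compact_continuous_image) (auto simp: C_c_def intro: continuous_on_subset)
 hence "bounded (k ` closure {x. k x ~= 0})" by (rule compact_imp_bounded)
 then obtain c where c0: "\<forall>y\<in>k ` closure {x. k x ~= 0}. norm y <= c"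
  unfolding bounded_iff by blast
 have c: "\<bar>k x\<bar> <= c" if "k x ~= 0" for x
 proof -
  have "x : closure {x. k x ~= 0}" using that closure_subset[of "{x. k x ~= 0}"] by blast
  thus ?thesis using c0 by auto
 qed
 have "\<bar>k x\<bar> <= max c 0" for x using c[of x] by (cases "k x = 0") auto
 thus ?thesis by blast
qed

lemma CC_bF: "k : CC ==> k : bF"
 using C_c_bounded by (auto simp: CC_def bF_def)

lemma CC_TF: "k : CC ==> k : TF"
proof -
 assume k: "k : CC"
 have "ALL x. x \<notin> closure {x. k x ~= 0} --> k x = 0" using closure_subset[of "{x. k x ~= 0}"] by blast
 moreover have "closure {x. k x ~= 0} : sets (completion M)" by (rule borel_sets_completion) simp
 ultimately show "k : TF"
  unfolding TF_def using CC_bF[OF k] compact_finite_measure[OF CC_supp[OF k]] by blast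
qed

lemma CC_borel: "k : CC ==> k : borel_measurable borel"
 using CC_cont borel_measurable_continuous_onI by blast

lemma C_c_compose:
 fixes Phi :: "'x::topological_space => 'b::euclidean_space" and U :: "'b => real"
 assumes Phi: "!!i. i : Basis ==> (%x. Phi x \<bullet> i) : C_c" and U: "continuous_on (range Phi) U" "U 0 = 0"
 shows "(%x. U (Phi x)) : C_c" "continuous_on UNIV Phi"
  "closure {x. U (Phi x) ~= 0} <= (\<Union>i\<in>Basis. closure {x. Phi x \<bullet> i ~= 0})"
proof -
 show c: "continuous_on UNIV Phi"
 proof -
  have "continuous_on UNIV (%x. SUM i:Basis. (Phi x \<bullet> i) *\<^sub>R i)"
   by (rule continuous_on_sum, rule continuous_on_scaleR) (use Phi in "auto simp: C_c_def")
  thus ?thesis by (simp add: euclidean_representation)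
 qed
 have "\<exists>i\<in>Basis. Phi x \<bullet> i ~= 0" if "U (Phi x) ~= 0" for x
  using that U(2) euclidean_eqI[of "Phi x" 0] by force
 hence "{x. U (Phi x) ~= 0} <= (\<Union>i\<in>Basis. closure {x. Phi x \<bullet> i ~= 0})"
  using closure_subset[of "{x. Phi x \<bullet> i ~= 0}" for i] by fast
 moreover have "closed (\<Union>i\<in>Basis. closure {x. Phi x \<bullet> i ~= 0})" by (intro closed_UN) auto
 ultimately show sub: "closure {x. U (Phi x) ~= 0} <= (\<Union>i\<in>Basis. closure {x. Phi x \<bullet> i ~= 0})"
  by (rule closure_minimal)
 have "compact (\<Union>i\<in>Basis. closure {x. Phi x \<bullet> i ~= 0})" using Phi by (intro compact_UN) (auto simp: C_c_def)
 hence "compact (closure {x. U (Phi x) ~= 0})"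
  using compact_closed_subset[OF _ closed_closure sub] by blast
 moreover have "continuous_on UNIV (%x. U (Phi x))"
  using continuous_on_compose2[OF U(1) c] by auto
 ultimately show "(%x. U (Phi x)) : C_c" by (simp add: C_c_def)
qed

text \<open>The Lipschitz condition is required on a set \<open>S\<close> only, so that smooth
  functions, which are Lipschitz on balls, can be composed. The origin belongs to \<open>S\<close>
  because the contraction also compares values with 0.\<close>

lemma CC_compose:
 fixes Phi :: "'a => 'b::euclidean_space" and U :: "'b => real"
 assumes Phi: "!!i. i : Basis ==> (%x. Phi x \<bullet> i) : CC" and U: "U 0 = 0"
  and S: "range Phi <= S" "0 : S" and lip: "!!p q. p : S ==> q : S ==> \<bar>U p - U q\<bar> <= L * norm (p - q)" and L: "0 <= L"
 shows "(%x. U (Phi x)) : CC"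
proof -
 have "L-lipschitz_on S U" using lip L by (intro lipschitz_onI) (auto simp: dist_real_def dist_norm)
 hence "continuous_on (range Phi) U" using lipschitz_on_continuous_on continuous_on_subset S(1) by blast
 from C_c_compose(1)[of Phi U] this Phi U have c: "(%x. U (Phi x)) : C_c" by (auto simp: CC_def)
 hence m: "(%x. U (Phi x)) : borel_measurable (completion M)"
  by (intro borel_fun_completion borel_measurable_continuous_onI) (simp add: C_c_def)
 have "(%x. U (Phi x)) : F"
  by (rule normal_contraction(1)[where Phi=Phi, OF CC_F[OF Phi] m L])
   (use lip[of "Phi x" "Phi y" for x y] lip[of "Phi x" 0 for x] S U in "force simp: image_subset_iff")+
 with c show ?thesis by (simp add: CC_def)
qed

lemma CC_real_compose:
 fixes psi :: "real => real"
 assumes f: "f : CC" and lip: "!!s t. \<bar>psi s - psi t\<bar> <= L * \<bar>s - t\<bar>" and 0: "psi 0 = 0" and L: "0 <= L"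
 shows "(%x. psi (f x)) : CC"
 by (rule CC_compose[where Phi=f and S=UNIV and L=L]) (use assms in auto)

lemma CC_add: "f : CC ==> g : CC ==> (%x. f x + g x) : CC"
proof -
 assume f: "f : CC" and g: "g : CC"
 have "(%x. (%p. fst p + snd p) (f x, g x)) : C_c"
  by (rule C_c_compose) (use f g in "auto simp: Basis_prod_def CC_def intro!: continuous_intros")
 thus ?thesis using dom_add f g by (auto simp: CC_def)
qed

lemma CC_mult: "f : CC ==> g : CC ==> (%x. f x * g x) : CC"
proof -
 assume f: "f : CC" and g: "g : CC"
 have "(%x. (%p. fst p * snd p) (f x, g x)) : C_c"
  by (rule C_c_compose) (use f g in "auto simp: Basis_prod_def CC_def intro!: continuous_intros")
 thus ?thesis using bF_F[OF bF_mult[OF CC_bF[OF f] CC_bF[OF g]]] by (auto simp: CC_def)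
qed

lemma CC_scale: "f : CC ==> (%x. c * f x) : CC"
 using CC_real_compose[of f "%t. c * t" "\<bar>c\<bar>"] by (simp flip: right_diff_distrib add: abs_mult)

lemma CC_diff: "f : CC ==> g : CC ==> (%x. f x - g x) : CC"
 using CC_add[of f "%x. (-1) * g x"] CC_scale[of g "-1"] by simp

lemma CC_zero: "(%x. 0) : CC"
 by (simp add: CC_def dom_zero C_c_def)

lemma CC_sum: "finite I ==> (!!i. i : I ==> f i : CC) ==> (%x. SUM i:I. f i x) : CC"
 by (induction I rule: finite_induct) (auto simp: CC_zero CC_add)

lemma CC_cut:
 assumes "f : CC" "0 <= d"
 shows "(%x. max (f x - d) 0) : CC" "(%x. min (max (f x - d) 0) e') : CC \<or> e' < 0" "(%x. max (- f x) 0) : CC"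
proof -
 show "(%x. max (f x - d) 0) : CC"
  by (rule CC_real_compose[OF assms(1), where psi="%t. max (t - d) 0" and L=1]) (use assms(2) in "auto simp: max_def")
 show "(%x. max (- f x) 0) : CC"
  by (rule CC_real_compose[OF assms(1), where psi="%t. max (- t) 0" and L=1]) (auto simp: max_def)
 show "(%x. min (max (f x - d) 0) e') : CC \<or> e' < 0"
 proof (cases "e' < 0")
  case False
  have "(%x. min (max (f x - d) 0) e') : CC"
   by (rule CC_real_compose[OF assms(1), where psi="%t. min (max (t - d) 0) e'" and L=1]) (use assms(2) False in "auto simp: max_def min_def")
  thus ?thesis by simp
 qed simp
qed

text \<open>Regularity supplies a test function within \<open>1/4\<close> of a continuous cutoff.
  Composing it with a piecewise linear function that is 0 up to \<open>1/4\<close> and 1 from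
  \<open>1/2\<close> on restores the exact values 0 and 1.\<close>

lemma CC_Urysohn:
 fixes K :: "'a set"
 assumes K: "compact K" and O: "open O'" "K <= O'"
 shows "\<exists>k\<in>CC. (ALL x. 0 <= k x & k x <= 1) & closure {x. k x ~= 0} <= O' & (EX V. open V & K <= V & (\<forall>x\<in>V. k x = 1))"
proof (cases "K = {}")
 case True
 thus ?thesis by (intro bexI[of _ "%x. 0"] CC_zero) auto
next
 case False
 obtain e where e: "0 < e" "compact {x. infdist x K <= e}" "{x. infdist x K <= e} <= O'"
  using compact_nbhd[OF K False O] by blast
 define f where "f x = max 0 (min 1 (2 - (2/e) * infdist x K))" for x
 have f0: "f x = 0" if "infdist x K \<ge> e" for x using that e(1) by (simp add: f_def field_simps)
 have f1: "f x = 1" if "infdist x K < e / 2" for x using that e(1) by (simp add: f_def field_simps)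
 have sub: "closure {x. f x ~= 0} <= {x. infdist x K <= e}"
 proof (rule closure_minimal)
  show "{x. f x ~= 0} <= {x. infdist x K <= e}" using f0 by (metis (mono_tags, lifting) linear mem_Collect_eq subsetI)
  show "closed {x. infdist x K <= e}" by (intro closed_Collect_le continuous_intros)
 qed
 have "f : C_c" unfolding C_c_def f_def[abs_def]
 proof (safe intro!: continuous_intros)
  show "compact (closure {x. max 0 (min 1 (2 - 2 / e * infdist x K)) ~= 0})"
   using compact_closed_subset[OF e(2) closed_closure sub] unfolding f_def .
 qed
 from regular_C_c[OF this, of "1/4"] obtain g where g: "g : CC" "!!x. \<bar>f x - g x\<bar> < 1/4"
  by (auto simp: CC_def)
 define k where "k x = min 1 (max 0 (4 * g x - 1))" for x
 have kC: "k : CC" unfolding k_def[abs_def]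
  by (rule CC_real_compose[OF g(1), where psi="%t. min 1 (max 0 (4 * t - 1))" and L=4]) (auto simp: max_def min_def abs_if)
 have "f x ~= 0" if "k x ~= 0" for x
  using that g(2)[of x] by (auto simp: k_def)
 hence "closure {x. k x ~= 0} <= closure {x. f x ~= 0}" by (intro closure_mono) auto
 hence supp: "closure {x. k x ~= 0} <= O'" using sub e(3) by blast
 have k1: "k x = 1" if "infdist x K < e / 2" for x
 proof -
  have "3/4 < g x" using f1[OF that] g(2)[of x] unfolding abs_less_iff by linarith
  thus ?thesis by (simp add: k_def)
 qed
 have "open {x. infdist x K < e / 2}" by (intro open_Collect_less continuous_intros)
 moreover have "K <= {x. infdist x K < e / 2}" using e(1) by auto
 ultimately show ?thesis using kC supp k1
  by (intro bexI[OF _ kC] conjI exI[of _ "{x. infdist x K < e / 2}"]) (auto simp: k_def)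
qed

lemma CC_cutoff:
 fixes K :: "'a set"
 assumes "compact K" "open O'" "K <= O'"
 obtains k V where "k : CC" "!!x. 0 <= k x" "!!x. k x <= 1" "closure {x. k x ~= 0} <= O'" "open V" "K <= V" "!!x. x : V ==> k x = 1"
 using CC_Urysohn[OF assms] that by metis

lemma sigma_compact: "\<exists>K :: nat => 'a set. (ALL n. compact (K n)) & incseq K & (\<Union>n. K n) = UNIV"
proof -
 have "\<forall>x::'a. EX U C. open U & compact C & x : U & U <= C"
  using locally_compact by (auto simp: locally_compact_space_def)
 then obtain U C where UC: "!!x. open (U x)" "!!x. compact (C x)" "!!x::'a. x : U x" "!!x. U x <= C x"
  by metis
 obtain D where D: "D <= range U" "countable D" "\<Union>D = \<Union>(range U)"
  using Lindelof[of "range U"] UC(1) by blast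
 have uni: "\<Union>D = UNIV" using D(3) UC(3) by auto
 have ne: "D ~= {}" using uni by auto
 obtain u :: "nat => 'a set" where u: "range u = D" using range_from_nat_into[OF ne D(2)] by blast
 have "ALL n. EX x. u n = U x" using u D(1) by blast
 then obtain x where x: "!!n::nat. u n = U (x n)" by metis
 define K where "K n = (\<Union>i\<le>n. C (x i))" for n
 have "y : (\<Union>n. K n)" for y
 proof -
  have "y : \<Union>(range u)" using uni u by simp
  then obtain n where "y : u n" by blast
  hence "y : K n" using x UC(4) unfolding K_def by fastforce
  thus ?thesis by blast
 qed
 moreover have "compact (K n)" for n unfolding K_def using UC(2) by (intro compact_UN) auto
 moreover have "incseq K" unfolding K_def incseq_def by fastforce
 ultimately show ?thesis by blast
qed

subsection \<open>Representation of bounded positive functionals\<close>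

text \<open>Caratheodory's construction, with \<open>CC\<close> in place of all continuous functions
  of compact support. Open sets receive the supremum of \<open>La\<close> over test functions below
  the indicator. The bound \<open>bd\<close> does the work of uniform approximation: removing the
  part of a function below the level \<open>d\<close> costs at most \<open>c * d\<close>
  (\<open>cutoff\<close>), and what is left lives on a compact level set.\<close>

lemma Riesz_CC:
 assumes add: "!!h k. h : CC ==> k : CC ==> La (%x. h x + k x) = La h + La k"
  and scale: "!!c k. k : CC ==> La (%x. c * k x) = c * La k"
  and pos: "!!k. k : CC ==> (!!x. 0 <= k x) ==> 0 <= La k"
  and bd: "!!k. k : CC ==> (!!x. 0 <= k x) ==> (!!x. k x <= 1) ==> La k <= c"
 shows "EX G. sets G = sets borel & finite_measure G & (\<forall>k\<in>CC. integral\<^sup>L G k = La k) & measure G UNIV <= c"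
proof -
 have diff: "La (%x. h x - k x) = La h - La k" if "h : CC" "k : CC" for h k
  using add[OF that(1) CC_scale[OF that(2), of "-1"]] scale[OF that(2), of "-1"] by simp
 have mono: "La h <= La k" if "h : CC" "k : CC" "!!x. h x <= k x" for h k
  using pos[OF CC_diff[OF that(2,1)]] diff[OF that(2,1)] that(3) by simp
 have zero: "La (%x. 0) = 0" using scale[OF CC_zero, of 0] by simp
 have c0: "0 <= c" using bd[OF CC_zero] zero by simp
 define below where "below U = {k : CC. ALL x. 0 <= k x & k x <= indicator U x}" for U
 define mu where "mu U = Sup (La ` below U)" for U
 have below1: "k x <= 1" if "k : below U" for k U x using that order_trans[of "k x" "indicator U x" 1] by (auto simp: below_def indicator_def split: if_splits)
 have belowC: "k : CC" "0 <= k x" if "k : below U" for k U x using that by (auto simp: below_def)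
 have belowIn: "x : U" if "k : below U" "0 < k x" for k U x
 proof (rule ccontr)
  assume "x \<notin> U"
  hence "k x <= 0" using that(1) by (auto simp: below_def indicator_def dest: spec[of _ x])
  thus False using that(2) by simp
 qed
 have b0: "(%x. 0) : below U" for U by (auto simp: below_def CC_zero)
 have bdd: "bdd_above (La ` below U)" for U
  by (rule bdd_aboveI[where M=c]) (use bd belowC below1 in blast)
 have mu_up: "La k <= mu U" if "k : below U" for k U
  unfolding mu_def by (rule cSup_upper) (use that bdd in auto)
 have mu_least: "mu U <= a" if "!!k. k : below U ==> La k <= a" for U a
  unfolding mu_def by (rule cSup_least) (use that b0 in auto)
 have mu0: "0 <= mu U" for U using mu_up[OF b0] zero by simp
 have mu_c: "mu U <= c" for U by (rule mu_least) (use bd belowC below1 in blast)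
 have mu_mono: "mu U <= mu V" if "U <= V" for U V
 proof (rule mu_least, rule mu_up)
  fix k assume k: "k : below U"
  have "k x <= indicator V x" for x
  proof -
   have "k x <= indicator U x" using k by (simp add: below_def)
   also have "indicator U x <= (indicator V x :: real)" using that by (auto simp: indicator_def)
   finally show ?thesis .
  qed
  thus "k : below V" using k by (simp add: below_def)
 qed
 have mu_empty: "mu {} = 0"
 proof (rule antisym[OF mu_least mu0])
  fix k assume "k : below {}"
  hence "k = (%x. 0)" by (auto simp: below_def intro: antisym)
  thus "La k <= 0" using zero by simp
 qed
 have cutoff: "La k <= La (%x. max (k x - d) 0) + c * d" if "k : CC" "!!x. 0 <= k x" "0 < d" for k d
 proof -
  have p: "(%x. max (k x - d) 0) : CC" using CC_cut(1)[OF that(1), of d] that(3) by simp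
  have "La (%x. (1/d) * (k x - max (k x - d) 0)) <= c"
   by (rule bd[OF CC_scale[OF CC_diff[OF that(1) p]]]) (use that in "auto simp: max_def field_simps")
  hence "(1/d) * (La k - La (%x. max (k x - d) 0)) <= c"
   unfolding scale[OF CC_diff[OF that(1) p]] diff[OF that(1) p] .
  thus ?thesis using that(3) by (simp add: field_simps)
 qed
 have level: "compact {x. d <= k x}" if "k : CC" "0 < d" for k d
 proof -
  have "closed {x. d <= k x}" using CC_cont[OF that(1)] by (intro closed_Collect_le continuous_intros)
  moreover have "{x. d <= k x} <= closure {x. k x ~= 0}" using that(2) closure_subset[of "{x. k x ~= 0}"] by force
  ultimately show ?thesis using compact_closed_subset[OF CC_supp[OF that(1)]] by blast
 qed
 have le_limit: "a <= b" if "!!d. 0 < d ==> a <= b + c * d" for a b :: real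
 proof (rule field_le_epsilon)
  fix e :: real assume e: "0 < e"
  have "a <= b + c * (e / (c + 1))" using that[of "e / (c + 1)"] e c0 by simp
  also have "c * (e / (c + 1)) <= e" using c0 e by (simp add: field_simps)
  finally show "a <= b + e" by simp
 qed
 have sub2: "mu (U \<union> V) <= mu U + mu V" if oU: "open U" and oV: "open V" for U V
 proof (rule mu_least)
  fix k assume k: "k : below (U \<union> V)"
  show "La k <= mu U + mu V"
  proof (rule le_limit)
   fix d :: real assume d: "0 < d"
   let ?K = "{x. d <= k x}" and ?k = "%x. max (k x - d) 0"
   have K: "compact ?K" by (rule level[OF belowC(1)[OF k] d])
   have sub: "?K <= U \<union> V" using belowIn[OF k] less_le_trans[OF d] by blast
   have p: "?k : CC" using CC_cut(1)[OF belowC(1)[OF k], of d] d by simp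
   \<comment> \<open>A partition subordinate to \<open>U\<close> and \<open>V\<close>:
     \<open>k1\<close> is 1 on a neighbourhood \<open>W\<close> of what \<open>V\<close> misses,
     \<open>k2\<close> is 1 on the rest of the level set, and so \<open>h1\<close> and
     \<open>h2\<close> add up to the cut function.\<close>
   have KV: "compact (?K - V)" using K oV by (rule compact_diff)
   have KU: "?K - V <= U" using sub by blast
   obtain k1 W where k1': "k1 : CC" "!!x. 0 <= k1 x" "!!x. k1 x <= 1" "closure {x. k1 x ~= 0} <= U" "open W" "?K - V <= W" "!!x. x : W ==> k1 x = 1"
    by (rule CC_cutoff[OF KV oU KU]) (rule that)
   have KW: "compact (?K - W)" using K k1'(5) by (rule compact_diff)
   have WV: "?K - W <= V" using k1'(6) by blast
   obtain k2 W' where k2': "k2 : CC" "!!x. 0 <= k2 x" "!!x. k2 x <= 1" "closure {x. k2 x ~= 0} <= V" "open W'" "?K - W <= W'" "!!x. x : W' ==> k2 x = 1"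
    by (rule CC_cutoff[OF KW oV WV]) (rule that)
   have k1: "k1 : CC" "0 <= k1 x & k1 x <= 1" "closure {x. k1 x ~= 0} <= U" "x : W ==> k1 x = 1" for x
    using k1' by auto
   have k2: "k2 : CC" "0 <= k2 x & k2 x <= 1" "closure {x. k2 x ~= 0} <= V" "x : ?K - W ==> k2 x = 1" for x
    using k2' by auto
   have pp: "0 <= ?k x" "?k x <= 1" for x using below1[OF k, of x] d by auto
   define h1 where "h1 x = ?k x * k1 x" for x
   define h2 where "h2 x = (?k x - h1 x) * k2 x" for x
   have h1: "h1 : CC" unfolding h1_def[abs_def] by (rule CC_mult[OF p k1(1)])
   have h2: "h2 : CC" unfolding h2_def[abs_def] by (rule CC_mult[OF CC_diff[OF p h1] k2(1)])
   have h1b: "0 <= h1 x" "h1 x <= ?k x" for x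
    unfolding h1_def using k1(2)[of x] pp(1)[of x] by (auto intro: mult_nonneg_nonneg mult_left_le)
   have h2b: "0 <= h2 x" "h2 x <= ?k x" for x
   proof -
    have "h2 x <= ?k x - h1 x" unfolding h2_def using k2(2)[of x] h1b(2)[of x] by (intro mult_left_le) auto
    thus "h2 x <= ?k x" using h1b(1)[of x] by linarith
    show "0 <= h2 x" unfolding h2_def using k2(2)[of x] h1b(2)[of x] by (intro mult_nonneg_nonneg) auto
   qed
   have "h1 : below U"
   proof -
    have "h1 x = 0" if "x \<notin> U" for x
     using that k1(3) closure_subset[of "{x. k1 x ~= 0}"] by (auto simp: h1_def)
    thus ?thesis using h1 h1b pp order_trans[OF h1b(2) pp(2)] by (auto simp: below_def indicator_def)
   qed
   moreover have "h2 : below V"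
   proof -
    have "h2 x = 0" if "x \<notin> V" for x
     using that k2(3) closure_subset[of "{x. k2 x ~= 0}"] by (auto simp: h2_def)
    thus ?thesis using h2 h2b pp order_trans[OF h2b(2) pp(2)] by (auto simp: below_def indicator_def)
   qed
   moreover have "?k = (%x. h1 x + h2 x)"
   proof
    fix x
    show "?k x = h1 x + h2 x"
    proof (cases "d <= k x")
     case True
     thus ?thesis using k1(4)[of x] k2(4)[of x] by (cases "x : W") (auto simp: h1_def h2_def)
    next
     case False
     thus ?thesis by (simp add: h1_def h2_def)
    qed
   qed
   hence "La ?k = La h1 + La h2" using add[OF h1 h2] by simp
   ultimately have "La ?k <= mu U + mu V" using mu_up[of h1 U] mu_up[of h2 V] by linarith
   thus "La k <= mu U + mu V + c * d"
    using cutoff[OF belowC(1)[OF k] belowC(2)[OF k] d] by linarith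
  qed
 qed
 have subfin: "mu (\<Union>i<n. U i) <= (\<Sum>i<n. mu (U i))" if "!!i. open (U i)" for U :: "nat => 'a set" and n
 proof (induction n)
  case 0
  thus ?case using mu_empty by simp
 next
  case (Suc n)
  have "(\<Union>i<Suc n. U i) = (\<Union>i<n. U i) \<union> U n" by (auto simp: less_Suc_eq)
  moreover have "open (\<Union>i<n. U i)" using that by blast
  ultimately show ?case using sub2[of "\<Union>i<n. U i" "U n"] that[of n] Suc by simp
 qed
 have subcount: "ennreal (mu (\<Union>i. U i)) <= (\<Sum>i. ennreal (mu (U i)))" if U: "!!i. open (U i)" for U :: "nat => 'a set"
 proof (cases "(\<Sum>i. ennreal (mu (U i))) = \<infinity>")
  case False
  have S: "summable (%i. mu (U i))" by (rule summable_suminf_not_top) (use mu0 False in auto)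
  have "mu (\<Union>i. U i) <= (\<Sum>i. mu (U i))"
  proof (rule mu_least)
   fix k assume k: "k : below (\<Union>i. U i)"
   show "La k <= (\<Sum>i. mu (U i))"
   proof (rule le_limit)
    fix d :: real assume d: "0 < d"
    let ?K = "{x. d <= k x}" and ?k = "%x. max (k x - d) 0"
    have K: "compact ?K" by (rule level[OF belowC(1)[OF k] d])
    have "?K <= (\<Union>i. U i)" using belowIn[OF k] less_le_trans[OF d] by blast
    then obtain T where T: "T <= UNIV" "finite T" "?K <= (\<Union>i\<in>T. U i)"
     by (rule compactE_image[OF K U])
    obtain n where "T <= {..<n}" using finite_nat_bounded[OF T(2)] by blast
    hence sub: "?K <= (\<Union>i<n. U i)" using T(3) by blast
    have p: "?k : CC" using CC_cut(1)[OF belowC(1)[OF k], of d] d by simp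
    have "?k x <= indicator (\<Union>i<n. U i) x" for x
     using sub below1[OF k, of x] d by (cases "d <= k x") (auto simp: indicator_def)
    hence "?k : below (\<Union>i<n. U i)" using p by (auto simp: below_def)
    hence "La ?k <= (\<Sum>i<n. mu (U i))" by (rule order_trans[OF mu_up subfin[OF U]])
    also have "... <= (\<Sum>i. mu (U i))" by (rule sum_le_suminf[OF S]) (use mu0 in auto)
    finally show "La k <= (\<Sum>i. mu (U i)) + c * d"
     using cutoff[OF belowC(1)[OF k] belowC(2)[OF k] d] by linarith
   qed
  qed
  thus ?thesis by (simp add: suminf_ennreal2[OF mu0 S] ennreal_leI)
 qed simp
 define om where "om A = (INF U\<in>{U. open U & A <= U}. ennreal (mu U))" for A :: "'a set"
 have om_open: "om U = ennreal (mu U)" if "open U" for U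
  unfolding om_def by (rule antisym[OF INF_lower INF_greatest]) (use that mu_mono in "auto intro: ennreal_leI")
 have om_mono: "om A <= om B" if "A <= B" for A B
  unfolding om_def by (rule INF_superset_mono) (use that in auto)
 have om_le: "om A <= ennreal (mu U)" if "open U" "A <= U" for A U
  unfolding om_def by (rule INF_lower) (use that in auto)
 have om_fin: "om A < \<infinity>" for A using om_le[of UNIV A] le_less_trans[of "om A"] by auto
 have om_approx: "EX U. open U & A <= U & ennreal (mu U) <= om A + ennreal e" if "0 < e" for A e
 proof -
  have "om A < om A + ennreal e" using om_fin[of A] that by (simp add: ennreal_less_zero_iff)
  hence "(INF U\<in>{U. open U & A <= U}. ennreal (mu U)) < om A + ennreal e" by (simp add: om_def)
  then obtain U where "open U" "A <= U" "ennreal (mu U) < om A + ennreal e" unfolding INF_less_iff by blast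
  thus ?thesis using less_imp_le by blast
 qed
 have om_sub: "om (\<Union>i. A i) <= (\<Sum>i. om (A i))" for A :: "nat => 'a set"
 proof (rule ennreal_le_epsilon)
  fix e :: real assume e: "0 < e"
  have "ALL i. EX U. open U & A i <= U & ennreal (mu U) <= om (A i) + ennreal (e * (1/2) ^ Suc i)"
   using om_approx e by simp
  then obtain U where U: "!!i. open (U i)" "!!i. A i <= U i" "!!i. ennreal (mu (U i)) <= om (A i) + ennreal (e * (1/2) ^ Suc i)"
   by metis
  have "om (\<Union>i. A i) <= ennreal (mu (\<Union>i. U i))" by (rule om_le) (use U in blast)+
  also have "... <= (\<Sum>i. ennreal (mu (U i)))" by (rule subcount[OF U(1)])
  also have "... <= (\<Sum>i. om (A i) + ennreal (e * (1/2) ^ Suc i))" by (rule suminf_le[OF U(3)]) auto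
  also have "... = (\<Sum>i. om (A i)) + (\<Sum>i. ennreal (e * (1/2) ^ Suc i))" by (rule suminf_add[symmetric]) auto
  also have "(\<Sum>i. ennreal (e * (1/2) ^ Suc i)) = ennreal e"
  proof -
   have "(%i. e * (1/2) ^ Suc i) sums (e * 1)" by (rule sums_mult[OF power_half_series])
   thus ?thesis using e by (subst suminf_ennreal_eq) auto
  qed
  finally show "om (\<Union>i. A i) <= (\<Sum>i. om (A i)) + ennreal e" .
 qed
 interpret P: sigma_algebra UNIV "Pow (UNIV :: 'a set)" by (rule sigma_algebra_Pow)
 have oms: "outer_measure_space (Pow UNIV) om"
  unfolding outer_measure_space_def positive_def increasing_def countably_subadditive_def
  using om_mono om_sub om_open[of "{}"] mu_empty by auto
 \<comment> \<open>The criterion is checked on open \<open>V\<close>. A test function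
   \<open>k\<close> below the intersection with \<open>U\<close> and another one below
   \<open>V\<close> minus the level set of \<open>k\<close> add up to at most \<open>1 + d\<close>,
   hence fit below \<open>V\<close> after scaling. Outer regularity of \<open>om\<close> extends
   this to all sets.\<close>
 have open_lambda: "U : lambda_system UNIV (Pow UNIV) om" if U: "open U" for U
 proof -
  have key: "om (V \<inter> U) + om (V - U) <= ennreal (mu V)" if V: "open V" for V
  proof -
   obtain r where r: "om (V - U) = ennreal r" "0 <= r"
    using om_fin[of "V - U"] by (cases "om (V - U)" rule: ennreal_cases) auto
   have "mu (V \<inter> U) <= mu V - r"
   proof (rule mu_least)
    fix k assume k: "k : below (V \<inter> U)"
    have "La k + r <= mu V"
    proof (rule le_limit)
     fix d :: real assume d: "0 < d"
     let ?V = "V - {x. d <= k x}"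
     have oV: "open ?V" using V compact_imp_closed[OF level[OF belowC(1)[OF k] d]] by blast
     have "V - U <= ?V" using belowIn[OF k] less_le_trans[OF d] by blast
     from om_le[OF oV this] have "ennreal r <= ennreal (mu ?V)" unfolding r(1) .
     hence rV: "r <= mu ?V" using mu0 by simp
     have "mu ?V <= (1 + d) * mu V - La k"
     proof (rule mu_least)
      fix h assume h: "h : below ?V"
      have hk: "(%x. h x + k x) : CC" by (rule CC_add[OF belowC(1)[OF h] belowC(1)[OF k]])
      have "(1 / (1 + d)) * (h x + k x) <= indicator V x" for x
      proof -
       have a: "h x <= indicator ?V x" "k x <= indicator (V \<inter> U) x" using h k by (auto simp: below_def)
       show ?thesis
       proof (cases "x : V")
        case True
        have "h x + k x <= 1 + d"
         using a(1) below1[OF h, of x] below1[OF k, of x] d by (cases "d <= k x") (auto simp: indicator_def)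
        thus ?thesis using True d by simp
       next
        case False
        hence "h x + k x <= 0" using a by (auto simp: indicator_def)
        thus ?thesis using False d by (simp add: mult_nonneg_nonpos divide_nonpos_pos)
       qed
      qed
      moreover have "0 <= (1 / (1 + d)) * (h x + k x)" for x
       using belowC(2)[OF h, of x] belowC(2)[OF k, of x] d by simp
      ultimately have "(%x. (1 / (1 + d)) * (h x + k x)) : below V"
       using CC_scale[OF hk, of "1 / (1 + d)"] by (auto simp: below_def)
      hence "(1 / (1 + d)) * (La h + La k) <= mu V"
       using mu_up[of "%x. (1 / (1 + d)) * (h x + k x)" V] scale[OF hk, of "1 / (1 + d)"] add[OF belowC(1)[OF h] belowC(1)[OF k]] by simp
      thus "La h <= (1 + d) * mu V - La k" using d by (simp add: field_simps)
     qed
     moreover have "mu V * d <= c * d" using mu_c[of V] d by (simp add: mult_right_mono)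
     ultimately show "La k + r <= mu V + c * d" using rV by (simp add: algebra_simps)
    qed
    thus "La k <= mu V - r" by simp
   qed
   hence "ennreal (mu (V \<inter> U) + r) <= ennreal (mu V)" by (intro ennreal_leI) linarith
   thus ?thesis
    unfolding om_open[OF open_Int[OF V U]] r(1) using r(2) mu0[of "V \<inter> U"] by simp
  qed
  have "om (U \<inter> A) + om ((UNIV - U) \<inter> A) = om A" for A
  proof (rule antisym)
   show "om (U \<inter> A) + om ((UNIV - U) \<inter> A) <= om A"
    unfolding om_def[of A]
   proof (rule INF_greatest)
    fix V assume V: "V : {U. open U & A <= U}"
    have "om (U \<inter> A) + om ((UNIV - U) \<inter> A) <= om (V \<inter> U) + om (V - U)"
     using V by (intro add_mono om_mono) auto
    also have "... <= ennreal (mu V)" using key V by blast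
    finally show "om (U \<inter> A) + om ((UNIV - U) \<inter> A) <= ennreal (mu V)" .
   qed
   define B where "B i = (if i = 0 then U \<inter> A else if i = Suc 0 then (UNIV - U) \<inter> A else {})" for i
   have "om A <= om (\<Union>i. B i)"
   proof (rule om_mono)
    have "A <= B 0 \<union> B (Suc 0)" by (auto simp: B_def)
    thus "A <= (\<Union>i. B i)" by blast
   qed
   also have "... <= (\<Sum>i. om (B i))" by (rule om_sub)
   also have "... = (SUM i:{0, Suc 0}. om (B i))"
    by (rule suminf_finite) (auto simp: B_def om_open mu_empty)
   finally show "om A <= om (U \<inter> A) + om ((UNIV - U) \<inter> A)" by (simp add: B_def)
  qed
  thus ?thesis by (simp add: lambda_system_def)
 qed
 have ms: "measure_space UNIV (lambda_system UNIV (Pow UNIV) om) om"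
  by (rule P.caratheodory_lemma[OF oms])
 then interpret L: sigma_algebra UNIV "lambda_system UNIV (Pow UNIV) om" by (simp add: measure_space_def)
 have borel_sub: "sets borel <= lambda_system UNIV (Pow UNIV) om"
 proof -
  have "sigma_sets UNIV {S :: 'a set. open S} <= lambda_system UNIV (Pow UNIV) om"
   by (rule L.sigma_sets_subset) (use open_lambda in blast)
  moreover have "sets borel = sigma_sets UNIV {S :: 'a set. open S}" by (simp add: borel_def)
  ultimately show ?thesis by simp
 qed
 define G where "G = measure_of UNIV (sets (borel :: 'a measure)) om"
 have setsG: "sets G = sets borel"
  unfolding G_def using sets.sigma_sets_eq[of "borel :: 'a measure"] by (subst sets_measure_of) auto
 have emG: "emeasure G A = om A" if "A : sets borel" for A
 proof (rule emeasure_measure_of[OF G_def])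
  show "positive (sets G) om" using ms unfolding measure_space_def positive_def by simp
  show "countably_additive (sets G) om"
   using ms borel_sub unfolding measure_space_def countably_additive_def setsG by blast
 qed (use that setsG in auto)
 have spaceG: "space G = UNIV" using sets_eq_imp_space_eq[OF setsG] by simp
 have emUNIV: "emeasure G UNIV <= ennreal c"
  using emG[of UNIV] om_open[of UNIV] mu_c by (simp add: ennreal_leI)
 have finG: "finite_measure G"
  by (rule finite_measureI) (use emUNIV in "auto simp: spaceG top_unique")
 then interpret G: finite_measure G .
 have mG: "measure G U = mu U" if "open U" for U
  using emG[of U] om_open[OF that] that mu0 by (simp add: measure_def)
 have kint: "integrable G k" if kC: "k : CC" for k
 proof -
  obtain b where b: "!!x. \<bar>k x\<bar> <= b" using bF_bound[OF CC_bF[OF kC]] by blast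
  have "k : borel_measurable G" using CC_borel[OF kC] by (subst measurable_cong_sets[OF setsG refl])
  thus ?thesis
   by (rule G.integrable_const_bound[where B=b, rotated]) (use b in auto)
 qed
 have posint: "integral\<^sup>L G k = La k" if k: "k : CC" "!!x. 0 <= k x" for k
 proof -
  obtain b where b: "!!x. \<bar>k x\<bar> <= b" using bF_bound[OF CC_bF[OF k(1)]] by blast
  have close: "\<bar>integral\<^sup>L G k - La k\<bar> <= c * d" if d: "0 < d" for d
  proof -
   \<comment> \<open>Layers of thickness \<open>d\<close>. Each lies between \<open>d\<close> times
     the indicators of two consecutive level sets, for \<open>La\<close> and for the integral alike,
     and the differences telescope.\<close>
   define h where "h i x = min (max (k x - real i * d) 0) d" for i :: nat and x
   have hC: "h i : CC" for i unfolding h_def[abs_def] using CC_cut(2)[OF k(1), of "real i * d" d] d by simp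
   define U where "U i = {x. real i * d < k x}" for i :: nat
   have oU: "open (U i)" for i unfolding U_def using CC_cont[OF k(1)] by (intro open_Collect_less continuous_intros)
   have [measurable]: "U i : sets G" for i using oU setsG by auto
   have iI: "integrable G (indicator (U i) :: 'a => real)" for i
    by (rule integrable_real_indicator) (auto simp: less_top[symmetric])
   have hlo: "d * indicator (U (Suc i)) x <= h i x" and hhi: "h i x <= d * indicator (U i) x" and h0: "0 <= h i x" for i x
    using d by (auto simp: h_def U_def indicator_def algebra_simps min_def max_def)
   have tele: "(\<Sum>i<n. h i x) = min (k x) (real n * d)" for n x
   proof (induction n)
    case 0
    thus ?case using k(2)[of x] by simp
   next
    case (Suc n)
    thus ?case using k(2)[of x] d by (auto simp: h_def min_def max_def algebra_simps)
   qed
   obtain n where n: "b / d <= real n" using real_arch_simple by blast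
   hence "b <= real n * d" using d by (simp add: field_simps)
   hence ksum: "k = (%x. \<Sum>i<n. h i x)"
   proof (intro ext)
    fix x
    have "k x <= real n * d" using \<open>b <= real n * d\<close> abs_le_D1[OF b[of x]] by linarith
    thus "k x = (\<Sum>i<n. h i x)" using tele[of x n] by simp
   qed
   have Lh: "La (%x. \<Sum>i<m. h i x) = (\<Sum>i<m. La (h i))" for m
   proof (induction m)
    case 0 thus ?case using zero by simp
   next
    case (Suc m)
    thus ?case using add[OF CC_sum[of "{..<m}" h] hC[of m]] hC by simp
   qed
   have each: "\<bar>integral\<^sup>L G (h i) - La (h i)\<bar> <= d * (mu (U i) - mu (U (Suc i)))" for i
   proof -
    have L1: "La (h i) <= d * mu (U i)"
    proof -
     have "(1/d) * h i x <= indicator (U i) x" for x using hhi[of i x] d by (simp add: field_simps)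
     hence "(%x. (1/d) * h i x) : below (U i)" using CC_scale[OF hC, of "1/d"] h0 d by (auto simp: below_def)
     hence "(1/d) * La (h i) <= mu (U i)" using mu_up[of "%x. (1/d) * h i x" "U i"] scale[OF hC, of "1/d"] by simp
     thus ?thesis using d by (simp add: field_simps)
    qed
    have "mu (U (Suc i)) <= La (h i) / d"
    proof (rule mu_least)
     fix g assume g: "g : below (U (Suc i))"
     have "d * g x <= h i x" for x
     proof -
      have "g x <= indicator (U (Suc i)) x" using g by (auto simp: below_def)
      hence "d * g x <= d * indicator (U (Suc i)) x" using d by simp
      thus ?thesis using hlo[of i x] by linarith
     qed
     hence "d * La g <= La (h i)" using mono[OF CC_scale[OF belowC(1)[OF g], of d] hC] scale[OF belowC(1)[OF g], of d] by simp
     thus "La g <= La (h i) / d" using d by (simp add: field_simps)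
    qed
    hence L2: "d * mu (U (Suc i)) <= La (h i)" using d by (simp add: field_simps)
    have "integral\<^sup>L G (h i) <= (LINT x|G. d * indicator (U i) x)"
     by (rule integral_mono[OF kint[OF hC]]) (use hhi iI in auto)
    hence I1: "integral\<^sup>L G (h i) <= d * mu (U i)" using mG[OF oU] by simp
    have "(LINT x|G. d * indicator (U (Suc i)) x) <= integral\<^sup>L G (h i)"
     by (rule integral_mono[OF _ kint[OF hC]]) (use hlo iI in auto)
    hence I2: "d * mu (U (Suc i)) <= integral\<^sup>L G (h i)" using mG[OF oU] by simp
    show ?thesis using L1 L2 I1 I2 unfolding right_diff_distrib abs_le_iff by linarith
   qed
   have "\<bar>integral\<^sup>L G k - La k\<bar> = \<bar>\<Sum>i<n. integral\<^sup>L G (h i) - La (h i)\<bar>"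
    by (subst (1 2) ksum) (simp add: Lh kint[OF hC] sum_subtractf)
   also have "... <= (\<Sum>i<n. d * (mu (U i) - mu (U (Suc i))))"
    by (rule order_trans[OF sum_abs sum_mono[OF each]])
   also have "... = d * (mu (U 0) - mu (U n))"
    unfolding sum_distrib_left[symmetric] by (subst sum_lessThan_telescope') simp
   also have "... <= d * c" using mu_c[of "U 0"] mu0[of "U n"] d by (intro mult_left_mono) auto
   finally show ?thesis by (simp add: mult.commute)
  qed
  have "\<bar>integral\<^sup>L G k - La k\<bar> <= 0" by (rule le_limit) (use close in simp)
  thus ?thesis by simp
 qed
 have "integral\<^sup>L G k = La k" if k: "k : CC" for k
 proof -
  have p: "(%x. max (k x) 0) : CC" and n: "(%x. max (- k x) 0) : CC"
   using CC_cut(1,3)[OF k, of 0] by auto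
  have eq: "k = (%x. max (k x) 0 - max (- k x) 0)" by (auto simp: max_def)
  have "integral\<^sup>L G k = integral\<^sup>L G (%x. max (k x) 0) - integral\<^sup>L G (%x. max (- k x) 0)"
   by (subst eq) (rule integral_diff[OF kint[OF p] kint[OF n]])
  also have "... = La (%x. max (k x) 0) - La (%x. max (- k x) 0)" using posint[OF p] posint[OF n] by simp
  also have "... = La k" using diff[OF p n] eq by simp
  finally show ?thesis .
 qed
 moreover have "measure G UNIV <= c" using emUNIV c0 by (simp add: measure_def enn2real_leI)
 ultimately show ?thesis using setsG finG by blast
qed

end

section \<open>Energy measures\<close>

lemma finite_measure_compact_approx:
 fixes G :: "'a::polish_space measure"
 assumes G: "sets G = sets borel" "finite_measure G" and A: "A : sets borel" and e: "0 < e"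
 shows "EX K. compact K & K <= A & measure G A < measure G K + e"
proof (cases "measure G A < e")
 case True
 thus ?thesis by (intro exI[of _ "{}"]) auto
next
 case False
 interpret finite_measure G by fact
 have "emeasure G A = (SUP K\<in>{K. K <= A & compact K}. emeasure G K)"
  by (rule inner_regular[OF G(1) _ A]) simp
 moreover have "ennreal (measure G A - e) < emeasure G A"
  unfolding emeasure_eq_measure using False e by (intro ennreal_lessI) auto
 ultimately have "ennreal (measure G A - e) < (SUP K\<in>{K. K <= A & compact K}. emeasure G K)" by (simp only:)
 then obtain K where "K <= A" "compact K" "ennreal (measure G A - e) < emeasure G K"
  unfolding less_SUP_iff by blast
 thus ?thesis unfolding emeasure_eq_measure using False by (auto simp: ennreal_less_iff)
qed

context mmd_space
begin

text \<open>The cutoffs are supported in shrinking neighbourhoods of \<open>K\<close> and equal 1 on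
  \<open>K\<close>, so at every point the sequence is eventually constant.\<close>

lemma CC_approx_compact:
 fixes K :: "'a set"
 assumes K: "compact K" and O: "open O'" "K <= O'"
 shows "\<exists>k :: nat => 'a => real. (ALL n. k n : CC & (ALL x. 0 <= k n x & k n x <= 1) & closure {x. k n x ~= 0} <= O' & (\<forall>x\<in>K. k n x = 1))
  & (ALL x. (%n. k n x) ---> indicator K x)"
proof (cases "K = {}")
 case True
 thus ?thesis by (intro exI[of _ "%_ _. 0"]) (auto simp: CC_zero)
next
 case False
 define W where "W n = O' \<inter> {x. infdist x K < 1 / real (Suc n)}" for n
 have oW: "open (W n)" for n unfolding W_def by (intro open_Int O open_Collect_less continuous_intros)
 have KW: "K <= W n" for n using O(2) by (auto simp: W_def)
 have "EX k. k : CC & (ALL x. 0 <= k x & k x <= 1) & closure {x. k x ~= 0} <= W n & (\<forall>x\<in>K. k x = 1)" for n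
  using CC_Urysohn[OF K oW KW, of n] by blast
 then obtain k where k: "!!n. k n : CC" "!!n x. 0 <= k n x & k n x <= 1" "!!n. closure {x. k n x ~= 0} <= W n" "!!n x. x : K ==> k n x = 1"
  by metis
 have "(%n. k n x) ---> indicator K x" for x
 proof (cases "x : K")
  case True
  thus ?thesis using k(4) by simp
 next
  case nK: False
  have "0 < infdist x K"
   using in_closed_iff_infdist_zero[OF compact_imp_closed[OF K] False, of x] nK infdist_nonneg[of x K] by linarith
  then obtain n0 where n0: "1 / real (Suc n0) < infdist x K" using reals_Archimedean by (auto simp: inverse_eq_divide)
  have "k n x = 0" if "n0 <= n" for n
  proof (rule ccontr)
   assume "k n x ~= 0"
   hence "x : W n" using k(3)[of n] closure_subset[of "{x. k n x ~= 0}"] by blast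
   hence "infdist x K < 1 / real (Suc n)" by (simp add: W_def)
   also have "... <= 1 / real (Suc n0)" using that by (simp add: frac_le)
   finally show False using n0 by simp
  qed
  hence "\<forall>\<^sub>F n in sequentially. k n x = indicator K x"
   unfolding eventually_sequentially using nK by (intro exI[of _ n0]) auto
  thus ?thesis by (rule tendsto_eventually)
 qed
 moreover have "closure {x. k n x ~= 0} <= O'" for n using k(3)[of n] by (auto simp: W_def)
 ultimately show ?thesis using k by blast
qed

text \<open>Finitely many measures are approximated from inside by a common compact set, and the
  indicator of that set by test functions. The support condition relative to \<open>O'\<close>
  admits inequalities that hold only locally.\<close>

lemma measure_combination_nonneg:
 fixes G :: "'i => 'a measure"
 assumes I: "finite I" and G: "!!i. i : I ==> sets (G i) = sets borel" "!!i. i : I ==> finite_measure (G i)"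
  and O: "open O'"
  and pos: "!!k. k : CC ==> (!!x. 0 <= k x) ==> closure {x. k x ~= 0} <= O' ==> 0 <= (SUM i:I. a i * integral\<^sup>L (G i) k)"
  and A: "A : sets borel" "A <= O'"
 shows "0 <= (SUM i:I. a i * measure (G i) A)"
proof -
 have cpt: "0 <= (SUM i:I. a i * measure (G i) K)" if K: "compact K" "K <= O'" for K
 proof -
  obtain k :: "nat => 'a => real" where k: "!!n. k n : CC" "!!n x. 0 <= k n x & k n x <= 1" "!!n. closure {x. k n x ~= 0} <= O'"
   "!!x. (%n. k n x) ---> indicator K x"
   using CC_approx_compact[OF K(1) O K(2)] by metis
  have "(%n. SUM i:I. a i * integral\<^sup>L (G i) (k n)) ---> (SUM i:I. a i * measure (G i) K)"
  proof (intro tendsto_sum tendsto_mult tendsto_const)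
   fix i assume i: "i : I"
   interpret finite_measure "G i" by (rule G(2)[OF i])
   have Km: "K : sets (G i)" using G(1)[OF i] compact_imp_closed[OF K(1)] by auto
   have "(%n. integral\<^sup>L (G i) (k n)) ---> integral\<^sup>L (G i) (indicator K)"
   proof (rule integral_dominated_convergence[where w="%_. 1"])
    show "k n : borel_measurable (G i)" for n
     using CC_borel[OF k(1)] by (subst measurable_cong_sets[OF G(1)[OF i] refl])
    show "(indicator K :: 'a => real) : borel_measurable (G i)" using Km by simp
   qed (use k(2,4) in auto)
   thus "(%n. integral\<^sup>L (G i) (k n)) ---> measure (G i) K" using Km by simp
  qed
  moreover have "0 <= (SUM i:I. a i * integral\<^sup>L (G i) (k n))" for n by (rule pos) (use k in auto)
  ultimately show ?thesis using LIMSEQ_le_const by blast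
 qed
 have "EX K. compact K & K <= A & (\<forall>i\<in>I. measure (G i) A < measure (G i) K + 1 / real (Suc n))" for n
 proof -
  have "\<forall>i\<in>I. EX K. compact K & K <= A & measure (G i) A < measure (G i) K + 1 / real (Suc n)"
   using finite_measure_compact_approx[OF G A(1), of _ "1 / real (Suc n)"] by simp
  then obtain K where K: "!!i. i : I ==> compact (K i) & K i <= A & measure (G i) A < measure (G i) (K i) + 1 / real (Suc n)"
   by metis
  have cU: "compact (\<Union>i\<in>I. K i)" using K I by (intro compact_UN) auto
  have "measure (G i) A < measure (G i) (\<Union>i\<in>I. K i) + 1 / real (Suc n)" if i: "i : I" for i
  proof -
   interpret finite_measure "G i" by (rule G(2)[OF i])
   have "measure (G i) (K i) <= measure (G i) (\<Union>i\<in>I. K i)"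
    by (rule finite_measure_mono) (use i G(1)[OF i] compact_imp_closed[OF cU] in auto)
   thus ?thesis using K[OF i] by linarith
  qed
  thus ?thesis using cU K by (intro exI[of _ "\<Union>i\<in>I. K i"]) blast
 qed
 then obtain K where K: "!!n. compact (K n)" "!!n. K n <= A" "!!n i. i : I ==> measure (G i) A < measure (G i) (K n) + 1 / real (Suc n)"
  by metis
 have "(%n. SUM i:I. a i * measure (G i) (K n)) ---> (SUM i:I. a i * measure (G i) A)"
 proof (intro tendsto_sum tendsto_mult tendsto_const)
  fix i assume i: "i : I"
  interpret finite_measure "G i" by (rule G(2)[OF i])
  have le: "measure (G i) (K n) <= measure (G i) A" for n
   by (rule finite_measure_mono) (use K(2) A G(1)[OF i] in auto)
  have "(%n. measure (G i) (K n) - measure (G i) A) ---> 0"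
  proof (rule LIMSEQ_null_bound)
   show "(%n. 1 / real (Suc n)) ---> 0" by (rule LIMSEQ_Suc[OF lim_1_over_n])
   show "\<bar>measure (G i) (K n) - measure (G i) A\<bar> <= 1 / real (Suc n)" for n using le[of n] K(3)[OF i, of n] by linarith
  qed
  thus "(%n. measure (G i) (K n)) ---> measure (G i) A" by (simp add: LIM_zero_iff)
 qed
 moreover have "0 <= (SUM i:I. a i * measure (G i) (K n))" for n by (rule cpt[OF K(1) order_trans[OF K(2) A(2)]])
 ultimately show ?thesis using LIMSEQ_le_const by blast
qed

text \<open>About \<open>G\<close> no more is known than the definition of the energy measure says.
  Comparing compact sets with cutoffs shows that its mass is at most that of \<open>H\<close>; inner
  regularity then forces the two to agree.\<close>

lemma measure_unique_CC:
 fixes G H :: "'a measure"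
 assumes G: "sets G = sets borel" and H: "sets H = sets borel" "finite_measure H"
  and eq: "!!k. k : CC ==> integrable G k & integral\<^sup>L G k = integral\<^sup>L H k"
 shows "G = H"
proof -
 interpret H: finite_measure H by fact
 have spaceG: "space G = UNIV" "space H = UNIV" using sets_eq_imp_space_eq[OF G] sets_eq_imp_space_eq[OF H(1)] by auto
 have Kle: "emeasure G K <= ennreal (measure H UNIV)" if K: "compact K" for K
 proof -
  obtain k V where k: "k : CC" "!!x. 0 <= k x" "!!x. k x <= 1" "closure {x. k x ~= 0} <= UNIV" "open V" "K <= V" "!!x. x : V ==> k x = 1"
   by (rule CC_cutoff[OF K open_UNIV subset_UNIV]) (rule that)
  have "emeasure G K = (\<integral>\<^sup>+x. indicator K x \<partial>G)" using compact_imp_closed[OF K] G by simp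
  also have "... <= (\<integral>\<^sup>+x. ennreal (k x) \<partial>G)"
   by (rule nn_integral_mono) (use k in "auto simp: indicator_def")
  also have "... = ennreal (integral\<^sup>L G k)" by (rule nn_integral_eq_integral) (use eq k in auto)
  also have "integral\<^sup>L G k = integral\<^sup>L H k" using eq k by auto
  also have "integral\<^sup>L H k <= (LINT x|H. 1)"
  proof (rule integral_mono)
   show "integrable H k"
    by (rule H.integrable_const_bound[where B=1]) (use k CC_borel[OF k(1)] in "auto simp: measurable_cong_sets[OF H(1) refl]")
  qed (use k in auto)
  also have "(LINT x|H. 1) = measure H UNIV" by (simp add: spaceG)
  finally show ?thesis by (simp add: ennreal_leI)
 qed
 obtain K :: "nat => 'a set" where K: "!!n. compact (K n)" "incseq K" "(\<Union>n. K n) = UNIV"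
  using sigma_compact by blast
 have "emeasure G UNIV = (SUP n. emeasure G (K n))"
 proof -
  have "range K <= sets G" using compact_imp_closed[OF K(1)] G by auto
  from SUP_emeasure_incseq[OF this K(2)] show ?thesis using K(3) by simp
 qed
 also have "... <= ennreal (measure H UNIV)" by (rule SUP_least) (rule Kle[OF K(1)])
 finally have "finite_measure G" by (intro finite_measureI) (auto simp: spaceG top_unique)
 then interpret G: finite_measure G .
 have le: "measure P A <= measure Q A" if PQ: "(P = G & Q = H) \<or> (P = H & Q = G)" and A: "A : sets borel" for P Q A
 proof -
  have "0 <= (SUM i:{True, False}. (if i then -1 else 1) * measure (if i then P else Q) A)"
  proof (rule measure_combination_nonneg[where O'=UNIV])
   show "0 <= (SUM i:{True, False}. (if i then - 1 else 1) * integral\<^sup>L (if i then P else Q) k)" if "k : CC" for k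
    using eq[OF that] PQ by auto
  qed (use PQ G H G.finite_measure_axioms A in auto)
  thus ?thesis by simp
 qed
 show "G = H"
 proof (rule measure_eqI)
  fix A assume "A : sets G"
  hence A: "A : sets borel" using G by simp
  show "emeasure G A = emeasure H A"
   using le[of G H A] le[of H G A] A by (simp add: G.emeasure_eq_measure H.emeasure_eq_measure)
 qed (use G H in auto)
qed

text \<open>The energy measure as it comes from the Riesz representation.
  \<open>energy_measure_eq\<close> identifies it with the definite description, so that its
  properties can be proved for \<open>Gm\<close>.\<close>

definition Gm :: "('a => real) => 'a measure" where
 "Gm f = (SOME G. sets G = sets borel & finite_measure G & (\<forall>k\<in>CC. integral\<^sup>L G k = Lb f f k) & measure G UNIV <= E f f)"

lemma Gm_props:
 assumes f: "f : F"
 shows sets_Gm: "sets (Gm f) = sets borel" and finite_Gm: "finite_measure (Gm f)"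
  and integral_Gm: "!!k. k : CC ==> integral\<^sup>L (Gm f) k = Lb f f k" and Gm_le: "measure (Gm f) UNIV <= E f f"
proof -
 have "EX G. sets G = sets borel & finite_measure G & (\<forall>k\<in>CC. integral\<^sup>L G k = Lb f f k) & measure G UNIV <= E f f"
 proof (rule Riesz_CC)
  show "Lb f f (%x. h x + k x) = Lb f f h + Lb f f k" if "h : CC" "k : CC" for h k
   using Lb_lin3[OF f f CC_TF[OF that(1)] CC_TF[OF that(2)], of 1 1] CC_TF[OF CC_add[OF that]] by simp
  show "Lb f f (%x. c * k x) = c * Lb f f k" if "k : CC" for c k
   using Lb_lin3[OF f f CC_TF[OF that] CC_TF[OF that], of c 0] CC_TF[OF CC_scale[OF that, of c]] by simp
  show "0 <= Lb f f k" if "k : CC" "!!x. 0 <= k x" for k by (rule Lb_nonneg[OF f CC_TF[OF that(1)] that(2)])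
  show "Lb f f k <= E f f" if "k : CC" "!!x. 0 <= k x" "!!x. k x <= 1" for k
   using Lb_le_form[OF f CC_TF[OF that(1)] that(2,3)] by simp
 qed
 from someI_ex[OF this] show "sets (Gm f) = sets borel" "finite_measure (Gm f)"
  "!!k. k : CC ==> integral\<^sup>L (Gm f) k = Lb f f k" "measure (Gm f) UNIV <= E f f"
  unfolding Gm_def by auto
qed

lemma space_Gm: "f : F ==> space (Gm f) = UNIV"
 using sets_eq_imp_space_eq[OF sets_Gm] by simp

lemma CC_integrable_finite:
 assumes "sets G = sets borel" "finite_measure G" "k : CC"
 shows "integrable G k"
proof -
 interpret finite_measure G by fact
 obtain b where b: "!!x. \<bar>k x\<bar> <= b" using bF_bound[OF CC_bF[OF assms(3)]] by blast
 have "k : borel_measurable G" using CC_borel[OF assms(3)] by (subst measurable_cong_sets[OF assms(1) refl])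
 thus ?thesis by (rule integrable_const_bound[where B=b, rotated]) (use b in auto)
qed

lemma Gm_combination:
 assumes I: "finite I" and f: "!!i. i : I ==> f i : F" and O: "open O'"
  and pos: "!!k. k : CC ==> (!!x. 0 <= k x) ==> closure {x. k x ~= 0} <= O' ==> 0 <= (SUM i:I. a i * Lb (f i) (f i) k)"
  and A: "A : sets borel" "A <= O'"
 shows "0 <= (SUM i:I. a i * measure (Gm (f i)) A)"
 by (rule measure_combination_nonneg[OF I sets_Gm[OF f] finite_Gm[OF f] O _ A])
  (use pos integral_Gm[OF f] in "auto cong: sum.cong")

text \<open>Lists of coefficients and functions allow linear relations between several energy
  measures to be written down term by term.\<close>

lemma Gm_combination_list:
 assumes f: "!!a g. (a, g) : set xs ==> g : F" and O: "open O'"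
  and pos: "!!k. k : CC ==> (!!x. 0 <= k x) ==> closure {x. k x ~= 0} <= O' ==> 0 <= (\<Sum>(a, g)\<leftarrow>xs. a * Lb g g k)"
  and A: "A : sets borel" "A <= O'"
 shows "0 <= (\<Sum>(a, g)\<leftarrow>xs. a * measure (Gm g) A)"
proof -
 have s: "(\<Sum>(a, g)\<leftarrow>xs. a * h g) = (SUM i:{..<length xs}. fst (xs ! i) * h (snd (xs ! i)))" for h :: "('a => real) => real"
  by (simp add: sum_list_sum_nth atLeast0LessThan case_prod_beta)
 show ?thesis unfolding s
 proof (rule Gm_combination[OF _ _ O _ A])
  show "snd (xs ! i) : F" if "i : {..<length xs}" for i using that f[of "fst (xs ! i)" "snd (xs ! i)"] by simp
 qed (use pos s in auto)
qed

lemma Lb_plus: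
 assumes "f : F" "g : F" "k : TF"
 shows "Lb (%x. f x + g x) (%x. f x + g x) k = Lb f f k + 2 * Lb f g k + Lb g g k"
 using Lb_add[OF assms(1,2) dom_add[OF assms(1,2)] assms(3)] Lb_add[OF assms(1,2,1,3)] Lb_add[OF assms(1,2,2,3)]
  Lb_sym[of "%x. f x + g x" f k] Lb_sym[of "%x. f x + g x" g k] Lb_sym[of g f k] by simp

lemma Lb_minus:
 assumes "f : F" "g : F" "k : TF"
 shows "Lb (%x. f x - g x) (%x. f x - g x) k = Lb f f k - 2 * Lb f g k + Lb g g k"
 using Lb_diff[OF assms(1,2) dom_diff[OF assms(1,2)] assms(3)] Lb_diff[OF assms(1,2,1,3)] Lb_diff[OF assms(1,2,2,3)]
  Lb_sym[of "%x. f x - g x" f k] Lb_sym[of "%x. f x - g x" g k] Lb_sym[of g f k] by simp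

lemma Lb_scaled: "f : F ==> k : TF ==> Lb (%x. c * f x) (%x. c * f x) k = c\<^sup>2 * Lb f f k"
 using Lb_scale[of f "%x. c * f x" k c] Lb_scale[of f f k c] Lb_sym[of f "%x. c * f x" k] dom_scale[of f c]
 by (simp add: power2_eq_square)

lemma Lb_young:
 assumes "f : F" "g : F" "k : TF" "!!x. 0 <= k x" "0 < s"
 shows "2 * Lb f g k <= s * Lb f f k + (1/s) * Lb g g k"
proof -
 have "0 <= Lb (%x. s * f x - g x) (%x. s * f x - g x) k"
  by (rule Lb_nonneg[OF dom_diff[OF dom_scale[OF assms(1)] assms(2)] assms(3,4)])
 also have "... = s\<^sup>2 * Lb f f k - 2 * (s * Lb f g k) + Lb g g k"
  unfolding Lb_minus[OF dom_scale[OF assms(1)] assms(2,3)] Lb_scaled[OF assms(1,3)] Lb_scale[OF assms(1,2,3)] ..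
 finally have "s * (2 * Lb f g k) <= s * (s * Lb f f k + (1/s) * Lb g g k)"
  using assms(5) by (simp add: algebra_simps power2_eq_square)
 thus ?thesis using assms(5) by (rule mult_left_le_imp_le)
qed

lemma Gm_young:
 assumes f: "f : F" and g: "g : F" and s: "0 < s" and A: "A : sets borel"
 shows "measure (Gm (%x. f x + g x)) A <= (1 + s) * measure (Gm f) A + (1 + 1/s) * measure (Gm g) A"
proof -
 have "0 <= (\<Sum>(a, h)\<leftarrow>[(1 + s, f), (1 + 1/s, g), (- 1, %x. f x + g x)]. a * measure (Gm h) A)"
 proof (rule Gm_combination_list[OF _ open_UNIV _ A])
  fix k assume k: "k : CC" "!!x. 0 <= k x"
  show "0 <= (\<Sum>(a, h)\<leftarrow>[(1 + s, f), (1 + 1/s, g), (- 1, %x. f x + g x)]. a * Lb h h k)"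
   using Lb_young[OF f g CC_TF[OF k(1)] k(2) s] Lb_plus[OF f g CC_TF[OF k(1)]] by (simp add: algebra_simps)
 qed (use f g dom_add in auto)
 thus ?thesis by simp
qed

lemma Gm_finite_sub: "f : F ==> A : sets borel ==> measure (Gm f) A <= E f f"
 using finite_measure.bounded_measure[OF finite_Gm, of f A] Gm_le[of f] space_Gm[of f] by simp

text \<open>Young's inequality with a small parameter \<open>s\<close> compares the two measures on
  \<open>A\<close> in both directions, with an error of \<open>s\<close> times the energies plus a
  multiple of the energy of the difference.\<close>

lemma Gm_conv:
 assumes u: "!!n. u n : F" and f: "f : F" and c: "E_conv u f" and A: "A : sets borel"
 shows "(%n. measure (Gm (u n)) A) ---> measure (Gm f) A"
proof (rule LIMSEQ_I)
 fix r :: real assume r: "0 < r"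
 define e where "e n = E (%x. u n x - f x) (%x. u n x - f x)" for n
 have e0: "0 <= e n" for n unfolding e_def by (rule form_nonneg[OF dom_diff[OF u f]])
 have es: "E (%x. f x - u n x) (%x. f x - u n x) = e n" for n
  unfolding e_def using f u form_sym[OF f u, of n] by (simp add: form_diff form_diff2 dom_diff)
 \<comment> \<open>In the limit the error bound becomes \<open>2 * s * E f f\<close>, which this
   choice keeps below \<open>r / 2\<close>.\<close>
 define s where "s = r / (4 * (E f f + 1))"
 have s: "0 < s" unfolding s_def using r form_nonneg[OF f] by simp
 have bound: "\<bar>measure (Gm (u n)) A - measure (Gm f) A\<bar> <= s * (2 * E f f + 2 * e n) + (1 + 1/s) * e n" for n
 proof -
  let ?m = "%g. measure (Gm g) A"
  have d: "(%x. u n x - f x) : F" "(%x. f x - u n x) : F" using dom_diff u f by auto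
  have 1: "?m (u n) <= (1 + t) * ?m f + (1 + 1/t) * e n" if "0 < t" for t
  proof -
   have "?m (%x. f x + (u n x - f x)) <= (1 + t) * ?m f + (1 + 1/t) * ?m (%x. u n x - f x)"
    by (rule Gm_young[OF f d(1) that A])
   also have "... <= (1 + t) * ?m f + (1 + 1/t) * e n"
    unfolding e_def using that by (intro add_mono mult_left_mono Gm_finite_sub d A) auto
   finally show ?thesis by simp
  qed
  have 2: "?m f <= (1 + s) * ?m (u n) + (1 + 1/s) * e n"
  proof -
   have "?m (%x. u n x + (f x - u n x)) <= (1 + s) * ?m (u n) + (1 + 1/s) * ?m (%x. f x - u n x)"
    by (rule Gm_young[OF u d(2) s A])
   also have "... <= (1 + s) * ?m (u n) + (1 + 1/s) * e n"
    unfolding es[symmetric] using s by (intro add_mono mult_left_mono Gm_finite_sub d A) auto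
   finally show ?thesis by simp
  qed
  have mf: "?m f <= E f f" by (rule Gm_finite_sub[OF f A])
  have "?m (u n) <= 2 * E f f + 2 * e n" using 1[of 1] mf by simp
  hence a: "s * ?m (u n) <= s * (2 * E f f + 2 * e n)" using s by simp
  have "?m f <= 2 * E f f + 2 * e n" using mf form_nonneg[OF f] e0[of n] by linarith
  hence b: "s * ?m f <= s * (2 * E f f + 2 * e n)" using s by simp
  show ?thesis using 1[OF s] 2 a b unfolding distrib_right[of 1 s] abs_le_iff by linarith
 qed
 have "(%n. s * (2 * E f f + 2 * e n) + (1 + 1/s) * e n) ---> s * (2 * E f f + 2 * 0) + (1 + 1/s) * 0"
  using c unfolding E_conv_def e_def by (intro tendsto_intros)
 moreover have "s * (2 * E f f + 2 * 0) + (1 + 1/s) * 0 < r"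
 proof -
  have "s * (2 * E f f + 2 * 0) = r / 2 * (E f f / (E f f + 1))"
   unfolding s_def using form_nonneg[OF f] by (simp add: field_simps)
  also have "... <= r / 2 * 1" using r form_nonneg[OF f] by (intro mult_left_mono) auto
  finally show ?thesis using r by simp
 qed
 ultimately have "\<forall>\<^sub>F n in sequentially. s * (2 * E f f + 2 * e n) + (1 + 1/s) * e n < r"
  by (rule order_tendstoD(2))
 hence "\<forall>\<^sub>F n in sequentially. norm (measure (Gm (u n)) A - measure (Gm f) A) < r"
  by eventually_elim (use bound le_less_trans in auto)
 thus "EX no. \<forall>n\<ge>no. norm (measure (Gm (u n)) A - measure (Gm f) A) < r"
  unfolding eventually_sequentially .
qed

lemma energy_measure_bounded_eq:
 assumes f: "f : bF"
 shows "energy_measure_bounded F E f = Gm f"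
 unfolding energy_measure_bounded_def
proof (rule the_equality)
 have fF: "f : F" by (rule bF_F[OF f])
 have eq: "integral\<^sup>L (Gm f) g = E f (%x. f x * g x) - 1/2 * E (%x. (f x)^2) g" if "g : CC" for g
  using integral_Gm[OF fF that] Lb_eq_Eb[OF f f CC_TF[OF that]] Eb_self by simp
 thus "sets (Gm f) = sets borel & (\<forall>g\<in>F \<inter> C_c. integrable (Gm f) g & (LINT x|Gm f. g x) = E f (%x. f x * g x) - 1/2 * E (%x. (f x)^2) g)"
  using sets_Gm[OF fF] CC_integrable_finite[OF sets_Gm[OF fF] finite_Gm[OF fF]] by (auto simp: CC_def)
 fix G assume G: "sets G = sets borel & (\<forall>g\<in>F \<inter> C_c. integrable G g & (LINT x|G. g x) = E f (%x. f x * g x) - 1/2 * E (%x. (f x)^2) g)"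
 show "G = Gm f"
  by (rule measure_unique_CC[OF _ sets_Gm[OF fF] finite_Gm[OF fF]]) (use G eq in "auto simp: CC_def")
qed

text \<open>Setwise convergence along the truncations is \<open>Gm_conv\<close>; a measure with
  these setwise limits is unique.\<close>

lemma energy_measure_eq:
 assumes f: "f : F"
 shows "energy_measure F E f = Gm f"
 unfolding energy_measure_def
proof (rule the_equality)
 have lim: "(%k. emeasure (energy_measure_bounded F E (trunc_fun k f)) A) ---> emeasure (Gm f) A" if A: "A : sets borel" for A
 proof -
  have "emeasure (energy_measure_bounded F E (trunc_fun k f)) A = ennreal (measure (Gm (trunc_fun k f)) A)" for k
   unfolding energy_measure_bounded_eq[OF trunc_bF[OF f]]
   by (rule finite_measure.emeasure_eq_measure[OF finite_Gm[OF trunc_dom(1)[OF f]]])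
  moreover have "emeasure (Gm f) A = ennreal (measure (Gm f) A)"
   by (rule finite_measure.emeasure_eq_measure[OF finite_Gm[OF f]])
  ultimately show ?thesis
   using Gm_conv[OF trunc_dom(1)[OF f] f trunc_conv(2)[OF f] A] by (simp add: tendsto_ennrealI)
 qed
 thus "sets (Gm f) = sets borel & (\<forall>A\<in>sets borel. (%k. emeasure (energy_measure_bounded F E (trunc_fun k f)) A) ---> emeasure (Gm f) A)"
  using sets_Gm[OF f] by blast
 fix G assume G: "sets G = sets borel & (\<forall>A\<in>sets borel. (%k. emeasure (energy_measure_bounded F E (trunc_fun k f)) A) ---> emeasure G A)"
 show "G = Gm f"
 proof (rule measure_eqI)
  show "sets G = sets (Gm f)" using G sets_Gm[OF f] by simp
  fix A assume "A : sets G"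
  hence "A : sets borel" using G by simp
  thus "emeasure G A = emeasure (Gm f) A" using G lim LIMSEQ_unique by blast
 qed
qed

subsection \<open>Locality\<close>

lemma fun_support_subset:
 assumes "f : borel_measurable borel"
 shows "fun_support (completion M) f <= closure {x. f x ~= 0}"
  and "open V ==> (!!x. x : V ==> f x = 0) ==> fun_support (completion M) f \<inter> V = {}"
  and "closed (fun_support (completion M) f)"
proof -
 have m: "(%x. ennreal \<bar>f x\<bar>) : borel_measurable (completion M)"
  using borel_fun_completion[OF assms] by measurable
 have 0: "fun_support (completion M) f \<inter> V = {}" if V: "open V" "!!x. x : V ==> f x = 0" for V
 proof -
  have "V : sets (completion M)" using V(1) by (intro borel_sets_completion) auto
  hence "emeasure (density (completion M) (%x. ennreal \<bar>f x\<bar>)) V = (\<integral>\<^sup>+x. ennreal \<bar>f x\<bar> * indicator V x \<partial>completion M)"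
   by (rule emeasure_density[OF m])
  also have "... = (\<integral>\<^sup>+x. 0 \<partial>completion M)" by (rule nn_integral_cong) (use V(2) in "auto simp: indicator_def")
  finally have em0: "emeasure (density (completion M) (%x. ennreal \<bar>f x\<bar>)) V = 0" by simp
  have False if "x : fun_support (completion M) f" "x : V" for x
  proof -
   have "0 < emeasure (density (completion M) (%x. ennreal \<bar>f x\<bar>)) V"
    using that V(1) unfolding fun_support_def measure_support_def by blast
   thus False unfolding em0 by simp
  qed
  thus ?thesis by blast
 qed
 thus "open V ==> (!!x. x : V ==> f x = 0) ==> fun_support (completion M) f \<inter> V = {}" by blast
 have "f x = 0" if "x : - closure {x. f x ~= 0}" for x using that closure_subset[of "{x. f x ~= 0}"] by blast
 from 0[OF open_Compl[OF closed_closure] this] have "fun_support (completion M) f \<inter> - closure {x. f x ~= 0} = {}"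
  by blast
 thus "fun_support (completion M) f <= closure {x. f x ~= 0}" by blast
 have "- fun_support (completion M) f = \<Union>{U. open U & emeasure (density (completion M) (%x. ennreal \<bar>f x\<bar>)) U = 0}"
  unfolding fun_support_def measure_support_def by (auto simp only: Compl_iff mem_Collect_eq not_all not_imp not_less le_zero_eq Union_iff set_eq_iff)
 moreover have "open (\<Union>{U. open U & emeasure (density (completion M) (%x. ennreal \<bar>f x\<bar>)) U = 0})" by blast
 ultimately have "open (- fun_support (completion M) f)" by simp
 thus "closed (fun_support (completion M) f)" by (simp add: closed_def)
qed

lemma form_local:
 assumes f: "f : CC" and g: "g : CC" and V: "open V" "closure {x. g x ~= 0} <= V" and a: "!!x. x : V ==> f x = a"
 shows "E f g = 0"
proof (rule strongly_local[OF CC_F[OF f] CC_F[OF g], where a=a])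
 have c: "compact (fun_support (completion M) h)" if "h : CC" for h
  using compact_closed_subset[OF CC_supp[OF that] fun_support_subset(3,1)[OF CC_borel[OF that]]] .
 show "compact (fun_support (completion M) f)" "compact (fun_support (completion M) g)" using c f g by auto
 have "fun_support (completion M) (%x. f x - a) \<inter> V = {}"
  by (rule fun_support_subset(2)[OF _ V(1)]) (use a CC_borel[OF f] in auto)
 thus "fun_support (completion M) (%x. f x - a) \<inter> fun_support (completion M) g = {}"
  using fun_support_subset(1)[OF CC_borel[OF g]] V(2) by blast
qed

text \<open>Near the support of \<open>k\<close> the function \<open>f\<close> equals
  \<open>a\<close>. The first term of \<open>Eb\<close> vanishes by locality, and the other two both
  reduce to \<open>a * E g k\<close> and cancel.\<close>

lemma Eb_local:
 assumes f: "f : CC" and g: "g : CC" and k: "k : CC" and V: "open V" "closure {x. k x ~= 0} <= V" and a: "!!x. x : V ==> f x = a"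
 shows "Eb f g k = 0"
proof -
 have gk: "(%x. g x * k x) : CC" and fg: "(%x. f x * g x) : CC" by (intro CC_mult f g k)+
 have "closure {x. g x * k x ~= 0} <= closure {x. k x ~= 0}" by (rule closure_mono) auto
 hence "E f (%x. g x * k x) = 0" using form_local[OF f gk V(1) _ a] V(2) by blast
 moreover have "(%x. f x * k x) = (%x. a * k x)"
 proof
  fix x show "f x * k x = a * k x"
   using a[of x] V(2) closure_subset[of "{x. k x ~= 0}"] by (cases "k x = 0") auto
 qed
 hence "E g (%x. f x * k x) = a * E g k" using form_scale2[OF CC_F[OF k] CC_F[OF g]] by simp
 moreover have "E (%x. f x * g x - a * g x) k = 0"
  by (rule form_local[OF CC_diff[OF fg CC_scale[OF g]] k V, where a=0]) (use a in auto)
 hence "E (%x. f x * g x) k = a * E g k"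
  using form_diff[OF CC_F[OF fg] dom_scale[OF CC_F[OF g]] CC_F[OF k]] form_scale[OF CC_F[OF g] CC_F[OF k]] by simp
 ultimately show ?thesis by (simp add: Eb_def)
qed

lemma Lb_local:
 assumes f: "f : CC" and g: "g : CC" and k: "k : CC" and V: "open V" "closure {x. k x ~= 0} <= V" and a: "!!x. x : V ==> f x = g x + a"
 shows "Lb f f k = Lb g g k"
proof -
 let ?d = "%x. f x - g x"
 have d: "?d : CC" by (rule CC_diff[OF f g])
 note B = CC_bF[OF f] CC_bF[OF g] CC_bF[OF k]
 have "Eb ?d f k = 0" "Eb ?d g k = 0" using Eb_local[OF d _ k V, of _ a] f g a by auto
 hence "Eb f f k = Eb g g k"
  using Eb_diff[OF B(1,2,1,3)] Eb_diff[OF B(1,2,2,3)] Eb_sym[of f g k] by simp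
 thus ?thesis using Lb_eq_Eb[OF B(1,1) CC_TF[OF k]] Lb_eq_Eb[OF B(2,2) CC_TF[OF k]] by simp
qed

lemma CC_dense:
 assumes f: "f : F"
 shows "EX u. (ALL n. u n : CC) & E_conv u f & L2_conv (completion M) u f"
proof -
 have "ALL n. EX g. g : CC & E1_form (completion M) E (%x. f x - g x) (%x. f x - g x) < 1 / real (Suc n)"
  using regular_dom[OF f] unfolding CC_def by (metis of_nat_0_less_iff zero_less_Suc zero_less_divide_1_iff)
 then obtain u where u: "!!n. u n : CC" "!!n. E1_form (completion M) E (%x. f x - u n x) (%x. f x - u n x) < 1 / real (Suc n)"
  by metis
 have lim: "(%n. 1 / real (Suc n)) ---> 0" by (rule LIMSEQ_Suc[OF lim_1_over_n])
 have e: "E (%x. f x - u n x) (%x. f x - u n x) = E (%x. u n x - f x) (%x. u n x - f x)" for n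
  using f CC_F[OF u(1)] form_sym[OF f CC_F[OF u(1)], of n] by (simp add: form_diff form_diff2 dom_diff)
 have i: "ip (completion M) (%x. f x - u n x) (%x. f x - u n x) = ip (completion M) (%x. u n x - f x) (%x. u n x - f x)" for n
  unfolding ip_def by (rule integral_cong) (auto simp: algebra_simps)
 have nn: "0 <= E (%x. u n x - f x) (%x. u n x - f x)" for n by (rule form_nonneg[OF dom_diff[OF CC_F[OF u(1)] f]])
 have "E_conv u f" unfolding E_conv_def
 proof (rule LIMSEQ_null_bound[OF _ lim])
  show "\<bar>E (%x. u n x - f x) (%x. u n x - f x)\<bar> <= 1 / real (Suc n)" for n
   using u(2)[of n] nn[of n] ip_nonneg[of "completion M" "%x. u n x - f x"] unfolding E1_form_eq e i by linarith
 qed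
 moreover have "L2_conv (completion M) u f" unfolding L2_conv_def
 proof (rule LIMSEQ_null_bound[OF _ lim])
  show "\<bar>ip (completion M) (%x. u n x - f x) (%x. u n x - f x)\<bar> <= 1 / real (Suc n)" for n
   using u(2)[of n] nn[of n] ip_nonneg[of "completion M" "%x. u n x - f x"] unfolding E1_form_eq e i by linarith
 qed
 ultimately show ?thesis using u(1) by blast
qed

text \<open>There is no jump and no killing part. For a test function \<open>u\<close>, a cutoff
  equal to 1 near its support yields \<open>E u u\<close> from the first term of the identity, while
  the second vanishes by strong locality. Density and \<open>Gm_conv\<close> extend this to
  \<open>F\<close>.\<close>

lemma Gm_total:
 assumes f: "f : F"
 shows "measure (Gm f) UNIV = E f f"
proof -
 have CCt: "measure (Gm u) UNIV = E u u" if u: "u : CC" for u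
 proof (rule antisym[OF Gm_le[OF CC_F[OF u]]])
  interpret finite_measure "Gm u" by (rule finite_Gm[OF CC_F[OF u]])
  obtain k V where k: "k : CC" "!!x. 0 <= k x" "!!x. k x <= 1" "closure {x. k x ~= 0} <= UNIV" "open V" "closure {x. u x ~= 0} <= V" "!!x. x : V ==> k x = 1"
   by (rule CC_cutoff[OF CC_supp[OF u] open_UNIV subset_UNIV]) (rule that)
  have "(%x. u x * k x) = u"
  proof
   fix x show "u x * k x = u x"
    using k(6,7) closure_subset[of "{x. u x ~= 0}"] by (cases "u x = 0") auto
  qed
  moreover have "E (%x. (u x)^2) k = 0"
  proof -
   have uu: "(%x. (u x)^2) : CC" using CC_mult[OF u u] by (simp add: power2_eq_square)
   have "closure {x. (u x)^2 ~= 0} <= V" using k(6) by simp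
   from form_local[OF k(1) uu k(5) this k(7)] show ?thesis using form_sym[OF CC_F[OF uu] CC_F[OF k(1)]] by simp
  qed
  ultimately have "integral\<^sup>L (Gm u) k = E u u"
   using integral_Gm[OF CC_F[OF u] k(1)] Lb_eq_Eb[OF CC_bF[OF u] CC_bF[OF u] CC_TF[OF k(1)]] Eb_self[of u k] by simp
  moreover have "integral\<^sup>L (Gm u) k <= (LINT x|Gm u. 1)"
   by (rule integral_mono[OF CC_integrable_finite[OF sets_Gm[OF CC_F[OF u]] finite_Gm[OF CC_F[OF u]] k(1)]]) (use k in auto)
  ultimately show "E u u <= measure (Gm u) UNIV" by (simp add: space_Gm[OF CC_F[OF u]])
 qed
 obtain u where u: "!!n. u n : CC" "E_conv u f" using CC_dense[OF f] by blast
 have "(%n. measure (Gm (u n)) UNIV) ---> measure (Gm f) UNIV"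
  by (rule Gm_conv[OF CC_F[OF u(1)] f u(2)]) simp
 moreover have "(%n. E (u n) (u n)) ---> E f f"
  by (rule E_conv_form[OF CC_F[OF u(1)] f CC_F[OF u(1)] f u(2) u(2)])
 ultimately show ?thesis using CCt[OF u(1)] LIMSEQ_unique by simp
qed

text \<open>The contraction principle is global, but on \<open>O'\<close> the functions may be
  replaced by \<open>w\<close> and \<open>Psi\<close>, which differ from them by constants there.
  The constant \<open>L\<close> can thus be a local one for \<open>u\<close> in terms of
  \<open>Phi\<close>.\<close>

lemma Gm_local_contraction:
 fixes Phi Psi :: "'a => 'b::euclidean_space"
 assumes u: "u : CC" and w: "w : CC" and Phi: "!!i. i : Basis ==> (%x. Phi x \<bullet> i) : CC" and Psi: "!!i. i : Basis ==> (%x. Psi x \<bullet> i) : CC"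
  and O: "open O'" and uw: "!!x. x : O' ==> u x = w x + a" and PhiPsi: "!!x. x : O' ==> Phi x = Psi x + b"
  and L: "0 <= L" and lip: "!!x y. \<bar>w x - w y\<bar> <= L * norm (Psi x - Psi y)" and lip0: "!!x. \<bar>w x\<bar> <= L * norm (Psi x)"
  and A: "A : sets borel" "A <= O'"
 shows "measure (Gm u) A <= L\<^sup>2 * (SUM i:Basis. measure (Gm (%x. Phi x \<bullet> i)) A)"
proof -
 define c :: "'b \<times> real => real" where "c i = (if snd i = 0 then L\<^sup>2 else -1)" for i
 have c: "(SUM i:Basis. c (i, 0) * g i) + c (0, 1) * h = L\<^sup>2 * (SUM i:Basis. g i) - h" for g h
  by (simp add: c_def sum_distrib_left)
 have "0 <= (SUM i:Basis. c i * measure (Gm (%x. (Phi x, u x) \<bullet> i)) A)"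
 proof (rule Gm_combination[OF finite_Basis _ O _ A])
  fix i :: "'b \<times> real" assume "i : Basis"
  thus "(%x. (Phi x, u x) \<bullet> i) : F" using CC_F[OF Phi] CC_F[OF u] by (auto simp: Basis_prod_def)
 next
  fix k assume k: "k : CC" "!!x. 0 <= k x" "closure {x. k x ~= 0} <= O'"
  have 1: "Lb u u k = Lb w w k" by (rule Lb_local[OF u w k(1) O k(3) uw])
  have 2: "Lb (%x. Phi x \<bullet> i) (%x. Phi x \<bullet> i) k = Lb (%x. Psi x \<bullet> i) (%x. Psi x \<bullet> i) k" if "i : Basis" for i
   by (rule Lb_local[OF Phi[OF that] Psi[OF that] k(1) O k(3), where a="b \<bullet> i"]) (simp add: PhiPsi inner_add_left)
  have "Lb w w k <= L\<^sup>2 * (SUM i:Basis. Lb (%x. Psi x \<bullet> i) (%x. Psi x \<bullet> i) k)"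
   using Eb_normal_contraction[where Phi=Psi, OF CC_bF[OF k(1)] k(2) CC_bF[OF Psi] CC_bF[OF w] L lip lip0]
    Lb_eq_Eb[OF CC_bF[OF w] CC_bF[OF w] CC_TF[OF k(1)]] Lb_eq_Eb[OF CC_bF[OF Psi] CC_bF[OF Psi] CC_TF[OF k(1)]]
   by (simp cong: sum.cong)
  thus "0 <= (SUM i:Basis. c i * Lb (%x. (Phi x, u x) \<bullet> i) (%x. (Phi x, u x) \<bullet> i) k)"
   unfolding sum_Basis_prod using c[of "%i. Lb (%x. Phi x \<bullet> i) (%x. Phi x \<bullet> i) k" "Lb u u k"] 1 2 by (simp cong: sum.cong)
 qed
 thus ?thesis
  unfolding sum_Basis_prod using c[of "%i. measure (Gm (%x. Phi x \<bullet> i)) A" "measure (Gm u) A"] by simp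
qed

end

subsection \<open>Sets of zero capacity are not charged\<close>

context mmd_space
begin

definition eng :: "('a => real) => real" where
 "eng f = E f f + ip (completion M) f f"

lemma eng_nonneg: "f : F ==> 0 <= eng f"
 by (simp add: eng_def form_nonneg)

lemma eng_add: "f : F ==> g : F ==> eng (%x. f x + g x) <= 2 * eng f + 2 * eng g"
 using form_bound_add[of f g] ip_bound_add[OF F_L2 F_L2, of f g] by (simp add: eng_def)

lemma eng_scale: "f : F ==> eng (%x. c * f x) = c\<^sup>2 * eng f"
 by (simp add: eng_def form_scale form_scale2 dom_scale ip_scale ip_scale2 power2_eq_square algebra_simps)

lemma eng_minus: "f : F ==> g : F ==> eng (%x. f x - g x) = eng (%x. g x - f x)"
 using eng_scale[OF dom_diff, of g f "-1"] by (simp add: minus_diff_eq)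

lemma eng_contraction:
 assumes f: "f : F" and lip: "!!s t. \<bar>psi s - psi t\<bar> <= \<bar>s - t\<bar>" and 0: "psi 0 = (0::real)"
 shows "(%x. psi (f x)) : F" "eng (%x. psi (f x)) <= eng f"
proof -
 show d: "(%x. psi (f x)) : F" using lipschitz_real_compose(1)[OF f, of psi 1] lip 0 by simp
 have "E (%x. psi (f x)) (%x. psi (f x)) <= E f f" using lipschitz_real_compose(2)[OF f, of psi 1] lip 0 by simp
 moreover have "ip (completion M) (%x. psi (f x)) (%x. psi (f x)) <= ip (completion M) f f" unfolding ip_def
 proof (rule integral_mono)
  show "integrable (completion M) (%x. psi (f x) * psi (f x))" by (rule L2_mult_integrable[OF F_L2[OF d] F_L2[OF d]])
  show "integrable (completion M) (%x. f x * f x)" by (rule L2_mult_integrable[OF F_L2[OF f] F_L2[OF f]])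
  show "psi (f x) * psi (f x) <= f x * f x" for x
   using lip[of "f x" 0] 0 power_mono[of "\<bar>psi (f x)\<bar>" "\<bar>f x\<bar>" 2] by (simp add: power2_eq_square)
 qed
 ultimately show "eng (%x. psi (f x)) <= eng f" by (simp add: eng_def)
qed

lemma form_le_eng: "f : F ==> E f f <= eng f" by (simp add: eng_def)
lemma ip_le_eng: "f : F ==> ip (completion M) f f <= eng f" by (simp add: eng_def form_nonneg)

text \<open>The products of \<open>f\<close> with \<open>k n\<close> have bounded energy and tend to
  zero in \<open>L2\<close>, hence weakly in energy; this is all that the first term of
  \<open>Eb\<close> asks for.\<close>

lemma Eb_null_sequence:
 assumes f: "f : bF" and k: "!!n. k n : bF" "!!n x. \<bar>k n x\<bar> <= 1" and e: "(%n. eng (k n)) ---> 0"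
 shows "(%n. Eb f f (k n)) ---> 0"
proof -
 let ?N = "completion M"
 have fF: "f : F" by (rule bF_F[OF f])
 have kF: "k n : F" for n by (rule bF_F[OF k(1)])
 obtain c where c: "0 <= c" "!!x. \<bar>f x\<bar> <= c" by (rule bF_bound[OF f]) (rule that)
 have f2: "(%x. (f x)^2) : F" using bF_F[OF bF_mult[OF f f]] by (simp add: power2_eq_square)
 have ek: "(%n. E (k n) (k n)) ---> 0"
  by (rule LIMSEQ_null_bound[OF _ e]) (use form_nonneg[OF kF] form_le_eng[OF kF] in "simp add: abs_le_iff")
 have ik: "(%n. ip ?N (k n) (k n)) ---> 0"
  by (rule LIMSEQ_null_bound[OF _ e]) (use ip_nonneg ip_le_eng[OF kF] in "simp add: abs_le_iff")
 obtain B where B: "!!n. E (k n) (k n) <= B" using convergent_imp_bounded[OF ek]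
   unfolding bounded_iff real_norm_def by (meson abs_le_D1 rangeI)
 have "(%n. E (%x. (f x)^2) (k n)) ---> 0"
 proof (rule LIMSEQ_null_bound)
  show "\<bar>E (%x. (f x)^2) (k n)\<bar> <= sqrt (E (%x. (f x)^2) (%x. (f x)^2)) * sqrt (E (k n) (k n))" for n
   by (rule form_Cauchy_Schwarz'[OF f2 kF])
  show "(%n. sqrt (E (%x. (f x)^2) (%x. (f x)^2)) * sqrt (E (k n) (k n))) ---> 0"
   using tendsto_mult_right_zero[OF tendsto_real_sqrt[OF ek, unfolded real_sqrt_zero]] .
 qed
 moreover have "(%n. E f (%x. f x * k n x)) ---> E f (%x. 0)"
 proof (rule weak_conv(3)[OF _ _ _ _ fF])
  show "(%x. f x * k n x) : F" for n by (rule bF_F[OF bF_mult[OF f k(1)]])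
  show "E (%x. f x * k n x) (%x. f x * k n x) <= (2 * max c 1)\<^sup>2 * (E f f + B)" for n
  proof -
   have "E (%x. f x * k n x) (%x. f x * k n x) <= (2 * max c 1)\<^sup>2 * (E f f + E (k n) (k n))"
    using c k(2) by (intro form_mult_bound(2)[OF fF kF]) (auto intro: max.coboundedI1 max.coboundedI2)
   also have "... <= (2 * max c 1)\<^sup>2 * (E f f + B)" using B by (intro mult_left_mono) auto
   finally show ?thesis .
  qed
  show "(%x. 0) : L2_fun ?N" by (rule L2_zero)
  show "L2_conv ?N (%n x. f x * k n x) (%x. 0)" unfolding L2_conv_def
  proof (rule LIMSEQ_null_bound)
   show "\<bar>ip ?N (%x. f x * k n x - 0) (%x. f x * k n x - 0)\<bar> <= c\<^sup>2 * ip ?N (k n) (k n)" for n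
   proof -
    have kL: "k n : L2_fun ?N" by (rule F_L2[OF kF])
    have fk: "(%x. f x * k n x) : L2_fun ?N" by (rule F_L2[OF bF_F[OF bF_mult[OF f k(1)]]])
    have "ip ?N (%x. f x * k n x) (%x. f x * k n x) <= (LINT x|?N. c\<^sup>2 * (k n x * k n x))" unfolding ip_def
    proof (rule integral_mono[OF L2_mult_integrable[OF fk fk]])
     show "integrable ?N (%x. c\<^sup>2 * (k n x * k n x))" by (intro integrable_mult_right L2_mult_integrable kL)
     show "f x * k n x * (f x * k n x) <= c\<^sup>2 * (k n x * k n x)" for x
     proof -
      have "(f x)^2 <= c\<^sup>2" using c power_mono[of "\<bar>f x\<bar>" c 2] by simp
      hence "(f x)^2 * (k n x)^2 <= c\<^sup>2 * (k n x)^2" by (rule mult_right_mono) simp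
      thus ?thesis by (simp add: power2_eq_square mult_ac)
     qed
    qed
    thus ?thesis using ip_nonneg[of ?N "%x. f x * k n x"] by (simp add: ip_def)
   qed
   show "(%n. c\<^sup>2 * ip ?N (k n) (k n)) ---> 0" by (rule tendsto_mult_right_zero[OF ik])
  qed
 qed
 ultimately have "(%n. E f (%x. f x * k n x) - 1/2 * E (%x. (f x)^2) (k n)) ---> E f (%x. 0) - 1/2 * 0"
  by (intro tendsto_diff tendsto_mult tendsto_const)
 thus ?thesis by (simp add: Eb_self form_zero2[OF fF])
qed

text \<open>The mass of \<open>C\<close> is at most the integral of any test function above its
  indicator, and \<open>Eb\<close> is monotone for pointwise inequalities. The truncated potential
  is therefore changed on a null set, without changing its energy, so that it lies above a
  continuous cutoff of \<open>C\<close> everywhere.\<close>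

lemma compact_null:
 assumes C: "compact C" and f: "f : F"
  and small: "!!eps. 0 < eps ==> EX g V. g : F & open V & C <= V & (AE x in completion M. x : V --> 1 <= g x) & eng g < eps"
 shows "measure (Gm f) C = 0"
proof -
 let ?N = "completion M"
 have lim: "(%n. 1 / real (Suc n)) ---> 0" by (rule LIMSEQ_Suc[OF lim_1_over_n])
 have "ALL n. EX g V. g : F & open V & C <= V & (AE x in ?N. x : V --> 1 <= g x) & eng g < 1 / real (Suc n)"
  by (intro allI small) simp
 from choice[OF this] obtain g where "ALL n. EX V. g n : F & open V & C <= V & (AE x in ?N. x : V --> 1 <= g n x) & eng (g n) < 1 / real (Suc n)" ..
 from choice[OF this] obtain V where "ALL n. g n : F & open (V n) & C <= V n & (AE x in ?N. x : V n --> 1 <= g n x) & eng (g n) < 1 / real (Suc n)" ..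
 hence g: "!!n. g n : F" "!!n. open (V n)" "!!n. C <= V n"
  "!!n. AE x in ?N. x : V n --> 1 <= g n x" "!!n. eng (g n) < 1 / real (Suc n)" by simp_all
 have "ALL n. \<exists>k\<in>CC. (ALL x. 0 <= k x & k x <= 1) & closure {x. k x ~= 0} <= V n & (EX W. open W & C <= W & (\<forall>x\<in>W. k x = 1))"
  using CC_Urysohn[OF C g(2,3)] by blast
 hence "ALL n. EX k. k : CC & (ALL x. 0 <= k x) & (ALL x. k x <= 1) & closure {x. k x ~= 0} <= V n & (\<forall>x\<in>C. k x = 1)" by blast
 from choice[OF this] obtain eta where "ALL n. eta n : CC & (ALL x. 0 <= eta n x) & (ALL x. eta n x <= 1) & closure {x. eta n x ~= 0} <= V n & (\<forall>x\<in>C. eta n x = 1)" ..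
 hence eta: "!!n. eta n : CC" "!!n x. 0 <= eta n x" "!!n x. eta n x <= 1" "!!n. closure {x. eta n x ~= 0} <= V n" "!!n x. x : C ==> eta n x = 1"
  by simp_all
 define w where "w n x = min (max (g n x) 0) 1" for n x
 define k where "k n x = max (w n x) (eta n x)" for n x
 have w: "w n : F" "eng (w n) <= eng (g n)" for n
  using eng_contraction[OF g(1)[of n], of "%t. min (max t 0) 1"] unfolding w_def[abs_def] by (auto simp: min_def max_def)
 have wk: "AE x in ?N. w n x = k n x" for n
  using g(4)[of n]
 proof eventually_elim
  case (elim x)
  show ?case
  proof (cases "x : V n")
   case True
   thus ?thesis using elim eta(3)[of n x] by (simp add: k_def w_def)
  next
   case False
   hence "eta n x = 0" using eta(4)[of n] closure_subset[of "{x. eta n x ~= 0}"] by blast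
   thus ?thesis by (simp add: k_def w_def)
  qed
 qed
 have km: "k n : borel_measurable ?N" for n
  unfolding k_def[abs_def] using F_meas[OF w(1)] F_meas[OF CC_F[OF eta(1)]] by (intro borel_measurable_max)
 have kF: "k n : F" for n by (rule dom_version[OF w(1) km wk])
 have k01: "0 <= k n x" "k n x <= 1" "eta n x <= k n x" for n x using eta(2,3)[of n x] by (auto simp: k_def w_def)
 have ek: "eng (k n) = eng (w n)" for n
 proof -
  have "E (k n) (k n) = E (w n) (w n)"
   using form_version[OF w(1) kF kF wk] form_version2[OF w(1) kF w(1) wk] by simp
  moreover have "ip ?N (k n) (k n) = ip ?N (w n) (w n)"
   using ip_AE_cong[OF F_meas[OF w(1)] F_meas[OF kF] F_meas[OF kF] wk] ip_AE_cong[OF F_meas[OF w(1)] F_meas[OF kF] F_meas[OF w(1)] wk]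
   by (simp add: ip_commute)
  ultimately show ?thesis by (simp add: eng_def)
 qed
 have kb: "k n : bF" for n by (rule bFI[OF kF, of _ 1]) (use k01 in "auto simp: abs_le_iff intro: order_trans[of _ 0]")
 have lk: "(%n. eng (k n)) ---> 0"
  by (rule LIMSEQ_null_bound[OF _ lim]) (use eng_nonneg[OF kF] ek w(2) g(5) in "smt (verit)")
 have bdd: "measure (Gm h) C = 0" if h: "h : bF" for h
 proof -
  have hF: "h : F" by (rule bF_F[OF h])
  interpret G: finite_measure "Gm h" by (rule finite_Gm[OF hF])
  have [measurable]: "C : sets (Gm h)" by (simp add: sets_Gm[OF hF] borel_compact[OF C])
  have "measure (Gm h) C <= Eb h h (k n)" for n
  proof -
   have "measure (Gm h) C = (LINT x|Gm h. indicator C x)" using space_Gm[OF hF] by simp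
   also have "... <= (LINT x|Gm h. eta n x)"
   proof (rule integral_mono)
    show "integrable (Gm h) (indicat_real C)"
     by (rule G.integrable_const_bound[where B=1]) (auto simp: indicator_def)
    show "integrable (Gm h) (eta n)" by (rule CC_integrable_finite[OF sets_Gm[OF hF] finite_Gm[OF hF] eta(1)])
    show "indicat_real C x <= eta n x" for x using eta(2)[of n x] eta(5)[of x n] by (simp add: indicator_def)
   qed
   also have "... = Lb h h (eta n)" by (rule integral_Gm[OF hF eta(1)])
   also have "... = Eb h h (eta n)" by (rule Lb_eq_Eb[OF h h CC_TF[OF eta(1)]])
   also have "... <= Eb h h (k n)"
    using Eb_nonneg[OF h bF_diff[OF kb[of n] CC_bF[OF eta(1)[of n]]]] k01(3)[where n=n] Eb_diff3[OF h h kb[of n] CC_bF[OF eta(1)[of n]]] by simp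
   finally show ?thesis .
  qed
  hence "measure (Gm h) C <= 0"
   using Eb_null_sequence[OF h kb _ lk] k01 by (intro LIMSEQ_le_const) (auto simp: abs_le_iff intro: order_trans[of _ 0])
  thus ?thesis by (simp add: measure_le_0_iff)
 qed
 have "trunc_fun n f : bF" for n
  by (rule bFI[OF trunc_dom(1)[OF f], of _ "real n"]) (auto simp: trunc_fun_def)
 hence "(%n. measure (Gm (trunc_fun n f)) C) = (%n. 0)" using bdd by simp
 thus ?thesis
  using Gm_conv[OF trunc_dom(1)[OF f] f trunc_conv(2)[OF f] borel_compact[OF C]] by (simp add: LIMSEQ_const_iff)
qed

lemma capacity_witness:
 assumes "capacity M F E U < ennreal e"
 shows "EX g V. g : F & open V & U <= V & (AE x in completion M. x : V --> g x = 1) & eng g < e"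
proof -
 obtain g where g: "g : F" "EX V. open V & U <= V & (AE x in M. x : V --> g x = 1)" "ennreal (E1_form (completion M) E g g) < ennreal e"
  using assms unfolding capacity_def INF_less_iff by auto
 have "eng g < e" using g(3) eng_nonneg[OF g(1)] unfolding E1_form_eq eng_def by (simp add: ennreal_less_iff)
 thus ?thesis using g(1,2) AE_completion by blast
qed

text \<open>A Borel-Cantelli argument. \<open>W l\<close> collects the points where
  \<open>u l\<close> is far from \<open>f\<close> or where \<open>f\<close> may be discontinuous,
  \<open>w l\<close> is a potential for it with energy of order \<open>(1/4) ^ l\<close>, and
  \<open>N\<close> is the upper limit of the \<open>W l\<close>. Off \<open>N\<close> the sequence
  converges; energy measures vanish on compact subsets of \<open>N\<close> by
  \<open>compact_null\<close>, hence on \<open>N\<close>.\<close>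

lemma quasicontinuous_approx:
 assumes f: "f : F" and q: "quasicontinuous M F E f"
 shows "EX u N. (ALL n. u n : CC) & E_conv u f & N : sets borel & (\<forall>g\<in>F. measure (Gm g) N = 0) & (ALL x. x \<notin> N --> (%n. u n x) ---> f x)"
proof -
 let ?N = "completion M"
 have "ALL l. EX g. g : CC & E1_form ?N E (%x. f x - g x) (%x. f x - g x) < (1/16) ^ l"
  using regular_dom[OF f] unfolding CC_def by (metis zero_less_divide_1_iff zero_less_numeral zero_less_power)
 then obtain u where u: "!!l. u l : CC" "!!l. eng (%x. f x - u l x) < (1/16) ^ l" unfolding E1_form_eq eng_def by metis
 have vF: "(%x. f x - u l x) : F" for l by (rule dom_diff[OF f CC_F[OF u(1)]])
 have "ALL l. EX U. open U & capacity M F E U < ennreal ((1/4) ^ l) & continuous_on (- U) f"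
  using q unfolding quasicontinuous_def by simp
 then obtain U where U: "!!l. open (U l)" "!!l. capacity M F E (U l) < ennreal ((1/4) ^ l)" "!!l. continuous_on (- U l) f" by metis
 have "ALL l. EX g V. g : F & open V & U l <= V & (AE x in ?N. x : V --> g x = 1) & eng g < (1/4) ^ l"
  by (intro allI capacity_witness[OF U(2)])
 from choice[OF this] obtain g where "ALL l. EX V. g l : F & open V & U l <= V & (AE x in ?N. x : V --> g l x = 1) & eng (g l) < (1/4) ^ l" ..
 from choice[OF this] obtain V where "ALL l. g l : F & open (V l) & U l <= V l & (AE x in ?N. x : V l --> g l x = 1) & eng (g l) < (1/4) ^ l" ..
 hence g: "!!l. g l : F" "!!l. U l <= V l" "!!l. AE x in ?N. x : V l --> g l x = 1" "!!l. eng (g l) < (1/4) ^ l" by simp_all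
 define W where "W l = {x. (1/2) ^ l < \<bar>f x - u l x\<bar>} \<union> U l" for l
 define w where "w l x = 2 ^ l * \<bar>f x - u l x\<bar> + \<bar>g l x\<bar>" for l x
 \<comment> \<open>Off \<open>U l\<close> the function \<open>f\<close> is continuous, so the points
   there with small deviation form a closed set.\<close>
 have W_open: "open (W l)" for l
 proof -
  have c: "continuous_on (- U l) (%x. \<bar>f x - u l x\<bar>)"
   by (intro continuous_on_rabs continuous_on_diff U(3) continuous_on_subset[OF CC_cont[OF u(1)]]) simp
  have "closed (- U l \<inter> (%x. \<bar>f x - u l x\<bar>) -` {..(1/2) ^ l})"
   by (rule continuous_closed_preimage[OF c]) (use U(1) in auto)
  moreover have "- W l = - U l \<inter> (%x. \<bar>f x - u l x\<bar>) -` {..(1/2) ^ l}" by (auto simp: W_def)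
  ultimately have "closed (- W l)" by (simp only:)
  thus ?thesis by (simp only: closed_def double_complement)
 qed
 have absv: "(%x. \<bar>f x - u l x\<bar>) : F" "eng (%x. \<bar>f x - u l x\<bar>) <= eng (%x. f x - u l x)" for l
  using eng_contraction[OF vF, of abs l] by auto
 have absg: "(%x. \<bar>g l x\<bar>) : F" "eng (%x. \<bar>g l x\<bar>) <= eng (g l)" for l
  using eng_contraction[OF g(1), of abs l] by auto
 have wF: "w l : F" for l unfolding w_def[abs_def] by (intro dom_add dom_scale absv absg)
 have w0: "0 <= w l x" for l x by (simp add: w_def)
 have wW: "AE x in ?N. x : W l --> 1 <= w l x" for l
  using g(3)[of l]
 proof eventually_elim
  case (elim x)
  show ?case
  proof
   assume x: "x : W l"
   show "1 <= w l x"
   proof (cases "x : U l")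
    case True
    thus ?thesis using elim g(2)[of l] by (auto simp: w_def)
   next
    case False
    hence "(1/2) ^ l <= \<bar>f x - u l x\<bar>" using x by (simp add: W_def)
    hence "2 ^ l * (1/2) ^ l <= 2 ^ l * \<bar>f x - u l x\<bar>" by simp
    hence "1 <= 2 ^ l * \<bar>f x - u l x\<bar>" by (simp add: power_one_over)
    thus ?thesis by (simp add: w_def)
   qed
  qed
 qed
 \<comment> \<open>The squared factor \<open>4 ^ l\<close> against \<open>(1/16) ^ l\<close> from
   the choice of \<open>u l\<close> leaves \<open>(1/4) ^ l\<close>, the same rate as for
   \<open>g l\<close>.\<close>
 have we: "eng (w l) <= 4 * (1/4) ^ l" for l
 proof -
  have "eng (w l) <= 2 * eng (%x. 2 ^ l * \<bar>f x - u l x\<bar>) + 2 * eng (%x. \<bar>g l x\<bar>)"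
   unfolding w_def[abs_def] by (rule eng_add[OF dom_scale[OF absv(1)] absg(1)])
  also have "eng (%x. 2 ^ l * \<bar>f x - u l x\<bar>) = (2 ^ l)^2 * eng (%x. \<bar>f x - u l x\<bar>)" by (rule eng_scale[OF absv(1)])
  also have "... <= (2 ^ l)\<^sup>2 * (1/16) ^ l" using absv(2)[of l] u(2)[of l] by (intro mult_left_mono) auto
  also have "(2 ^ l)^2 * (1/16) ^ l = (1/4 :: real) ^ l"
   by (simp add: power_mult[symmetric] mult.commute[of l] power_mult flip: power_mult_distrib)
  finally show ?thesis using absg(2)[of l] g(4)[of l] by simp
 qed
 \<comment> \<open>Splitting off one summand doubles both energies. At the rate \<open>1/4\<close>
   the constant 16 reproduces itself: \<open>2 * 4 + 2 * 16 / 4 = 16\<close>.\<close>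
 have ws: "(%x. \<Sum>j<m. w (k + j) x) : F & eng (%x. \<Sum>j<m. w (k + j) x) <= 16 * (1/4) ^ k" for m k
 proof (induction m arbitrary: k)
  case 0
  show ?case using eng_scale[OF dom_zero, of 0] by (simp add: dom_zero)
 next
  case (Suc m)
  have eq: "(%x. \<Sum>j<Suc m. w (k + j) x) = (%x. w k x + (\<Sum>j<m. w (Suc k + j) x))"
   by (rule ext) (subst sum.lessThan_Suc_shift, simp)
  have 1: "(%x. \<Sum>j<m. w (Suc k + j) x) : F" "eng (%x. \<Sum>j<m. w (Suc k + j) x) <= 16 * (1/4) ^ Suc k" using Suc[of "Suc k"] by auto
  have "eng (%x. w k x + (\<Sum>j<m. w (Suc k + j) x)) <= 2 * eng (w k) + 2 * eng (%x. \<Sum>j<m. w (Suc k + j) x)"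
   by (rule eng_add[OF wF 1(1)])
  also have "... <= 16 * (1/4) ^ k" using we[of k] 1(2) by simp
  finally show ?case unfolding eq using dom_add[OF wF 1(1)] by blast
 qed
 define N where "N = (\<Inter>k. \<Union>l\<in>{k..}. W l)"
 have Nb: "N : sets borel" unfolding N_def by (intro sets.countable_INT'' sets.countable_UN'' borel_open W_open) auto
 have K0: "measure (Gm h) K = 0" if K: "compact K" "K <= N" and h: "h : F" for K h
 proof (rule compact_null[OF K(1) h])
  fix eps :: real assume "0 < eps"
  hence "EX k. (1/4) ^ k < eps / 16" by (intro real_arch_pow_inv) auto
  then obtain k where k: "(1/4) ^ k < eps / 16" ..
  have "K <= (\<Union>l\<in>{k..}. W l)" using K(2) by (auto simp: N_def)
  \<comment> \<open>By compactness a finite sum of potentials is enough.\<close>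
  then obtain I where I: "I <= {k..}" "finite I" "K <= (\<Union>l\<in>I. W l)" using compactE_image[OF K(1), of "{k..}" W] W_open by auto
  define m where "m = Suc (Max (insert 0 I))"
  have Im: "\<exists>j<m. l = k + j" if "l : I" for l
  proof (intro exI conjI)
   have "l <= Max (insert 0 I)" using that I(2) by (intro Max_ge) auto
   thus "l - k < m" by (simp add: m_def)
   show "l = k + (l - k)" using that I(1) by auto
  qed
  show "EX g V. g : F & open V & K <= V & (AE x in ?N. x : V --> 1 <= g x) & eng g < eps"
  proof (intro exI conjI)
   show "(%x. \<Sum>j<m. w (k + j) x) : F" using ws by blast
   show "open (\<Union>l\<in>I. W l)" using W_open by auto
   show "K <= (\<Union>l\<in>I. W l)" by fact
   have "AE x in ?N. ALL l. x : W l --> 1 <= w l x" using wW by (simp add: AE_all_countable)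
   thus "AE x in ?N. x : (\<Union>l\<in>I. W l) --> 1 <= (\<Sum>j<m. w (k + j) x)"
   proof eventually_elim
    case (elim x)
    show ?case
    proof
     assume "x : (\<Union>l\<in>I. W l)"
     then obtain l where l: "l : I" "x : W l" by blast
     obtain j where j: "j < m" "l = k + j" using Im[OF l(1)] by blast
     have "1 <= w (k + j) x" using elim l j by simp
     also have "... <= (\<Sum>j<m. w (k + j) x)" using j w0 by (intro member_le_sum) auto
     finally show "1 <= (\<Sum>j<m. w (k + j) x)" .
    qed
   qed
   show "eng (%x. \<Sum>j<m. w (k + j) x) < eps" using ws[of k m] k by auto
  qed
 qed
 have "measure (Gm h) N = 0" if h: "h : F" for h
 proof (rule ccontr)
  assume "measure (Gm h) N ~= 0"
  hence "0 < measure (Gm h) N" using measure_nonneg[of "Gm h" N] by linarith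
  then obtain K where "compact K" "K <= N" "measure (Gm h) N < measure (Gm h) K + measure (Gm h) N"
   using finite_measure_compact_approx[OF sets_Gm[OF h] finite_Gm[OF h] Nb] by blast
  thus False using K0[OF _ _ h] by simp
 qed
 moreover have "(%n. u n x) ---> f x" if xN: "x \<notin> N" for x
 proof -
  obtain k where k: "!!l. k <= l ==> x \<notin> W l" using xN by (auto simp: N_def)
  have "(%n. u n x - f x) ---> 0"
  proof (rule Lim_null_comparison)
   show "\<forall>\<^sub>F l in sequentially. norm (u l x - f x) <= (1/2) ^ l"
    using k by (auto simp: W_def not_less eventually_sequentially abs_minus_commute)
   show "(%l. (1/2::real) ^ l) ---> 0" by (rule LIMSEQ_realpow_zero) auto
  qed
  thus ?thesis by (simp add: LIM_zero_iff)
 qed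
 moreover have "E_conv u f" unfolding E_conv_def
 proof (rule LIMSEQ_null_bound)
  show "\<bar>E (%x. u l x - f x) (%x. u l x - f x)\<bar> <= (1/16) ^ l" for l
   using form_nonneg[OF dom_diff[OF CC_F[OF u(1)] f], of l] form_le_eng[OF dom_diff[OF CC_F[OF u(1)] f], of l]
    eng_minus[OF f CC_F[OF u(1)], of l] u(2)[of l] by simp
  show "(%l. (1/16::real) ^ l) ---> 0" by (rule LIMSEQ_realpow_zero) auto
 qed
 ultimately show ?thesis using u(1) Nb by blast
qed

text \<open>\<open>nu\<close> restricted to the complement of \<open>N\<close> still dominates all
  energy measures; minimality makes \<open>nu\<close> absolutely continuous with respect to this
  restriction.\<close>

lemma minimal_null:
 assumes nu: "minimal_energy_dominant F E nu" and N: "N : sets borel" and 0: "!!g. g : F ==> measure (Gm g) N = 0"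
 shows "emeasure nu N = 0"
proof -
 have s: "sets nu = sets borel" "sigma_finite_measure nu" and ac: "!!f. f : F ==> absolutely_continuous nu (Gm f)"
  using nu energy_measure_eq by (auto simp: minimal_energy_dominant_def energy_dominant_def)
 note [measurable_cong] = s(1)
 note [measurable] = N
 interpret sigma_finite_measure nu by fact
 let ?nu' = "density nu (indicator (- N))"
 have em: "emeasure ?nu' A = emeasure nu (A \<inter> - N)" if "A : sets borel" for A
  using that by (subst emeasure_density) (auto simp: indicator_inter_arith[symmetric] mult.commute s(1))
 have "energy_dominant F E ?nu'" unfolding energy_dominant_def
 proof (intro conjI ballI)
  show "sets ?nu' = sets borel" by (simp add: s(1))
  show "sigma_finite_measure ?nu'"
   using sigma_finite_iff_density_finite[of "indicator (- N)"] by (auto intro!: AE_I2 simp: indicator_def)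
  fix f assume f: "f : F"
  have "emeasure (Gm f) A = 0" if A: "A : sets borel" "emeasure nu (A \<inter> - N) = 0" for A
  proof -
   have "A \<inter> - N : null_sets nu" using A N by (auto simp: null_sets_def s(1))
   hence "emeasure (Gm f) (A \<inter> - N) = 0" using ac[OF f] by (auto simp: absolutely_continuous_def null_sets_def)
   moreover have "emeasure (Gm f) N = 0"
    using finite_measure.emeasure_eq_measure[OF finite_Gm[OF f]] 0[OF f] by simp
   moreover have "emeasure (Gm f) A <= emeasure (Gm f) (A \<inter> - N) + emeasure (Gm f) N"
    using A N by (intro order_trans[OF emeasure_mono[of A "(A \<inter> - N) \<union> N"] emeasure_subadditive]) (auto simp: sets_Gm[OF f])
   ultimately show ?thesis by simp
  qed
  thus "absolutely_continuous ?nu' (energy_measure F E f)"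
   unfolding energy_measure_eq[OF f] absolutely_continuous_def null_sets_def
   using em by (auto simp: s(1) sets_Gm[OF f])
 qed
 hence "absolutely_continuous ?nu' nu" using nu by (auto simp: minimal_energy_dominant_def)
 moreover have "N : null_sets ?nu'" using em[OF N] by (simp add: null_sets_def s(1) N)
 ultimately have "N : null_sets nu" by (auto simp: absolutely_continuous_def)
 thus ?thesis by auto
qed

end

subsection \<open>Densities of energy measures and the chain rule\<close>

lemma AE_nonneg_of_integrals:
 fixes a :: "'a => real"
 assumes a: "integrable m a" and O: "O' : sets m"
  and pos: "!!A. A : sets m ==> A <= O' ==> 0 <= (LINT x:A|m. a x)"
 shows "AE x in m. x : O' --> 0 <= a x"
proof -
 define A where "A = {x : space m. x : O' & a x < 0}"
 have [measurable]: "a : borel_measurable m" using a by simp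
 have A: "A : sets m" unfolding A_def using O by measurable
 have i: "integrable m (%x. indicator A x * (- a x))" using integrable_mult_indicator[OF A, of "%x. - a x"] a by simp
 have nn: "0 <= indicator A x * (- a x)" for x by (auto simp: A_def indicator_def)
 have "(LINT x|m. indicator A x * (- a x)) = - (LINT x:A|m. a x)" by (simp add: set_lebesgue_integral_def)
 also have "... <= 0" using pos[OF A] by (auto simp: A_def)
 finally have "(LINT x|m. indicator A x * (- a x)) = 0" using integral_nonneg[of m "%x. indicator A x * (- a x)"] nn by simp
 hence "AE x in m. indicator A x * (- a x) = 0" using integral_nonneg_eq_0_iff_AE[OF i] nn by simp
 thus ?thesis using AE_space by eventually_elim (auto simp: A_def indicator_def not_less split: if_splits)
qed

lemma gradient_lipschitz:
 fixes V :: "'c::euclidean_space => real"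
 assumes d: "!!z. (V has_derivative (%v. G z \<bullet> v)) (at z)" and S: "convex S" "!!z. z : S ==> norm (G z) <= w"
  and pq: "p : S" "q : S"
 shows "\<bar>V p - V q\<bar> <= w * norm (p - q)"
proof -
 have "norm (V p - V q) <= w * norm (p - q)"
 proof (rule differentiable_bound[OF S(1), where f'="%z v. G z \<bullet> v"])
  show "(V has_derivative (%v. G z \<bullet> v)) (at z within S)" for z by (rule has_derivative_at_withinI[OF d])
  show "onorm (%v. G z \<bullet> v) <= w" if z: "z : S" for z
  proof (rule onorm_le)
   fix v show "norm (G z \<bullet> v) <= w * norm v"
    using Cauchy_Schwarz_ineq2[of "G z" v] mult_right_mono[OF S(2)[OF z] norm_ge_zero[of v]] by simp
  qed
 qed (use pq in auto)
 thus ?thesis by simp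
qed

locale dominated_mmd_space = mmd_space M F E
 for M :: "'a::polish_space measure" and F E +
 fixes nu :: "'a measure"
 assumes dominant: "energy_dominant F E nu"
begin

lemma sets_nu [measurable_cong, simp]: "sets nu = sets borel" and sigma_finite_nu: "sigma_finite_measure nu"
 and Gm_ac: "f : F ==> absolutely_continuous nu (Gm f)"
 using dominant energy_measure_eq by (auto simp: energy_dominant_def)

sublocale nu: sigma_finite_measure nu by (rule sigma_finite_nu)

lemma space_nu [simp]: "space nu = UNIV"
 using sets_eq_imp_space_eq[OF sets_nu] by simp

definition dens :: "('a => real) => 'a => real" where
 "dens f = (SOME r. integrable nu r & (ALL x. 0 <= r x) & (\<forall>A\<in>sets borel. (LINT x:A|nu. r x) = measure (Gm f) A))"

lemma dens_props:
 assumes f: "f : F"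
 shows dens_integrable: "integrable nu (dens f)" and dens_nonneg: "!!x. 0 <= dens f x"
  and dens_integral: "!!A. A : sets borel ==> (LINT x:A|nu. dens f x) = measure (Gm f) A"
proof -
 interpret G: finite_measure "Gm f" by (rule finite_Gm[OF f])
 have s: "sets (Gm f) = sets nu" by (simp add: sets_Gm[OF f])
 obtain D where D: "D : borel_measurable nu" "AE x in nu. RN_deriv nu (Gm f) x = ennreal (D x)" "!!x. 0 <= D x"
  by (rule nu.real_RN_deriv[OF finite_Gm[OF f] Gm_ac[OF f] s]) (rule that)
 note [measurable] = D(1)
 have G: "Gm f = density nu (%x. ennreal (D x))"
  using nu.density_RN_deriv[OF Gm_ac[OF f] s] density_cong[OF _ _ D(2)] by simp
 have em: "emeasure (Gm f) A = (\<integral>\<^sup>+x. ennreal (D x) * indicator A x \<partial>nu)" if "A : sets borel" for A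
  using that unfolding G by (subst emeasure_density) auto
 have "(\<integral>\<^sup>+x. ennreal (D x) \<partial>nu) < \<infinity>" using em[of UNIV] G.emeasure_finite[of UNIV] by (simp add: less_top[symmetric])
 hence "integrable nu D" using D(3) by (intro integrableI_nonneg) auto
 moreover have "(LINT x:A|nu. D x) = measure (Gm f) A" if A: "A : sets borel" for A
 proof -
  have "(LINT x:A|nu. D x) = enn2real (\<integral>\<^sup>+x. ennreal (indicator A x * D x) \<partial>nu)"
   unfolding set_lebesgue_integral_def using A D(3) by (subst integral_eq_nn_integral) auto
  also have "(\<integral>\<^sup>+x. ennreal (indicator A x * D x) \<partial>nu) = emeasure (Gm f) A"
   unfolding em[OF A] by (intro nn_integral_cong) (auto simp: indicator_def)
  finally show ?thesis by (simp add: measure_def)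
 qed
 ultimately have "EX r. integrable nu r & (ALL x. 0 <= r x) & (\<forall>A\<in>sets borel. (LINT x:A|nu. r x) = measure (Gm f) A)"
  using D(3) by blast
 from someI_ex[OF this] show "integrable nu (dens f)" "!!x. 0 <= dens f x" "!!A. A : sets borel ==> (LINT x:A|nu. dens f x) = measure (Gm f) A"
  unfolding dens_def by auto
qed

lemma set_integrable_nu: "integrable nu a ==> A : sets borel ==> set_integrable nu A (a :: 'a => real)"
 unfolding set_integrable_def by (rule integrable_mult_indicator) auto

lemma dens_list:
 assumes "!!a g. (a, g) : set xs ==> g : F"
 shows "integrable nu (%x. \<Sum>(a, g)\<leftarrow>xs. a * dens g x) &
  (\<forall>A\<in>sets borel. (LINT x:A|nu. (\<Sum>(a, g)\<leftarrow>xs. a * dens g x)) = (\<Sum>(a, g)\<leftarrow>xs. a * measure (Gm g) A))"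
 using assms
proof (induction xs)
 case (Cons y ys)
 obtain b h where y: "y = (b, h)" by (cases y)
 have h: "h : F" using Cons.prems[of b h] y by simp
 have IH: "integrable nu (%x. \<Sum>(a, g)\<leftarrow>ys. a * dens g x)"
  "!!A. A : sets borel ==> (LINT x:A|nu. (\<Sum>(a, g)\<leftarrow>ys. a * dens g x)) = (\<Sum>(a, g)\<leftarrow>ys. a * measure (Gm g) A)"
  using Cons by auto
 have i: "integrable nu (%x. b * dens h x)" by (rule integrable_mult_right[OF dens_integrable[OF h]])
 have "(LINT x:A|nu. b * dens h x + (\<Sum>(a, g)\<leftarrow>ys. a * dens g x)) = b * measure (Gm h) A + (\<Sum>(a, g)\<leftarrow>ys. a * measure (Gm g) A)"
  if A: "A : sets borel" for A
  by (subst set_integral_add(2)[OF set_integrable_nu[OF i A] set_integrable_nu[OF IH(1) A]]) (simp add: dens_integral[OF h A] IH(2)[OF A])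
 thus ?case using i IH(1) y by simp
qed (simp add: set_lebesgue_integral_def)

text \<open>Linear inequalities between the functionals \<open>Lb\<close> descend to the densities,
  almost everywhere. The algebraic rules for \<open>gam\<close> are obtained in this way.\<close>

lemma dens_combination:
 assumes f: "!!a g. (a, g) : set xs ==> g : F"
  and pos: "!!k. k : CC ==> (!!x. 0 <= k x) ==> 0 <= (\<Sum>(a, g)\<leftarrow>xs. a * Lb g g k)"
 shows "AE x in nu. 0 <= (\<Sum>(a, g)\<leftarrow>xs. a * dens g x)"
proof -
 have D: "integrable nu (%x. \<Sum>(a, g)\<leftarrow>xs. a * dens g x) &
  (\<forall>A\<in>sets borel. (LINT x:A|nu. (\<Sum>(a, g)\<leftarrow>xs. a * dens g x)) = (\<Sum>(a, g)\<leftarrow>xs. a * measure (Gm g) A))"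
  by (rule dens_list) (erule f)
 have "AE x in nu. x : UNIV --> 0 <= (\<Sum>(a, g)\<leftarrow>xs. a * dens g x)"
 proof (rule AE_nonneg_of_integrals)
  show "integrable nu (%x. \<Sum>(a, g)\<leftarrow>xs. a * dens g x)" using D by blast
  fix A assume A: "A : sets nu"
  have "0 <= (\<Sum>(a, g)\<leftarrow>xs. a * measure (Gm g) A)"
  proof (rule Gm_combination_list[where O'=UNIV])
   show "g : F" if "(a, g) : set xs" for a g by (rule f[OF that])
   show "0 <= (\<Sum>(a, g)\<leftarrow>xs. a * Lb g g k)" if "k : CC" "!!x. 0 <= k x" for k by (rule pos[OF that])
  qed (use A in auto)
  thus "0 <= (LINT x:A|nu. (\<Sum>(a, g)\<leftarrow>xs. a * dens g x))" using D A by simp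
 qed simp
 thus ?thesis by simp
qed

lemma dens_identity:
 assumes f: "!!a g. (a, g) : set xs ==> g : F"
  and zero: "!!k. k : CC ==> (\<Sum>(a, g)\<leftarrow>xs. a * Lb g g k) = 0"
 shows "AE x in nu. (\<Sum>(a, g)\<leftarrow>xs. a * dens g x) = 0"
proof -
 let ?ys = "map (%(a, g). (- a, g)) xs"
 have neg: "(\<Sum>(a, g)\<leftarrow>?ys. a * h g) = - (\<Sum>(a, g)\<leftarrow>xs. a * h g)" for h :: "('a => real) => real"
  by (induction xs) auto
 have "AE x in nu. 0 <= (\<Sum>(a, g)\<leftarrow>?ys. a * dens g x)"
  by (rule dens_combination) (use f zero neg in auto)
 moreover have "AE x in nu. 0 <= (\<Sum>(a, g)\<leftarrow>xs. a * dens g x)"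
  by (rule dens_combination) (use f zero in auto)
 ultimately show ?thesis unfolding neg by eventually_elim simp
qed

text \<open>Polarised in the same way as \<open>mutual_energy_measure\<close>, so that the two agree
  on Borel sets; bilinearity holds almost everywhere.\<close>

definition gam :: "('a => real) => ('a => real) => 'a => real" where
 "gam f g x = (dens (%x. f x + g x) x - dens (%x. f x - g x) x) / 4"

lemma gam_integrable: "f : F ==> g : F ==> integrable nu (gam f g)"
 unfolding gam_def[abs_def] by (intro integrable_divide integrable_diff dens_integrable dom_add dom_diff)

lemma gam_mutual:
 assumes f: "f : F" and g: "g : F" and A: "A : sets borel"
 shows "(LINT x:A|nu. gam f g x) = mutual_energy_measure F E f g A"
proof -
 note i = set_integrable_nu[OF dens_integrable[OF dom_add[OF f g]] A] set_integrable_nu[OF dens_integrable[OF dom_diff[OF f g]] A]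
 have "(LINT x:A|nu. gam f g x) = (LINT x:A|nu. dens (%x. f x + g x) x - dens (%x. f x - g x) x) / 4"
  unfolding gam_def by (simp add: set_lebesgue_integral_def)
 thus ?thesis
  unfolding set_integral_diff(2)[OF i] dens_integral[OF dom_add[OF f g] A] dens_integral[OF dom_diff[OF f g] A]
  by (simp add: mutual_energy_measure_def energy_measure_eq dom_add dom_diff f g)
qed

lemma dens_total: "f : F ==> (LINT x|nu. dens f x) = E f f"
 using dens_integral[of f UNIV] Gm_total[of f] by (simp add: set_lebesgue_integral_def)

lemma gam_total:
 assumes f: "f : F" and g: "g : F"
 shows "(LINT x|nu. gam f g x) = E f g"
proof -
 have "(LINT x|nu. gam f g x) = (E (%x. f x + g x) (%x. f x + g x) - E (%x. f x - g x) (%x. f x - g x)) / 4"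
  unfolding gam_def using dens_integrable[OF dom_add[OF f g]] dens_integrable[OF dom_diff[OF f g]]
  by (simp add: dens_total dom_add dom_diff f g)
 also have "... = E f g"
  using f g form_sym[OF f g] by (simp add: form_add form_add2 form_diff form_diff2 dom_add dom_diff)
 finally show ?thesis .
qed

lemma Lb_polar:
 assumes "f : F" "g : F" "k : TF"
 shows "Lb (%x. f x + g x) (%x. f x + g x) k = Lb (%x. f x - g x) (%x. f x - g x) k + 4 * Lb f g k"
 using Lb_plus[OF assms] Lb_minus[OF assms] by simp

lemma gam_sym:
 assumes f: "f : F" and g: "g : F"
 shows "AE x in nu. gam f g x = gam g f x"
proof -
 have "AE x in nu. (\<Sum>(a, g)\<leftarrow>[(1, %x. f x + g x), (-1, %x. f x - g x), (-1, %x. g x + f x), (1, %x. g x - f x)]. a * dens g x) = 0"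
  by (rule dens_identity) (use f g in "auto simp: dom_add dom_diff Lb_polar CC_TF Lb_sym[of g f]")
 thus ?thesis by eventually_elim (simp add: gam_def)
qed

lemma gam_add:
 assumes p: "p : F" and f: "f : F" and g: "g : F"
 shows "AE x in nu. gam p (%x. f x + g x) x = gam p f x + gam p g x"
proof -
 have fg: "(%x. f x + g x) : F" by (rule dom_add[OF f g])
 have L: "Lb p (%x. f x + g x) k = Lb p f k + Lb p g k" if "k : CC" for k
  using Lb_add[OF f g p CC_TF[OF that]] Lb_sym[of p] by simp
 have "AE x in nu. (\<Sum>(a, g)\<leftarrow>[(1, %x. p x + (f x + g x)), (-1, %x. p x - (f x + g x)), (-1, %x. p x + f x), (1, %x. p x - f x), (-1, %x. p x + g x), (1, %x. p x - g x)]. a * dens g x) = 0"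
 proof (rule dens_identity)
  show "h : F" if "(a, h) : set [(1, %x. p x + (f x + g x)), (-1, %x. p x - (f x + g x)), (-1, %x. p x + f x), (1, %x. p x - f x), (-1, %x. p x + g x), (1, %x. p x - g x)]" for a and h
   using that dom_add[OF p fg] dom_diff[OF p fg] dom_add[OF p f] dom_diff[OF p f] dom_add[OF p g] dom_diff[OF p g] by auto
  show "(\<Sum>(a, g)\<leftarrow>[(1, %x. p x + (f x + g x)), (-1, %x. p x - (f x + g x)), (-1, %x. p x + f x), (1, %x. p x - f x), (-1, %x. p x + g x), (1, %x. p x - g x)]. a * Lb g g k) = 0"
   if k: "k : CC" for k
   using Lb_polar[OF p fg CC_TF[OF k]] Lb_polar[OF p f CC_TF[OF k]] Lb_polar[OF p g CC_TF[OF k]] L[OF k] by simp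
 qed
 thus ?thesis by eventually_elim (simp add: gam_def field_simps)
qed

lemma gam_scale:
 assumes p: "p : F" and f: "f : F"
 shows "AE x in nu. gam p (%x. c * f x) x = c * gam p f x"
proof -
 have cf: "(%x. c * f x) : F" by (rule dom_scale[OF f])
 have L: "Lb p (%x. c * f x) k = c * Lb p f k" if "k : CC" for k
  using Lb_scale[OF f p CC_TF[OF that]] Lb_sym[of p] by simp
 have "AE x in nu. (\<Sum>(a, g)\<leftarrow>[(1, %x. p x + c * f x), (-1, %x. p x - c * f x), (- c, %x. p x + f x), (c, %x. p x - f x)]. a * dens g x) = 0"
 proof (rule dens_identity)
  show "h : F" if "(a, h) : set [(1, %x. p x + c * f x), (-1, %x. p x - c * f x), (- c, %x. p x + f x), (c, %x. p x - f x)]" for a h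
   using that dom_add[OF p cf] dom_diff[OF p cf] dom_add[OF p f] dom_diff[OF p f] by auto
  show "(\<Sum>(a, g)\<leftarrow>[(1, %x. p x + c * f x), (-1, %x. p x - c * f x), (- c, %x. p x + f x), (c, %x. p x - f x)]. a * Lb g g k) = 0"
   if k: "k : CC" for k
   using Lb_polar[OF p cf CC_TF[OF k]] Lb_polar[OF p f CC_TF[OF k]] L[OF k] by (simp add: algebra_simps)
 qed
 thus ?thesis by eventually_elim (simp add: gam_def field_simps)
qed

lemma gam_sum:
 assumes p: "p : F" and I: "finite I" and f: "!!i. i : I ==> f i : F"
 shows "AE x in nu. gam p (%x. SUM i:I. c i * f i x) x = (SUM i:I. c i * gam p (f i) x)"
 using I f
proof (induction I rule: finite_induct)
 case empty
 show ?case using gam_scale[OF p p, of 0] by simp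
next
 case (insert i I)
 have fi: "f i : F" "(%x. c i * f i x) : F" "(%x. SUM i:I. c i * f i x) : F"
  using insert by (auto intro!: dom_sum dom_scale)
 have "AE x in nu. gam p (%x. SUM i:I. c i * f i x) x = (SUM i:I. c i * gam p (f i) x)" using insert by auto
 thus ?case using gam_add[OF p fi(2,3)] gam_scale[OF p fi(1), of "c i"]
  by eventually_elim (use insert.hyps in simp)
qed

lemma gam_young:
 assumes f: "f : F" and g: "g : F" and s: "0 < s"
 shows "AE x in nu. \<bar>gam f g x\<bar> <= (s * dens f x + dens g x / s) / 2"
proof -
 have fF: "(%x. - 1 * f x) : F" by (rule dom_scale[OF f])
 have y: "2 * \<bar>Lb f g k\<bar> <= s * Lb f f k + (1/s) * Lb g g k" if k: "k : CC" "!!x. 0 <= k x" for k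
  using Lb_young[OF f g CC_TF[OF k(1)] k(2) s] Lb_young[OF fF g CC_TF[OF k(1)] k(2) s]
   Lb_scaled[OF f CC_TF[OF k(1)], of "-1"] Lb_scale[OF f g CC_TF[OF k(1)], of "-1"] by simp
 have P: "AE x in nu. 0 <= (\<Sum>(a, g)\<leftarrow>[(2 * s, f), (2 / s, g), (b, %x. f x + g x), (- b, %x. f x - g x)]. a * dens g x)" if b: "b = 1 \<or> b = -1" for b
 proof (rule dens_combination)
  show "h : F" if "(a, h) : set [(2 * s, f), (2 / s, g), (b, %x. f x + g x), (- b, %x. f x - g x)]" for a h
   using that f g dom_add[OF f g] dom_diff[OF f g] by auto
  show "0 <= (\<Sum>(a, g)\<leftarrow>[(2 * s, f), (2 / s, g), (b, %x. f x + g x), (- b, %x. f x - g x)]. a * Lb g g k)"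
   if k: "k : CC" "!!x. 0 <= k x" for k
   using y[OF k] b Lb_polar[OF f g CC_TF[OF k(1)]] by (auto simp: abs_if split: if_splits)
 qed
 from P[OF disjI1[OF refl]] P[OF disjI2[OF refl]] show ?thesis
  by eventually_elim (auto simp: gam_def abs_if field_simps)
qed

lemma gam_integral_abs:
 assumes f: "f : F" and g: "g : F" and s: "0 < s"
 shows "(LINT x|nu. \<bar>gam f g x\<bar>) <= (s * E f f + E g g / s) / 2"
proof -
 have i: "integrable nu (%x. (s * dens f x + dens g x / s) / 2)" using dens_integrable[OF f] dens_integrable[OF g] by simp
 have "(LINT x|nu. \<bar>gam f g x\<bar>) <= (LINT x|nu. (s * dens f x + dens g x / s) / 2)"
  by (rule integral_mono_AE[OF integrable_abs[OF gam_integrable[OF f g]] i gam_young[OF f g s]])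
 also have "... = (s * E f f + E g g / s) / 2"
  using dens_integrable[OF f] dens_integrable[OF g] by (simp add: dens_total f g)
 finally show ?thesis .
qed

text \<open>The nearest point map \<open>c\<close> of the closed ball is a contraction and the
  identity on the ball, so \<open>V\<close> composed with \<open>c\<close> is Lipschitz with
  constant \<open>w\<close> everywhere. The local contraction then bounds the density of
  \<open>V (Phi x)\<close> by \<open>w\<^sup>2\<close> times that of \<open>Phi\<close>, and
  \<open>gam_young\<close> with parameter \<open>w\<close> makes the mixed density linear in
  \<open>w\<close>.\<close>

lemma chain_rule_local:
 fixes Phi :: "'a => 'c::euclidean_space" and U :: "'c => real" and G :: "'c => 'c"
 assumes Phi: "!!b. b : Basis ==> (%x. Phi x \<bullet> b) : CC" and VC: "(%x. V (Phi x)) : CC"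
  and d: "!!z. (V has_derivative (%v. G z \<bullet> v)) (at z)"
  and r: "0 < r" and w: "0 < w" "!!z. z : cball a r ==> norm (G z) <= w" and p: "p : F"
 shows "AE x in nu. Phi x : ball a r --> \<bar>gam p (%x. V (Phi x)) x\<bar> <= w * ((dens p x + (SUM b:Basis. dens (%x. Phi x \<bullet> b) x)) / 2)"
proof -
 define c where "c = closest_point (cball a r)"
 have cb: "convex (cball a r)" "closed (cball a r)" "cball a r ~= {}" using r by auto
 have cl: "norm (c y - c z) <= norm (y - z)" for y z
  using closest_point_lipschitz[OF cb, of y z] by (simp add: c_def dist_norm)
 have cin: "c y : cball a r" for y unfolding c_def by (rule closest_point_in_set[OF cb(2,3)])
 have cid: "c y = y" if "y : ball a r" for y using that unfolding c_def by (intro closest_point_self) auto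
 have Vl: "\<bar>V (c y) - V (c z)\<bar> <= w * norm (c y - c z)" for y z
  by (rule gradient_lipschitz[OF d cb(1) w(2) cin cin])
 \<comment> \<open>Constants are subtracted so that the modified functions vanish where
   \<open>Phi\<close> does and remain test functions.\<close>
 define Psi where "Psi x = c (Phi x) - c 0" for x
 define u where "u x = V (c (Phi x)) - V (c 0)" for x
 have PsiC: "(%x. Psi x \<bullet> b) : CC" if b: "b : Basis" for b
  unfolding Psi_def
 proof (rule CC_compose[OF Phi, where U="%y. (c y - c 0) \<bullet> b" and S=UNIV and L=1])
  show "\<bar>(c y - c 0) \<bullet> b - (c z - c 0) \<bullet> b\<bar> <= 1 * norm (y - z)" for y z
   using Basis_le_norm[OF b, of "c y - c z"] cl[of y z] by (simp add: inner_diff_left)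
 qed auto
 have uC: "u : CC"
  unfolding u_def[abs_def]
 proof (rule CC_compose[OF Phi, where U="%y. V (c y) - V (c 0)" and S=UNIV and L=w])
  show "\<bar>V (c y) - V (c 0) - (V (c z) - V (c 0))\<bar> <= w * norm (y - z)" for y z
   using order_trans[OF Vl[of y z] mult_left_mono[OF cl[of y z], of w]] w(1) by simp
 qed (use w(1) in auto)
 have cont: "continuous_on UNIV Phi"
  by (subst continuous_on_componentwise) (use CC_cont[OF Phi] in auto)
 define O' where "O' = Phi -` ball a r"
 have O: "open O'" unfolding O'_def using cont by (rule open_vimage[OF open_ball])
 have le: "measure (Gm (%x. V (Phi x))) A <= w\<^sup>2 * (SUM b:Basis. measure (Gm (%x. Phi x \<bullet> b)) A)" if A: "A : sets borel" "A <= O'" for A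
 proof (rule Gm_local_contraction[OF VC uC Phi PsiC O _ _ _ _ _ A])
  show "V (Phi x) = u x + V (c 0)" "Phi x = Psi x + c 0" if "x : O'" for x
   using that cid[of "Phi x"] by (auto simp: u_def Psi_def O'_def)
  show "\<bar>u x - u y\<bar> <= w * norm (Psi x - Psi y)" for x y using Vl[of "Phi x" "Phi y"] by (simp add: u_def Psi_def)
  show "\<bar>u x\<bar> <= w * norm (Psi x)" for x using Vl[of "Phi x" 0] by (simp add: u_def Psi_def)
 qed (use w in auto)
 have VF: "(%x. V (Phi x)) : F" by (rule CC_F[OF VC])
 have PhiF: "(%x. Phi x \<bullet> b) : F" if "b : Basis" for b by (rule CC_F[OF Phi[OF that]])
 have i: "integrable nu (%x. w\<^sup>2 * (SUM b:Basis. dens (%x. Phi x \<bullet> b) x))"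
  by (intro integrable_mult_right integrable_sum dens_integrable PhiF)
 have "AE x in nu. x : O' --> 0 <= w\<^sup>2 * (SUM b:Basis. dens (%x. Phi x \<bullet> b) x) - dens (%x. V (Phi x)) x"
 proof (rule AE_nonneg_of_integrals)
  show "integrable nu (%x. w\<^sup>2 * (SUM b:Basis. dens (%x. Phi x \<bullet> b) x) - dens (%x. V (Phi x)) x)"
   by (intro integrable_diff i dens_integrable VF)
  show "O' : sets nu" using O by simp
  fix A assume A': "A : sets nu" "A <= O'"
  hence A: "A : sets borel" by simp
  have "(LINT x:A|nu. w\<^sup>2 * (SUM b:Basis. dens (%x. Phi x \<bullet> b) x) - dens (%x. V (Phi x)) x)
   = (LINT x:A|nu. w\<^sup>2 * (SUM b:Basis. dens (%x. Phi x \<bullet> b) x)) - (LINT x:A|nu. dens (%x. V (Phi x)) x)"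
   by (rule set_integral_diff(2)[OF set_integrable_nu[OF i A] set_integrable_nu[OF dens_integrable[OF VF] A]])
  also have "(LINT x:A|nu. w\<^sup>2 * (SUM b:Basis. dens (%x. Phi x \<bullet> b) x)) = w\<^sup>2 * (SUM b:Basis. measure (Gm (%x. Phi x \<bullet> b)) A)"
  proof -
   have "(LINT x:A|nu. w\<^sup>2 * (SUM b:Basis. dens (%x. Phi x \<bullet> b) x)) = w\<^sup>2 * (LINT x|nu. (SUM b:Basis. indicator A x *\<^sub>R dens (%x. Phi x \<bullet> b) x))"
    by (simp add: set_lebesgue_integral_def sum_distrib_left mult_ac flip: integral_mult_right_zero)
   also have "(LINT x|nu. (SUM b:Basis. indicator A x *\<^sub>R dens (%x. Phi x \<bullet> b) x)) = (SUM b:Basis. (LINT x:A|nu. dens (%x. Phi x \<bullet> b) x))"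
    unfolding set_lebesgue_integral_def
    by (rule integral_sum) (use set_integrable_nu[OF dens_integrable[OF PhiF] A] in "simp add: set_integrable_def")
   also have "... = (SUM b:Basis. measure (Gm (%x. Phi x \<bullet> b)) A)" by (intro sum.cong refl dens_integral[OF PhiF A])
   finally show ?thesis .
  qed
  also have "(LINT x:A|nu. dens (%x. V (Phi x)) x) = measure (Gm (%x. V (Phi x))) A" by (rule dens_integral[OF VF A])
  finally show "0 <= (LINT x:A|nu. w\<^sup>2 * (SUM b:Basis. dens (%x. Phi x \<bullet> b) x) - dens (%x. V (Phi x)) x)"
   using le[OF A A'(2)] by simp
 qed
 thus ?thesis using gam_young[OF p VF w(1)]
 proof eventually_elim
  case (elim x)
  show ?case
  proof
   assume "Phi x : ball a r"
   hence "dens (%x. V (Phi x)) x <= w\<^sup>2 * (SUM b:Basis. dens (%x. Phi x \<bullet> b) x)" using elim by (simp add: O'_def)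
   hence "dens (%x. V (Phi x)) x / w <= w * (SUM b:Basis. dens (%x. Phi x \<bullet> b) x)"
    using w(1) by (simp add: divide_le_eq power2_eq_square mult_ac)
   thus "\<bar>gam p (%x. V (Phi x)) x\<bar> <= w * ((dens p x + (SUM b:Basis. dens (%x. Phi x \<bullet> b) x)) / 2)"
    using elim by (simp add: algebra_simps)
  qed
 qed
qed

text \<open>Near a point \<open>a\<close> the function minus its linear part
  \<open>g a \<bullet> z\<close> has gradient at most \<open>w\<close>, so by the local estimate the
  defect \<open>J\<close> of the chain rule is at most \<open>w * H\<close>. Finitely many balls
  cover the bounded range of \<open>Phi\<close>, and \<open>w\<close> tends to zero along a sequence
  with one common null set.\<close>

lemma chain_rule:
 fixes Phi :: "'a => 'c::euclidean_space" and U :: "'c => real" and g :: "'c => 'c"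
 assumes Phi: "!!b. b : Basis ==> (%x. Phi x \<bullet> b) : CC" and U: "U 0 = 0"
  and d: "!!z. (U has_derivative (%v. g z \<bullet> v)) (at z)" and g: "continuous_on UNIV g" and p: "p : F"
 shows "(%x. U (Phi x)) : CC"
  and "AE x in nu. gam p (%x. U (Phi x)) x = (SUM b:Basis. (g (Phi x) \<bullet> b) * gam p (%x. Phi x \<bullet> b) x)"
proof -
 have "\<forall>b\<in>Basis. EX c. ALL x. \<bar>Phi x \<bullet> b\<bar> <= c" using CC_bF[OF Phi] by (auto simp: bF_def)
 then obtain B where B: "!!b x. b : Basis ==> \<bar>Phi x \<bullet> b\<bar> <= B b" by metis
 define R where "R = \<bar>SUM b:(Basis::'c set). B b\<bar>"
 have R: "Phi x : cball 0 R" for x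
 proof -
  have "norm (Phi x) <= (SUM b:Basis. \<bar>Phi x \<bullet> b\<bar>)" by (rule norm_le_l1)
  also have "... <= (SUM b:Basis. B b)" by (intro sum_mono B)
  finally show ?thesis by (simp add: R_def)
 qed
 have R0: "0 <= R" by (simp add: R_def)
 have VC: "(%x. U (Phi x) - q \<bullet> Phi x) : CC" and Vd: "((%z. U z - q \<bullet> z) has_derivative (%v. (g z - q) \<bullet> v)) (at z)" for q z
 proof -
  show Vd: "((%z. U z - q \<bullet> z) has_derivative (%v. (g z - q) \<bullet> v)) (at z)" for z
   by (rule derivative_eq_intros d refl)+ (simp add: inner_diff_left)
  have "compact ((%z. g z - q) ` cball 0 R)"
   by (intro compact_continuous_image continuous_on_diff continuous_on_const continuous_on_subset[OF g]) auto
  from compact_imp_bounded[OF this] obtain L where "\<forall>z\<in>cball 0 R. norm (g z - q) <= L"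
   unfolding bounded_iff ball_simps by blast
  hence L: "!!z. z : cball 0 R ==> norm (g z - q) <= L" by blast
  have L0: "0 <= L" using order_trans[OF norm_ge_zero L[of 0]] R0 by simp
  show "(%x. U (Phi x) - q \<bullet> Phi x) : CC"
  proof (rule CC_compose[OF Phi, where U="%z. U z - q \<bullet> z" and S="cball 0 R" and L=L])
   show "\<bar>U y - q \<bullet> y - (U z - q \<bullet> z)\<bar> <= L * norm (y - z)" if "y : cball 0 R" "z : cball 0 R" for y z
    by (rule gradient_lipschitz[OF Vd convex_cball L that])
   show "range Phi <= cball 0 R" using R by blast
  qed (use U R0 L0 in auto)
 qed
 show UC: "(%x. U (Phi x)) : CC" using VC[of 0] by simp
 have UF: "(%x. U (Phi x)) : F" by (rule CC_F[OF UC])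
 have PhiF: "(%x. Phi x \<bullet> b) : F" if "b : Basis" for b by (rule CC_F[OF Phi[OF that]])
 define H where "H x = (dens p x + (SUM b:Basis. dens (%x. Phi x \<bullet> b) x)) / 2 + (SUM b:Basis. \<bar>gam p (%x. Phi x \<bullet> b) x\<bar>)" for x
 define J where "J x = gam p (%x. U (Phi x)) x - (SUM b:Basis. (g (Phi x) \<bullet> b) * gam p (%x. Phi x \<bullet> b) x)" for x
 have loc: "AE x in nu. Phi x : ball a r --> \<bar>J x\<bar> <= w * H x"
  if r: "0 < r" and w: "0 < w" "!!z. z : cball a r ==> norm (g z - g a) <= w" for a r w
 proof -
  let ?V = "%z. U z - g a \<bullet> z"
  have eqV: "(%x. ?V (Phi x)) = (%x. U (Phi x) + (SUM b:Basis. - (g a \<bullet> b) * (Phi x \<bullet> b)))"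
   by (rule ext) (subst euclidean_inner, simp add: sum_negf)
  have sF: "(%x. SUM b:Basis. - (g a \<bullet> b) * (Phi x \<bullet> b)) : F" by (intro dom_sum dom_scale PhiF) auto
  have "AE x in nu. gam p (%x. ?V (Phi x)) x = gam p (%x. U (Phi x)) x + gam p (%x. SUM b:Basis. - (g a \<bullet> b) * (Phi x \<bullet> b)) x"
   unfolding eqV by (rule gam_add[OF p UF sF])
  moreover have "AE x in nu. gam p (%x. SUM b:Basis. - (g a \<bullet> b) * (Phi x \<bullet> b)) x = (SUM b:Basis. - (g a \<bullet> b) * gam p (%x. Phi x \<bullet> b) x)"
   by (rule gam_sum[OF p finite_Basis PhiF])
  moreover have "AE x in nu. Phi x : ball a r --> \<bar>gam p (%x. ?V (Phi x)) x\<bar> <= w * ((dens p x + (SUM b:Basis. dens (%x. Phi x \<bullet> b) x)) / 2)"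
   by (rule chain_rule_local[OF Phi VC Vd r w p])
  ultimately show ?thesis
  proof eventually_elim
   case (elim x)
   show ?case
   proof
    assume x: "Phi x : ball a r"
    have J: "J x = gam p (%x. ?V (Phi x)) x - (SUM b:Basis. ((g (Phi x) - g a) \<bullet> b) * gam p (%x. Phi x \<bullet> b) x)"
     unfolding J_def elim(1,2) by (simp add: inner_diff_left left_diff_distrib sum_subtractf sum_negf)
    have S: "\<bar>SUM b:Basis. ((g (Phi x) - g a) \<bullet> b) * gam p (%x. Phi x \<bullet> b) x\<bar> <= (SUM b:Basis. w * \<bar>gam p (%x. Phi x \<bullet> b) x\<bar>)"
    proof (rule order_trans[OF sum_abs sum_mono])
     fix b :: 'c assume b: "b : Basis"
     have "\<bar>(g (Phi x) - g a) \<bullet> b\<bar> <= w"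
      using Basis_le_norm[OF b, of "g (Phi x) - g a"] w(2)[of "Phi x"] x by simp
     thus "\<bar>((g (Phi x) - g a) \<bullet> b) * gam p (%x. Phi x \<bullet> b) x\<bar> <= w * \<bar>gam p (%x. Phi x \<bullet> b) x\<bar>"
      unfolding abs_mult by (rule mult_right_mono) simp
    qed
    have "w * H x = w * ((dens p x + (SUM b:Basis. dens (%x. Phi x \<bullet> b) x)) / 2) + (SUM b:Basis. w * \<bar>gam p (%x. Phi x \<bullet> b) x\<bar>)"
     unfolding H_def distrib_left sum_distrib_left ..
    moreover have "\<bar>gam p (%x. ?V (Phi x)) x\<bar> <= w * ((dens p x + (SUM b:Basis. dens (%x. Phi x \<bullet> b) x)) / 2)"
     using elim(3) x by blast
    ultimately show "\<bar>J x\<bar> <= w * H x" using J S by linarith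
   qed
  qed
 qed
 have all: "AE x in nu. \<bar>J x\<bar> <= w * H x" if w: "0 < w" for w
 proof -
  have "\<forall>a\<in>cball 0 R. \<exists>r>0. \<forall>z\<in>cball a r. norm (g z - g a) <= w"
  proof
   fix a :: 'c
   have "continuous (at a) g" using g by (simp add: continuous_on_eq_continuous_at)
   then obtain r where r: "0 < r" "!!z. dist z a < r ==> dist (g z) (g a) < w" using w unfolding continuous_at_eps_delta by blast
   show "\<exists>r>0. \<forall>z\<in>cball a r. norm (g z - g a) <= w"
    using r by (intro exI[of _ "r/2"]) (auto simp: dist_norm[symmetric] dist_commute intro!: less_imp_le)
  qed
  then obtain r where r: "!!a. a : cball 0 R ==> 0 < r a" "!!a z. a : cball 0 R ==> z : cball a (r a) ==> norm (g z - g a) <= w" by metis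
  have "cball 0 R <= (\<Union>a\<in>cball 0 R. ball a (r a))" using r(1) by force
  then obtain D where D: "D <= cball 0 R" "finite D" "cball 0 R <= (\<Union>a\<in>D. ball a (r a))"
   by (rule compactE_image[OF compact_cball open_ball]) (rule that)
  have "AE x in nu. \<forall>a\<in>D. Phi x : ball a (r a) --> \<bar>J x\<bar> <= w * H x"
   by (rule AE_finite_allI[OF D(2)]) (use D(1) in "blast intro: loc[OF r(1) w r(2)]")
  thus ?thesis
  proof eventually_elim
   case (elim x)
   thus ?case using R[of x] D(3) by blast
  qed
 qed
 have "AE x in nu. ALL k. \<bar>J x\<bar> <= (1 / real (Suc k)) * H x" unfolding AE_all_countable by (intro allI all) simp
 hence "AE x in nu. J x = 0"
 proof eventually_elim
  case (elim x)
  have "(%k. (1 / real (Suc k)) * H x) ---> 0" by (rule tendsto_mult_left_zero[OF LIMSEQ_Suc[OF lim_1_over_n]])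
  hence "\<bar>J x\<bar> <= 0" by (rule LIMSEQ_le_const) (use elim in blast)
  thus ?case by simp
 qed
 thus "AE x in nu. gam p (%x. U (Phi x)) x = (SUM b:Basis. (g (Phi x) \<bullet> b) * gam p (%x. Phi x \<bullet> b) x)"
  by eventually_elim (simp add: J_def)
qed

end

subsection \<open>The divergence estimate for the image measure\<close>

lemma Basis_cart: "(Basis :: (real^'n::finite) set) = (%j. axis j 1) ` UNIV"
 by (auto simp: Basis_vec_def)

lemma sum_Basis_cart: "(SUM b:(Basis :: (real^'n::finite) set). f b) = (SUM j:UNIV. f (axis j 1))"
 unfolding Basis_cart by (subst sum.reindex) (auto simp: inj_on_def axis_eq_axis)

text \<open>One factor is bounded and converges almost everywhere, the other converges in
  \<open>L1\<close>; the difference is split accordingly.\<close>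

lemma integral_product_conv:
 fixes a :: "nat => 'a => real"
 assumes a: "!!m. a m : borel_measurable M" "a' : borel_measurable M" "!!m x. \<bar>a m x\<bar> <= B"
  and lim: "AE x in M. (%m. a m x) ---> a' x"
  and b: "!!m. integrable M (b m)" "integrable M b'" "(%m. LINT x|M. \<bar>b m x - b' x\<bar>) ---> 0"
 shows "integrable M (%x. a m x * b m x)" "integrable M (%x. a' x * b' x)"
  "(%m. LINT x|M. a m x * b m x) ---> (LINT x|M. a' x * b' x)"
proof -
 note [measurable] = a(1,2) borel_measurable_integrable[OF b(1)] borel_measurable_integrable[OF b(2)]
 have B: "0 <= B" using order_trans[OF abs_ge_zero a(3)] .
 have bd: "integrable M (%x. a m x * c x)" if c: "integrable M c" for m and c :: "'a => real"
 proof (rule integrable_bound)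
  note [measurable] = borel_measurable_integrable[OF c]
  show "integrable M (%x. B * c x)" using c by simp
  show "(%x. a m x * c x) : borel_measurable M" by measurable
  show "AE x in M. norm (a m x * c x) <= norm (B * c x)" using a(3) B by (intro AE_I2) (simp add: abs_mult mult_right_mono)
 qed
 show i1: "integrable M (%x. a m x * b m x)" for m by (rule bd[OF b(1)])
 have dc: "integrable M (%x. a' x * b' x)" "(%m. LINT x|M. a m x * b' x) ---> (LINT x|M. a' x * b' x)"
 proof -
  have l: "AE x in M. (%m. a m x * b' x) ---> a' x * b' x" using lim by eventually_elim (intro tendsto_intros)
  have w: "integrable M (%x. B * \<bar>b' x\<bar>)" using b(2) by simp
  have d: "AE x in M. norm (a m x * b' x) <= B * \<bar>b' x\<bar>" for m using a(3) by (intro AE_I2) (simp add: abs_mult mult_right_mono)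
  show "integrable M (%x. a' x * b' x)" by (rule integrable_dominated_convergence[OF _ _ w l d]) measurable
  show "(%m. LINT x|M. a m x * b' x) ---> (LINT x|M. a' x * b' x)"
   by (rule integral_dominated_convergence[OF _ _ w l d]) measurable
 qed
 show "integrable M (%x. a' x * b' x)" by (rule dc(1))
 have "(%m. (LINT x|M. a m x * b m x) - (LINT x|M. a m x * b' x)) ---> 0"
 proof (rule LIMSEQ_null_bound)
  show "\<bar>(LINT x|M. a m x * b m x) - (LINT x|M. a m x * b' x)\<bar> <= B * (LINT x|M. \<bar>b m x - b' x\<bar>)" for m
  proof -
   have i: "integrable M (%x. b m x - b' x)" using b(1,2) by simp
   have "(LINT x|M. a m x * b m x) - (LINT x|M. a m x * b' x) = (LINT x|M. a m x * (b m x - b' x))"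
    using integral_diff[OF i1 bd[OF b(2)], of m m] by (simp add: right_diff_distrib)
   also have "\<bar>...\<bar> <= (LINT x|M. B * \<bar>b m x - b' x\<bar>)"
    by (rule order_trans[OF integral_abs_bound integral_mono[OF integrable_abs[OF bd[OF i]]]])
     (use i a(3) in "auto simp: abs_mult intro!: mult_right_mono")
   finally show ?thesis by simp
  qed
  show "(%m. B * (LINT x|M. \<bar>b m x - b' x\<bar>)) ---> 0" by (rule tendsto_mult_right_zero[OF b(3)])
 qed
 from tendsto_add[OF this dc(2)] show "(%m. LINT x|M. a m x * b m x) ---> (LINT x|M. a' x * b' x)" by simp
qed

context dominated_mmd_space
begin

text \<open>By linearity only the mixed density of \<open>p\<close> with the difference matters.
  Young's inequality with small \<open>s\<close> bounds its integral by \<open>s * E p p\<close>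
  plus a multiple of the energy of the difference.\<close>

lemma gam_conv:
 assumes p: "p : F" and u: "!!m. u m : F" and f: "f : F" and c: "E_conv u f"
 shows "(%m. LINT x|nu. \<bar>gam p (u m) x - gam p f x\<bar>) ---> 0"
proof (rule LIMSEQ_I)
 fix r :: real assume r: "0 < r"
 define s where "s = r / (E p p + 1)"
 have Ep: "0 <= E p p" by (rule form_nonneg[OF p])
 have s: "0 < s" "s * E p p <= r" using r Ep by (auto simp: s_def field_simps)
 define d where "d m x = u m x - f x" for m x
 have dF: "d m : F" for m unfolding d_def[abs_def] by (rule dom_diff[OF u f])
 have "0 < r * s" using r s by simp
 from order_tendstoD(2)[OF c[unfolded E_conv_def] this]
 have "\<forall>\<^sub>F m in sequentially. E (d m) (d m) < r * s" unfolding d_def .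
 then obtain m0 where m0: "!!m. m0 <= m ==> E (d m) (d m) < r * s" by (auto simp: eventually_sequentially)
 have le: "(LINT x|nu. \<bar>gam p (u m) x - gam p f x\<bar>) <= (s * E p p + E (d m) (d m) / s) / 2" for m
 proof -
  have "(%x. d m x + f x) = u m" by (auto simp: d_def)
  hence "AE x in nu. gam p (u m) x = gam p (d m) x + gam p f x" using gam_add[OF p dF f] by metis
  hence "AE x in nu. \<bar>gam p (u m) x - gam p f x\<bar> = \<bar>gam p (d m) x\<bar>" by eventually_elim simp
  hence "(LINT x|nu. \<bar>gam p (u m) x - gam p f x\<bar>) = (LINT x|nu. \<bar>gam p (d m) x\<bar>)"
   by (intro integral_cong_AE) (use gam_integrable[OF p u] gam_integrable[OF p f] gam_integrable[OF p dF] in auto)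
  thus ?thesis using gam_integral_abs[OF p dF s(1), of m] by simp
 qed
 show "EX no. \<forall>n\<ge>no. norm ((LINT x|nu. \<bar>gam p (u n) x - gam p f x\<bar>) - 0) < r"
 proof (intro exI allI impI)
  fix m assume "m0 <= m"
  hence "E (d m) (d m) / s < r" using m0[of m] s(1) by (simp add: divide_less_eq mult.commute)
  moreover have "0 <= (LINT x|nu. \<bar>gam p (u m) x - gam p f x\<bar>)" by simp
  ultimately show "norm ((LINT x|nu. \<bar>gam p (u m) x - gam p f x\<bar>) - 0) < r" using le[of m] s(2) by simp
 qed
qed

text \<open>Leibniz and chain rule in one application to the pair \<open>(u, h)\<close>. The factor
  \<open>h\<close> makes the composed function vanish at the origin, as \<open>chain_rule\<close>
  requires, whatever the value of \<open>T\<close> there.\<close>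

lemma product_chain:
 fixes T :: "real^'n::finite => real^'n"
 assumes T: "!!y. (T has_derivative (%h. T' y *v h)) (at y)" "continuous_on UNIV T'"
  and h: "h : CC" and u: "!!j. (%x. u x $ j) : CC" and p: "p : F"
 shows "(%x. h x * T (u x) $ i) : CC"
  and "AE x in nu. gam p (%x. h x * T (u x) $ i) x = (SUM j:UNIV. h x * T' (u x) $ i $ j * gam p (%x. u x $ j) x) + T (u x) $ i * gam p h x"
proof -
 define Phi where "Phi x = (u x, h x)" for x
 define U where "U z = snd z * T (fst z) $ i" for z :: "(real^'n) \<times> real"
 define g where "g z = (snd z *\<^sub>R (T' (fst z) $ i), T (fst z) $ i)" for z :: "(real^'n) \<times> real"
 have Tc: "continuous_on UNIV T" using T(1) has_derivative_continuous continuous_at_imp_continuous_on by blast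
 have Phi: "(%x. Phi x \<bullet> b) : CC" if "b : Basis" for b
 proof -
  from that consider j where "b = (axis j 1, 0)" | "b = (0, 1)" unfolding Basis_prod_def Basis_cart by auto
  thus ?thesis by cases (use u h in \<open>auto simp: Phi_def inner_axis\<close>)
 qed
 have d: "(U has_derivative (%v. g z \<bullet> v)) (at z)" for z
 proof -
  have "((%z. T (fst z)) has_derivative (%v. T' (fst z) *v fst v)) (at z)"
   by (rule has_derivative_compose[OF has_derivative_fst[OF has_derivative_ident] T(1)])
  from bounded_linear.has_derivative[OF bounded_linear_vec_nth this, of i]
  have "((%z. T (fst z) $ i) has_derivative (%v. (T' (fst z) *v fst v) $ i)) (at z)" .
  from has_derivative_mult[OF has_derivative_snd[OF has_derivative_ident] this]
  show ?thesis unfolding U_def[abs_def]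
   by (rule has_derivative_eq_rhs) (auto simp: g_def inner_prod_def matrix_vector_mul_component)
 qed
 have gc: "continuous_on UNIV g"
  unfolding g_def by (intro continuous_intros continuous_on_compose2[OF T(2)] continuous_on_compose2[OF Tc]) auto
 have U0: "U 0 = 0" by (simp add: U_def)
 have eq: "(%x. U (Phi x)) = (%x. h x * T (u x) $ i)" by (auto simp: U_def Phi_def)
 show "(%x. h x * T (u x) $ i) : CC" using chain_rule(1)[OF Phi U0 d gc p] unfolding eq .
 have "AE x in nu. gam p (%x. U (Phi x)) x = (SUM b:Basis. (g (Phi x) \<bullet> b) * gam p (%x. Phi x \<bullet> b) x)"
  by (rule chain_rule(2)[OF Phi U0 d gc p])
 thus "AE x in nu. gam p (%x. h x * T (u x) $ i) x = (SUM j:UNIV. h x * T' (u x) $ i $ j * gam p (%x. u x $ j) x) + T (u x) $ i * gam p h x"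
  unfolding eq sum_Basis_prod sum_Basis_cart by (simp add: g_def Phi_def inner_axis)
qed

text \<open>The test functions are \<open>h x * T (u m x) $ i\<close>. The form of a resolvent
  against them is bounded by the supremum of \<open>T\<close>; integrating the mixed densities
  instead produces the derivative of \<open>T\<close> against the matrix of
  \<open>gam (p i) (phi j)\<close>, cut by \<open>h\<close>. \<open>W\<close> is the deviation of
  this matrix from the identity on \<open>G\<close>. The limit in \<open>m\<close> replaces
  \<open>u m\<close> by \<open>psi\<close>.\<close>

lemma good_estimate_image:
 fixes phi psi :: "'a => real^'n::finite"
 assumes phi: "!!i. (%x. phi x $ i) : F" and u: "!!m i. (%x. u m x $ i) : CC" "!!i. E_conv (%m x. u m x $ i) (%x. phi x $ i)"
  and psi: "psi : borel_measurable borel" "AE x in nu. (%m. u m x) ---> psi x"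
  and q: "!!i. q i : F" and h: "h : CC" and G: "G : sets borel" "emeasure nu G < \<infinity>"
  and W: "W = (%x. \<chi> i j. h x * gam (Rs m0 (q i)) (%x. phi x $ j) x - (if i = j then indicator G x else 0))"
 shows "\<exists>C\<ge>0. good_estimate (distr (density nu (indicator G)) borel psi) (distr (density nu (%x. ennreal (norm (W x)))) borel psi) C"
proof -
 let ?N = "completion M"
 define p where "p i = Rs m0 (q i)" for i
 have p: "p i : F" for i unfolding p_def by (rule Rs_conv(3)[OF q])
 have hF: "h : F" by (rule CC_F[OF h])
 obtain hb where hb: "!!x. \<bar>h x\<bar> <= hb" using CC_bF[OF h] by (auto simp: bF_def)
 have [measurable]: "h : borel_measurable borel" by (rule CC_borel[OF h])
 have [measurable]: "(%x. u m x $ i) : borel_measurable borel" for m i by (rule CC_borel[OF u(1)])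
 have um [measurable]: "u m : borel_measurable borel" for m
  by (subst borel_measurable_euclidean_space) (auto simp: Basis_cart inner_axis)
 note [measurable] = psi(1) G(1)
 have gm [measurable]: "gam (p i) (%x. phi x $ j) : borel_measurable borel" for i j
  using borel_measurable_integrable[OF gam_integrable[OF p phi]] by simp
 have Wi: "W x $ i $ j = h x * gam (p i) (%x. phi x $ j) x - (if i = j then indicator G x else 0)" for x i j
  by (simp add: W p_def)
 have [measurable]: "(%x. W x $ i) : borel_measurable borel" for i
  by (subst borel_measurable_euclidean_space) (auto simp: Basis_cart inner_axis Wi)
 have Wm [measurable]: "W : borel_measurable borel"
  by (subst borel_measurable_euclidean_space) (auto simp: Basis_vec_def inner_axis inner_axis' Basis_cart Wi)
 \<comment> \<open>The first part bounds the \<open>L2\<close> pairing of \<open>q i - p i\<close>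
   with the test function, by the arithmetic-geometric mean inequality; the second bounds the term
   in which the derivative falls on \<open>h\<close>. Neither involves \<open>T\<close>.\<close>
 define C where "C = (SUM i:UNIV. real (Suc m0) * ((ip ?N (%x. q i x - p i x) (%x. q i x - p i x) + ip ?N h h) / 2) + (LINT x|nu. \<bar>gam (p i) h x\<bar>))"
 have C0: "0 <= C" unfolding C_def
  by (intro sum_nonneg add_nonneg_nonneg mult_nonneg_nonneg divide_nonneg_nonneg) (auto simp: integral_nonneg)
 have "good_estimate (distr (density nu (indicator G)) borel psi) (distr (density nu (%x. ennreal (norm (W x)))) borel psi) C"
  unfolding good_estimate_def
 proof (intro allI impI)
  fix T :: "real^'n => real^'n" and T' tau
  assume T: "ALL y. (T has_derivative (%h. T' y *v h)) (at y)" and T'c: "continuous_on UNIV T'" and T'b: "bounded (range T')"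
   and Ttau: "ALL y. norm (T y) <= tau"
  have Tc: "continuous_on UNIV T" using T has_derivative_continuous continuous_at_imp_continuous_on by blast
  have Tij: "continuous_on UNIV (%y. T' y $ i $ j)" for i j by (intro continuous_intros T'c)
  have [measurable]: "T' : borel_measurable borel" "T : borel_measurable borel" "(%y. T' y $ i $ j) : borel_measurable borel" "(%y. T y $ i) : borel_measurable borel" for i j
   by (intro borel_measurable_continuous_onI continuous_intros T'c Tc)+
  have tau: "0 <= tau" using order_trans[OF norm_ge_zero] Ttau by blast
  obtain B where B: "!!y. norm (T' y) <= B" using T'b by (auto simp: bounded_iff)
  have Bij: "\<bar>T' y $ i $ j\<bar> <= B" for y i j
   using order_trans[OF order_trans[OF component_le_norm_cart[of "T' y $ i" j] Finite_Cartesian_Product.norm_nth_le[of "T' y" i]] B[of y]] .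
  have Ti: "\<bar>T y $ i\<bar> <= tau" for y i using order_trans[OF component_le_norm_cart[of "T y" i]] Ttau by blast
  define I where "I m i j = (LINT x|nu. (h x * T' (u m x) $ i $ j) * gam (p i) (%x. u m x $ j) x)" for m i j
  define I' where "I' i j = (LINT x|nu. (h x * T' (psi x) $ i $ j) * gam (p i) (%x. phi x $ j) x)" for i j
  have ipc: "integrable nu (%x. (h x * T' (u m x) $ i $ j) * gam (p i) (%x. u m x $ j) x)"
   "integrable nu (%x. (h x * T' (psi x) $ i $ j) * gam (p i) (%x. phi x $ j) x)" "(%m. I m i j) ---> I' i j" for m i j
  proof -
   have a1: "(%x. h x * T' (u m x) $ i $ j) : borel_measurable nu" for m by measurable
   have a2: "(%x. h x * T' (psi x) $ i $ j) : borel_measurable nu" by measurable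
   have a3: "\<bar>h x * T' (u m x) $ i $ j\<bar> <= hb * B" for m x
    unfolding abs_mult by (intro mult_mono hb Bij abs_ge_zero order_trans[OF abs_ge_zero hb])
   have a4: "AE x in nu. (%m. h x * T' (u m x) $ i $ j) ---> h x * T' (psi x) $ i $ j"
    using psi(2)
   proof eventually_elim
    case (elim x)
    have "(%m. T' (u m x) $ i $ j) ---> T' (psi x) $ i $ j"
     using continuous_on_tendsto_compose[OF Tij elim] by simp
    thus ?case by (rule tendsto_mult[OF tendsto_const])
   qed
   note * = integral_product_conv[OF a1 a2 a3 a4 gam_integrable[OF p CC_F[OF u(1)]] gam_integrable[OF p phi] gam_conv[OF p CC_F[OF u(1)] phi u(2)]]
   show "integrable nu (%x. (h x * T' (u m x) $ i $ j) * gam (p i) (%x. u m x $ j) x)"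
    "integrable nu (%x. (h x * T' (psi x) $ i $ j) * gam (p i) (%x. phi x $ j) x)" "(%m. I m i j) ---> I' i j"
    using * unfolding I_def I'_def by auto
  qed
  have Im: "(SUM i:UNIV. SUM j:UNIV. I m i j) <= C * tau" for m
  proof -
   have "(SUM j:UNIV. I m i j) <= (real (Suc m0) * ((ip ?N (%x. q i x - p i x) (%x. q i x - p i x) + ip ?N h h) / 2) + (LINT x|nu. \<bar>gam (p i) h x\<bar>)) * tau" for i
   proof -
    define v where "v x = h x * T (u m x) $ i" for x
    note pc = product_chain[OF T[rule_format] T'c h u(1) p]
    have vC: "v : CC" unfolding v_def[abs_def] by (rule pc(1))
    have vF: "v : F" by (rule CC_F[OF vC])
    have i2: "integrable nu (%x. T (u m x) $ i * gam (p i) h x)"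
    proof (rule integrable_bound)
     show "integrable nu (%x. tau * gam (p i) h x)" using gam_integrable[OF p hF] by simp
     show "(%x. T (u m x) $ i * gam (p i) h x) : borel_measurable nu"
      using borel_measurable_integrable[OF gam_integrable[OF p hF]] by measurable
     show "AE x in nu. norm (T (u m x) $ i * gam (p i) h x) <= norm (tau * gam (p i) h x)"
      using Ti tau by (intro AE_I2) (simp add: abs_mult mult_right_mono)
    qed
    have "E (p i) v = (LINT x|nu. gam (p i) v x)" by (rule gam_total[OF p vF, symmetric])
    also have "... = (LINT x|nu. (SUM j:UNIV. h x * T' (u m x) $ i $ j * gam (p i) (%x. u m x $ j) x) + T (u m x) $ i * gam (p i) h x)"
     using pc(2) ipc(1) i2 gam_integrable[OF p vF] unfolding v_def
     by (intro integral_cong_AE) (auto intro!: borel_measurable_integrable)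
    also have "... = (SUM j:UNIV. I m i j) + (LINT x|nu. T (u m x) $ i * gam (p i) h x)"
     unfolding I_def using ipc(1) i2 by (simp add: integral_sum)
    finally have eq: "(SUM j:UNIV. I m i j) = E (p i) v - (LINT x|nu. T (u m x) $ i * gam (p i) h x)" by simp
    have "\<bar>LINT x|nu. T (u m x) $ i * gam (p i) h x\<bar> <= (LINT x|nu. tau * \<bar>gam (p i) h x\<bar>)"
     by (rule order_trans[OF integral_abs_bound integral_mono[OF integrable_abs[OF i2]]])
      (use gam_integrable[OF p hF] Ti in "auto simp: abs_mult intro!: mult_right_mono")
    hence b1: "- (LINT x|nu. T (u m x) $ i * gam (p i) h x) <= (LINT x|nu. \<bar>gam (p i) h x\<bar>) * tau" by (simp add: mult.commute)
    have dF: "(%x. q i x - p i x) : F" by (rule dom_diff[OF q p])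
    \<comment> \<open>This is why \<open>p i\<close> is a resolvent: the form becomes an
      \<open>L2\<close> pairing, in which \<open>v\<close> enters through its values only.\<close>
    have "E (p i) v = real (Suc m0) * (ip ?N (q i) v - ip ?N (p i) v)" unfolding p_def by (rule Rs_eq[OF F_L2[OF q] vF])
    also have "ip ?N (q i) v - ip ?N (p i) v = ip ?N (%x. q i x - p i x) v"
     by (rule ip_diff[OF F_L2[OF q] F_L2[OF p] F_L2[OF vF], symmetric])
    also have "real (Suc m0) * ... <= real (Suc m0) * (((ip ?N (%x. q i x - p i x) (%x. q i x - p i x) + ip ?N h h) / 2) * tau)"
    proof (rule mult_left_mono)
     have i3: "integrable ?N (%x. (q i x - p i x) * (q i x - p i x))" "integrable ?N (%x. h x * h x)"
      by (rule L2_mult_integrable[OF F_L2 F_L2]; rule dF hF)+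
     have "ip ?N (%x. q i x - p i x) v <= (LINT x|?N. (((q i x - p i x) * (q i x - p i x) + h x * h x) / 2) * tau)"
      unfolding ip_def
     proof (rule integral_mono[OF L2_mult_integrable[OF F_L2[OF dF] F_L2[OF vF]]])
      show "integrable ?N (%x. (((q i x - p i x) * (q i x - p i x) + h x * h x) / 2) * tau)" using i3 by simp
      fix x
      define a where "a = q i x - p i x"
      have "a * v x <= \<bar>a\<bar> * \<bar>v x\<bar>" by (metis abs_ge_self abs_mult)
      also have "... <= \<bar>a\<bar> * (\<bar>h x\<bar> * tau)" unfolding v_def abs_mult using Ti by (intro mult_left_mono) auto
      also have "... <= ((a * a + h x * h x) / 2) * tau"
      proof -
       have "\<bar>a\<bar> * \<bar>h x\<bar> <= (a * a + h x * h x) / 2"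
        using sum_squares_bound[of "\<bar>a\<bar>" "\<bar>h x\<bar>"] by (simp add: power2_eq_square)
       from mult_right_mono[OF this tau] show ?thesis by (simp add: mult.assoc)
      qed
      finally show "(q i x - p i x) * v x <= (((q i x - p i x) * (q i x - p i x) + h x * h x) / 2) * tau" unfolding a_def .
     qed
     also have "... = ((ip ?N (%x. q i x - p i x) (%x. q i x - p i x) + ip ?N h h) / 2) * tau"
      unfolding ip_def using i3 by simp
     finally show "ip ?N (%x. q i x - p i x) v <= ((ip ?N (%x. q i x - p i x) (%x. q i x - p i x) + ip ?N h h) / 2) * tau" .
    qed simp
    finally show ?thesis using b1 unfolding eq distrib_right by (simp only: mult.assoc)
   qed
   thus ?thesis unfolding C_def sum_distrib_right by (intro sum_mono)
  qed
  have "(%m. SUM i:UNIV. SUM j:UNIV. I m i j) ---> (SUM i:UNIV. SUM j:UNIV. I' i j)" by (intro tendsto_sum ipc(3))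
  hence I': "(SUM i:UNIV. SUM j:UNIV. I' i j) <= C * tau" by (rule LIMSEQ_le_const2) (use Im in blast)
  define J where "J x = (SUM i:UNIV. SUM j:UNIV. (h x * T' (psi x) $ i $ j) * gam (p i) (%x. phi x $ j) x)" for x
  have Ji: "integrable nu J" "(LINT x|nu. J x) = (SUM i:UNIV. SUM j:UNIV. I' i j)"
   unfolding J_def[abs_def] I'_def using ipc(2) by (auto simp: integral_sum)
  have Gi: "integrable nu (indicat_real G)" using G by (simp add: integrable_indicator_iff)
  have Wint: "integrable nu (%x. norm (W x))"
  proof (rule integrable_bound)
   show "integrable nu (%x. SUM i:UNIV. SUM j:UNIV. hb * \<bar>gam (p i) (%x. phi x $ j) x\<bar> + indicator G x)"
    using Gi gam_integrable[OF p phi] by (intro integrable_sum integrable_add) auto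
   show "AE x in nu. norm (norm (W x)) <= norm (SUM i:UNIV. SUM j:UNIV. hb * \<bar>gam (p i) (%x. phi x $ j) x\<bar> + indicator G x)"
   proof (rule AE_I2)
    fix x
    have "norm (W x) <= (SUM i:UNIV. SUM j:UNIV. \<bar>W x $ i $ j\<bar>)"
     unfolding norm_vec_def[of "W x"] by (rule order_trans[OF L2_set_le_sum sum_mono[OF norm_le_l1_cart]]) simp
    also have "... <= (SUM i:UNIV. SUM j:UNIV. hb * \<bar>gam (p i) (%x. phi x $ j) x\<bar> + indicator G x)"
    proof (intro sum_mono)
     fix i j
     have "\<bar>h x * gam (p i) (%x. phi x $ j) x\<bar> <= hb * \<bar>gam (p i) (%x. phi x $ j) x\<bar>"
      unfolding abs_mult by (rule mult_right_mono[OF hb]) simp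
     thus "\<bar>W x $ i $ j\<bar> <= hb * \<bar>gam (p i) (%x. phi x $ j) x\<bar> + indicator G x"
      unfolding Wi by (auto simp: indicator_def)
    qed
    finally show "norm (norm (W x)) <= norm (SUM i:UNIV. SUM j:UNIV. hb * \<bar>gam (p i) (%x. phi x $ j) x\<bar> + indicator G x)" by simp
   qed
  qed measurable
  have WTi: "integrable nu (%x. norm (W x) * norm (T' (psi x)))"
  proof (rule integrable_bound)
   show "integrable nu (%x. norm (W x) * B)" using Wint by simp
   show "AE x in nu. norm (norm (W x) * norm (T' (psi x))) <= norm (norm (W x) * B)"
    using B order_trans[OF norm_ge_zero B] by (intro AE_I2) (simp add: mult_left_mono)
  qed measurable
  have "(LINT y|distr (density nu (indicator G)) borel psi. trace (T' y)) = (LINT x|density nu (%x. ennreal (indicator G x)). trace (T' (psi x)))"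
   by (subst integral_distr) (auto simp: trace_def ennreal_indicator)
  also have "... = (LINT x|nu. indicator G x * trace (T' (psi x)))"
   by (subst integral_density) (auto simp: trace_def)
  also have "... <= (LINT x|nu. norm (W x) * norm (T' (psi x)) + J x)"
  proof (rule integral_mono)
   show "integrable nu (%x. norm (W x) * norm (T' (psi x)) + J x)" using WTi Ji(1) by simp
   show "integrable nu (%x. indicator G x * trace (T' (psi x)))"
   proof (rule integrable_bound)
    show "integrable nu (%x. (real CARD('n) * B) * indicator G x)" using Gi by (intro integrable_mult_right)
    have "\<bar>trace (T' y)\<bar> <= real CARD('n) * B" for y
    proof -
     have "\<bar>trace (T' y)\<bar> <= (SUM i:UNIV. \<bar>T' y $ i $ i\<bar>)" unfolding trace_def by (rule sum_abs)
     also have "... <= (SUM i:(UNIV::'n set). B)" by (intro sum_mono Bij)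
     finally show ?thesis by simp
    qed
    thus "AE x in nu. norm (indicator G x * trace (T' (psi x))) <= norm ((real CARD('n) * B) * indicator G x)"
     by (intro AE_I2) (auto simp: indicator_def intro: order_trans[OF _ abs_ge_self])
   qed (auto simp: trace_def)
   fix x
   \<comment> \<open>Cauchy-Schwarz for matrices. Pairing \<open>W\<close> with the derivative of
     \<open>T\<close> gives \<open>J\<close> minus the trace on \<open>G\<close>.\<close>
   have "- (T' (psi x) \<bullet> W x) <= norm (W x) * norm (T' (psi x))"
    using Cauchy_Schwarz_ineq2[of "T' (psi x)" "W x"] by (simp add: abs_le_iff mult.commute)
   moreover have "T' (psi x) \<bullet> W x = J x - indicator G x * trace (T' (psi x))"
   proof -
    have "T' (psi x) \<bullet> W x = (SUM i:UNIV. SUM j:UNIV. T' (psi x) $ i $ j * W x $ i $ j)" by (simp add: inner_vec_def)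
    also have "... = (SUM i:UNIV. (SUM j:UNIV. (h x * T' (psi x) $ i $ j) * gam (p i) (%x. phi x $ j) x) - T' (psi x) $ i $ i * indicator G x)"
    proof (intro sum.cong refl)
     fix i
     have "(SUM j:UNIV. T' (psi x) $ i $ j * (if i = j then indicator G x else 0)) = T' (psi x) $ i $ i * indicator G x"
      by (simp add: if_distrib cong: if_cong)
     thus "(SUM j:UNIV. T' (psi x) $ i $ j * W x $ i $ j) = (SUM j:UNIV. (h x * T' (psi x) $ i $ j) * gam (p i) (%x. phi x $ j) x) - T' (psi x) $ i $ i * indicator G x"
      unfolding Wi right_diff_distrib sum_subtractf by (simp add: mult_ac)
    qed
    also have "... = J x - indicator G x * trace (T' (psi x))"
     by (simp add: J_def trace_def sum_subtractf sum_distrib_left mult.commute)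
    finally show ?thesis .
   qed
   ultimately show "indicator G x * trace (T' (psi x)) <= norm (W x) * norm (T' (psi x)) + J x" by simp
  qed
  also have "... = (LINT x|nu. norm (W x) * norm (T' (psi x))) + (SUM i:UNIV. SUM j:UNIV. I' i j)"
   using WTi Ji by simp
  also have "(LINT x|nu. norm (W x) * norm (T' (psi x))) = (LINT y|distr (density nu (%x. ennreal (norm (W x)))) borel psi. norm (T' y))"
   by (subst integral_distr, simp, simp, subst integral_density) auto
  finally show "(LINT y|distr (density nu (indicator G)) borel psi. trace (T' y))
   <= (LINT y|distr (density nu (%x. ennreal (norm (W x)))) borel psi. norm (T' y)) + C * tau" using I' by linarith
 qed
 thus ?thesis using C0 by blast
qed

end

section \<open>Sets with almost constant matrix and null image\<close>

context dominated_mmd_space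
begin

text \<open>On \<open>B0\<close> the constant matrix \<open>D\<close> nearly inverts
  \<open>gma\<close>, so the functions \<open>q = D phi\<close> have mixed densities with
  \<open>phi\<close> close to the identity matrix. Resolvents of \<open>q\<close> and a test
  function \<open>h\<close> close to the indicator of \<open>G\<close> make the error measure of
  \<open>good_estimate_image\<close> as small as \<open>null_set_not_charged\<close> asks for; the
  accompanying constant is irrelevant there.\<close>

lemma image_not_charged:
 fixes phi psi :: "'a => real^'n::finite" and gma :: "'a => real^'n^'n"
 assumes phi: "!!i. (%x. phi x $ i) : F" and u: "!!m i. (%x. u m x $ i) : CC" "!!i. E_conv (%m x. u m x $ i) (%x. phi x $ i)"
  and psi: "psi : borel_measurable borel" "AE x in nu. (%m. u m x) ---> psi x"
  and gma: "!!i j. AE x in nu. gam (%x. phi x $ i) (%x. phi x $ j) x = gma x $ i $ j"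
  and gmai: "!!i j. integrable nu (%x. gma x $ i $ j)"
  and A: "A : sets borel" "emeasure lborel A = 0"
  and dlt: "0 < dlt" "!!(sig :: (real^'n) measure) eps K C. finite_measure sig ==> sets sig = sets borel ==> finite_measure eps ==> sets eps = sets borel ==>
   compact K ==> emeasure lborel K = 0 ==> 0 <= C ==> good_estimate sig eps C ==> measure eps UNIV <= dlt * measure sig K ==> measure sig K = 0"
  and B0: "B0 : sets borel" "emeasure nu B0 < \<infinity>" "!!x. x : B0 ==> psi x : A"
  and D: "!!x i j. x : B0 ==> \<bar>(D ** gma x) $ i $ j - mat 1 $ i $ j\<bar> <= dlt / (4 * real CARD('n) ^ 2)"
 shows "emeasure nu B0 = 0"
proof (rule ccontr)
 assume pos0: "emeasure nu B0 ~= 0"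
 let ?n = "CARD('n)"
 have n0: "0 < real ?n" by simp
 note [measurable] = psi(1) B0(1) A(1)
 define sig0 where "sig0 = distr (density nu (indicator B0)) borel psi"
 have ssig0: "sets sig0 = sets borel" by (simp add: sig0_def)
 have emsig0: "emeasure sig0 B = emeasure nu (B0 \<inter> psi -` B)" if "B : sets borel" for B
 proof -
  have [measurable]: "B : sets borel" by fact
  have m: "psi -` B : sets borel" using measurable_sets[OF psi(1), of B] by simp
  thus ?thesis unfolding sig0_def
   by (subst emeasure_distr) (auto simp: emeasure_density nn_integral_indicator indicator_inter_arith[symmetric] simp flip: indicator_inter_arith)
 qed
 have fsig0: "finite_measure sig0"
  by (rule finite_measureI) (use emsig0[of UNIV] B0(2) sets_eq_imp_space_eq[OF ssig0] in "auto simp: less_top")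
 interpret sig0: finite_measure sig0 by (rule fsig0)
 have "B0 \<inter> psi -` A = B0" using B0(3) by auto
 hence "emeasure sig0 A ~= 0" using emsig0[OF A(1)] pos0 by simp
 hence "0 < measure sig0 A" by (simp add: sig0.emeasure_eq_measure measure_nonneg less_le)
 \<comment> \<open>A compact part of \<open>A\<close> that is still charged; \<open>G\<close> is its
   preimage in \<open>B0\<close>.\<close>
 then obtain K where K: "compact K" "K <= A" "measure sig0 A < measure sig0 K + measure sig0 A"
  using finite_measure_compact_approx[OF ssig0 fsig0 A(1)] by blast
 have [measurable]: "K : sets borel" by (rule borel_compact[OF K(1)])
 have K0: "emeasure lborel K = 0" using emeasure_mono[OF K(2), of lborel] A by simp
 define G where "G = B0 \<inter> psi -` K"
 have G: "G : sets borel" unfolding G_def using measurable_sets[OF psi(1), of K] by (intro sets.Int) auto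
 note [measurable] = G
 have Gfin: "emeasure nu G < \<infinity>" using emeasure_mono[of G B0 nu] B0(2) by (auto simp: G_def intro: le_less_trans)
 define al where "al = measure nu G"
 have emal: "emeasure nu G = ennreal al" unfolding al_def using Gfin by (intro emeasure_eq_ennreal_measure) auto
 have "0 < measure sig0 K" using K(3) by simp
 moreover have "measure sig0 K = al" using emsig0[of K] by (simp add: al_def G_def measure_def)
 ultimately have al: "0 < al" by simp
 have Gi: "integrable nu (indicat_real G)" using Gfin by (simp add: integrable_indicator_iff)
 define q where "q i x = (SUM l:UNIV. D $ i $ l * phi x $ l)" for i x
 have q: "q i : F" for i unfolding q_def[abs_def] by (intro dom_sum dom_scale phi) simp
 have gq: "AE x in nu. gam (q i) (%x. phi x $ j) x = (D ** gma x) $ i $ j" for i j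
 proof -
  have "AE x in nu. gam (q i) (%x. phi x $ j) x = gam (%x. phi x $ j) (q i) x" by (rule gam_sym[OF q phi])
  moreover have "AE x in nu. gam (%x. phi x $ j) (q i) x = (SUM l:UNIV. D $ i $ l * gam (%x. phi x $ j) (%x. phi x $ l) x)"
   unfolding q_def[abs_def] by (rule gam_sum[OF phi finite phi])
  moreover have "AE x in nu. ALL l. gam (%x. phi x $ j) (%x. phi x $ l) x = gam (%x. phi x $ l) (%x. phi x $ j) x"
   unfolding AE_all_countable by (intro allI gam_sym phi)
  moreover have "AE x in nu. ALL l. gam (%x. phi x $ l) (%x. phi x $ j) x = gma x $ l $ j"
   unfolding AE_all_countable by (intro allI gma)
  ultimately show ?thesis by eventually_elim (simp add: matrix_matrix_mult_def)
 qed
 \<comment> \<open>An integrable bound for all entries. \<open>nu\<close> may be infinite, so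
   \<open>h\<close> is compared with the indicator of \<open>G\<close> in \<open>L1\<close> with
   weight \<open>w\<close>, that is, for the finite measure \<open>omg\<close>.\<close>
 define w where "w x = (SUM i:UNIV. SUM j:UNIV. \<bar>(D ** gma x) $ i $ j\<bar>)" for x
 have Dgmai: "integrable nu (%x. (D ** gma x) $ i $ j)" for i j
  using gmai by (simp add: matrix_matrix_mult_def)
 have wi: "integrable nu w" unfolding w_def[abs_def] using Dgmai by (intro integrable_sum integrable_abs)
 note [measurable] = borel_measurable_integrable[OF wi]
 have w0: "0 <= w x" for x by (simp add: w_def sum_nonneg)
 \<comment> \<open>Each entry of \<open>W\<close> may cost \<open>4 * eta\<close>: one for the
   resolvent, two for \<open>h\<close>, one for the deviation on \<open>B0\<close>. The
   \<open>n ^ 2\<close> entries together give \<open>dlt * al\<close>.\<close>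
 define eta where "eta = dlt / (4 * real ?n ^ 2) * al"
 have eta: "0 < eta" using dlt(1) al n0 by (simp add: eta_def)
 obtain h where h: "h : CC" "!!x. \<bar>h x\<bar> <= 1" "(LINT x|nu. \<bar>h x - indicator G x\<bar> * w x) < 2 * eta" "integrable nu (%x. \<bar>h x - indicator G x\<bar> * w x)"
 proof -
  define omg where "omg = density nu (%x. ennreal (w x))"
  have somg: "sets omg = sets borel" by (simp add: omg_def)
  have em: "emeasure omg B = ennreal (LINT x|nu. w x * indicator B x)" if "B : sets borel" for B
  proof -
   have [measurable]: "B : sets borel" by fact
   have "emeasure omg B = (\<integral>\<^sup>+x. ennreal (w x * indicator B x) \<partial>nu)"
    unfolding omg_def by (subst emeasure_density) (auto intro!: nn_integral_cong simp: indicator_def)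
   also have "... = ennreal (LINT x|nu. w x * indicator B x)"
    using w0 integrable_mult_indicator[of B nu w] wi by (intro nn_integral_eq_integral) (auto simp: mult.commute)
   finally show ?thesis .
  qed
  have fomg: "finite_measure omg" by (rule finite_measureI) (simp add: em sets_eq_imp_space_eq[OF somg])
  have me: "measure omg B = (LINT x|nu. w x * indicator B x)" if "B : sets borel" for B
   using em[OF that] w0 by (simp add: measure_def integral_nonneg)
  obtain K1 where K1: "compact K1" "K1 <= G" "measure omg G < measure omg K1 + eta"
   using finite_measure_compact_approx[OF somg fomg G eta] by blast
  have [measurable]: "K1 : sets borel" by (rule borel_compact[OF K1(1)])
  obtain k :: "nat => 'a => real" where "(ALL n. k n : CC & (ALL x. 0 <= k n x & k n x <= 1) & closure {x. k n x ~= 0} <= UNIV & (\<forall>x\<in>K1. k n x = 1))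
   & (ALL x. (%n. k n x) ---> indicator K1 x)" using CC_approx_compact[OF K1(1) open_UNIV subset_UNIV] by blast
  hence k: "!!n. k n : CC" "!!n x. 0 <= k n x" "!!n x. k n x <= 1" "!!x. (%n. k n x) ---> indicator K1 x" by auto
  have [measurable]: "k n : borel_measurable borel" for n by (rule CC_borel[OF k(1)])
  have kK: "\<bar>k n x - indicator B x\<bar> <= 1" for n x and B :: "'a set" using k(2,3)[of n x] by (auto simp: indicator_def)
  have bnd: "norm (\<bar>k n x - indicator B x\<bar> * w x) <= w x" for n x and B :: "'a set"
   using mult_right_mono[OF kK w0, of n x B x] w0[of x] by (simp add: abs_mult)
  have "(%n. LINT x|nu. \<bar>k n x - indicator K1 x\<bar> * w x) ---> (LINT x|nu. 0)"
  proof (rule integral_dominated_convergence[OF _ _ wi])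
   show "AE x in nu. (%n. \<bar>k n x - indicator K1 x\<bar> * w x) ---> 0"
   proof (rule AE_I2)
    fix x
    have "(%n. k n x - indicator K1 x) ---> 0" using k(4)[of x] by (simp add: LIM_zero)
    thus "(%n. \<bar>k n x - indicator K1 x\<bar> * w x) ---> 0" by (intro tendsto_mult_left_zero tendsto_rabs_zero)
   qed
   show "AE x in nu. norm (\<bar>k n x - indicator K1 x\<bar> * w x) <= w x" for n by (intro AE_I2 bnd)
  qed measurable
  hence "(%n. LINT x|nu. \<bar>k n x - indicator K1 x\<bar> * w x) ---> 0" by simp
  from order_tendstoD(2)[OF this eta] obtain n where n: "(LINT x|nu. \<bar>k n x - indicator K1 x\<bar> * w x) < eta"
   by (auto simp: eventually_sequentially)
  have ik: "integrable nu (%x. \<bar>k n x - indicator B x\<bar> * w x)" if [measurable]: "B : sets borel" for B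
   by (rule integrable_bound[OF wi]) (use bnd[of n _ B] w0 in auto)
  have i1: "integrable nu (%x. w x * indicator B x)" if "B : sets borel" for B
   using integrable_mult_indicator[of B nu w] wi that by (simp add: mult.commute)
  have "(LINT x|nu. \<bar>k n x - indicator G x\<bar> * w x) <= (LINT x|nu. \<bar>k n x - indicator K1 x\<bar> * w x + (w x * indicator G x - w x * indicator K1 x))"
  proof (rule integral_mono)
   show "integrable nu (%x. \<bar>k n x - indicator G x\<bar> * w x)" by (rule ik) measurable
   show "integrable nu (%x. \<bar>k n x - indicator K1 x\<bar> * w x + (w x * indicator G x - w x * indicator K1 x))"
    by (intro integrable_add integrable_diff ik i1) measurable
   fix x
   show "\<bar>k n x - indicator G x\<bar> * w x <= \<bar>k n x - indicator K1 x\<bar> * w x + (w x * indicator G x - w x * indicator K1 x)"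
   proof -
    have "\<bar>k n x - indicator G x\<bar> <= \<bar>k n x - indicator K1 x\<bar> + (indicator G x - indicator K1 x)"
     using K1(2) by (auto simp: indicator_def)
    from mult_right_mono[OF this w0[of x]] show ?thesis by (simp add: algebra_simps)
   qed
  qed
  also have "... = (LINT x|nu. \<bar>k n x - indicator K1 x\<bar> * w x) + (measure omg G - measure omg K1)"
   using ik[of K1] i1[of G] i1[of K1] by (simp add: me)
  also have "... < 2 * eta" using n K1(3) by simp
  finally show thesis using that[of "k n"] k(1) kK[of n _ "{}"] ik[of G] G by simp
 qed
 have hF: "h : F" by (rule CC_F[OF h(1)])
 have "\<forall>\<^sub>F m in sequentially. ALL i j. (LINT x|nu. \<bar>gam (%x. phi x $ j) (Rs m (q i)) x - gam (%x. phi x $ j) (q i) x\<bar>) < eta"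
  by (intro eventually_all_finite order_tendstoD(2)[OF gam_conv[OF phi Rs_conv(3)[OF q] q Rs_conv(1)[OF q]] eta])
 then obtain m0 where m0: "!!i j. (LINT x|nu. \<bar>gam (%x. phi x $ j) (Rs m0 (q i)) x - gam (%x. phi x $ j) (q i) x\<bar>) < eta"
  by (auto simp: eventually_sequentially)
 define p where "p i = Rs m0 (q i)" for i
 have p: "p i : F" for i unfolding p_def by (rule Rs_conv(3)[OF q])
 define W where "W x = (\<chi> i j. h x * gam (Rs m0 (q i)) (%x. phi x $ j) x - (if i = j then indicator G x else 0))" for x
 define eps where "eps = distr (density nu (%x. ennreal (norm (W x)))) borel psi"
 define sig where "sig = distr (density nu (indicator G)) borel psi"
 have "\<exists>C\<ge>0. good_estimate sig eps C" unfolding sig_def eps_def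
  by (rule good_estimate_image[OF phi u psi q h(1) G Gfin]) (rule ext, rule W_def)
 then obtain C where C: "0 <= C" "good_estimate sig eps C" by (elim exE conjE)
 have Wi: "W x $ i $ j = h x * gam (p i) (%x. phi x $ j) x - (if i = j then indicator G x else 0)" for x i j
  by (simp add: W_def p_def)
 have [measurable]: "h : borel_measurable borel" by (rule CC_borel[OF h(1)])
 have gpi: "integrable nu (gam (p i) (%x. phi x $ j))" for i j by (rule gam_integrable[OF p phi])
 have Wij: "integrable nu (%x. W x $ i $ j)" for i j
 proof -
  have "integrable nu (%x. h x * gam (p i) (%x. phi x $ j) x)"
  proof (rule integrable_bound[OF gpi])
   show "(%x. h x * gam (p i) (%x. phi x $ j) x) : borel_measurable nu" using borel_measurable_integrable[OF gpi] by measurable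
   show "AE x in nu. norm (h x * gam (p i) (%x. phi x $ j) x) <= norm (gam (p i) (%x. phi x $ j) x)"
    using mult_right_mono[OF h(2) abs_ge_zero] by (intro AE_I2) (simp add: abs_mult)
  qed
  thus ?thesis unfolding Wi using Gi by (cases "i = j") auto
 qed
 have Wle: "(LINT x|nu. \<bar>W x $ i $ j\<bar>) <= 4 * eta" for i j
 proof -
  let ?d = "%x. \<bar>gam (%x. phi x $ j) (Rs m0 (q i)) x - gam (%x. phi x $ j) (q i) x\<bar>"
  have di: "integrable nu ?d" using gam_integrable[OF phi p[unfolded p_def]] gam_integrable[OF phi q] by simp
  have "(LINT x|nu. \<bar>W x $ i $ j\<bar>) <= (LINT x|nu. ?d x + \<bar>h x - indicator G x\<bar> * w x + dlt / (4 * real ?n ^ 2) * indicator G x)"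
  proof (rule integral_mono_AE)
   show "integrable nu (%x. \<bar>W x $ i $ j\<bar>)" using Wij by simp
   show "integrable nu (%x. ?d x + \<bar>h x - indicator G x\<bar> * w x + dlt / (4 * real ?n ^ 2) * indicator G x)"
    by (intro integrable_add di h(4) integrable_mult_right Gi)
   show "AE x in nu. \<bar>W x $ i $ j\<bar> <= ?d x + \<bar>h x - indicator G x\<bar> * w x + dlt / (4 * real ?n ^ 2) * indicator G x"
    using gq[of i j] gam_sym[OF q phi, of i j] gam_sym[OF p phi, of i j]
   proof eventually_elim
    case (elim x)
    define a where "a = gam (p i) (%x. phi x $ j) x"
    define b where "b = (D ** gma x) $ i $ j"
    have d: "?d x = \<bar>a - b\<bar>" using elim by (simp add: a_def b_def p_def)
    have b1: "\<bar>b\<bar> <= w x"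
    proof -
     have "\<bar>b\<bar> <= (SUM j:UNIV. \<bar>(D ** gma x) $ i $ j\<bar>)" unfolding b_def by (rule member_le_sum) auto
     also have "... <= w x" unfolding w_def by (rule member_le_sum[where f="%i. SUM j:UNIV. \<bar>(D ** gma x) $ i $ j\<bar>"]) (auto simp: sum_nonneg)
     finally show ?thesis .
    qed
    have 1: "\<bar>h x * (a - b)\<bar> <= \<bar>a - b\<bar>" unfolding abs_mult using mult_right_mono[OF h(2) abs_ge_zero] by simp
    have 2: "\<bar>(h x - indicator G x) * b\<bar> <= \<bar>h x - indicator G x\<bar> * w x" unfolding abs_mult by (rule mult_left_mono[OF b1]) simp
    have 3: "\<bar>indicator G x * b - (if i = j then indicator G x else 0)\<bar> <= dlt / (4 * real ?n ^ 2) * indicator G x"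
     using D[of x i j] by (auto simp: indicator_def G_def b_def mat_def)
    \<comment> \<open>The three errors apart: resolvent against \<open>q\<close>, cutoff against
      indicator, and the product of \<open>D\<close> and \<open>gma\<close> against the
      identity.\<close>
    have "W x $ i $ j = h x * (a - b) + (h x - indicator G x) * b + (indicator G x * b - (if i = j then indicator G x else 0))"
     unfolding Wi a_def[symmetric] by (simp add: algebra_simps)
    thus ?case unfolding d using 1 2 3 by linarith
   qed
  qed
  also have "... = (LINT x|nu. ?d x) + (LINT x|nu. \<bar>h x - indicator G x\<bar> * w x) + dlt / (4 * real ?n ^ 2) * al"
   using di h(4) Gi by (simp add: al_def)
  also have "... <= 4 * eta" using m0[of j i] h(3) unfolding eta_def[symmetric] by simp
  finally show ?thesis .
 qed
 have [measurable]: "(%x. W x $ i $ j) : borel_measurable borel" for i j using borel_measurable_integrable[OF Wij[of i j]] by simp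
 have [measurable]: "(%x. W x $ i) : borel_measurable borel" for i
  by (subst borel_measurable_euclidean_space) (auto simp: Basis_cart inner_axis)
 have Wm [measurable]: "W : borel_measurable borel"
  by (subst borel_measurable_euclidean_space) (auto simp: Basis_vec_def inner_axis inner_axis' Basis_cart)
 have nW: "norm (W x) <= (SUM i:UNIV. SUM j:UNIV. \<bar>W x $ i $ j\<bar>)" for x
  unfolding norm_vec_def[of "W x"] by (rule order_trans[OF L2_set_le_sum sum_mono[OF norm_le_l1_cart]]) simp
 have iS: "integrable nu (%x. SUM i:UNIV. SUM j:UNIV. \<bar>W x $ i $ j\<bar>)" using Wij by simp
 have iW: "integrable nu (%x. norm (W x))"
  by (rule integrable_bound[OF iS]) (use order_trans[OF nW abs_ge_self] in auto)
 have "(LINT x|nu. norm (W x)) <= (LINT x|nu. (SUM i:UNIV. SUM j:UNIV. \<bar>W x $ i $ j\<bar>))" by (rule integral_mono[OF iW iS nW])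
 also have "... = (SUM i:UNIV. SUM j:UNIV. (LINT x|nu. \<bar>W x $ i $ j\<bar>))" using Wij by (simp add: integral_sum)
 also have "... <= (SUM i:(UNIV::'n set). SUM j:(UNIV::'n set). 4 * eta)" by (intro sum_mono Wle)
 also have "... = dlt * al" using n0 by (simp add: eta_def power2_eq_square)
 finally have Wtot: "(LINT x|nu. norm (W x)) <= dlt * al" .
 have emeps: "emeasure eps UNIV = ennreal (LINT x|nu. norm (W x))"
  unfolding eps_def by (subst emeasure_distr) (auto simp: emeasure_density nn_integral_eq_integral[OF iW])
 have seps: "sets eps = sets borel" by (simp add: eps_def)
 have feps: "finite_measure eps" by (rule finite_measureI) (simp add: emeps sets_eq_imp_space_eq[OF seps])
 have ssig: "sets sig = sets borel" by (simp add: sig_def)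
 have emsig: "emeasure sig B = emeasure nu (G \<inter> psi -` B)" if "B : sets borel" for B
 proof -
  have [measurable]: "B : sets borel" by fact
  have m: "psi -` B : sets borel" using measurable_sets[OF psi(1), of B] by simp
  thus ?thesis unfolding sig_def
   by (subst emeasure_distr) (auto simp: emeasure_density nn_integral_indicator indicator_inter_arith[symmetric] simp flip: indicator_inter_arith)
 qed
 have fsig: "finite_measure sig" by (rule finite_measureI) (use emsig[of UNIV] Gfin sets_eq_imp_space_eq[OF ssig] in "auto simp: less_top")
 have "G \<inter> psi -` K = G" by (auto simp: G_def)
 hence msig: "measure sig K = al" using emsig[of K] by (simp add: measure_def al_def)
 have "measure eps UNIV <= dlt * measure sig K" using Wtot emeps unfolding msig by (simp add: measure_def)
 from dlt(2)[OF fsig ssig feps seps K(1) K0 C this] show False using msig al by simp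
qed

end

section \<open>Borel version of the map and countable decomposition of the nondegenerate set\<close>

theorem theorem2p65:
  fixes \<mu> \<nu> :: "'a::polish_space measure"
    and F :: "('a \<Rightarrow> real) set"
    and E :: "('a \<Rightarrow> real) \<Rightarrow> ('a \<Rightarrow> real) \<Rightarrow> real"
    and \<phi> :: "'a \<Rightarrow> real ^ 'n"
    and \<gamma> :: "'a \<Rightarrow> real ^ 'n ^ 'n"
  assumes "mmd_space \<mu> F E"
    and "minimal_energy_dominant F E \<nu>"
    and "\<And>i. (\<lambda>x. \<phi> x $ i) \<in> F"
    and "\<And>i. quasicontinuous \<mu> F E (\<lambda>x. \<phi> x $ i)"
    and "carre_du_champ_matrix F E \<nu> \<phi> \<gamma>"
  shows "\<phi> \<in> borel_measurable (nondegenerate_part \<nu> \<gamma>)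
    \<and> absolutely_continuous lborel (distr (nondegenerate_part \<nu> \<gamma>) borel \<phi>)"
proof -
 note \<phi> = assms(3)
 interpret mmd_space \<mu> F E by fact
 interpret dominated_mmd_space \<mu> F E \<nu>
  by unfold_locales (use assms(2) in "simp add: minimal_energy_dominant_def")
 have "ALL i. EX u N. (ALL n. u n : CC) & E_conv u (%x. \<phi> x $ i) & N : sets borel & (\<forall>g\<in>F. measure (Gm g) N = 0) & (ALL x. x \<notin> N --> (%n. u n x) ---> \<phi> x $ i)"
  by (intro allI quasicontinuous_approx assms(3,4))
 from choice[OF this] obtain v where "ALL i. EX N. (ALL n. v i n : CC) & E_conv (v i) (%x. \<phi> x $ i) & N : sets borel & (\<forall>g\<in>F. measure (Gm g) N = 0) & (ALL x. x \<notin> N --> (%n. v i n x) ---> \<phi> x $ i)" ..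
 from choice[OF this] obtain Z where "ALL i. (ALL n. v i n : CC) & E_conv (v i) (%x. \<phi> x $ i) & Z i : sets borel & (\<forall>g\<in>F. measure (Gm g) (Z i) = 0) & (ALL x. x \<notin> Z i --> (%n. v i n x) ---> \<phi> x $ i)" ..
 hence v: "!!i n. v i n : CC" "!!i. E_conv (v i) (%x. \<phi> x $ i)" and Z: "!!i. Z i : sets borel" "!!i g. g : F ==> measure (Gm g) (Z i) = 0"
  and vZ: "!!i x. x \<notin> Z i ==> (%n. v i n x) ---> \<phi> x $ i" by simp_all
 define N where "N = (\<Union>i. Z i)"
 have N [measurable]: "N : sets borel" unfolding N_def by (intro sets.countable_UN'' Z(1)) auto
 have "Z i : null_sets \<nu>" for i using minimal_null[OF assms(2) Z(1) Z(2)] Z(1) by (auto simp: null_sets_def)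
 hence N0: "N : null_sets \<nu>" unfolding N_def by (intro null_sets_UN') auto
 define u where "u m x = (\<chi> i. v i m x)" for m x
 have u: "(%x. u m x $ i) : CC" "E_conv (%m x. u m x $ i) (%x. \<phi> x $ i)" for m i using v by (simp_all add: u_def)
 have uN: "(%m. u m x) ---> \<phi> x" if "x \<notin> N" for x
  by (rule vec_tendstoI) (use vZ[of x] that in "simp add: u_def N_def")
 have [measurable]: "u m : borel_measurable borel" for m
  by (subst borel_measurable_euclidean_space) (use CC_borel[OF u(1)] in "auto simp: Basis_cart inner_axis")
 \<comment> \<open>A Borel version of \<phi>: the limit of the continuous maps \<open>u m\<close>,
   set to zero on the exceptional set.\<close>
 define \<psi> where "\<psi> x = (if x : N then 0 else \<phi> x)" for x
 have \<psi>m [measurable]: "\<psi> : borel_measurable borel"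
 proof (rule borel_measurable_LIMSEQ_metric)
  show "(%x. if x : N then 0 else u m x) : borel_measurable borel" for m by measurable
  show "(%m. if x : N then 0 else u m x) ---> \<psi> x" for x using uN[of x] by (simp add: \<psi>_def)
 qed
 have aeN: "AE x in \<nu>. x \<notin> N" using N0 by (rule AE_not_in)
 have \<psi>l: "AE x in \<nu>. (%m. u m x) ---> \<psi> x" using aeN by eventually_elim (use uN in \<open>simp add: \<psi>_def\<close>)
 have \<gamma>i: "integrable \<nu> (%x. \<gamma> x $ i $ j)" for i j using assms(5) by (simp add: carre_du_champ_matrix_def)
 have \<gamma>e: "AE x in \<nu>. gam (%x. \<phi> x $ i) (%x. \<phi> x $ j) x = \<gamma> x $ i $ j" for i j
  by (rule density_unique_real[OF gam_integrable[OF \<phi> \<phi>] \<gamma>i])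
   (use assms(5) gam_mutual[OF \<phi> \<phi>] in "simp add: carre_du_champ_matrix_def")
 have \<gamma>m [measurable]: "(%x. \<gamma> x $ i $ j) : borel_measurable borel" for i j using borel_measurable_integrable[OF \<gamma>i] by simp
 have [measurable]: "(%x. det (\<gamma> x)) : borel_measurable borel" unfolding det_def by measurable
 let ?P = "density \<nu> (indicator {x. 0 < det (\<gamma> x)})"
 have sP: "sets ?P = sets borel" "space ?P = UNIV" by simp_all
 have NP: "N : null_sets ?P" using null_sets_density_iff[of "indicator {x. 0 < det (\<gamma> x)}" \<nu> N] aeN
  by (auto elim: eventually_mono)
 \<comment> \<open>Preimages under \<phi> and \<psi> differ only inside the null set
   \<open>N\<close>, and the completion contains all of its subsets.\<close>
 have meas: "\<phi> : borel_measurable (completion ?P)"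
 proof (rule measurableI)
  fix B :: "(real^'n) set" assume B: "B : sets borel"
  have e1: "\<phi> -` B = (\<psi> -` B - N) \<union> (\<phi> -` B \<inter> N)" by (auto simp: \<psi>_def)
  have "\<psi> -` B : sets borel" using measurable_sets[OF \<psi>m B] by simp
  hence e2: "\<psi> -` B - N : sets (completion ?P)" using N sP by (intro sets_completionI_sets) auto
  have e3: "\<phi> -` B \<inter> N : null_sets (completion ?P)"
   by (rule null_sets_completion_subset[OF _ null_sets_completionI[OF NP]]) auto
  have "\<phi> -` B : sets (completion ?P)" by (subst e1) (rule sets.Un[OF e2 null_setsD2[OF e3]])
  thus "\<phi> -` B \<inter> space (completion ?P) : sets (completion ?P)" by simp
 qed simp
 obtain \<delta> :: real where \<delta>: "0 < \<delta>" "!!(\<sigma> :: (real^'n) measure) \<epsilon> K C. finite_measure \<sigma> ==> sets \<sigma> = sets borel ==> finite_measure \<epsilon> ==> sets \<epsilon> = sets borel ==>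
   compact K ==> emeasure lborel K = 0 ==> 0 <= C ==> good_estimate \<sigma> \<epsilon> C ==> measure \<epsilon> UNIV <= \<delta> * measure \<sigma> K ==> measure \<sigma> K = 0"
  by (rule null_set_not_charged) (rule that)
 have key: "AE x in \<nu>. 0 < det (\<gamma> x) --> \<psi> x \<notin> A" if A: "A : sets borel" "emeasure lborel A = 0" for A
 proof -
  note [measurable] = A(1)
  \<comment> \<open>\<nu> is only \<sigma>-finite, whereas \<open>image_not_charged\<close> works on
    sets of finite measure.\<close>
  obtain S :: "nat => 'a set" where S: "range S <= sets \<nu>" "(\<Union>i. S i) = space \<nu>" "!!i. emeasure \<nu> (S i) ~= \<infinity>"
   by (rule nu.sigma_finite) (rule that)
  define b where "b = \<delta> / (4 * real CARD('n) ^ 2)"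
  have b: "0 < b" using \<delta>(1) by (simp add: b_def)
  \<comment> \<open>Approximate inverses are taken from a countable dense set of matrices, so that
    countably many sets \<open>G C k\<close> cover all nondegenerate points over
    \<open>A\<close>.\<close>
  obtain Q :: "(real^'n^'n) set" where Q: "countable Q" "!!X. open X ==> X ~= {} ==> \<exists>d\<in>Q. d : X"
   by (rule countable_dense_setE) (rule that)
  define G where "G C k = {x : S k. \<psi> x : A & (ALL i j. \<bar>(C ** \<gamma> x) $ i $ j - mat 1 $ i $ j\<bar> <= b)}" for C k
  have Gnull: "AE x in \<nu>. x \<notin> G C k" for C k
  proof -
   have [measurable]: "S k : sets borel" using S(1) by auto
   have [measurable]: "(%x. (C ** \<gamma> x) $ i $ j) : borel_measurable borel" for i j by (simp add: matrix_matrix_mult_def)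
   have "{x. ALL i j. \<bar>(C ** \<gamma> x) $ i $ j - mat 1 $ i $ j\<bar> <= b} = (\<Inter>i. \<Inter>j. {x. \<bar>(C ** \<gamma> x) $ i $ j - mat 1 $ i $ j\<bar> <= b})" by auto
   also have "... : sets borel" by (intro sets.countable_INT'') auto
   finally have "S k \<inter> \<psi> -` A \<inter> {x. ALL i j. \<bar>(C ** \<gamma> x) $ i $ j - mat 1 $ i $ j\<bar> <= b} : sets borel"
    using measurable_sets[OF \<psi>m A(1)] by (intro sets.Int) auto
   moreover have "G C k = S k \<inter> \<psi> -` A \<inter> {x. ALL i j. \<bar>(C ** \<gamma> x) $ i $ j - mat 1 $ i $ j\<bar> <= b}" by (auto simp: G_def)
   ultimately have Gb: "G C k : sets borel" by simp
   have Gf: "emeasure \<nu> (G C k) < \<infinity>"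
    using emeasure_mono[of "G C k" "S k" \<nu>] S(3)[of k] by (auto simp: G_def less_top intro: le_less_trans)
   have "emeasure \<nu> (G C k) = 0"
    by (rule image_not_charged[OF \<phi> u \<psi>m \<psi>l \<gamma>e \<gamma>i A \<delta> Gb Gf, where D=C]) (auto simp: G_def b_def)
   hence "G C k : null_sets \<nu>" using Gb by (simp add: null_sets_def)
   thus ?thesis by (rule AE_not_in)
  qed
  have "AE x in \<nu>. \<forall>C\<in>Q. ALL k. x \<notin> G C k"
   unfolding AE_ball_countable[OF Q(1)] AE_all_countable using Gnull by blast
  thus ?thesis
  proof eventually_elim
   case (elim x)
   show ?case
   proof (intro impI notI)
    assume d: "0 < det (\<gamma> x)" and a: "\<psi> x : A"
    have "x : (\<Union>i. S i)" unfolding S(2) by simp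
    then obtain k where k: "x : S k" by blast
    have "invertible (\<gamma> x)" using d by (simp add: invertible_det_nz)
    \<comment> \<open>The exact left inverse at \<open>x\<close> is replaced by a nearby matrix of
      \<open>Q\<close>; the matrices that are good enough form an open set.\<close>
    then obtain C0 where C0: "C0 ** \<gamma> x = mat 1" unfolding invertible_def by blast
    define X where "X = {C. norm (C ** \<gamma> x - mat 1) < b}"
    have "continuous_on UNIV (%C :: real^'n^'n. norm (C ** \<gamma> x - mat 1))"
     unfolding matrix_matrix_mult_def by (intro continuous_intros)
    hence "open X" unfolding X_def by (intro open_Collect_less continuous_on_const)
    moreover have "C0 : X" using C0 b by (simp add: X_def)
    ultimately obtain C where C: "C : Q" "C : X" using Q(2)[of X] by blast
    have "\<bar>(C ** \<gamma> x) $ i $ j - mat 1 $ i $ j\<bar> <= b" for i j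
    proof -
     have "\<bar>(C ** \<gamma> x - mat 1) $ i $ j\<bar> <= norm (C ** \<gamma> x - mat 1)"
      by (rule order_trans[OF component_le_norm_cart Finite_Cartesian_Product.norm_nth_le])
     thus ?thesis using C(2) by (simp add: X_def)
    qed
    hence "x : G C k" using k a by (simp add: G_def)
    thus False using elim C(1) by blast
   qed
  qed
 qed
 have "absolutely_continuous lborel (distr (completion ?P) borel \<phi>)"
  unfolding absolutely_continuous_def
 proof
  fix A :: "(real^'n) set" assume "A : null_sets lborel"
  hence A: "A : sets borel" "emeasure lborel A = 0" by auto
  have "AE x in \<nu>. 0 < det (\<gamma> x) --> \<phi> x \<notin> A" using key[OF A] aeN by eventually_elim (simp add: \<psi>_def)
  hence "AE x in ?P. \<phi> x \<notin> A" by (subst AE_density) (auto elim!: eventually_mono simp: indicator_def)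
  hence ae: "AE x in completion ?P. \<phi> x \<notin> A" by (rule AE_completion)
  have "emeasure (distr (completion ?P) borel \<phi>) A = emeasure (completion ?P) (\<phi> -` A \<inter> space (completion ?P))"
   by (rule emeasure_distr[OF meas A(1)])
  also have "... = 0"
   using ae measurable_sets[OF meas A(1)] by (subst emeasure_eq_0_AE[of "%x. \<phi> x : A", symmetric]) (auto simp: vimage_def Int_def conj_commute)
  finally show "A : null_sets (distr (completion ?P) borel \<phi>)" using A(1) by (simp add: null_sets_def)
 qed
 thus ?thesis using meas by (simp add: nondegenerate_part_def)
qed

end
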